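(* Suppose $n\delta_n\to+\infty$ as $n\to+\infty$, put $\varphi_n=\sqrt{\delta_n/n}$, and for $\theta\in\Theta$ let $F=F(\theta)=r\ln\Bigl(\frac{\psi(\theta)+r}{\psi(\theta)}\Bigr)$. Let $\hat\theta_n$ be the maximum likelihood estimator and, for any continuous and strictly positive prior density $q$ on $\Theta$, let $\tilde\theta_n$ be the corresponding Bayesian estimator for quadratic loss. Then, with $\theta_n^*$ standing for either $\hat\theta_n$ or $\tilde\theta_n$: \begin{itemize} \item $\theta_n^*$ is consistent: for every $\theta\in\Theta$, $\theta_n^*\to\theta$ in $\mathbf{P}_\theta$-probability; \item $\theta_n^*$ is asymptotically normal with rate $\varphi_n$ and limit variance $1/F$: for every $\theta\in\Theta$, $\varphi_n^{-1}(\theta_n^*-\theta)$ converges in distribution under $\mathbf{P}_\theta$ to $\xi_{1/F}\sim\mathcal{N}(0,1/F(\theta))$; \item polynomial moments converge: for every $\theta\in\Theta$ and every $p>0$, $\lim_{n\to+\infty}\varphi_n^{-p}\,\mathbf{E}_\theta|\theta_n^*-\theta|^p=\mathbf{E}|\xi_{1/F}|^p$; \item $\theta_n^*$ is asymptotically efficient: for all $\theta_0\in\Theta$, \[ \lim_{\epsilon\to0}\ \lim_{n\to+\infty}\ \sup_{|\theta-\theta_0|<\epsilon}\varphi_n^{-2}\,\mathbf{E}_\theta\bigl(\theta_n^*-\theta\bigr)^2=\frac1{F(\theta_0)}. \] \end{itemize}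
   Context: Let $0<\alpha<\beta<\tau$ be known constants, $\psi$ a known strictly positive continuous function on $[0,\tau]$, $r>-\min_{0\le t\le\tau}\psi(t)$ a known constant with $r\neq0$, and $(\delta_n)$ a known sequence of positive numbers decreasing to $0$. The unknown parameter is $\theta\in\Theta=(\alpha,\beta)$. For each $n\ge1$ one observes $X^{(n)}=(X_1,\ldots,X_n)$, where $X_j=(X_j(t),\ 0\le t\le\tau)$, $j=1,\ldots,n$, are independent inhomogeneous Poisson processes on $[0,\tau]$ with common intensity function \[ \lambda_\theta^{(n)}(t)=\psi(t)+\frac{r}{\delta_n}(t-\theta)\,\mathbb{1}_{[\theta,\theta+\delta_n)}(t)+r\,\mathbb{1}_{[\theta+\delta_n,\tau]}(t),\qquad 0\le t\le\tau. \] $\mathbf{P}_\theta=\mathbf{P}_\theta^{(n)}$ denotes the law of $X^{(n)}$ and $\mathbf{E}_\theta$ the corresponding expectation. The likelihood (with respect to the law of $n$ independent unit-intensity homogeneous Poisson processes) is \[ L(\theta,X^{(n)})=\exp\Bigl\{\sum_{j=1}^n\int_0^\tau\ln\bigl(\lambda^{(n)}_\theta(t)\bigr)\,\mathrm{d}X_j(t)-n\int_0^\tau\bigl(\lambda^{(n)}_\theta(t)-1\bigr)\mathrm{d}t\Bigr\}. \] The maximum likelihood estimator is $\hat\theta_n=\operatorname{argsup}_{\theta\in\Theta}L(\theta,X^{(n)})$, i.e. a (measurable choice of a) point of $[\alpha,\beta]$ at which the supremum of $L(\cdot,X^{(n)})$ over $\Theta$ is attained, $L$ being extended by continuity to $[\alpha,\beta]$.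 The Bayesian estimator for quadratic loss and prior density $q$ is \[ \tilde\theta_n=\frac{\int_\alpha^\beta\theta\,q(\theta)\,L(\theta,X^{(n)})\,\mathrm{d}\theta}{\int_\alpha^\beta q(\theta)\,L(\theta,X^{(n)})\,\mathrm{d}\theta}. \] *)

theory Defs
  imports "HOL-Probability.Probability"
begin

text \<open>
  A trajectory is a function \<open>x :: real \<Rightarrow> nat\<close>; only its values on \<open>[0, \<tau>]\<close> matter.
\<close>

definition counting_path :: "real \<Rightarrow> (real \<Rightarrow> nat) \<Rightarrow> bool" where
  "counting_path \<tau> x \<longleftrightarrow>
     x 0 = 0 \<and> mono_on {0..\<tau>} x \<and>
     (\<forall>t\<in>{0..<\<tau>}. continuous (at_right t) (\<lambda>s. real (x s)))"

text \<open>
  In the increment law the case \<open>s = t\<close> is left out because \<open>poisson_pmf\<close> is only specified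
  for positive rates.  Subtraction on \<open>nat\<close> does not truncate here, the paths being monotone.
\<close>

definition poisson_process ::
    "'w measure \<Rightarrow> real \<Rightarrow> (real \<Rightarrow> real) \<Rightarrow> ('w \<Rightarrow> real \<Rightarrow> nat) \<Rightarrow> bool" where
  "poisson_process M \<tau> lam N \<longleftrightarrow>
     (\<forall>\<omega>\<in>space M. counting_path \<tau> (N \<omega>)) \<and>
     (\<forall>t\<in>{0..\<tau>}. (\<lambda>\<omega>. N \<omega> t) \<in> M \<rightarrow>\<^sub>M count_space UNIV) \<and>
     (\<forall>s t. 0 \<le> s \<and> s < t \<and> t \<le> \<tau> \<longrightarrow>
        distr M (count_space UNIV) (\<lambda>\<omega>. N \<omega> t - N \<omega> s) =
          measure_pmf (poisson_pmf (LBINT u:{s..t}. lam u))) \<and>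
     (\<forall>k (t :: nat \<Rightarrow> real). mono_on {..k} t \<and> t ` {..k} \<subseteq> {0..\<tau>} \<longrightarrow>
        prob_space.indep_vars M (\<lambda>_. count_space UNIV)
          (\<lambda>i \<omega>. N \<omega> (t (Suc i)) - N \<omega> (t i)) {..<k})"

definition intensity ::
    "(real \<Rightarrow> real) \<Rightarrow> real \<Rightarrow> real \<Rightarrow> real \<Rightarrow> real \<Rightarrow> real \<Rightarrow> real" where
  "intensity \<psi> r \<tau> d \<theta> t =
     \<psi> t + r / d * (t - \<theta>) * indicator {\<theta>..<\<theta> + d} t + r * indicator {\<theta> + d..\<tau>} t"

text \<open>
  For each sample size \<open>n\<close>, all the laws \<open>P n \<theta>\<close>, \<open>\<theta> \<in> \<Theta>\<close>, live on the measurable space \<open>S n\<close>.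
  The observation is \<open>X n \<omega> j t = X\<^sub>j(t)(\<omega>)\<close>, for \<open>1 \<le> j \<le> n\<close> and \<open>0 \<le> t \<le> \<tau>\<close>.
\<close>

definition poisson_model ::
    "(real \<Rightarrow> real) \<Rightarrow> real \<Rightarrow> real \<Rightarrow> (nat \<Rightarrow> real) \<Rightarrow> real set \<Rightarrow>
     (nat \<Rightarrow> 'w measure) \<Rightarrow> (nat \<Rightarrow> real \<Rightarrow> 'w measure) \<Rightarrow>
     (nat \<Rightarrow> 'w \<Rightarrow> nat \<Rightarrow> real \<Rightarrow> nat) \<Rightarrow> bool" where
  "poisson_model \<psi> r \<tau> \<delta> \<Theta> S P X \<longleftrightarrow>
     (\<forall>n\<ge>1. \<forall>\<theta>\<in>\<Theta>.
        prob_space (P n \<theta>) \<and> sets (P n \<theta>) = sets (S n) \<and>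
        (\<forall>j\<in>{1..n}. poisson_process (P n \<theta>) \<tau> (intensity \<psi> r \<tau> (\<delta> n) \<theta>) (\<lambda>\<omega>. X n \<omega> j)) \<and>
        prob_space.indep_vars (P n \<theta>) (\<lambda>j. \<Pi>\<^sub>M t\<in>{0..\<tau>}. count_space UNIV)
          (\<lambda>j \<omega>. restrict (X n \<omega> j) {0..\<tau>}) {1..n})"

text \<open>
  The Lebesgue--Stieltjes measure \<open>dx\<close> of a counting path on \<open>[0, \<tau>]\<close>: the path is continued
  as a constant outside \<open>[0, \<tau>]\<close>, so that no mass lies there.
\<close>

definition path_measure :: "real \<Rightarrow> (real \<Rightarrow> nat) \<Rightarrow> real measure" where
  "path_measure \<tau> x = interval_measure (\<lambda>t. real (x (max 0 (min \<tau> t))))"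

text \<open>
  For \<open>0 < \<alpha> < \<beta> < \<tau>\<close> the same formula at \<open>\<theta> = \<alpha>\<close> and \<open>\<theta> = \<beta>\<close> is the extension by continuity of
  the likelihood to \<open>[\<alpha>, \<beta>]\<close>: for \<open>d > 0\<close> and \<open>0 \<le> t \<le> \<tau>\<close> the intensity is
  \<open>\<psi> t + r * max 0 (min 1 ((t - \<theta>) / d))\<close>, which is Lipschitz in \<open>\<theta>\<close> uniformly in \<open>t\<close>.
\<close>

definition likelihood ::
    "(real \<Rightarrow> real) \<Rightarrow> real \<Rightarrow> real \<Rightarrow> (nat \<Rightarrow> real) \<Rightarrow> nat \<Rightarrow> real \<Rightarrow> (nat \<Rightarrow> real \<Rightarrow> nat) \<Rightarrow> real" where
  "likelihood \<psi> r \<tau> \<delta> n \<theta> x =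
     exp ((\<Sum>j=1..n. LINT t:{0..\<tau>}|path_measure \<tau> (x j). ln (intensity \<psi> r \<tau> (\<delta> n) \<theta> t))
          - real n * (LBINT t:{0..\<tau>}. intensity \<psi> r \<tau> (\<delta> n) \<theta> t - 1))"

text \<open>A maximum likelihood estimator is any measurable selection of maximisers.\<close>

definition is_MLE ::
    "(real \<Rightarrow> real) \<Rightarrow> real \<Rightarrow> real \<Rightarrow> (nat \<Rightarrow> real) \<Rightarrow> real \<Rightarrow> real \<Rightarrow>
     (nat \<Rightarrow> 'w measure) \<Rightarrow> (nat \<Rightarrow> 'w \<Rightarrow> nat \<Rightarrow> real \<Rightarrow> nat) \<Rightarrow> (nat \<Rightarrow> 'w \<Rightarrow> real) \<Rightarrow> bool" where
  "is_MLE \<psi> r \<tau> \<delta> \<alpha> \<beta> S X est \<longleftrightarrow>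
     (\<forall>n\<ge>1. est n \<in> borel_measurable (S n) \<and>
        (\<forall>\<omega>\<in>space (S n).
           est n \<omega> \<in> {\<alpha>..\<beta>} \<and>
           likelihood \<psi> r \<tau> \<delta> n (est n \<omega>) (X n \<omega>) =
             (SUP \<theta>\<in>{\<alpha><..<\<beta>}. likelihood \<psi> r \<tau> \<delta> n \<theta> (X n \<omega>))))"

definition prior_density :: "real \<Rightarrow> real \<Rightarrow> (real \<Rightarrow> real) \<Rightarrow> bool" where
  "prior_density \<alpha> \<beta> q \<longleftrightarrow>
     continuous_on {\<alpha><..<\<beta>} q \<and> (\<forall>\<theta>\<in>{\<alpha><..<\<beta>}. q \<theta> > 0) \<and>
     set_integrable lborel {\<alpha><..<\<beta>} q \<and> (LBINT \<theta>:{\<alpha><..<\<beta>}. q \<theta>) = 1"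

definition bayes_estimator ::
    "(real \<Rightarrow> real) \<Rightarrow> real \<Rightarrow> real \<Rightarrow> (nat \<Rightarrow> real) \<Rightarrow> real \<Rightarrow> real \<Rightarrow> (real \<Rightarrow> real) \<Rightarrow>
     nat \<Rightarrow> (nat \<Rightarrow> real \<Rightarrow> nat) \<Rightarrow> real" where
  "bayes_estimator \<psi> r \<tau> \<delta> \<alpha> \<beta> q n x =
     (LBINT \<theta>:{\<alpha><..<\<beta>}. \<theta> * q \<theta> * likelihood \<psi> r \<tau> \<delta> n \<theta> x) /
     (LBINT \<theta>:{\<alpha><..<\<beta>}. q \<theta> * likelihood \<psi> r \<tau> \<delta> n \<theta> x)"

definition is_bayes ::
    "(real \<Rightarrow> real) \<Rightarrow> real \<Rightarrow> real \<Rightarrow> (nat \<Rightarrow> real) \<Rightarrow> real \<Rightarrow> real \<Rightarrow> (real \<Rightarrow> real) \<Rightarrow>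
     (nat \<Rightarrow> 'w measure) \<Rightarrow> (nat \<Rightarrow> 'w \<Rightarrow> nat \<Rightarrow> real \<Rightarrow> nat) \<Rightarrow> (nat \<Rightarrow> 'w \<Rightarrow> real) \<Rightarrow> bool" where
  "is_bayes \<psi> r \<tau> \<delta> \<alpha> \<beta> q S X est \<longleftrightarrow>
     (\<forall>n\<ge>1. \<forall>\<omega>\<in>space (S n). est n \<omega> = bayes_estimator \<psi> r \<tau> \<delta> \<alpha> \<beta> q n (X n \<omega>))"

definition rate :: "(nat \<Rightarrow> real) \<Rightarrow> nat \<Rightarrow> real" where
  "rate \<delta> n = sqrt (\<delta> n / real n)"

definition fisher :: "(real \<Rightarrow> real) \<Rightarrow> real \<Rightarrow> real \<Rightarrow> real" where
  "fisher \<psi> r \<theta> = r * ln ((\<psi> \<theta> + r) / \<psi> \<theta>)"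

text \<open>The centred normal law with variance \<open>v > 0\<close>; \<open>normal_density\<close> takes the standard deviation.\<close>

definition centred_normal :: "real \<Rightarrow> real measure" where
  "centred_normal v = density lborel (\<lambda>x. ennreal (normal_density 0 (sqrt v) x))"

end

theory Submission
  imports Defs
begin

text \<open>
  Write \<open>u = (v - \<theta>) / \<phi>\<close> with \<open>\<phi> = sqrt (d / n)\<close>, \<open>d = \<delta> n\<close>, for the local parameter, and \<open>llr u\<close>
  for the log-likelihood ratio of \<open>\<theta> + \<phi> u\<close> against the true value \<open>\<theta>\<close>. The transition zone of the
  intensity has length \<open>d\<close> and contains of the order of \<open>n d\<close> jumps. Shifting it by \<open>\<phi> u\<close> changes the
  intensity by order \<open>\<phi> / d\<close> on a set of length \<open>d\<close>, so the change is worth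
  \<open>n d (\<phi> / d)\<^sup>2 = 1\<close> unit of information, while \<open>\<epsilon> = \<phi> / d = 1 / sqrt (n d)\<close> tends to \<open>0\<close>.
  Hence the limit experiment is a Gaussian shift. Its information is
  \<open>r\<^sup>2 \<integral>\<^sub>0\<^sup>1 ds / (\<psi> \<theta> + r s) = r ln ((\<psi> \<theta> + r) / \<psi> \<theta>)\<close>, because a typical point of the zone sits
  at a uniform height of the ramp.

  The proof follows the method of Ibragimov and Khasminskii.

  Everything about the Poisson sample comes from one formula, \<open>exp_sample_integral\<close>: the Laplace
  transform of the integral of a bounded left-continuous function against the sample. It is
  obtained from the independence of finitely many increments by left Riemann sums.

  The log-likelihood is only piecewise smooth in the parameter, but it is absolutely continuous
  with the explicit derivative \<open>score\<close> (lemma \<open>llr_increment\<close>). This gives the two ingredients of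
  the method. First, the Hellinger bound \<open>E exp (llr u / 2) \<le> C exp (- \<kappa> \<bar>u\<bar>)\<close> (where \<open>\<kappa>\<close> is \<open>kap\<close> below), together with a
  bound on the exponential moments of the score under the alternative, makes
  \<open>V = 1 + \<integral> \<bar>d/dw exp (\<kappa> \<bar>w\<bar> / 4 + llr w / 2)\<bar> dw\<close> integrable uniformly in \<open>n\<close> (up to replacing the
  derivative by a majorant), and \<open>V\<close> bounds all the functions
  \<open>exp (\<kappa> \<bar>u\<bar> / 4 + llr u / 2)\<close> at once. Secondly, \<open>score w - score 0 + F w\<close> tends to \<open>0\<close> in mean square,
  and its square integrated over a compact set of \<open>w\<close> has expectation tending to \<open>0\<close>, so that
  \<open>llr u = u D - F u\<^sup>2 / 2 + o(1)\<close> uniformly on compact sets in probability, where \<open>D = score 0\<close> is asymptotically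
  normal with variance \<open>F\<close>.

  The normalised error \<open>U\<close> of either estimator is then controlled deterministically, path by path:
  an exponential function of \<open>\<bar>U\<bar>\<close> is bounded by an integrable variable, and \<open>U = D / F + o(1)\<close> off an
  event of small probability. For the maximum likelihood estimator both facts are immediate from
  the envelope and from the quadratic expansion. For the Bayesian estimator \<open>U\<close> is a posterior
  mean, whose tails are controlled by the envelope and by a lower bound for the total mass. With the
  asymptotic normality of \<open>D\<close> these two facts imply the limit law, the convergence of all moments and the consistency
  (locale \<open>expanding_sequence\<close>).

  All of this is done for an arbitrary sequence of true parameters \<open>t n\<close> that converges to a point
  \<open>\<theta>0\<close> of the parameter interval. Convergence of the risk along all such sequences is locally
  uniform convergence, and this gives the supremum in the last claim.
\<close>

section \<open>Left Riemann sums\<close>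

text \<open>
  The largest multiple of \<open>\<tau> / k\<close> strictly below \<open>t\<close>: the ceiling minus one, rather than the floor,
  makes it the left end of the cell of \<open>t\<close> when the cells are closed on the right.
\<close>

definition left_node :: "real \<Rightarrow> nat \<Rightarrow> real \<Rightarrow> real" where
  "left_node \<tau> k t = \<tau> * of_int (\<lceil>t * real k / \<tau>\<rceil> - 1) / real k"

lemma left_node_less:
  assumes "0 < \<tau>" "0 < k"
  shows "left_node \<tau> k t < t"
proof -
  have "of_int (\<lceil>t * real k / \<tau>\<rceil> - 1) < t * real k / \<tau>" by linarith
  then show ?thesis using assms unfolding left_node_def by (simp add: field_simps)
qed

lemma left_node_ge:
  assumes "0 < \<tau>" "0 < k"
  shows "t - \<tau> / real k \<le> left_node \<tau> k t"
proof -
  have "t * real k / \<tau> - 1 \<le> of_int (\<lceil>t * real k / \<tau>\<rceil> - 1)" by linarith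
  then have "\<tau> * (t * real k / \<tau> - 1) / real k \<le> left_node \<tau> k t"
    using assms unfolding left_node_def by (intro divide_right_mono mult_left_mono) auto
  moreover have "\<tau> * (t * real k / \<tau> - 1) / real k = t - \<tau> / real k" using assms by (simp add: field_simps)
  ultimately show ?thesis by simp
qed

lemma left_node_tendsto:
  assumes "0 < \<tau>"
  shows "filterlim (\<lambda>k. left_node \<tau> (Suc k) t) (at_left t) sequentially"
  unfolding filterlim_at
proof (intro conjI)
  have "(\<lambda>k. t - \<tau> / real (Suc k)) \<longlonglongrightarrow> t - 0"
    using LIMSEQ_Suc[OF lim_const_over_n[of \<tau>]] by (intro tendsto_diff tendsto_const) simp
  then have "(\<lambda>k. t - \<tau> / real (Suc k)) \<longlonglongrightarrow> t" by simp
  from this tendsto_const show "((\<lambda>k. left_node \<tau> (Suc k) t) \<longlongrightarrow> t) sequentially"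
    by (rule tendsto_sandwich[rotated 2])
      (use left_node_less[OF assms] left_node_ge[OF assms] in \<open>auto simp: less_imp_le simp del: of_nat_Suc\<close>)
  show "\<forall>\<^sub>F k in sequentially. left_node \<tau> (Suc k) t \<in> {..<t} \<and> left_node \<tau> (Suc k) t \<noteq> t"
    using left_node_less[OF assms, of "Suc k" for k] by (auto intro!: always_eventually simp: less_le)
qed

lemma mem_grid_cell_iff:
  assumes "0 < \<tau>" "0 < k"
  shows "t \<in> {\<tau> * real i / real k<..\<tau> * real (Suc i) / real k} \<longleftrightarrow> \<lceil>t * real k / \<tau>\<rceil> = int i + 1"
  using assms by (auto simp: ceiling_eq_iff field_simps)

lemma left_step_function_eq:
  fixes f :: "real \<Rightarrow> 'b::real_vector"
  assumes "0 < \<tau>" "0 < k"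
  shows "indicator {0<..\<tau>} t *\<^sub>R f (left_node \<tau> k t) =
    (\<Sum>i<k. indicator {\<tau> * real i / real k<..\<tau> * real (Suc i) / real k} t *\<^sub>R f (\<tau> * real i / real k))"
proof -
  let ?c = "\<lceil>t * real k / \<tau>\<rceil>"
  have *: "(\<Sum>i<k. indicator {\<tau> * real i / real k<..\<tau> * real (Suc i) / real k} t *\<^sub>R f (\<tau> * real i / real k))
     = (\<Sum>i<k. if ?c = int i + 1 then f (\<tau> * real i / real k) else 0)"
    using mem_grid_cell_iff[OF assms, of t] by (intro sum.cong) (simp_all add: indicator_def)
  show ?thesis
  proof (cases "t \<in> {0<..\<tau>}")
    case True
    then have "0 < t * real k / \<tau>" "t * real k / \<tau> \<le> real k"
      using assms by (auto simp: field_simps)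
    then have c: "0 < ?c" "?c \<le> int k" by (simp_all add: ceiling_le_iff del: zero_less_ceiling) linarith
    define i0 where "i0 = nat (?c - 1)"
    have i0: "i0 < k" "?c = int i0 + 1" using c unfolding i0_def by arith+
    have "(\<Sum>i<k. if ?c = int i + 1 then f (\<tau> * real i / real k) else 0)
        = (\<Sum>i<k. if i = i0 then f (\<tau> * real i / real k) else 0)"
      by (intro sum.cong) (auto simp: i0)
    also have "\<dots> = f (\<tau> * real i0 / real k)" using i0(1) by (simp add: sum.delta)
    also have "\<dots> = f (left_node \<tau> k t)" by (simp add: left_node_def i0(2))
    finally show ?thesis using True * by simp
  next
    case False
    have "?c \<noteq> int i + 1" if "i < k" for i
    proof
      assume "?c = int i + 1"
      then have t: "\<tau> * real i / real k < t" "t \<le> \<tau> * real (Suc i) / real k"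
        using mem_grid_cell_iff[OF assms, of t i] by auto
      moreover have "\<tau> * real (Suc i) / real k \<le> \<tau>" "0 \<le> \<tau> * real i / real k"
        using assms that by (auto simp: field_simps simp del: of_nat_Suc)
      ultimately have "0 < t \<and> t \<le> \<tau>" by linarith
      with False show False by auto
    qed
    then show ?thesis unfolding * using False by (auto intro!: sum.neutral[symmetric])
  qed
qed

lemma integral_left_step_function:
  fixes f :: "real \<Rightarrow> 'b::{banach, second_countable_topology}"
  assumes "finite_measure \<mu>" and [measurable_cong]: "sets \<mu> = sets borel" and "0 < \<tau>" "0 < k"
  shows "(LINT t:{0<..\<tau>}|\<mu>. f (left_node \<tau> k t)) =
    (\<Sum>i<k. measure \<mu> {\<tau> * real i / real k<..\<tau> * real (Suc i) / real k} *\<^sub>R f (\<tau> * real i / real k))"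
proof -
  interpret finite_measure \<mu> by fact
  have sp: "space \<mu> = UNIV" using sets_eq_imp_space_eq[OF assms(2)] by simp
  show ?thesis
    unfolding set_lebesgue_integral_def left_step_function_eq[OF assms(3,4)]
    by (subst Bochner_Integration.integral_sum)
      (auto simp: assms(2) emeasure_eq_measure intro!: integrable_scaleR_left)
qed

lemma left_step_function_tendsto:
  assumes "0 < \<tau>" "continuous (at_left t) f"
  shows "(\<lambda>k. f (left_node \<tau> (Suc k) t)) \<longlonglongrightarrow> f t"
  using assms(2) left_node_tendsto[OF assms(1)] unfolding continuous_within
  by (rule filterlim_compose)

text \<open>
  Left endpoints are strictly smaller than the points of their cell, so that left continuity of
  the integrand makes the step functions converge at every point, whatever the atoms of the measure.
\<close>

lemma left_riemann_sum_tendsto: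
  fixes f :: "real \<Rightarrow> 'b::{banach, second_countable_topology}"
  assumes "finite_measure \<mu>" and sets[measurable_cong]: "sets \<mu> = sets borel" and "0 < \<tau>"
    and [measurable]: "f \<in> borel_measurable borel"
    and bd: "\<And>t. norm (f t) \<le> C" and lc: "\<And>t. continuous (at_left t) f"
  shows "(\<lambda>k. \<Sum>i<Suc k. measure \<mu> {\<tau> * real i / real (Suc k)<..\<tau> * real (Suc i) / real (Suc k)} *\<^sub>R
            f (\<tau> * real i / real (Suc k))) \<longlonglongrightarrow> (LINT t:{0<..\<tau>}|\<mu>. f t)"
proof -
  interpret finite_measure \<mu> by fact
  have [measurable]: "(\<lambda>t. left_node \<tau> (Suc k) t) \<in> borel_measurable borel" for k
    unfolding left_node_def by measurable
  have "(\<lambda>k. LINT t:{0<..\<tau>}|\<mu>. f (left_node \<tau> (Suc k) t)) \<longlonglongrightarrow> (LINT t:{0<..\<tau>}|\<mu>. f t)"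
    unfolding set_lebesgue_integral_def
  proof (rule integral_dominated_convergence[where w="\<lambda>_. C"])
    show "AE t in \<mu>. (\<lambda>k. indicat_real {0<..\<tau>} t *\<^sub>R f (left_node \<tau> (Suc k) t)) \<longlonglongrightarrow> indicat_real {0<..\<tau>} t *\<^sub>R f t"
      by (intro AE_I2 tendsto_intros left_step_function_tendsto assms)
    show "AE t in \<mu>. norm (indicat_real {0<..\<tau>} t *\<^sub>R f (left_node \<tau> (Suc k) t)) \<le> C" for k
      using bd order.trans[OF norm_ge_zero bd] by (auto simp: indicator_def)
  qed (auto intro: borel_measurable_scaleR)
  then show ?thesis
    by (simp only: integral_left_step_function[OF assms(1,2,3) zero_less_Suc])
qed

section \<open>Integration against a counting path\<close>

text \<open>
  The integrator of \<open>path_measure\<close> is the path continued by constants. The lemmas below transfer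
  its properties from \<open>[0, \<tau>]\<close> to the whole line, where the Stieltjes measure is defined.
\<close>

locale counting_trajectory =
  fixes \<tau> :: real and x :: "real \<Rightarrow> nat"
  assumes \<tau>_pos: "0 < \<tau>" and path: "counting_path \<tau> x"
begin

abbreviation (input) F :: "real \<Rightarrow> real" where "F \<equiv> \<lambda>t. real (x (max 0 (min \<tau> t)))"

lemma F_mono: "s \<le> t \<Longrightarrow> F s \<le> F t"
  using path \<tau>_pos unfolding counting_path_def by (auto intro!: mono_onD[of "{0..\<tau>}" x])

lemma F_right_cont: "continuous (at_right a) F"
proof -
  consider "a < 0" | "a \<in> {0..<\<tau>}" | "a \<ge> \<tau>" by fastforce
  then show ?thesis
  proof cases
    case 1
    have "\<forall>\<^sub>F t in at_right a. F t = F a"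
      using eventually_at_right_real[OF 1] by eventually_elim (use 1 \<tau>_pos in auto)
    then show ?thesis unfolding continuous_within by (rule tendsto_eventually)
  next
    case 2
    have "continuous (at_right a) (\<lambda>s. real (x s))" using path 2 unfolding counting_path_def by auto
    moreover have "\<forall>\<^sub>F t in at_right a. real (x t) = F t"
      using eventually_at_right_real[of a \<tau>] 2 by (auto elim!: eventually_mono)
    ultimately show ?thesis unfolding continuous_within using 2 \<tau>_pos
      by (auto intro: Lim_transform_eventually simp: min_def max_def)
  next
    case 3
    have "\<forall>\<^sub>F t in at_right a. F t = F a"
      using eventually_at_right_real[of a "a+1"] by (rule eventually_mono) (use 3 in auto)
    then show ?thesis unfolding continuous_within by (rule tendsto_eventually)
  qed
qed

lemma sets_path_measure[simp, measurable_cong]: "sets (path_measure \<tau> x) = sets borel"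
  and space_path_measure[simp]: "space (path_measure \<tau> x) = UNIV"
  by (simp_all add: path_measure_def)

lemma emeasure_Ioc: "a \<le> b \<Longrightarrow> emeasure (path_measure \<tau> x) {a<..b} = F b - F a"
  unfolding path_measure_def by (rule emeasure_interval_measure_Ioc) (auto intro: F_mono F_right_cont simp del: of_nat_le_iff)

lemma measure_Ioc: "0 \<le> a \<Longrightarrow> a \<le> b \<Longrightarrow> b \<le> \<tau> \<Longrightarrow> measure (path_measure \<tau> x) {a<..b} = real (x b) - real (x a)"
  unfolding path_measure_def
  by (subst measure_interval_measure_Ioc) (auto intro: F_mono F_right_cont simp del: of_nat_le_iff)

text \<open>
  The constant continuation puts no mass outside \<open>(0, \<tau>]\<close>, and none at \<open>0\<close> because of right continuity.
\<close>

lemma AE_support: "AE t in path_measure \<tau> x. t \<in> {0<..\<tau>}"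
proof (rule AE_I)
  let ?N = "(\<Union>m::nat. {- real m<..0}) \<union> (\<Union>m::nat. {\<tau><..\<tau> + real m})"
  show "{t \<in> space (path_measure \<tau> x). t \<notin> {0<..\<tau>}} \<subseteq> ?N"
  proof
    fix t assume "t \<in> {t \<in> space (path_measure \<tau> x). t \<notin> {0<..\<tau>}}"
    then have t: "t \<le> 0 \<or> \<tau> < t" by auto
    obtain m1 where "- t < real m1" using reals_Archimedean2 by blast
    moreover obtain m2 where "t - \<tau> < real m2" using reals_Archimedean2 by blast
    ultimately have "t \<in> {- real m1<..0} \<or> t \<in> {\<tau><..\<tau> + real m2}" using t by force
    then show "t \<in> ?N" by blast
  qed
  have "emeasure (path_measure \<tau> x) {- real m<..0} = 0" for m
    using \<tau>_pos by (subst emeasure_Ioc) (auto simp: min_def max_def ennreal_0[symmetric] simp del: ennreal_0 intro!: arg_cong[where f=ennreal])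
  moreover have "emeasure (path_measure \<tau> x) {\<tau><..\<tau> + real m} = 0" for m
    using \<tau>_pos by (subst emeasure_Ioc) (auto simp: min_def max_def)
  ultimately show "emeasure (path_measure \<tau> x) ?N = 0"
    by (subst emeasure_Un_null_set) (auto intro!: emeasure_UN_eq_0 simp: null_sets_def)
qed auto

lemma finite_path_measure: "finite_measure (path_measure \<tau> x)"
proof
  have "emeasure (path_measure \<tau> x) UNIV = emeasure (path_measure \<tau> x) {0<..\<tau>}"
    by (rule emeasure_eq_AE) (use AE_support in auto)
  also have "\<dots> \<noteq> \<infinity>" using \<tau>_pos by (subst emeasure_Ioc) auto
  finally show "emeasure (path_measure \<tau> x) (space (path_measure \<tau> x)) \<noteq> \<infinity>" by simp
qed

sublocale finite_measure "path_measure \<tau> x" by (rule finite_path_measure)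

lemma total_mass: "measure (path_measure \<tau> x) UNIV = real (x \<tau>)"
proof -
  have "measure (path_measure \<tau> x) UNIV = measure (path_measure \<tau> x) {0<..\<tau>}"
    by (rule measure_eq_AE) (use AE_support in auto)
  also have "\<dots> = x \<tau>"
    using \<tau>_pos path by (subst measure_Ioc) (auto simp: counting_path_def)
  finally show ?thesis .
qed

lemma integral_eq_set_integral:
  fixes f :: "real \<Rightarrow> 'b::{banach, second_countable_topology}"
  assumes [measurable]: "f \<in> borel_measurable borel"
  shows "(LINT t|path_measure \<tau> x. f t) = (LINT t:{0<..\<tau>}|path_measure \<tau> x. f t)"
proof -
  have "AE t in path_measure \<tau> x. f t = indicat_real {0<..\<tau>} t *\<^sub>R f t"
    using AE_support by eventually_elim auto
  then show ?thesis unfolding set_lebesgue_integral_def by (intro integral_cong_AE) auto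
qed

lemma set_integral_eq_integral:
  fixes f g :: "real \<Rightarrow> real"
  assumes [measurable]: "g \<in> borel_measurable borel" and eq: "\<And>t. t \<in> {0..\<tau>} \<Longrightarrow> f t = g t"
  shows "(LINT t:{0..\<tau>}|path_measure \<tau> x. f t) = (LINT t|path_measure \<tau> x. g t)"
proof -
  have "(LINT t:{0..\<tau>}|path_measure \<tau> x. f t) = (LINT t:{0..\<tau>}|path_measure \<tau> x. g t)"
    by (rule set_lebesgue_integral_cong) (use eq in auto)
  moreover have "AE t in path_measure \<tau> x. indicat_real {0..\<tau>} t *\<^sub>R g t = g t"
    using AE_support by eventually_elim auto
  then have "(LINT t:{0..\<tau>}|path_measure \<tau> x. g t) = (LINT t|path_measure \<tau> x. g t)"
    unfolding set_lebesgue_integral_def by (intro integral_cong_AE) auto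
  ultimately show ?thesis by simp
qed

lemma integrable_bounded:
  fixes f :: "real \<Rightarrow> real"
  assumes [measurable]: "f \<in> borel_measurable borel" and bd: "\<And>t. \<bar>f t\<bar> \<le> C"
  shows "integrable (path_measure \<tau> x) f"
  by (rule integrable_const_bound[where B=C]) (use bd in auto)

lemma abs_integral_le:
  fixes f :: "real \<Rightarrow> real"
  assumes [measurable]: "f \<in> borel_measurable borel" and bd: "\<And>t. \<bar>f t\<bar> \<le> C"
  shows "\<bar>LINT t|path_measure \<tau> x. f t\<bar> \<le> C * real (x \<tau>)"
proof -
  have "\<bar>LINT t|path_measure \<tau> x. f t\<bar> \<le> (LINT t|path_measure \<tau> x. \<bar>f t\<bar>)"
    by (rule integral_abs_bound)
  also have "\<dots> \<le> (LINT t|path_measure \<tau> x. C)"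
    by (intro integral_mono integrable_abs integrable_bounded[OF assms] integrable_const bd)
  finally show ?thesis by (simp add: total_mass mult.commute)
qed

lemma increment_eq: "0 \<le> s \<Longrightarrow> s \<le> t \<Longrightarrow> t \<le> \<tau> \<Longrightarrow> real (x t) - real (x s) = real (x t - x s)"
  using path unfolding counting_path_def by (subst of_nat_diff) (auto intro!: mono_onD[of "{0..\<tau>}" x])

text \<open>
  This reduces a path integral to finitely many increments of the path, whose joint law is known.
\<close>

lemma riemann_sum_tendsto:
  fixes f :: "real \<Rightarrow> real"
  assumes [measurable]: "f \<in> borel_measurable borel" and bd: "\<And>t. \<bar>f t\<bar> \<le> C" and lc: "\<And>t. continuous (at_left t) f"
  shows "(\<lambda>k. \<Sum>i<Suc k. real (x (\<tau> * real (Suc i) / real (Suc k)) - x (\<tau> * real i / real (Suc k))) *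
            f (\<tau> * real i / real (Suc k))) \<longlonglongrightarrow> (LINT t|path_measure \<tau> x. f t)"
proof -
  have "(\<lambda>k. \<Sum>i<Suc k. measure (path_measure \<tau> x) {\<tau> * real i / real (Suc k)<..\<tau> * real (Suc i) / real (Suc k)} *\<^sub>R
            f (\<tau> * real i / real (Suc k))) \<longlonglongrightarrow> (LINT t:{0<..\<tau>}|path_measure \<tau> x. f t)"
    by (rule left_riemann_sum_tendsto[where C=C]) (use assms \<tau>_pos in \<open>auto intro: finite_path_measure\<close>)
  moreover have "measure (path_measure \<tau> x) {\<tau> * real i / real (Suc k)<..\<tau> * real (Suc i) / real (Suc k)} =
      real (x (\<tau> * real (Suc i) / real (Suc k)) - x (\<tau> * real i / real (Suc k)))" if "i < Suc k" for i k
  proof -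
    have "0 \<le> \<tau> * real i / real (Suc k)" "\<tau> * real i / real (Suc k) \<le> \<tau> * real (Suc i) / real (Suc k)"
      "\<tau> * real (Suc i) / real (Suc k) \<le> \<tau>" using that \<tau>_pos by (auto simp: field_simps)
    then show ?thesis by (subst measure_Ioc) (auto simp: increment_eq)
  qed
  then have "(\<lambda>k. \<Sum>i<Suc k. measure (path_measure \<tau> x) {\<tau> * real i / real (Suc k)<..\<tau> * real (Suc i) / real (Suc k)} *\<^sub>R
            f (\<tau> * real i / real (Suc k))) =
      (\<lambda>k. \<Sum>i<Suc k. real (x (\<tau> * real (Suc i) / real (Suc k)) - x (\<tau> * real i / real (Suc k))) *
            f (\<tau> * real i / real (Suc k)))"
    unfolding real_scaleR_def by (intro ext sum.cong refl arg_cong2[where f="(*)"]) auto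
  ultimately show ?thesis by (simp only: integral_eq_set_integral[OF assms(1)])
qed

end

section \<open>The exponential formula for Poisson processes\<close>

text \<open>
  The argument \<open>z\<close> is complex because both the moment generating function (for the bounds) and the
  characteristic function (for the limit law) are needed.
\<close>

lemma poisson_exp:
  fixes z :: complex
  assumes "0 < \<mu>"
  shows "integrable (measure_pmf (poisson_pmf \<mu>)) (\<lambda>k. exp (z * of_nat k))" (is ?I)
    and "(LINT k|measure_pmf (poisson_pmf \<mu>). exp (z * of_nat k)) = exp (of_real \<mu> * (exp z - 1))" (is ?E)
proof -
  let ?g = "\<lambda>k. pmf (poisson_pmf \<mu>) k *\<^sub>R exp (z * of_nat k)"
  have g: "?g k = exp (- of_real \<mu>) * ((of_real \<mu> * exp z) ^ k /\<^sub>R fact k)" for k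
  proof -
    have "exp (z * of_nat k) = exp z ^ k" by (metis exp_of_nat_mult mult.commute)
    then have "?g k = of_real (\<mu> ^ k / fact k * exp (- \<mu>)) * exp z ^ k"
      using assms by (simp add: scaleR_conv_of_real)
    also have "\<dots> = exp (of_real (- \<mu>)) * ((of_real \<mu> * exp z) ^ k /\<^sub>R fact k)"
      unfolding exp_of_real scaleR_conv_of_real by (simp add: power_mult_distrib divide_inverse)
    finally show ?thesis by simp
  qed
  have sm: "(\<lambda>k. ?g k) sums (exp (- of_real \<mu>) * exp (of_real \<mu> * exp z))"
    unfolding g by (intro sums_mult exp_converges)
  have "summable (\<lambda>k. norm (?g k))"
    unfolding g norm_mult by (intro summable_mult summable_norm_exp)
  then have int: "integrable (count_space UNIV) ?g" by (simp add: integrable_count_space_nat_iff)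
  show ?I unfolding measure_pmf_eq_density
    by (subst integrable_density) (use int in auto)
  have "(LINT k|measure_pmf (poisson_pmf \<mu>). exp (z * of_nat k)) = (LINT k|count_space UNIV. ?g k)"
    unfolding measure_pmf_eq_density by (subst integral_density) auto
  also have "\<dots> = exp (- of_real \<mu>) * exp (of_real \<mu> * exp z)"
    using int sm by (simp add: integral_count_space_nat sums_iff)
  also have "\<dots> = exp (of_real \<mu> * (exp z - 1))" by (simp add: exp_add[symmetric] algebra_simps)
  finally show ?E .
qed

text \<open>
  The two-sided bound on the intensity holds on the whole line; this avoids restrictions to
  \<open>[0, \<tau>]\<close> in the integrability conditions.
\<close>

locale poisson_sample = prob_space M for M :: "'w measure" +
  fixes \<tau> :: real and lam :: "real \<Rightarrow> real" and n :: nat and X :: "'w \<Rightarrow> nat \<Rightarrow> real \<Rightarrow> nat" and l L :: real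
  assumes \<tau>_pos: "0 < \<tau>" and l_pos: "0 < l"
    and intensity_measurable[measurable]: "lam \<in> borel_measurable borel"
    and intensity_ge: "\<And>t. l \<le> lam t" and intensity_le: "\<And>t. lam t \<le> L"
    and processes: "\<And>j. j \<in> {1..n} \<Longrightarrow> poisson_process M \<tau> lam (\<lambda>\<omega>. X \<omega> j)"
    and indep: "indep_vars (\<lambda>j. \<Pi>\<^sub>M t\<in>{0..\<tau>}. count_space UNIV)
          (\<lambda>j \<omega>. restrict (X \<omega> j) {0..\<tau>}) {1..n}"
begin

definition sample_integral :: "(real \<Rightarrow> real) \<Rightarrow> 'w \<Rightarrow> real" where
  "sample_integral f \<omega> = (\<Sum>j=1..n. LINT t|path_measure \<tau> (X \<omega> j). f t)"

definition grid_sum :: "nat \<Rightarrow> (real \<Rightarrow> real) \<Rightarrow> 'w \<Rightarrow> real" where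
  "grid_sum k f \<omega> = (\<Sum>j=1..n. \<Sum>i<k. real (X \<omega> j (\<tau> * real (Suc i) / real k) - X \<omega> j (\<tau> * real i / real k)) * f (\<tau> * real i / real k))"

lemma trajectory: "\<omega> \<in> space M \<Longrightarrow> j \<in> {1..n} \<Longrightarrow> counting_trajectory \<tau> (X \<omega> j)"
  using processes[of j] \<tau>_pos unfolding poisson_process_def counting_trajectory_def by auto

lemma node_in: "i \<le> k \<Longrightarrow> 0 < k \<Longrightarrow> \<tau> * real i / real k \<in> {0..\<tau>}"
  using \<tau>_pos by (auto simp: field_simps)

lemma node_order:
  assumes "i < k"
  shows "0 \<le> \<tau> * real i / real k" "\<tau> * real i / real k < \<tau> * real (Suc i) / real k" "\<tau> * real (Suc i) / real k \<le> \<tau>"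
  using node_in[of i k] node_in[of "Suc i" k] assms \<tau>_pos by (simp_all add: divide_strict_right_mono)

lemma X_measurable: "j \<in> {1..n} \<Longrightarrow> t \<in> {0..\<tau>} \<Longrightarrow> (\<lambda>\<omega>. X \<omega> j t) \<in> M \<rightarrow>\<^sub>M count_space UNIV"
  using processes[of j] unfolding poisson_process_def by auto

lemma increment_measurable:
  assumes "j \<in> {1..n}" "t \<in> {0..\<tau>}" "s \<in> {0..\<tau>}"
  shows "(\<lambda>\<omega>. X \<omega> j t - X \<omega> j s) \<in> M \<rightarrow>\<^sub>M count_space UNIV"
proof -
  have "(\<lambda>\<omega>. a - X \<omega> j s) \<in> M \<rightarrow>\<^sub>M count_space UNIV" for a
    by (rule measurable_compose[OF X_measurable[OF assms(1,3)], of "\<lambda>y. a - y"]) simp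
  then show ?thesis
    by (rule measurable_compose_countable[OF _ X_measurable[OF assms(1,2)], of "\<lambda>a \<omega>. a - X \<omega> j s"])
qed

lemma grid_sum_tendsto:
  assumes "\<omega> \<in> space M" "f \<in> borel_measurable borel" "\<And>t. \<bar>f t\<bar> \<le> C" "\<And>t. continuous (at_left t) f"
  shows "(\<lambda>k. grid_sum (Suc k) f \<omega>) \<longlonglongrightarrow> sample_integral f \<omega>"
  unfolding grid_sum_def sample_integral_def
  by (intro tendsto_sum counting_trajectory.riemann_sum_tendsto[OF trajectory, where C=C] assms)

text \<open>
  Joint measurability in a parameter and the sample point is needed for Fubini's theorem. It passes
  to the limit from the grid sums, which involve \<open>\<omega>\<close> only through finitely many integer variables.
\<close>

lemma sample_integral_measurable_pair:
  fixes f :: "'a \<Rightarrow> real \<Rightarrow> real"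
  assumes f: "\<And>t. (\<lambda>a. f a t) \<in> borel_measurable N"
    and "\<And>a. a \<in> space N \<Longrightarrow> f a \<in> borel_measurable borel"
    and "\<And>a t. a \<in> space N \<Longrightarrow> \<bar>f a t\<bar> \<le> C" and "\<And>a t. a \<in> space N \<Longrightarrow> continuous (at_left t) (f a)"
  shows "(\<lambda>(a, \<omega>). sample_integral (f a) \<omega>) \<in> borel_measurable (N \<Otimes>\<^sub>M M)"
proof (rule borel_measurable_LIMSEQ_real)
  show "(\<lambda>k. case p of (a, \<omega>) \<Rightarrow> grid_sum (Suc k) (f a) \<omega>) \<longlonglongrightarrow> (case p of (a, \<omega>) \<Rightarrow> sample_integral (f a) \<omega>)"
    if "p \<in> space (N \<Otimes>\<^sub>M M)" for p
  proof -
    have "fst p \<in> space N" "snd p \<in> space M" using that by (auto simp: space_pair_measure)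
    then show ?thesis unfolding split_beta
      by (intro grid_sum_tendsto[where C=C] assms(2-4))
  qed
  show "(\<lambda>p. case p of (a, \<omega>) \<Rightarrow> grid_sum (Suc k) (f a) \<omega>) \<in> borel_measurable (N \<Otimes>\<^sub>M M)" for k
  proof -
    have inc: "(\<lambda>\<omega>. real (X \<omega> j (\<tau> * real (Suc i) / real (Suc k)) - X \<omega> j (\<tau> * real i / real (Suc k)))) \<in> borel_measurable M"
      if "j \<in> {1..n}" "i < Suc k" for i j
      by (rule measurable_compose[OF increment_measurable[OF that(1) node_in[of "Suc i" "Suc k"] node_in[of i "Suc k"]]])
        (use that(2) in auto)
    show ?thesis unfolding grid_sum_def split_beta
      by (intro borel_measurable_sum borel_measurable_times
          measurable_compose[OF measurable_snd inc] measurable_compose[OF measurable_fst f]) auto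
  qed
qed

lemma sample_integral_measurable:
  assumes "f \<in> borel_measurable borel" "\<And>t. \<bar>f t\<bar> \<le> C" "\<And>t. continuous (at_left t) f"
  shows "sample_integral f \<in> borel_measurable M"
proof (rule borel_measurable_LIMSEQ_real)
  show "(\<lambda>k. grid_sum (Suc k) f \<omega>) \<longlonglongrightarrow> sample_integral f \<omega>" if "\<omega> \<in> space M" for \<omega>
    by (rule grid_sum_tendsto[OF that assms])
  show "grid_sum (Suc k) f \<in> borel_measurable M" for k
  proof -
    have "(\<lambda>\<omega>. real (X \<omega> j (\<tau> * real (Suc i) / real (Suc k)) - X \<omega> j (\<tau> * real i / real (Suc k)))) \<in> borel_measurable M"
      if "j \<in> {1..n}" "i < Suc k" for i j
      by (rule measurable_compose[OF increment_measurable[OF that(1) node_in[of "Suc i" "Suc k"] node_in[of i "Suc k"]]])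
        (use that(2) in auto)
    then show ?thesis unfolding grid_sum_def
      by (intro borel_measurable_sum borel_measurable_times) auto
  qed
qed

lemma intensity_bounds: "\<bar>lam t\<bar> \<le> L" "0 < lam t" "0 \<le> lam t"
  using intensity_ge[of t] intensity_le[of t] l_pos by auto

lemma total_intensity_pos: "s < t \<Longrightarrow> 0 < (LBINT u:{s..t}. lam u)"
proof -
  assume "s < t"
  have *: "set_integrable lborel {s..t} lam"
    using intensity_bounds unfolding set_integrable_def
    by (intro integrableI_bounded_set_indicator[where B=L]) (auto simp: emeasure_lborel_Icc_eq)
  have "0 < (t - s) * l" using \<open>s < t\<close> l_pos by auto
  also have "\<dots> = (LBINT u:{s..t}. l)" using \<open>s < t\<close> by (simp add: set_lebesgue_integral_def)
  also have "\<dots> \<le> (LBINT u:{s..t}. lam u)"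
    by (rule set_integral_mono) (use * intensity_ge in \<open>auto simp: set_integrable_def emeasure_lborel_Icc_eq intro!: integrable_real_indicator\<close>)
  finally show ?thesis .
qed

lemma increment_exp:
  fixes z :: complex
  assumes "j \<in> {1..n}" "0 \<le> s" "s < t" "t \<le> \<tau>"
  shows "integrable M (\<lambda>\<omega>. exp (z * of_nat (X \<omega> j t - X \<omega> j s)))" (is ?I)
    and "(LINT \<omega>|M. exp (z * of_nat (X \<omega> j t - X \<omega> j s))) = exp (of_real (LBINT u:{s..t}. lam u) * (exp z - 1))" (is ?E)
proof -
  let ?\<mu> = "LBINT u:{s..t}. lam u" and ?D = "\<lambda>\<omega>. X \<omega> j t - X \<omega> j s"
  have dist: "distr M (count_space UNIV) ?D = measure_pmf (poisson_pmf ?\<mu>)"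
    using processes[OF assms(1)] assms(2-) unfolding poisson_process_def by blast
  have D: "?D \<in> M \<rightarrow>\<^sub>M count_space UNIV"
    by (rule increment_measurable) (use assms in auto)
  have pos: "0 < ?\<mu>" using total_intensity_pos assms(3) .
  show ?I using poisson_exp(1)[OF pos, of z] unfolding dist[symmetric]
    by (subst (asm) integrable_distr_eq[OF D]) auto
  show ?E using poisson_exp(2)[OF pos, of z] unfolding dist[symmetric]
    by (subst (asm) integral_distr[OF D]) auto
qed

lemma path_increments_exp:
  fixes z :: complex
  assumes j: "j \<in> {1..n}" and k: "0 < k"
  shows "integrable M (\<lambda>\<omega>. \<Prod>i<k. exp (z * of_real (f (\<tau> * real i / real k)) *
            of_nat (X \<omega> j (\<tau> * real (Suc i) / real k) - X \<omega> j (\<tau> * real i / real k))))" (is "integrable M (\<lambda>\<omega>. \<Prod>i<k. ?Y i \<omega>)")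
    and "(LINT \<omega>|M. (\<Prod>i<k. exp (z * of_real (f (\<tau> * real i / real k)) *
            of_nat (X \<omega> j (\<tau> * real (Suc i) / real k) - X \<omega> j (\<tau> * real i / real k))))) =
         (\<Prod>i<k. exp (of_real (LBINT u:{\<tau> * real i / real k..\<tau> * real (Suc i) / real k}. lam u) *
            (exp (z * of_real (f (\<tau> * real i / real k))) - 1)))"
proof -
  let ?t = "\<lambda>i. \<tau> * real i / real k"
  have "mono_on {..k} ?t" using \<tau>_pos k by (auto intro!: mono_onI divide_right_mono)
  moreover have "?t ` {..k} \<subseteq> {0..\<tau>}" using node_in[OF _ k] by auto
  ultimately have "indep_vars (\<lambda>_. count_space UNIV) (\<lambda>i \<omega>. X \<omega> j (?t (Suc i)) - X \<omega> j (?t i)) {..<k}"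
    using processes[OF j] unfolding poisson_process_def by blast
  then have ind: "indep_vars (\<lambda>_. borel) ?Y {..<k}"
    by (rule indep_vars_compose2) simp
  have t: "0 \<le> ?t i" "?t i < ?t (Suc i)" "?t (Suc i) \<le> \<tau>" if "i < k" for i
    using node_order[OF that] by auto
  have int: "integrable M (?Y i)" if "i \<in> {..<k}" for i
    using increment_exp(1)[OF j t] that by auto
  show "integrable M (\<lambda>\<omega>. \<Prod>i<k. ?Y i \<omega>)"
    by (rule indep_vars_integrable[OF _ ind int]) auto
  have "(LINT \<omega>|M. (\<Prod>i<k. ?Y i \<omega>)) = (\<Prod>i<k. LINT \<omega>|M. ?Y i \<omega>)"
    by (rule indep_vars_lebesgue_integral[OF _ ind int]) auto
  then show "(LINT \<omega>|M. (\<Prod>i<k. ?Y i \<omega>)) =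
         (\<Prod>i<k. exp (of_real (LBINT u:{?t i..?t (Suc i)}. lam u) * (exp (z * of_real (f (?t i))) - 1)))"
    using increment_exp(2)[OF j t] by simp
qed

text \<open>
  Independence is used twice: of the increments of one path, and of the paths. The independence
  hypothesis on the paths concerns whole restricted paths, so the product over one path has to be
  written as a measurable function of them.
\<close>

lemma grid_exp:
  fixes z :: complex
  assumes k: "0 < k"
  shows "integrable M (\<lambda>\<omega>. exp (z * of_real (grid_sum k f \<omega>)))" (is ?I)
    and "(LINT \<omega>|M. exp (z * of_real (grid_sum k f \<omega>))) =
         exp (of_nat n * (\<Sum>i<k. of_real (LBINT u:{\<tau> * real i / real k..\<tau> * real (Suc i) / real k}. lam u) *
            (exp (z * of_real (f (\<tau> * real i / real k))) - 1)))" (is ?E)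
proof -
  let ?t = "\<lambda>i. \<tau> * real i / real k"
  define Y where "Y y = (\<Prod>i<k. exp (z * of_real (f (?t i)) * of_nat (y (?t (Suc i)) - y (?t i))))" for y :: "real \<Rightarrow> nat"
  let ?P = "\<Pi>\<^sub>M t\<in>{0..\<tau>}. count_space (UNIV :: nat set)"
  have "(\<lambda>y. y (?t (Suc i)) - y (?t i)) \<in> ?P \<rightarrow>\<^sub>M count_space UNIV" if "i < k" for i
  proof -
    have "?t i \<in> {0..\<tau>}" "?t (Suc i) \<in> {0..\<tau>}" using node_in[of _ k] k that by (metis less_imp_le) (metis Suc_leI k node_in that)
    note m = this[THEN measurable_component_singleton, of "\<lambda>_. count_space (UNIV :: nat set)"]
    have "(\<lambda>y. a - y (?t i)) \<in> ?P \<rightarrow>\<^sub>M count_space UNIV" for a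
      by (rule measurable_compose[OF m(1), of "\<lambda>b. a - b"]) simp
    then show ?thesis by (rule measurable_compose_countable[OF _ m(2), of "\<lambda>a y. a - y (?t i)"])
  qed
  note inc = measurable_compose[OF this, of _ "\<lambda>d. exp (_ * of_nat d :: complex)" borel]
  have Ym: "Y \<in> ?P \<rightarrow>\<^sub>M borel"
    unfolding Y_def by (intro borel_measurable_prod inc) auto
  have restr: "Y (restrict (X \<omega> j) {0..\<tau>}) = Y (X \<omega> j)" for \<omega> j
    unfolding Y_def using node_in[OF _ k] by (intro prod.cong) (auto simp: Suc_le_eq simp del: of_nat_Suc)
  have ind: "indep_vars (\<lambda>_. borel) (\<lambda>j \<omega>. Y (X \<omega> j)) {1..n}"
    using indep_vars_compose2[OF indep, where Y="\<lambda>_. Y" and N="\<lambda>_. borel"] Ym by (simp add: restr)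
  have eq: "exp (z * of_real (grid_sum k f \<omega>)) = (\<Prod>j=1..n. Y (X \<omega> j))" for \<omega>
    unfolding grid_sum_def Y_def exp_sum[OF finite_atLeastAtMost, symmetric] exp_sum[OF finite_lessThan, symmetric]
    by (simp add: sum_distrib_left mult_ac)
  have int: "integrable M (\<lambda>\<omega>. Y (X \<omega> j))" if "j \<in> {1..n}" for j
    unfolding Y_def by (rule path_increments_exp(1)[OF that k])
  show ?I unfolding eq by (rule indep_vars_integrable[OF _ ind int]) auto
  have "(LINT \<omega>|M. (\<Prod>j=1..n. Y (X \<omega> j))) = (\<Prod>j=1..n. LINT \<omega>|M. Y (X \<omega> j))"
    by (rule indep_vars_lebesgue_integral[OF _ ind int]) auto
  also have "\<dots> = (\<Prod>j=1..n. \<Prod>i<k. exp (of_real (LBINT u:{?t i..?t (Suc i)}. lam u) * (exp (z * of_real (f (?t i))) - 1)))"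
    by (rule prod.cong) (simp_all only: Y_def path_increments_exp(2)[OF _ k])
  finally show ?E unfolding eq exp_sum[OF finite_lessThan, symmetric] by (simp add: exp_of_nat_mult)
qed

text \<open>
  The total number of jumps has all exponential moments; it dominates every grid sum in the passage
  to the limit below. A grid with a single cell gives it.
\<close>

lemma integrable_exp_total: "integrable M (\<lambda>\<omega>. exp (a * (\<Sum>j=1..n. real (X \<omega> j \<tau>))))"
proof -
  have "integrable M (\<lambda>\<omega>. norm (exp (complex_of_real a * of_real (grid_sum 1 (\<lambda>_. 1) \<omega>))))"
    by (intro integrable_norm grid_exp) auto
  moreover have "norm (exp (complex_of_real a * of_real (grid_sum 1 (\<lambda>_. 1) \<omega>))) = exp (a * (\<Sum>j=1..n. real (X \<omega> j \<tau>)))"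
    if "\<omega> \<in> space M" for \<omega>
  proof -
    have "X \<omega> j 0 = 0" if "j \<in> {1..n}" for j
      using counting_trajectory.path[OF trajectory[OF \<open>\<omega> \<in> space M\<close> that]] by (simp add: counting_path_def)
    then show ?thesis by (simp add: grid_sum_def norm_exp_eq_Re)
  qed
  ultimately show ?thesis by (subst (asm) Bochner_Integration.integrable_cong) auto
qed

lemma abs_grid_sum_le:
  assumes \<omega>: "\<omega> \<in> space M" and C: "\<And>t. \<bar>f t\<bar> \<le> C" and k: "0 < k"
  shows "\<bar>grid_sum k f \<omega>\<bar> \<le> C * (\<Sum>j=1..n. real (X \<omega> j \<tau>))"
proof -
  let ?t = "\<lambda>i. \<tau> * real i / real k"
  have "\<bar>\<Sum>i<k. real (X \<omega> j (?t (Suc i)) - X \<omega> j (?t i)) * f (?t i)\<bar> \<le> C * real (X \<omega> j \<tau>)" if j: "j \<in> {1..n}" for j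
  proof -
    interpret counting_trajectory \<tau> "X \<omega> j" by (rule trajectory[OF \<omega> j])
    have "\<bar>\<Sum>i<k. real (X \<omega> j (?t (Suc i)) - X \<omega> j (?t i)) * f (?t i)\<bar>
        \<le> (\<Sum>i<k. \<bar>real (X \<omega> j (?t (Suc i)) - X \<omega> j (?t i)) * f (?t i)\<bar>)" by (rule sum_abs)
    also have "\<dots> \<le> (\<Sum>i<k. (real (X \<omega> j (?t (Suc i))) - real (X \<omega> j (?t i))) * C)"
    proof (rule sum_mono)
      fix i assume "i \<in> {..<k}"
      then have "0 \<le> ?t i" "?t i \<le> ?t (Suc i)" "?t (Suc i) \<le> \<tau>"
        using node_order[of i k] by auto
      note e = increment_eq[OF this]
      show "\<bar>real (X \<omega> j (?t (Suc i)) - X \<omega> j (?t i)) * f (?t i)\<bar> \<le> (real (X \<omega> j (?t (Suc i))) - real (X \<omega> j (?t i))) * C"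
        unfolding e abs_mult abs_of_nat by (intro mult_left_mono C of_nat_0_le_iff)
    qed
    also have "\<dots> = (real (X \<omega> j (?t k)) - real (X \<omega> j (?t 0))) * C"
      unfolding sum_distrib_right[symmetric] by (subst sum_lessThan_telescope) simp
    also have "\<dots> = C * real (X \<omega> j \<tau>)" using k path by (simp add: counting_path_def)
    finally show ?thesis .
  qed
  then have "(\<Sum>j=1..n. \<bar>\<Sum>i<k. real (X \<omega> j (?t (Suc i)) - X \<omega> j (?t i)) * f (?t i)\<bar>) \<le> (\<Sum>j=1..n. C * real (X \<omega> j \<tau>))"
    by (intro sum_mono)
  then show ?thesis unfolding grid_sum_def sum_distrib_left
    by (intro order.trans[OF sum_abs])
qed

text \<open>
  The weights are the masses of the cells under the measure with density \<open>lam\<close>, so that this is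
  again a left Riemann sum.
\<close>

lemma intensity_riemann_sum_tendsto:
  fixes G :: "real \<Rightarrow> complex"
  assumes [measurable]: "G \<in> borel_measurable borel" and C: "\<And>t. norm (G t) \<le> C" and "\<And>t. continuous (at_left t) G"
  shows "(\<lambda>k. \<Sum>i<Suc k. of_real (LBINT u:{\<tau> * real i / real (Suc k)..\<tau> * real (Suc i) / real (Suc k)}. lam u) *
            G (\<tau> * real i / real (Suc k))) \<longlonglongrightarrow> (CLBINT t:{0..\<tau>}. G t * of_real (lam t))"
proof -
  define \<nu> where "\<nu> = density lborel (\<lambda>t. ennreal (lam t * indicator {0<..\<tau>} t))"
  have [simp, measurable_cong]: "sets \<nu> = sets borel" by (simp add: \<nu>_def)
  have intl: "set_integrable lborel {a..b} lam" for a b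
    using intensity_bounds unfolding set_integrable_def
    by (intro integrableI_bounded_set_indicator[where B=L]) (auto simp: emeasure_lborel_Icc_eq)
  have em: "emeasure \<nu> {a<..b} = ennreal (LBINT u:{a..b}. lam u)" if "0 \<le> a" "b \<le> \<tau>" for a b
  proof -
    have "emeasure \<nu> {a<..b} = (\<integral>\<^sup>+ t. ennreal (lam t * indicator {0<..\<tau>} t) * indicator {a<..b} t \<partial>lborel)"
      unfolding \<nu>_def by (subst emeasure_density) auto
    also have "\<dots> = (\<integral>\<^sup>+ t. ennreal (indicator {a..b} t *\<^sub>R lam t) \<partial>lborel)"
      by (rule nn_integral_cong_AE) (use AE_lborel_singleton[of a] that in \<open>auto elim!: eventually_mono simp: indicator_def\<close>)
    also have "\<dots> = ennreal (LBINT u:{a..b}. lam u)"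
      unfolding set_lebesgue_integral_def
      by (rule nn_integral_eq_integral) (use intl[of a b] intensity_bounds in \<open>auto simp: set_integrable_def\<close>)
    finally show ?thesis .
  qed
  have "finite_measure \<nu>"
  proof
    have "emeasure \<nu> UNIV = emeasure \<nu> {0<..\<tau>}"
      unfolding \<nu>_def by (subst (1 2) emeasure_density) (auto intro!: nn_integral_cong simp: indicator_def)
    then show "emeasure \<nu> (space \<nu>) \<noteq> \<infinity>" using em[of 0 \<tau>] by (simp add: \<nu>_def)
  qed
  then have "(\<lambda>k. \<Sum>i<Suc k. measure \<nu> {\<tau> * real i / real (Suc k)<..\<tau> * real (Suc i) / real (Suc k)} *\<^sub>R
            G (\<tau> * real i / real (Suc k))) \<longlonglongrightarrow> (LINT t:{0<..\<tau>}|\<nu>. G t)"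
    by (rule left_riemann_sum_tendsto[where C=C]) (use assms \<tau>_pos in auto)
  moreover have "measure \<nu> {\<tau> * real i / real (Suc k)<..\<tau> * real (Suc i) / real (Suc k)} =
      (LBINT u:{\<tau> * real i / real (Suc k)..\<tau> * real (Suc i) / real (Suc k)}. lam u)" if "i < Suc k" for i k
  proof -
    have "0 \<le> (LBINT u:{a..b}. lam u)" for a b
      unfolding set_lebesgue_integral_def using intensity_bounds by (intro integral_nonneg_AE) auto
    moreover have "0 \<le> \<tau> * real i / real (Suc k)" "\<tau> * real (Suc i) / real (Suc k) \<le> \<tau>" using node_order[OF that] by auto
    ultimately show ?thesis using em by (simp add: measure_def)
  qed
  then have "(\<lambda>k. \<Sum>i<Suc k. measure \<nu> {\<tau> * real i / real (Suc k)<..\<tau> * real (Suc i) / real (Suc k)} *\<^sub>R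
            G (\<tau> * real i / real (Suc k))) = (\<lambda>k. \<Sum>i<Suc k. of_real (LBINT u:{\<tau> * real i / real (Suc k)..\<tau> * real (Suc i) / real (Suc k)}. lam u) *
            G (\<tau> * real i / real (Suc k)))"
    unfolding scaleR_conv_of_real by (intro ext sum.cong refl arg_cong2[where f="(*)"] arg_cong[where f=of_real]) auto
  moreover have "(LINT t:{0<..\<tau>}|\<nu>. G t) = (CLBINT t:{0..\<tau>}. G t * of_real (lam t))"
  proof -
    have "(LINT t:{0<..\<tau>}|\<nu>. G t) = (LINT t|lborel. (lam t * indicator {0<..\<tau>} t) *\<^sub>R indicator {0<..\<tau>} t *\<^sub>R G t)"
      unfolding \<nu>_def set_lebesgue_integral_def using intensity_bounds by (subst integral_density) auto
    also have "\<dots> = (CLBINT t:{0..\<tau>}. G t * of_real (lam t))"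
      unfolding set_lebesgue_integral_def
      by (rule integral_cong_AE) (use AE_lborel_singleton[of 0] in \<open>auto elim!: eventually_mono simp: indicator_def scaleR_conv_of_real\<close>)
    finally show ?thesis .
  qed
  ultimately show ?thesis by simp
qed

text \<open>
  The exponential formula (Campbell's theorem). On a grid it is \<open>grid_exp\<close>; left continuity of \<open>f\<close> lets both
  sides converge as the grid is refined, the left side by dominated convergence.
\<close>

theorem exp_sample_integral:
  fixes z :: complex
  assumes [measurable]: "f \<in> borel_measurable borel" and C: "\<And>t. \<bar>f t\<bar> \<le> C" and lc: "\<And>t. continuous (at_left t) f"
  shows "integrable M (\<lambda>\<omega>. exp (z * of_real (sample_integral f \<omega>)))"
    and "(LINT \<omega>|M. exp (z * of_real (sample_integral f \<omega>))) =
         exp (of_nat n * (CLBINT t:{0..\<tau>}. (exp (z * of_real (f t)) - 1) * of_real (lam t)))"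
proof -
  have [measurable]: "sample_integral f \<in> borel_measurable M" by (rule sample_integral_measurable[OF assms])
  have gm[measurable]: "(\<lambda>\<omega>. exp (z * of_real (grid_sum (Suc k) f \<omega>))) \<in> borel_measurable M" for k
    by (rule borel_measurable_integrable[OF grid_exp(1)]) simp
  let ?T = "\<lambda>\<omega>. exp (cmod z * C * (\<Sum>j=1..n. real (X \<omega> j \<tau>)))"
  have conv: "AE \<omega> in M. (\<lambda>k. exp (z * of_real (grid_sum (Suc k) f \<omega>))) \<longlonglongrightarrow> exp (z * of_real (sample_integral f \<omega>))"
    by (intro AE_I2 tendsto_intros grid_sum_tendsto[where C=C] assms)
  have bd: "AE \<omega> in M. norm (exp (z * of_real (grid_sum (Suc k) f \<omega>))) \<le> ?T \<omega>" for k
  proof (rule AE_I2)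
    fix \<omega> assume \<omega>: "\<omega> \<in> space M"
    have "Re (z * of_real (grid_sum (Suc k) f \<omega>)) \<le> cmod z * \<bar>grid_sum (Suc k) f \<omega>\<bar>"
      using complex_Re_le_cmod[of "z * of_real (grid_sum (Suc k) f \<omega>)"] by (simp add: norm_mult)
    also have "\<dots> \<le> cmod z * (C * (\<Sum>j=1..n. real (X \<omega> j \<tau>)))"
      by (intro mult_left_mono abs_grid_sum_le[OF \<omega> C]) auto
    finally show "norm (exp (z * of_real (grid_sum (Suc k) f \<omega>))) \<le> ?T \<omega>" by (simp add: norm_exp_eq_Re mult.assoc)
  qed
  show "integrable M (\<lambda>\<omega>. exp (z * of_real (sample_integral f \<omega>)))"
    by (rule integrable_dominated_convergence[OF _ gm integrable_exp_total conv bd]) simp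
  have "(\<lambda>k. LINT \<omega>|M. exp (z * of_real (grid_sum (Suc k) f \<omega>))) \<longlonglongrightarrow> (LINT \<omega>|M. exp (z * of_real (sample_integral f \<omega>)))"
    by (rule integral_dominated_convergence[OF _ gm integrable_exp_total conv bd]) simp
  moreover have "(\<lambda>k. LINT \<omega>|M. exp (z * of_real (grid_sum (Suc k) f \<omega>))) \<longlonglongrightarrow>
      exp (of_nat n * (CLBINT t:{0..\<tau>}. (exp (z * of_real (f t)) - 1) * of_real (lam t)))"
    unfolding grid_exp(2)[OF zero_less_Suc]
  proof (intro tendsto_exp tendsto_mult tendsto_const intensity_riemann_sum_tendsto)
    show "norm (exp (z * of_real (f t)) - 1) \<le> exp (cmod z * C) + 1" for t
    proof -
      have "norm (exp (z * of_real (f t))) \<le> exp (norm (z * of_real (f t)))" by (rule norm_exp)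
      also have "\<dots> \<le> exp (cmod z * C)" using C[of t] by (simp add: norm_mult mult_left_mono)
      finally show ?thesis using norm_triangle_ineq4[of "exp (z * of_real (f t))" 1] unfolding norm_one by linarith
    qed
    show "continuous (at_left t) (\<lambda>t. exp (z * of_real (f t)) - 1)" for t
      by (intro continuous_intros lc)
  qed simp
  ultimately show "(LINT \<omega>|M. exp (z * of_real (sample_integral f \<omega>))) =
         exp (of_nat n * (CLBINT t:{0..\<tau>}. (exp (z * of_real (f t)) - 1) * of_real (lam t)))"
    by (rule LIMSEQ_unique)
qed

corollary exp_sample_integral_real:
  assumes [measurable]: "f \<in> borel_measurable borel" and C: "\<And>t. \<bar>f t\<bar> \<le> C" and lc: "\<And>t. continuous (at_left t) f"
  shows "integrable M (\<lambda>\<omega>. exp (sample_integral f \<omega>))"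
    and "expectation (\<lambda>\<omega>. exp (sample_integral f \<omega>)) = exp (real n * (LBINT t:{0..\<tau>}. (exp (f t) - 1) * lam t))"
proof -
  have "integrable M (\<lambda>\<omega>. complex_of_real (exp (sample_integral f \<omega>)))"
    using exp_sample_integral(1)[OF assms, of 1] by (simp add: exp_of_real)
  then show "integrable M (\<lambda>\<omega>. exp (sample_integral f \<omega>))" by (simp add: complex_of_real_integrable_eq)
  have "complex_of_real (LINT \<omega>|M. exp (sample_integral f \<omega>)) = (LINT \<omega>|M. complex_of_real (exp (sample_integral f \<omega>)))"
    by simp
  also have "\<dots> = exp (of_nat n * (CLBINT t:{0..\<tau>}. of_real ((exp (f t) - 1) * lam t)))"
    using exp_sample_integral(2)[OF assms, of 1] by (simp add: exp_of_real[symmetric])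
  also have "(CLBINT t:{0..\<tau>}. of_real ((exp (f t) - 1) * lam t)) = of_real (LBINT t:{0..\<tau>}. (exp (f t) - 1) * lam t)"
    by (rule set_integral_complex_of_real)
  finally have "complex_of_real (LINT \<omega>|M. exp (sample_integral f \<omega>)) =
      complex_of_real (exp (real n * (LBINT t:{0..\<tau>}. (exp (f t) - 1) * lam t)))"
    unfolding exp_of_real[symmetric] of_real_mult of_real_of_nat_eq .
  then show "expectation (\<lambda>\<omega>. exp (sample_integral f \<omega>)) = exp (real n * (LBINT t:{0..\<tau>}. (exp (f t) - 1) * lam t))"
    by (simp only: of_real_eq_iff)
qed

end

section \<open>The ramp intensity\<close>

definition ramp :: "real \<Rightarrow> real" where
  "ramp x = max 0 (min 1 x)"

lemma ramp_bounds: "0 \<le> ramp x" "ramp x \<le> 1" by (auto simp: ramp_def)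

lemma ramp_lipschitz: "\<bar>ramp x - ramp y\<bar> \<le> \<bar>x - y\<bar>" by (auto simp: ramp_def)

lemma ramp_mono: "x \<le> y \<Longrightarrow> ramp x \<le> ramp y" by (auto simp: ramp_def)

lemma ramp_measurable[measurable]: "ramp \<in> borel_measurable borel"
  unfolding ramp_def by measurable

lemma continuous_on_ramp[continuous_intros]: "continuous_on A f \<Longrightarrow> continuous_on A (\<lambda>x. ramp (f x))"
  unfolding ramp_def by (intro continuous_intros)

lemma left_continuous_indicator_Ioc:
  "continuous (at_left t) (indicator {a<..b} :: real \<Rightarrow> real)"
proof -
  have "\<forall>\<^sub>F s in at_left t. indicator {a<..b} s = (indicator {a<..b} t :: real)"
  proof -
    consider "t \<le> a" | "a < t" "t \<le> b" | "a < t" "b < t" by linarith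
    then show ?thesis
    proof cases
      case 1
      have "t - 1 < t" by simp
      from eventually_at_left_real[OF this] show ?thesis by (rule eventually_mono) (use 1 in auto)
    next
      case 2
      show ?thesis using eventually_at_left_real[OF 2(1)] by (rule eventually_mono) (use 2 in auto)
    next
      case 3
      show ?thesis using eventually_at_left_real[OF 3(2)] by (rule eventually_mono) (use 3 in auto)
    qed
  qed
  then show ?thesis unfolding continuous_within by (rule tendsto_eventually)
qed

lemma set_integrable_Icc_bounded:
  fixes f :: "real \<Rightarrow> real"
  assumes [measurable]: "f \<in> borel_measurable borel" and "\<And>t. t \<in> {a..b} \<Longrightarrow> \<bar>f t\<bar> \<le> C"
  shows "set_integrable lborel {a..b} f"
  unfolding set_integrable_def using assms
  by (intro integrableI_bounded_set_indicator[where B=C]) (auto simp: emeasure_lborel_Icc_eq)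

lemma LBINT_const_Icc: "a \<le> b \<Longrightarrow> (LBINT t:{a..b}. (c::real)) = c * (b - a)"
  by (simp add: set_lebesgue_integral_def)

lemma LBINT_indicator_Ioc:
  fixes c :: real
  assumes "0 \<le> a" "a \<le> b" "b \<le> \<tau>"
  shows "(LBINT t:{0..\<tau>}. c * indicator {a<..b} t) = c * (b - a)"
proof -
  have "(LBINT t:{0..\<tau>}. c * indicator {a<..b} t) = (LINT t|lborel. c * indicator {a<..b} t)"
    unfolding set_lebesgue_integral_def by (rule Bochner_Integration.integral_cong) (use assms in \<open>auto simp: indicator_def\<close>)
  then show ?thesis using assms by simp
qed

locale ramp_intensity =
  fixes \<alpha> \<beta> \<tau> r :: real and \<psi> :: "real \<Rightarrow> real"
  assumes \<alpha>_pos: "0 < \<alpha>" and \<alpha>_less: "\<alpha> < \<beta>" and \<beta>_less: "\<beta> < \<tau>"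
    and \<psi>_cont: "continuous_on {0..\<tau>} \<psi>" and \<psi>_pos: "\<forall>t\<in>{0..\<tau>}. \<psi> t > 0"
    and r_greater: "r > - (INF t\<in>{0..\<tau>}. \<psi> t)" and r_nonzero: "r \<noteq> 0"
begin

lemma tau_pos: "0 < \<tau>" using \<alpha>_pos \<alpha>_less \<beta>_less by simp

text \<open>
  Outside \<open>[0, \<tau>]\<close> nothing is known about \<open>\<psi>\<close>; the constant continuation is continuous and keeps the
  bounds of \<open>\<psi>\<close>.
\<close>

definition psi_ext :: "real \<Rightarrow> real" where "psi_ext t = \<psi> (max 0 (min \<tau> t))"

text \<open>
  The intensity as a continuous function on the whole line, for a transition zone of length \<open>d\<close> that
  starts at \<open>v\<close>.
\<close>

definition lam :: "real \<Rightarrow> real \<Rightarrow> real \<Rightarrow> real" where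
  "lam d v t = psi_ext t + r * ramp ((t - v) / d)"

definition lo :: real where "lo = (INF t\<in>{0..\<tau>}. \<psi> t) + min 0 r"

definition hi :: real where "hi = (SUP t\<in>{0..\<tau>}. \<psi> t) + \<bar>r\<bar>"

text \<open>
  Up to the factor \<open>- r / d\<close> this is the derivative of \<open>ln (lam d v t)\<close> with respect to \<open>v\<close>. The zone is
  taken closed on the right, so that the function is left continuous in \<open>t\<close>, as the exponential
  formula demands.
\<close>

definition win :: "real \<Rightarrow> real \<Rightarrow> real \<Rightarrow> real" where
  "win d v t = indicator {v<..v + d} t / lam d v t"

lemma clip_in: "max 0 (min \<tau> t) \<in> {0..\<tau>}" using tau_pos by auto

lemma psi_ext_eq: "t \<in> {0..\<tau>} \<Longrightarrow> psi_ext t = \<psi> t" by (simp add: psi_ext_def)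

lemma psi_bdd: "bdd_below (\<psi> ` {0..\<tau>})" "bdd_above (\<psi> ` {0..\<tau>})"
  using compact_imp_bounded[OF compact_continuous_image[OF \<psi>_cont compact_Icc]]
  by (auto intro: bounded_imp_bdd_below bounded_imp_bdd_above)

lemma psi_ext_bounds: "(INF t\<in>{0..\<tau>}. \<psi> t) \<le> psi_ext t" "psi_ext t \<le> (SUP t\<in>{0..\<tau>}. \<psi> t)"
  unfolding psi_ext_def using clip_in by (auto intro: cINF_lower cSUP_upper psi_bdd)

lemma lo_pos: "0 < lo"
proof -
  obtain s where s: "s \<in> {0..\<tau>}" "\<forall>t\<in>{0..\<tau>}. \<psi> s \<le> \<psi> t"
    using continuous_attains_inf[OF compact_Icc _ \<psi>_cont] tau_pos by auto
  then have "\<psi> s \<le> (INF t\<in>{0..\<tau>}. \<psi> t)" by (intro cINF_greatest) auto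
  then have "0 < (INF t\<in>{0..\<tau>}. \<psi> t)" using s \<psi>_pos by (meson less_le_trans)
  then show ?thesis using r_greater unfolding lo_def by (auto simp: min_def)
qed

lemma lam_ge: "lo \<le> lam d v t"
proof -
  have "min 0 r \<le> r * ramp x" for x
    using ramp_bounds[of x] by (cases "0 \<le> r") (auto simp: min_def mult_le_cancel_left1)
  then show ?thesis unfolding lo_def lam_def by (intro add_mono psi_ext_bounds)
qed

lemma lam_le: "lam d v t \<le> hi"
proof -
  have "r * ramp x \<le> \<bar>r\<bar>" for x
    using ramp_bounds[of x] by (metis abs_ge_self abs_le_D1 abs_mult abs_of_nonneg mult_left_le abs_ge_zero)
  then show ?thesis unfolding hi_def lam_def by (intro add_mono psi_ext_bounds)
qed

lemma lam_pos: "0 < lam d v t" using lam_ge lo_pos by (rule less_le_trans[rotated])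

lemma hi_pos: "0 < hi" using lam_pos lam_le by (rule less_le_trans)

lemma continuous_on_psi_ext: "continuous_on UNIV psi_ext"
  unfolding psi_ext_def
  by (rule continuous_on_compose2[OF \<psi>_cont]) (use clip_in in \<open>auto intro!: continuous_intros\<close>)

lemma psi_ext_measurable[measurable]: "psi_ext \<in> borel_measurable borel"
  by (rule borel_measurable_continuous_onI[OF continuous_on_psi_ext])

lemma continuous_on_lam: "0 < d \<Longrightarrow> continuous_on UNIV (lam d v)"
  unfolding lam_def by (intro continuous_intros continuous_on_psi_ext) simp

lemma isCont_lam: "0 < d \<Longrightarrow> isCont (lam d v) t"
  using continuous_on_lam[of d v] by (simp add: continuous_on_eq_continuous_at)

lemma lam_measurable_pair[measurable]: "(\<lambda>(v, t). lam d v t) \<in> borel_measurable (borel \<Otimes>\<^sub>M borel)"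
  unfolding lam_def split_beta by measurable

lemma lam_measurable[measurable]: "lam d v \<in> borel_measurable borel"
  unfolding lam_def by measurable

lemma intensity_eq_lam:
  assumes "0 < d" "t \<in> {0..\<tau>}"
  shows "intensity \<psi> r \<tau> d v t = lam d v t"
  using assms by (auto simp: intensity_def lam_def psi_ext_eq ramp_def indicator_def field_simps)

lemma win_bounds: "0 \<le> win d v t" "win d v t \<le> 1 / lo" "\<bar>win d v t\<bar> \<le> 1 / lo"
proof -
  have "1 / lam d v t \<le> 1 / lo" using lam_ge lo_pos by (intro divide_left_mono mult_pos_pos lam_pos) auto
  then show "0 \<le> win d v t" "win d v t \<le> 1 / lo" "\<bar>win d v t\<bar> \<le> 1 / lo"
    using lam_pos[of d v t] lo_pos by (auto simp: win_def indicator_def)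
qed

lemma win_measurable_pair[measurable]: "(\<lambda>(v, t). win d v t) \<in> borel_measurable (borel \<Otimes>\<^sub>M borel)"
proof -
  have "(\<lambda>(v, t). (if v < t \<and> t \<le> v + d then 1 else 0) / lam d v t) \<in> borel_measurable (borel \<Otimes>\<^sub>M borel)"
    unfolding split_beta by measurable
  then show ?thesis by (simp add: win_def indicator_def)
qed

lemma win_measurable[measurable]: "win d v \<in> borel_measurable borel"
  unfolding win_def by measurable

lemma left_continuous_win: "0 < d \<Longrightarrow> continuous (at_left t) (win d v)"
  unfolding win_def
  by (intro continuous_divide left_continuous_indicator_Ioc continuous_at_imp_continuous_at_within[OF isCont_lam])
     (auto simp: less_imp_neq[OF lam_pos, symmetric])

lemma left_continuous_ln_lam: "0 < d \<Longrightarrow> continuous (at_left t) (\<lambda>t. ln (lam d v t))"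
  by (intro continuous_ln continuous_at_imp_continuous_at_within[OF isCont_lam]) (auto simp: less_imp_neq[OF lam_pos, symmetric])

lemma abs_lam_le: "\<bar>lam d v t\<bar> \<le> hi" using lam_pos[of d v t] lam_le[of d v t] by simp

lemma abs_ln_lam_le: "\<bar>ln (lam d v t)\<bar> \<le> \<bar>ln lo\<bar> + \<bar>ln hi\<bar>"
proof -
  have "ln lo \<le> ln (lam d v t)" "ln (lam d v t) \<le> ln hi"
    using lo_pos lam_pos[of d v t] lam_ge[of d v t] lam_le[of d v t] by auto
  then show ?thesis by linarith
qed

text \<open>
  A jump in the zone has weight \<open>1 / lam\<close>, so the intensity cancels and only the length of the zone remains.
\<close>

lemma integral_win_lam:
  assumes "0 \<le> v" "0 < d" "v + d \<le> \<tau>"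
  shows "(LBINT t:{0..\<tau>}. win d v t * lam d v t) = d"
proof -
  have "win d v t * lam d v t = 1 * indicator {v<..v+d} t" for t
    using lam_pos[of d v t] by (simp add: win_def)
  then show ?thesis using LBINT_indicator_Ioc[of v "v+d" \<tau> 1] assms by simp
qed

text \<open>
  The compensator of the log-likelihood is affine in the parameter as long as the zone lies inside
  \<open>[0, \<tau>]\<close>; therefore the compensator of the score is a constant.
\<close>

lemma integral_ramp:
  assumes "0 \<le> v" "0 < d" "v + d \<le> \<tau>"
  shows "(LBINT t:{0..\<tau>}. ramp ((t - v) / d)) = \<tau> - v - d / 2"
proof -
  define G where "G t = d / 2 * (ramp ((t - v) / d))\<^sup>2 + max 0 (t - v - d)" for t
  have "((\<lambda>t. ramp ((t - v) / d)) has_integral (G \<tau> - G 0)) {0..\<tau>}"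
  proof (rule fundamental_theorem_of_calculus_strong[where S="{v, v + d}"])
    show "0 \<le> \<tau>" using tau_pos by simp
    show "continuous_on {0..\<tau>} G" unfolding G_def by (intro continuous_intros) (use assms in auto)
    fix t assume "t \<in> {0..\<tau>} - {v, v + d}"
    then consider "t < v" | "v < t" "t < v + d" | "v + d < t" by force
    then show "(G has_vector_derivative ramp ((t - v) / d)) (at t)"
      unfolding has_real_derivative_iff_has_vector_derivative[symmetric]
    proof cases
      case 1
      have "((\<lambda>_. 0) has_real_derivative ramp ((t - v) / d)) (at t)"
        using 1 assms by (auto simp: ramp_def max_def divide_le_0_iff zero_le_divide_iff not_le intro!: derivative_eq_intros)
      then show "(G has_real_derivative ramp ((t - v) / d)) (at t)"
        by (rule has_field_derivative_transform_within_open[of _ _ _ "{..<v}"])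
          (use 1 assms in \<open>auto simp: G_def ramp_def max_def divide_le_0_iff not_le divide_neg_pos\<close>)
    next
      case 2
      have "((\<lambda>t. (t - v)\<^sup>2 / (2 * d)) has_real_derivative ramp ((t - v) / d)) (at t)"
        using 2 assms by (auto simp: ramp_def max_def min_def field_simps intro!: derivative_eq_intros)
      then show "(G has_real_derivative ramp ((t - v) / d)) (at t)"
        by (rule has_field_derivative_transform_within_open[of _ _ _ "{v<..<v+d}"])
          (use 2 assms in \<open>auto simp: G_def ramp_def max_def min_def field_simps power2_eq_square\<close>)
    next
      case 3
      have "((\<lambda>t. d / 2 + (t - v - d)) has_real_derivative ramp ((t - v) / d)) (at t)"
        using 3 assms by (auto simp: ramp_def max_def min_def field_simps intro!: derivative_eq_intros)
      then show "(G has_real_derivative ramp ((t - v) / d)) (at t)"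
        by (rule has_field_derivative_transform_within_open[of _ _ _ "{v+d<..}"])
          (use 3 assms in \<open>auto simp: G_def ramp_def max_def min_def field_simps power2_eq_square\<close>)
    qed
  qed simp
  moreover have "G \<tau> - G 0 = \<tau> - v - d / 2"
    using assms by (auto simp: G_def ramp_def max_def min_def field_simps power2_eq_square)
  moreover have "set_integrable lborel {0..\<tau>} (\<lambda>t. ramp ((t - v) / d))"
    by (rule set_integrable_Icc_bounded[where C=1]) (use ramp_bounds in auto)
  ultimately show ?thesis by (simp add: set_borel_integral_eq_integral(2) integral_unique)
qed

lemma integral_lam:
  assumes "0 \<le> v" "0 < d" "v + d \<le> \<tau>"
  shows "(LBINT t:{0..\<tau>}. lam d v t) = (LBINT t:{0..\<tau>}. psi_ext t) + r * (\<tau> - v - d / 2)"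
proof -
  have "set_integrable lborel {0..\<tau>} psi_ext"
    by (rule borel_integrable_atLeastAtMost')
      (rule continuous_on_subset[OF continuous_on_psi_ext], simp)
  moreover have "set_integrable lborel {0..\<tau>} (\<lambda>t. ramp ((t - v) / d))"
    by (rule set_integrable_Icc_bounded[where C=1]) (use ramp_bounds in auto)
  ultimately show ?thesis unfolding lam_def
    by (subst set_integral_add) (auto simp: integral_ramp[OF assms])
qed

context
  fixes d v1 v2 :: real
  assumes d: "0 < d" and v: "0 \<le> v1" "v1 \<le> v2" "v2 + d \<le> \<tau>"
begin

private abbreviation (input) D :: "real \<Rightarrow> real" where
  "D \<equiv> \<lambda>t. ramp ((t - v1) / d) - ramp ((t - v2) / d)"

lemma ramp_diff_bounds: "0 \<le> D t" "D t \<le> (v2 - v1) / d"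
proof -
  show "0 \<le> D t" using v d by (simp add: ramp_mono divide_right_mono)
  show "D t \<le> (v2 - v1) / d"
    using ramp_lipschitz[of "(t - v1) / d" "(t - v2) / d"] v d by (simp add: diff_divide_distrib[symmetric])
qed

lemma ramp_diff_support: "D t \<noteq> 0 \<Longrightarrow> t \<in> {v1<..v2 + d}"
  using d v by (auto simp: ramp_def max_def min_def field_simps split: if_splits)

lemma ramp_diff_integrable: "set_integrable lborel {0..\<tau>} D"
  "set_integrable lborel {0..\<tau>} (\<lambda>t. (D t)\<^sup>2)"
proof -
  have "\<bar>D t\<bar> \<le> 1" for t using ramp_bounds[of "(t - v1) / d"] ramp_bounds[of "(t - v2) / d"] by linarith
  then have "\<bar>D t\<bar> \<le> 1 \<and> \<bar>(D t)\<^sup>2\<bar> \<le> 1" for t by (simp add: abs_square_le_1)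
  then show "set_integrable lborel {0..\<tau>} D" "set_integrable lborel {0..\<tau>} (\<lambda>t. (D t)\<^sup>2)"
    by (auto intro!: set_integrable_Icc_bounded[where C=1])
qed

lemma integral_ramp_diff: "(LBINT t:{0..\<tau>}. D t) = v2 - v1"
proof -
  have "set_integrable lborel {0..\<tau>} (\<lambda>t. ramp ((t - x) / d))" for x
    by (rule set_integrable_Icc_bounded[where C=1]) (use ramp_bounds in auto)
  then show ?thesis using v d by (subst set_integral_diff) (auto simp: integral_ramp)
qed

text \<open>
  The difference \<open>D\<close> of two ramps has integral \<open>h = v2 - v1\<close> and lives on an interval of length \<open>h + d\<close>,
  so that this is the Cauchy-Schwarz inequality. It is sharp enough for both regimes: it behaves
  like \<open>h\<^sup>2 / d\<close> for small \<open>h\<close> and like \<open>h\<close> for large \<open>h\<close>.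
\<close>

lemma integral_ramp_diff_sq_ge: "(v2 - v1)\<^sup>2 / (v2 - v1 + d) \<le> (LBINT t:{0..\<tau>}. (D t)\<^sup>2)"
proof -
  \<comment> \<open>With this slope, integrating 2 k D - k^2 <= D^2 over the support gives Cauchy-Schwarz.\<close>
  define k where "k = (v2 - v1) / (v2 - v1 + d)"
  have i: "set_integrable lborel {0..\<tau>} (\<lambda>t. k\<^sup>2 * indicator {v1<..v2 + d} t)"
    by (rule set_integrable_Icc_bounded[where C="k\<^sup>2"]) (auto simp: indicator_def)
  have e: "(LBINT t:{0..\<tau>}. k\<^sup>2 * indicator {v1<..v2 + d} t) = k\<^sup>2 * (v2 + d - v1)"
    by (rule LBINT_indicator_Ioc) (use v d in auto)
  have "2 * k * (v2 - v1) - k\<^sup>2 * (v2 + d - v1) = (LBINT t:{0..\<tau>}. 2 * k * D t - k\<^sup>2 * indicator {v1<..v2 + d} t)"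
    unfolding e[symmetric] integral_ramp_diff[symmetric]
    using ramp_diff_integrable(1) i by (subst set_integral_diff) auto
  also have "\<dots> \<le> (LBINT t:{0..\<tau>}. (D t)\<^sup>2)"
  proof (rule set_integral_mono)
    show "2 * k * D t - k\<^sup>2 * indicator {v1<..v2 + d} t \<le> (D t)\<^sup>2" for t
    proof (cases "D t = 0")
      case False
      then show ?thesis using ramp_diff_support[of t] sum_squares_bound[of k "D t"] by simp
    qed simp
  qed (use ramp_diff_integrable i in auto)
  also have "2 * k * (v2 - v1) - k\<^sup>2 * (v2 + d - v1) = (v2 - v1)\<^sup>2 / (v2 - v1 + d)"
  proof -
    have ks: "k * (v2 + d - v1) = v2 - v1" 
    proof -
      have "v2 + d - v1 = v2 - v1 + d" "v2 - v1 + d \<noteq> 0" using v d by auto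
      then show ?thesis by (simp only: k_def times_divide_eq_left) (rule nonzero_mult_div_cancel_right)
    qed
    have "k\<^sup>2 * (v2 + d - v1) = k * (v2 - v1)" unfolding power2_eq_square mult.assoc ks ..
    then have "2 * k * (v2 - v1) - k\<^sup>2 * (v2 + d - v1) = k * (v2 - v1)" by simp
    then show ?thesis by (simp add: k_def power2_eq_square)
  qed
  finally show ?thesis .
qed

lemma integral_ramp_diff_sq_le: "(LBINT t:{0..\<tau>}. (D t)\<^sup>2) \<le> ((v2 - v1) / d)\<^sup>2 * (v2 - v1 + d)"
proof -
  have "(LBINT t:{0..\<tau>}. (D t)\<^sup>2) \<le> (LBINT t:{0..\<tau>}. ((v2 - v1) / d)\<^sup>2 * indicator {v1<..v2 + d} t)"
  proof (rule set_integral_mono)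
    show "set_integrable lborel {0..\<tau>} (\<lambda>t. ((v2 - v1) / d)\<^sup>2 * indicator {v1<..v2 + d} t)"
      by (rule set_integrable_Icc_bounded[where C="((v2 - v1) / d)\<^sup>2"]) (auto simp: indicator_def)
    show "(D t)\<^sup>2 \<le> ((v2 - v1) / d)\<^sup>2 * indicator {v1<..v2 + d} t" for t
    proof (cases "D t = 0")
      case False
      then show ?thesis using ramp_diff_support[of t] ramp_diff_bounds[of t] by (auto intro!: power_mono)
    qed simp
  qed (use ramp_diff_integrable in auto)
  also have "\<dots> = ((v2 - v1) / d)\<^sup>2 * (v2 + d - v1)"
    by (rule LBINT_indicator_Ioc) (use v d in auto)
  finally show ?thesis by (simp add: algebra_simps)
qed

end

text \<open>
  As a function of \<open>w\<close> the logarithm has kinks where \<open>t\<close> enters and leaves the transition zone; the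
  fundamental theorem of calculus tolerates these two points.
\<close>

lemma ln_lam_diff_eq_integral:
  assumes d: "0 < d" and \<phi>: "0 < \<phi>" and ab: "a \<le> b"
  shows "ln (lam d (\<theta> + \<phi> * b) t) - ln (lam d (\<theta> + \<phi> * a) t) =
    - (r * \<phi> / d) * (LBINT w:{a..b}. win d (\<theta> + \<phi> * w) t)"
proof -
  have c: "continuous_on {a..b} (\<lambda>w. ln (lam d (\<theta> + \<phi> * w) t))"
    by (intro continuous_on_ln) (use lam_pos[of d _ t] d in \<open>auto simp: lam_def less_imp_neq[symmetric] intro!: continuous_intros\<close>)
  have "((\<lambda>w. - (r * \<phi> / d) * win d (\<theta> + \<phi> * w) t) has_integral
      (ln (lam d (\<theta> + \<phi> * b) t) - ln (lam d (\<theta> + \<phi> * a) t))) {a..b}"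
  proof (rule fundamental_theorem_of_calculus_strong[where S="{(t - \<theta>) / \<phi>, (t - \<theta> - d) / \<phi>}", OF _ ab _ c])
    fix w assume "w \<in> {a..b} - {(t - \<theta>) / \<phi>, (t - \<theta> - d) / \<phi>}"
    then have "w \<noteq> (t - \<theta>) / \<phi>" "w \<noteq> (t - \<theta> - d) / \<phi>" by auto
    then have "\<theta> + \<phi> * w \<noteq> t" "\<theta> + \<phi> * w + d \<noteq> t" using \<phi> by (auto simp: field_simps)
    then consider "t < \<theta> + \<phi> * w" | "\<theta> + \<phi> * w < t" "t < \<theta> + \<phi> * w + d" | "\<theta> + \<phi> * w + d < t" by linarith
    then show "((\<lambda>w. ln (lam d (\<theta> + \<phi> * w) t)) has_vector_derivative - (r * \<phi> / d) * win d (\<theta> + \<phi> * w) t) (at w)"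
      unfolding has_real_derivative_iff_has_vector_derivative[symmetric]
    proof cases
      case 1
      have "((\<lambda>_. ln (psi_ext t)) has_real_derivative - (r * \<phi> / d) * win d (\<theta> + \<phi> * w) t) (at w)"
        using 1 by (auto simp: win_def intro!: derivative_eq_intros)
      then show "((\<lambda>w. ln (lam d (\<theta> + \<phi> * w) t)) has_real_derivative - (r * \<phi> / d) * win d (\<theta> + \<phi> * w) t) (at w)"
        by (rule has_field_derivative_transform_within_open[of _ _ _ "{w. t < \<theta> + \<phi> * w}"])
          (use 1 d in \<open>auto simp: lam_def ramp_def divide_le_0_iff max_def not_le field_simps intro!: open_Collect_less continuous_intros\<close>)
    next
      case 2
      have eq: "lam d (\<theta> + \<phi> * x) t = psi_ext t + r * ((t - (\<theta> + \<phi> * x)) / d)" if "\<theta> + \<phi> * x < t" "t < \<theta> + \<phi> * x + d" for x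
        using that d by (auto simp: lam_def ramp_def max_def min_def field_simps)
      have "((\<lambda>x. ln (psi_ext t + r * ((t - (\<theta> + \<phi> * x)) / d))) has_real_derivative - (r * \<phi> / d) * win d (\<theta> + \<phi> * w) t) (at w)"
        using 2 d lam_pos[of d "\<theta> + \<phi> * w" t] by (auto simp: win_def eq mult_ac intro!: derivative_eq_intros)
      moreover have "{w. \<theta> + \<phi> * w < t \<and> t < \<theta> + \<phi> * w + d} = {w. \<theta> + \<phi> * w < t} \<inter> {w. t < \<theta> + \<phi> * w + d}" by auto
      then have "open {w. \<theta> + \<phi> * w < t \<and> t < \<theta> + \<phi> * w + d}"
        by (auto intro!: open_Int open_Collect_less continuous_intros)
      ultimately show "((\<lambda>w. ln (lam d (\<theta> + \<phi> * w) t)) has_real_derivative - (r * \<phi> / d) * win d (\<theta> + \<phi> * w) t) (at w)"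
        by (rule has_field_derivative_transform_within_open) (use 2 eq in auto)
    next
      case 3
      have "((\<lambda>_. ln (psi_ext t + r)) has_real_derivative - (r * \<phi> / d) * win d (\<theta> + \<phi> * w) t) (at w)"
        using 3 by (auto simp: win_def intro!: derivative_eq_intros)
      then show "((\<lambda>w. ln (lam d (\<theta> + \<phi> * w) t)) has_real_derivative - (r * \<phi> / d) * win d (\<theta> + \<phi> * w) t) (at w)"
        by (rule has_field_derivative_transform_within_open[of _ _ _ "{w. \<theta> + \<phi> * w + d < t}"])
          (use 3 d in \<open>auto simp: lam_def ramp_def max_def min_def field_simps intro!: open_Collect_less continuous_intros\<close>)
    qed
  qed simp
  then have "integral {a..b} (\<lambda>w. - (r * \<phi> / d) * win d (\<theta> + \<phi> * w) t) =
      ln (lam d (\<theta> + \<phi> * b) t) - ln (lam d (\<theta> + \<phi> * a) t)" by (rule integral_unique)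
  moreover have i: "set_integrable lborel {a..b} (\<lambda>w. - (r * \<phi> / d) * win d (\<theta> + \<phi> * w) t)"
    by (intro set_integrable_mult_right set_integrable_Icc_bounded[where C="1/lo"]) (use win_bounds(3) in auto)
  moreover have "(LBINT w:{a..b}. - (r * \<phi> / d) * win d (\<theta> + \<phi> * w) t) =
      - (r * \<phi> / d) * (LBINT w:{a..b}. win d (\<theta> + \<phi> * w) t)"
    by (rule set_integral_mult_right)
  ultimately show ?thesis using set_borel_integral_eq_integral(2)[OF i] by metis
qed

end

section \<open>Exponentials of absolutely continuous functions, and Fubini for the sample\<close>

text \<open>
  The inequality \<open>\<bar>d/dw exp (f w)\<bar> \<le> k w exp (f w)\<close> in integrated form, for a function \<open>f\<close> of which only the
  increments are known to be bounded by an integral of \<open>k\<close>. As \<open>f\<close> may have kinks, the proof uses a partition: over a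
  cell of length \<open>h\<close> the exponential varies by a factor of at most \<open>exp (K h)\<close>, the cells are added up,
  and \<open>h\<close> tends to \<open>0\<close>.
\<close>

lemma exp_increment_le_integral:
  fixes f k :: "real \<Rightarrow> real"
  assumes inc: "\<And>x y. A \<le> x \<Longrightarrow> x \<le> y \<Longrightarrow> y \<le> B \<Longrightarrow> \<bar>f y - f x\<bar> \<le> integral {x..y} k"
    and bd: "\<And>x. A \<le> x \<Longrightarrow> x \<le> B \<Longrightarrow> 0 \<le> k x \<and> k x \<le> K"
    and kint: "k integrable_on {A..B}" and int: "(\<lambda>w. k w * exp (f w)) integrable_on {A..B}"
    and ab: "A \<le> a" "a \<le> b" "b \<le> B"
  shows "\<bar>exp (f b) - exp (f a)\<bar> \<le> integral {a..b} (\<lambda>w. k w * exp (f w))"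
proof -
  have sub: "g integrable_on {x..y}" if "g integrable_on {A..B}" "A \<le> x" "y \<le> B" for g :: "real \<Rightarrow> real" and x y
    by (rule integrable_on_subinterval[OF that(1)]) (use that in auto)
  have K: "0 \<le> K" using bd[of a] ab by (meson order.trans)
  have lip: "\<bar>f y - f x\<bar> \<le> K * (y - x)" if "A \<le> x" "x \<le> y" "y \<le> B" for x y
  proof -
    have "integral {x..y} k \<le> integral {x..y} (\<lambda>_. K)"
      by (rule integral_le[OF sub[OF kint] integrable_const_ivl]) (use that bd in auto)
    then show ?thesis using inc[OF that] that by (simp add: mult.commute)
  qed
  have cell: "\<bar>exp (f y) - exp (f x)\<bar> \<le> exp (K * h) * integral {x..y} (\<lambda>w. k w * exp (f w))"
    if "A \<le> x" "x \<le> y" "y \<le> B" "y - x \<le> h" for x y h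
  proof -
    define m where "m = max (f x) (f y)"
    \<comment> \<open>The mean value inequality for exp, with the larger of the two end values.\<close>
    have mvt: "\<bar>exp (f y) - exp (f x)\<bar> \<le> exp m * \<bar>f y - f x\<bar>"
    proof -
      have *: "exp q - exp p \<le> exp q * (q - p)" for p q :: real
      proof -
        have "exp q * (1 + (p - q)) \<le> exp q * exp (p - q)"
          by (intro mult_left_mono) auto
        then show ?thesis by (simp add: exp_add[symmetric] algebra_simps)
      qed
      show ?thesis
      proof (cases "f x \<le> f y")
        case True then show ?thesis using *[of "f y" "f x"] by (simp add: m_def)
      next
        case False then show ?thesis using *[of "f x" "f y"] by (simp add: m_def)
      qed
    qed
    have "exp m * integral {x..y} k = integral {x..y} (\<lambda>w. exp m * k w)" by simp
    also have "\<dots> \<le> integral {x..y} (\<lambda>w. exp (K * h) * (k w * exp (f w)))"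
    proof (intro integral_le)
      fix w assume w: "w \<in> {x..y}"
      have "K * (y - w) \<le> K * h" "K * (w - x) \<le> K * h" using w that K by (auto intro!: mult_left_mono)
      then have "m \<le> f w + K * h"
        using lip[of w y] lip[of x w] w that unfolding m_def by (auto simp: abs_le_iff)
      then have "exp m \<le> exp (K * h) * exp (f w)" by (simp add: exp_add[symmetric] add.commute)
      then show "exp m * k w \<le> exp (K * h) * (k w * exp (f w))"
        using bd[of w] w that by (simp add: mult.left_commute[of _ "k w"] mult.commute[of _ "k w"] mult_left_mono)
    qed (use that in \<open>auto intro!: integrable_on_mult_right sub[OF kint] sub[OF int]\<close>)
    also have "\<dots> = exp (K * h) * integral {x..y} (\<lambda>w. k w * exp (f w))" by simp
    finally have "exp m * integral {x..y} k \<le> exp (K * h) * integral {x..y} (\<lambda>w. k w * exp (f w))" .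
    moreover have "exp m * \<bar>f y - f x\<bar> \<le> exp m * integral {x..y} k" using inc[OF that(1-3)] by simp
    ultimately show ?thesis using mvt by linarith
  qed
  have chain: "\<bar>exp (f y) - exp (f a)\<bar> \<le> exp (K * h) * integral {a..y} (\<lambda>w. k w * exp (f w))"
    if h: "0 < h" and "a \<le> y" "y \<le> B" "y \<le> a + real N * h" for h y N
    using that(2-)
  proof (induction N arbitrary: y)
    case 0
    then show ?case using ab by simp
  next
    case (Suc N)
    show ?case
    proof (cases "y - h \<le> a")
      case True
      then show ?thesis using cell[of a y h] Suc.prems ab by simp
    next
      case False
      define x where "x = y - h"
      have x: "a \<le> x" "x \<le> y" "x \<le> B" "x \<le> a + real N * h"
        using False h Suc.prems by (auto simp: x_def algebra_simps)
      have "\<bar>exp (f y) - exp (f a)\<bar> \<le> \<bar>exp (f x) - exp (f a)\<bar> + \<bar>exp (f y) - exp (f x)\<bar>" by simp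
      also have "\<dots> \<le> exp (K * h) * integral {a..x} (\<lambda>w. k w * exp (f w)) + exp (K * h) * integral {x..y} (\<lambda>w. k w * exp (f w))"
        using Suc.IH[OF x(1,3,4)] cell[of x y h] x ab Suc.prems by (simp add: x_def)
      also have "\<dots> = exp (K * h) * integral {a..y} (\<lambda>w. k w * exp (f w))"
        using Henstock_Kurzweil_Integration.integral_combine[OF x(1,2) sub[OF int ab(1) Suc.prems(2)]]
        by (simp add: distrib_left[symmetric])
      finally show ?thesis .
    qed
  qed
  have "((\<lambda>h. exp (K * h) * integral {a..b} (\<lambda>w. k w * exp (f w))) \<longlongrightarrow> exp (K * 0) * integral {a..b} (\<lambda>w. k w * exp (f w))) (at_right 0)"
    by (intro tendsto_intros)
  moreover have "\<forall>\<^sub>F h in at_right 0. \<bar>exp (f b) - exp (f a)\<bar> \<le> exp (K * h) * integral {a..b} (\<lambda>w. k w * exp (f w))"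
    unfolding eventually_at_right_field
  proof (intro exI[of _ 1] conjI allI impI)
    fix h :: real assume "0 < h"
    obtain N where "(b - a) / h < real N" using reals_Archimedean2 by blast
    then have "b \<le> a + real N * h" using \<open>0 < h\<close> by (simp add: field_simps)
    then show "\<bar>exp (f b) - exp (f a)\<bar> \<le> exp (K * h) * integral {a..b} (\<lambda>w. k w * exp (f w))"
      using chain \<open>0 < h\<close> ab by auto
  qed simp
  ultimately show ?thesis
    by (intro tendsto_lowerbound[where F="at_right (0::real)" and f="\<lambda>h. exp (K * h) * integral {a..b} (\<lambda>w. k w * exp (f w))"]) auto
qed

lemma (in poisson_sample) sample_integral_add:
  assumes "\<omega> \<in> space M" "f \<in> borel_measurable borel" "g \<in> borel_measurable borel" "\<And>t. \<bar>f t\<bar> \<le> C" "\<And>t. \<bar>g t\<bar> \<le> C'"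
  shows "sample_integral (\<lambda>t. f t + g t) \<omega> = sample_integral f \<omega> + sample_integral g \<omega>"
  unfolding sample_integral_def sum.distrib[symmetric]
  by (intro sum.cong refl Bochner_Integration.integral_add counting_trajectory.integrable_bounded[OF trajectory, where C=C]
      counting_trajectory.integrable_bounded[OF trajectory, where C=C'] assms)

lemma (in poisson_sample) sample_integral_cmult: "sample_integral (\<lambda>t. c * f t) \<omega> = c * sample_integral f \<omega>"
  by (simp add: sample_integral_def sum_distrib_left)

lemma (in poisson_sample) sample_integral_diff:
  assumes "\<omega> \<in> space M" "f \<in> borel_measurable borel" "g \<in> borel_measurable borel" "\<And>t. \<bar>f t\<bar> \<le> C" "\<And>t. \<bar>g t\<bar> \<le> C'"
  shows "sample_integral (\<lambda>t. f t - g t) \<omega> = sample_integral f \<omega> - sample_integral g \<omega>"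
  using sample_integral_add[OF assms(1,2), of "\<lambda>t. (-1) * g t" C C'] sample_integral_cmult[of "-1" g \<omega>] assms(3-) by simp

lemma (in poisson_sample) abs_sample_integral_le:
  assumes "\<omega> \<in> space M" "f \<in> borel_measurable borel" "\<And>t. \<bar>f t\<bar> \<le> C"
  shows "\<bar>sample_integral f \<omega>\<bar> \<le> C * (\<Sum>j=1..n. real (X \<omega> j \<tau>))"
  unfolding sample_integral_def sum_distrib_left
  by (intro order.trans[OF sum_abs] sum_mono counting_trajectory.abs_integral_le[OF trajectory] assms) 

lemma (in poisson_sample) sample_integral_Fubini:
  fixes f :: "real \<Rightarrow> real \<Rightarrow> real"
  assumes \<omega>: "\<omega> \<in> space M" and [measurable]: "(\<lambda>(w, t). f w t) \<in> borel_measurable (borel \<Otimes>\<^sub>M borel)"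
    and bd: "\<And>w t. \<bar>f w t\<bar> \<le> C"
  shows "sample_integral (\<lambda>t. (LBINT w:{a..b}. f w t)) \<omega> = (LBINT w:{a..b}. sample_integral (f w) \<omega>)"
    and "set_integrable lborel {a..b} (\<lambda>w. sample_integral (f w) \<omega>)"
proof -
  have *: "(LINT t|path_measure \<tau> (X \<omega> j). (LBINT w:{a..b}. f w t)) = (LBINT w:{a..b}. (LINT t|path_measure \<tau> (X \<omega> j). f w t))
      \<and> set_integrable lborel {a..b} (\<lambda>w. LINT t|path_measure \<tau> (X \<omega> j). f w t)" if j: "j \<in> {1..n}" for j
  proof -
    interpret counting_trajectory \<tau> "X \<omega> j" by (rule trajectory[OF \<omega> j])
    interpret P: pair_sigma_finite lborel "path_measure \<tau> (X \<omega> j)" ..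
    have m: "(\<lambda>(w, t). f w t) \<in> borel_measurable (lborel \<Otimes>\<^sub>M path_measure \<tau> (X \<omega> j))"
      by (subst measurable_cong_sets[OF sets_pair_measure_cong[of lborel borel "path_measure \<tau> (X \<omega> j)" borel] refl]) auto
    have "integrable (lborel \<Otimes>\<^sub>M path_measure \<tau> (X \<omega> j)) (\<lambda>p. indicator ({a..b} \<times> UNIV) p *\<^sub>R (case p of (w, t) \<Rightarrow> f w t))"
    proof (rule integrableI_bounded_set_indicator[where B=C, OF _ m])
      show "{a..b} \<times> UNIV \<in> sets (lborel \<Otimes>\<^sub>M path_measure \<tau> (X \<omega> j))" by simp
      have "emeasure (lborel \<Otimes>\<^sub>M path_measure \<tau> (X \<omega> j)) ({a..b} \<times> UNIV) = emeasure lborel {a..b} * emeasure (path_measure \<tau> (X \<omega> j)) UNIV"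
        by (rule emeasure_pair_measure_Times) auto
      also have "\<dots> < \<infinity>" using emeasure_eq_measure[of UNIV] by (auto simp: emeasure_lborel_Icc_eq ennreal_mult_less_top)
      finally show "emeasure (lborel \<Otimes>\<^sub>M path_measure \<tau> (X \<omega> j)) ({a..b} \<times> UNIV) < \<infinity>" .
    qed (use bd in auto)
    also have "(\<lambda>p. indicator ({a..b} \<times> UNIV) p *\<^sub>R (case p of (w, t) \<Rightarrow> f w t)) = (\<lambda>(w, t). indicator {a..b} w *\<^sub>R f w t)"
      by (auto simp: indicator_def fun_eq_iff)
    finally have int: "integrable (lborel \<Otimes>\<^sub>M path_measure \<tau> (X \<omega> j)) (\<lambda>(w, t). indicator {a..b} w *\<^sub>R f w t)" .
    show ?thesis using P.Fubini_integral[OF int] P.integrable_fst'[OF int] by (simp add: set_lebesgue_integral_def set_integrable_def)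
  qed
  show "set_integrable lborel {a..b} (\<lambda>w. sample_integral (f w) \<omega>)"
    unfolding sample_integral_def using * unfolding set_integrable_def scaleR_sum_right
    by (intro Bochner_Integration.integrable_sum) auto
  have "(LBINT w:{a..b}. sample_integral (f w) \<omega>) = (\<Sum>j=1..n. LBINT w:{a..b}. (LINT t|path_measure \<tau> (X \<omega> j). f w t))"
    unfolding sample_integral_def using * unfolding set_lebesgue_integral_def set_integrable_def scaleR_sum_right
    by (intro Bochner_Integration.integral_sum) auto
  then show "sample_integral (\<lambda>t. (LBINT w:{a..b}. f w t)) \<omega> = (LBINT w:{a..b}. sample_integral (f w) \<omega>)"
    using * by (simp add: sample_integral_def)
qed

text \<open>
  The remainder that is left after the exponential formula has been centred.
\<close>

lemma exp_second_order: "exp x - 1 - x \<le> x\<^sup>2 * exp \<bar>x\<bar>" "0 \<le> exp x - 1 - x" for x :: real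
proof -
  obtain t where t: "\<bar>t\<bar> \<le> \<bar>x\<bar>" "exp x = (\<Sum>m<2. x ^ m / fact m) + exp t / fact 2 * x ^ 2"
    using Maclaurin_exp_le[of x 2] by blast
  have "exp t \<le> exp \<bar>x\<bar>" using t(1) by simp
  then have "exp t / 2 \<le> exp \<bar>x\<bar>" using exp_ge_zero[of "\<bar>x\<bar>"] by linarith
  then have "exp t / 2 * x\<^sup>2 \<le> exp \<bar>x\<bar> * x\<^sup>2" by (intro mult_right_mono) auto
  then show "exp x - 1 - x \<le> x\<^sup>2 * exp \<bar>x\<bar>" using t(2) by (simp add: numeral_2_eq_2 mult.commute)
  show "0 \<le> exp x - 1 - x" using exp_ge_add_one_self[of x] by linarith
qed

lemma integral_exp_minus_abs_le:
  fixes a p q :: real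
  assumes "0 < a" "p \<le> 0" "0 \<le> q"
  shows "(LBINT w:{p..q}. exp (- a * \<bar>w\<bar>)) \<le> 2 / a"
proof -
  have c: "continuous_on S (\<lambda>w::real. exp (- a * \<bar>w\<bar>))" for S by (intro continuous_intros)
  have 1: "((\<lambda>w. exp (- a * \<bar>w\<bar>)) has_integral (exp (a * 0) / a - exp (a * p) / a)) {p..0}"
  proof -
    have "((\<lambda>w. exp (a * w)) has_integral (exp (a * 0) / a - exp (a * p) / a)) {p..0}"
      by (rule fundamental_theorem_of_calculus)
        (use assms in \<open>auto simp: has_real_derivative_iff_has_vector_derivative[symmetric] intro!: derivative_eq_intros\<close>)
    then show ?thesis by (rule has_integral_eq[rotated]) auto
  qed
  have 2: "((\<lambda>w. exp (- a * \<bar>w\<bar>)) has_integral (- exp (- a * q) / a - - exp (- a * 0) / a)) {0..q}"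
  proof -
    have "((\<lambda>w. exp (- a * w)) has_integral (- exp (- a * q) / a - - exp (- a * 0) / a)) {0..q}"
      by (rule fundamental_theorem_of_calculus)
        (use assms in \<open>auto simp: has_real_derivative_iff_has_vector_derivative[symmetric] intro!: derivative_eq_intros\<close>)
    then show ?thesis by (rule has_integral_eq[rotated]) auto
  qed
  have "integral {p..q} (\<lambda>w. exp (- a * \<bar>w\<bar>)) = (1 - exp (a * p)) / a + (1 - exp (- a * q)) / a"
    using has_integral_combine[OF assms(2,3) 1 2] by (simp add: integral_unique diff_divide_distrib)
  also have "\<dots> \<le> 2 / a" using assms by (simp add: field_simps)
  finally show ?thesis
    by (subst set_borel_integral_eq_integral(2)[OF borel_integrable_atLeastAtMost'[OF c]])
qed

text \<open>
  Bounds that are pointwise in the local parameter integrate to a bound on the expectation of an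
  integral over the parameter.
\<close>

lemma (in prob_space) expectation_LBINT_le:
  fixes F :: "real \<Rightarrow> 'a \<Rightarrow> real"
  assumes F[measurable]: "(\<lambda>(w, \<omega>). F w \<omega>) \<in> borel_measurable (borel \<Otimes>\<^sub>M M)"
    and nonneg: "\<And>w \<omega>. \<omega> \<in> space M \<Longrightarrow> 0 \<le> F w \<omega>"
    and path: "\<And>\<omega>. \<omega> \<in> space M \<Longrightarrow> set_integrable lborel {a..b} (\<lambda>w. F w \<omega>)"
    and int: "\<And>w. w \<in> {a..b} \<Longrightarrow> integrable M (F w)"
    and le: "\<And>w. w \<in> {a..b} \<Longrightarrow> expectation (F w) \<le> h w"
    and h: "set_integrable lborel {a..b} h"
  shows "integrable M (\<lambda>\<omega>. LBINT w:{a..b}. F w \<omega>)"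
    and "expectation (\<lambda>\<omega>. LBINT w:{a..b}. F w \<omega>) \<le> (LBINT w:{a..b}. h w)"
proof -
  interpret P: pair_sigma_finite lborel M ..
  have [measurable]: "(\<lambda>(w, \<omega>). F w \<omega>) \<in> borel_measurable (lborel \<Otimes>\<^sub>M M)" 
    by (subst measurable_cong_sets[OF sets_pair_measure_cong[of lborel borel M M] refl]) auto
  have [measurable]: "(\<lambda>(\<omega>, w). F w \<omega>) \<in> borel_measurable (M \<Otimes>\<^sub>M lborel)"
    using measurable_pair_swap[OF \<open>(\<lambda>(w, \<omega>). F w \<omega>) \<in> borel_measurable (lborel \<Otimes>\<^sub>M M)\<close>] by (simp add: split_beta)
  have m: "(\<lambda>\<omega>. LBINT w:{a..b}. F w \<omega>) \<in> borel_measurable M"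
    unfolding set_lebesgue_integral_def by (intro lborel.borel_measurable_lebesgue_integral) (simp add: split_beta, measurable)
  have nn: "0 \<le> (LBINT w:{a..b}. F w \<omega>)" if "\<omega> \<in> space M" for \<omega>
    unfolding set_lebesgue_integral_def using nonneg[OF that] by (intro integral_nonneg_AE AE_I2) (simp add: indicator_def)
  have hn: "0 \<le> h w" if "w \<in> {a..b}" for w
  proof -
    have "0 \<le> expectation (F w)" by (intro integral_nonneg_AE AE_I2 nonneg)
    then show ?thesis using le[OF that] by linarith
  qed
  have "(\<integral>\<^sup>+ \<omega>. ennreal (LBINT w:{a..b}. F w \<omega>) \<partial>M) = (\<integral>\<^sup>+ \<omega>. (\<integral>\<^sup>+ w. ennreal (indicator {a..b} w *\<^sub>R F w \<omega>) \<partial>lborel) \<partial>M)"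
    unfolding set_lebesgue_integral_def
    by (intro nn_integral_cong nn_integral_eq_integral[symmetric])
      (use path nonneg in \<open>auto simp: set_integrable_def indicator_def\<close>)
  also have "\<dots> = (\<integral>\<^sup>+ w. (\<integral>\<^sup>+ \<omega>. ennreal (indicator {a..b} w *\<^sub>R F w \<omega>) \<partial>M) \<partial>lborel)"
    by (intro P.Fubini') (simp add: split_beta, measurable)
  also have "\<dots> \<le> (\<integral>\<^sup>+ w. ennreal (indicator {a..b} w *\<^sub>R h w) \<partial>lborel)"
  proof (rule nn_integral_mono)
    fix w :: real
    show "(\<integral>\<^sup>+ \<omega>. ennreal (indicator {a..b} w *\<^sub>R F w \<omega>) \<partial>M) \<le> ennreal (indicator {a..b} w *\<^sub>R h w)"
    proof (cases "w \<in> {a..b}")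
      case True
      then show ?thesis using int[OF True] le[OF True] nonneg
        by (auto simp: nn_integral_eq_integral intro!: ennreal_leI)
    qed simp
  qed
  also have "\<dots> = ennreal (LBINT w:{a..b}. h w)"
    unfolding set_lebesgue_integral_def
    by (rule nn_integral_eq_integral) (use h hn in \<open>auto simp: set_integrable_def indicator_def\<close>)
  finally have *: "(\<integral>\<^sup>+ \<omega>. ennreal (LBINT w:{a..b}. F w \<omega>) \<partial>M) \<le> ennreal (LBINT w:{a..b}. h w)" .
  show i: "integrable M (\<lambda>\<omega>. LBINT w:{a..b}. F w \<omega>)"
    by (rule integrableI_nonneg[OF m]) (use nn * in \<open>auto intro: le_less_trans\<close>)
  have "0 \<le> (LBINT w:{a..b}. h w)"
    unfolding set_lebesgue_integral_def using hn by (intro integral_nonneg_AE AE_I2) (auto simp: indicator_def)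
  then show "expectation (\<lambda>\<omega>. LBINT w:{a..b}. F w \<omega>) \<le> (LBINT w:{a..b}. h w)"
    using * nn by (subst (asm) nn_integral_eq_integral[OF i]) auto
qed

section \<open>The experiment at one sample size\<close>

text \<open>
  One sample size \<open>n\<close>, with \<open>d\<close> the length of the transition zone and \<open>\<theta>\<close> the true parameter. The
  condition \<open>\<beta> + d \<le> \<tau>\<close> keeps every zone inside the observation interval and \<open>1 \<le> n d\<close> says that \<open>\<phi> \<le> d\<close>;
  both hold for large \<open>n\<close>.
\<close>

locale ramp_experiment = ramp_intensity +
  fixes n :: nat and d \<theta> :: real and M :: "'w measure" and X :: "'w \<Rightarrow> nat \<Rightarrow> real \<Rightarrow> nat"
  assumes n_pos: "1 \<le> n" and d_pos: "0 < d" and \<beta>_d: "\<beta> + d \<le> \<tau>" and nd: "1 \<le> real n * d"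
    and \<theta>_in: "\<alpha> < \<theta>" "\<theta> < \<beta>"
    and prob: "prob_space M"
    and procs: "\<forall>j\<in>{1..n}. poisson_process M \<tau> (intensity \<psi> r \<tau> d \<theta>) (\<lambda>\<omega>. X \<omega> j)"
    and ind: "prob_space.indep_vars M (\<lambda>j. \<Pi>\<^sub>M t\<in>{0..\<tau>}. count_space UNIV) (\<lambda>j \<omega>. restrict (X \<omega> j) {0..\<tau>}) {1..n}"

sublocale ramp_experiment \<subseteq> poisson_sample M \<tau> "lam d \<theta>" n X lo hi
proof -
  have "(LBINT u:{s..t}. intensity \<psi> r \<tau> d \<theta> u) = (LBINT u:{s..t}. lam d \<theta> u)" if "0 \<le> s" "t \<le> \<tau>" for s t
    by (rule set_lebesgue_integral_cong) (use that d_pos in \<open>auto simp: intensity_eq_lam\<close>)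
  then have "poisson_process M \<tau> (lam d \<theta>) (\<lambda>\<omega>. X \<omega> j)" if "j \<in> {1..n}" for j
    using bspec[OF procs that] unfolding poisson_process_def by fastforce
  with prob show "poisson_sample M \<tau> (lam d \<theta>) n X lo hi"
    unfolding poisson_sample_def poisson_sample_axioms_def
    using tau_pos lo_pos lam_ge lam_le ind by auto
qed

context ramp_experiment
begin

definition \<phi> :: real where "\<phi> = sqrt (d / real n)"

definition par :: "real \<Rightarrow> real" where "par u = \<theta> + \<phi> * u"

definition ul :: real where "ul = (\<alpha> - \<theta>) / \<phi>"

definition ur :: real where "ur = (\<beta> - \<theta>) / \<phi>"

definition loglik :: "real \<Rightarrow> 'w \<Rightarrow> real" where
  "loglik v \<omega> = sample_integral (\<lambda>t. ln (lam d v t)) \<omega> - real n * (LBINT t:{0..\<tau>}. lam d v t)"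

definition llr :: "real \<Rightarrow> 'w \<Rightarrow> real" where
  "llr u \<omega> = loglik (par u) \<omega> - loglik \<theta> \<omega>"

text \<open>
  The derivative of \<open>llr\<close>: \<open>\<phi>\<close> times the derivative of the log-likelihood at \<open>par u\<close>. The term \<open>n d\<close> is the
  mean of the sample integral under the parameter \<open>par u\<close>.
\<close>

definition score :: "real \<Rightarrow> 'w \<Rightarrow> real" where
  "score u \<omega> = - (r * \<phi> / d) * (sample_integral (win d (par u)) \<omega> - real n * d)"

lemma \<phi>_pos: "0 < \<phi>" using n_pos d_pos by (simp add: \<phi>_def)

lemma \<phi>_sq: "real n * \<phi>\<^sup>2 = d" using n_pos d_pos by (simp add: \<phi>_def)

lemma \<epsilon>_sq: "real n * d * (\<phi> / d)\<^sup>2 = 1"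
  using \<phi>_sq d_pos by (simp add: power_divide power2_eq_square)

lemma \<epsilon>_le_1: "\<phi> / d \<le> 1"
proof -
  have "(\<phi> / d)\<^sup>2 \<le> 1" using \<epsilon>_sq nd mult_right_mono[OF nd, of "(\<phi> / d)\<^sup>2"] by simp
  then have "(\<phi> / d)\<^sup>2 \<le> 1\<^sup>2" by simp
  then show ?thesis by (rule power2_le_imp_le) simp
qed

lemma \<epsilon>_pos: "0 < \<phi> / d" using \<phi>_pos d_pos by simp

lemma par_0: "par 0 = \<theta>" by (simp add: par_def)

lemma ul_less: "ul < 0" and ur_greater: "0 < ur"
  using \<theta>_in \<phi>_pos by (auto simp: ul_def ur_def field_simps)

lemma par_in_iff: "par u \<in> {\<alpha>..\<beta>} \<longleftrightarrow> u \<in> {ul..ur}"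
  using \<phi>_pos by (auto simp: par_def ul_def ur_def field_simps)

lemma par_range: "u \<in> {ul..ur} \<Longrightarrow> 0 \<le> par u" "u \<in> {ul..ur} \<Longrightarrow> par u + d \<le> \<tau>"
  using par_in_iff[of u] \<alpha>_pos \<beta>_d by auto

lemma \<theta>_range: "0 \<le> \<theta>" "\<theta> + d \<le> \<tau>" using \<theta>_in \<alpha>_pos \<beta>_d by auto

text \<open>
  The constant \<open>n \<tau>\<close> comes from the reference intensity \<open>1\<close> and cancels in ratios.
\<close>

lemma likelihood_eq:
  assumes "\<omega> \<in> space M" and d: "d = \<delta> n"
  shows "likelihood \<psi> r \<tau> \<delta> n v (X \<omega>) = exp (loglik v \<omega> + real n * \<tau>)"
proof -
  have "(LINT t:{0..\<tau>}|path_measure \<tau> (X \<omega> j). ln (intensity \<psi> r \<tau> d v t)) = (LINT t|path_measure \<tau> (X \<omega> j). ln (lam d v t))"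
    if "j \<in> {1..n}" for j
    by (rule counting_trajectory.set_integral_eq_integral[OF trajectory[OF assms(1) that]])
      (use intensity_eq_lam d_pos in auto)
  moreover have "(LBINT t:{0..\<tau>}. intensity \<psi> r \<tau> d v t - 1) = (LBINT t:{0..\<tau>}. lam d v t - 1)"
    by (rule set_lebesgue_integral_cong) (use intensity_eq_lam d_pos in auto)
  moreover have "(LBINT t:{0..\<tau>}. lam d v t - 1) = (LBINT t:{0..\<tau>}. lam d v t) - \<tau>"
  proof (subst set_integral_diff)
    show "set_integrable lborel {0..\<tau>} (lam d v)" by (rule set_integrable_Icc_bounded[OF lam_measurable abs_lam_le])
    show "set_integrable lborel {0..\<tau>} (\<lambda>_. 1 :: real)" by (rule set_integrable_Icc_bounded[where C=1]) auto
  qed (use tau_pos LBINT_const_Icc[of 0 \<tau> 1] in simp)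
  ultimately have e: "(LBINT t:{0..\<tau>}. intensity \<psi> r \<tau> d v t - 1) = (LBINT t:{0..\<tau>}. lam d v t) - \<tau>"
    and "(\<Sum>j=1..n. LINT t:{0..\<tau>}|path_measure \<tau> (X \<omega> j). ln (intensity \<psi> r \<tau> d v t)) = sample_integral (\<lambda>t. ln (lam d v t)) \<omega>"
    by (simp_all add: sample_integral_def)
  then show ?thesis
    unfolding likelihood_def loglik_def d[symmetric] by (simp add: right_diff_distrib)
qed

lemma loglik_measurable_pair[measurable]: "(\<lambda>(v, \<omega>). loglik v \<omega>) \<in> borel_measurable (borel \<Otimes>\<^sub>M M)"
proof -
  have 1[measurable]: "(\<lambda>(v, \<omega>). sample_integral (\<lambda>t. ln (lam d v t)) \<omega>) \<in> borel_measurable (borel \<Otimes>\<^sub>M M)"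
    by (rule sample_integral_measurable_pair[where C="\<bar>ln lo\<bar> + \<bar>ln hi\<bar>"])
      (use abs_ln_lam_le left_continuous_ln_lam d_pos in auto)
  have [measurable]: "(\<lambda>v. LBINT t:{0..\<tau>}. lam d v t) \<in> borel_measurable borel"
    unfolding set_lebesgue_integral_def
    by (intro lborel.borel_measurable_lebesgue_integral) (unfold split_beta lam_def, measurable)
  show ?thesis unfolding loglik_def split_beta using 1 by (simp add: split_beta)
qed

lemma llr_measurable_pair[measurable]: "(\<lambda>(u, \<omega>). llr u \<omega>) \<in> borel_measurable (borel \<Otimes>\<^sub>M M)"
proof -
  have [measurable]: "par \<in> borel_measurable borel" unfolding par_def by measurable
  show ?thesis unfolding llr_def split_beta
    by (intro borel_measurable_diff measurable_compose[OF _ loglik_measurable_pair[unfolded split_beta], of "\<lambda>p. (par (fst p), snd p)", simplified]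
        measurable_compose[OF _ loglik_measurable_pair[unfolded split_beta], of "\<lambda>p. (\<theta>, snd p)", simplified]) auto
qed

lemma score_measurable_pair[measurable]: "(\<lambda>(u, \<omega>). score u \<omega>) \<in> borel_measurable (borel \<Otimes>\<^sub>M M)"
proof -
  have [measurable]: "par \<in> borel_measurable borel" unfolding par_def by measurable
  have "(\<lambda>(u, \<omega>). sample_integral (win d (par u)) \<omega>) \<in> borel_measurable (borel \<Otimes>\<^sub>M M)"
    by (rule sample_integral_measurable_pair[where C="1/lo"])
      (use win_bounds(3) left_continuous_win d_pos in auto)
  then show ?thesis unfolding score_def split_beta by simp
qed

lemma path_measurable:
  assumes "(\<lambda>(u, \<omega>). F u \<omega>) \<in> borel_measurable (borel \<Otimes>\<^sub>M M)" "\<omega> \<in> space M"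
  shows "(\<lambda>u::real. F u \<omega> :: real) \<in> borel_measurable borel"
  using measurable_compose[OF measurable_Pair2'[OF assms(2)] assms(1)] by simp

lemma section_measurable:
  assumes "(\<lambda>(u, \<omega>). F u \<omega>) \<in> borel_measurable (borel \<Otimes>\<^sub>M M)"
  shows "(\<lambda>\<omega>. F (u::real) \<omega> :: real) \<in> borel_measurable M"
  using measurable_compose[OF measurable_Pair1'[of u borel M] assms] by simp

definition total :: "'w \<Rightarrow> real" where "total \<omega> = (\<Sum>j=1..n. real (X \<omega> j \<tau>))"

lemma abs_score_le:
  assumes "\<omega> \<in> space M"
  shows "\<bar>score u \<omega>\<bar> \<le> \<bar>r * \<phi> / d\<bar> * (total \<omega> / lo + real n * d)"
proof -
  have "\<bar>sample_integral (win d (par u)) \<omega>\<bar> \<le> 1 / lo * total \<omega>"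
    unfolding total_def by (rule abs_sample_integral_le[OF assms]) (use win_bounds in auto)
  then have "\<bar>sample_integral (win d (par u)) \<omega> - real n * d\<bar> \<le> total \<omega> / lo + real n * d"
    using d_pos by (intro order.trans[OF abs_triangle_ineq4] add_mono) auto
  then show ?thesis unfolding score_def abs_mult abs_minus_cancel by (rule mult_left_mono) simp
qed

lemma abs_llr_le:
  assumes "\<omega> \<in> space M"
  shows "\<bar>llr u \<omega>\<bar> \<le> 2 * ((\<bar>ln lo\<bar> + \<bar>ln hi\<bar>) * total \<omega> + real n * (hi * \<tau>))"
proof -
  have *: "\<bar>loglik v \<omega>\<bar> \<le> (\<bar>ln lo\<bar> + \<bar>ln hi\<bar>) * total \<omega> + real n * (hi * \<tau>)" for v
  proof -
    have "\<bar>sample_integral (\<lambda>t. ln (lam d v t)) \<omega>\<bar> \<le> (\<bar>ln lo\<bar> + \<bar>ln hi\<bar>) * total \<omega>"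
      unfolding total_def by (rule abs_sample_integral_le[OF assms]) (use abs_ln_lam_le in auto)
    moreover have "\<bar>LBINT t:{0..\<tau>}. lam d v t\<bar> \<le> hi * \<tau>"
    proof -
      have "\<bar>LBINT t:{0..\<tau>}. lam d v t\<bar> = (LBINT t:{0..\<tau>}. lam d v t)"
        unfolding set_lebesgue_integral_def using lam_pos by (intro abs_of_nonneg integral_nonneg_AE AE_I2) (auto simp: less_imp_le)
      also have "\<dots> \<le> (LBINT t:{0..\<tau>}. hi)"
        by (intro set_integral_mono set_integrable_Icc_bounded[where C=hi] abs_lam_le lam_le) (use hi_pos in auto)
      finally show ?thesis using tau_pos LBINT_const_Icc[of 0 \<tau> hi] by simp
    qed
    then have "\<bar>real n * (LBINT t:{0..\<tau>}. lam d v t)\<bar> \<le> real n * (hi * \<tau>)" by (simp add: abs_mult mult_left_mono)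
    ultimately show ?thesis unfolding loglik_def by (intro order.trans[OF abs_triangle_ineq4] add_mono)
  qed
  show ?thesis unfolding llr_def mult_2 by (rule order.trans[OF abs_triangle_ineq4 add_mono[OF * *]])
qed

lemma score_integrable: "\<omega> \<in> space M \<Longrightarrow> set_integrable lborel {a..b} (\<lambda>w. score w \<omega>)"
  by (rule set_integrable_Icc_bounded[OF path_measurable[OF score_measurable_pair] abs_score_le])

text \<open>
  The logarithms are integrated over the local parameter pointwise in \<open>t\<close>, and Fubini's theorem for the
  path measures exchanges the two integrals. The range \<open>ul, ur\<close> keeps the compensator affine.
\<close>

lemma llr_increment:
  assumes \<omega>: "\<omega> \<in> space M" and ab: "ul \<le> a" "a \<le> b" "b \<le> ur"
  shows "llr b \<omega> - llr a \<omega> = integral {a..b} (\<lambda>w. score w \<omega>)"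
proof -
  let ?G = "\<bar>ln lo\<bar> + \<bar>ln hi\<bar>" and ?S = "\<lambda>w. sample_integral (win d (par w)) \<omega>"
  have [measurable]: "par \<in> borel_measurable borel" unfolding par_def by measurable
  have wm: "(\<lambda>(w, t). win d (par w) t) \<in> borel_measurable (borel \<Otimes>\<^sub>M borel)"
    using measurable_compose[OF _ win_measurable_pair[of d, unfolded split_beta], of "\<lambda>p. (par (fst p), snd p)" "borel \<Otimes>\<^sub>M borel"]
    by (simp add: split_beta)
  note F = sample_integral_Fubini[OF \<omega> wm win_bounds(3)]
  have "sample_integral (\<lambda>t. ln (lam d (par b) t)) \<omega> - sample_integral (\<lambda>t. ln (lam d (par a) t)) \<omega>
      = sample_integral (\<lambda>t. ln (lam d (par b) t) - ln (lam d (par a) t)) \<omega>"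
    by (rule sample_integral_diff[symmetric, OF \<omega>, of _ _ ?G ?G]) (use abs_ln_lam_le in auto)
  also have "(\<lambda>t. ln (lam d (par b) t) - ln (lam d (par a) t)) = (\<lambda>t. - (r * \<phi> / d) * (LBINT w:{a..b}. win d (par w) t))"
    unfolding par_def by (intro ext ln_lam_diff_eq_integral d_pos \<phi>_pos ab)
  also have "sample_integral \<dots> \<omega> = - (r * \<phi> / d) * (LBINT w:{a..b}. ?S w)"
    unfolding sample_integral_cmult F(1) ..
  finally have A: "sample_integral (\<lambda>t. ln (lam d (par b) t)) \<omega> - sample_integral (\<lambda>t. ln (lam d (par a) t)) \<omega>
      = - (r * \<phi> / d) * (LBINT w:{a..b}. ?S w)" .
  have B: "(LBINT t:{0..\<tau>}. lam d (par b) t) - (LBINT t:{0..\<tau>}. lam d (par a) t) = - r * \<phi> * (b - a)"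
    using par_range[of a] par_range[of b] ab d_pos by (simp add: integral_lam par_def algebra_simps)
  have "integral {a..b} (\<lambda>w. score w \<omega>) = (LBINT w:{a..b}. score w \<omega>)"
    by (rule set_borel_integral_eq_integral(2)[symmetric, OF score_integrable[OF \<omega>]])
  also have "\<dots> = - (r * \<phi> / d) * (LBINT w:{a..b}. ?S w - real n * d)"
    unfolding score_def by (rule set_integral_mult_right)
  also have "(LBINT w:{a..b}. ?S w - real n * d) = (LBINT w:{a..b}. ?S w) - real n * d * (b - a)"
    using F(2) LBINT_const_Icc[OF ab(2), of "real n * d"]
    by (subst set_integral_diff) (auto intro!: set_integrable_Icc_bounded[where C="\<bar>real n * d\<bar>"])
  finally have C: "integral {a..b} (\<lambda>w. score w \<omega>) = - (r * \<phi> / d) * ((LBINT w:{a..b}. ?S w) - real n * d * (b - a))" .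
  have "llr b \<omega> - llr a \<omega> =
      (sample_integral (\<lambda>t. ln (lam d (par b) t)) \<omega> - sample_integral (\<lambda>t. ln (lam d (par a) t)) \<omega>)
      - real n * ((LBINT t:{0..\<tau>}. lam d (par b) t) - (LBINT t:{0..\<tau>}. lam d (par a) t))"
    by (simp add: llr_def loglik_def algebra_simps)
  then show ?thesis unfolding A B C using d_pos by (simp add: field_simps)
qed

lemma llr_0: "llr 0 \<omega> = 0" by (simp add: llr_def par_0)

end

section \<open>Moments of the likelihood ratio, and its envelope\<close>

context ramp_intensity
begin

text \<open>
  The exponential rate in the Hellinger bound. The constants below bound, uniformly in the sample
  size: \<open>K4\<close> the integrand of four times the score, \<open>C2\<close> the exponential moments of the score under
  the alternative, \<open>C3\<close> the inverse likelihood ratio near the true value, \<open>C4\<close> and \<open>C5\<close> the integrand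
  of the envelope, and \<open>CV\<close> the envelope.
\<close>

definition kap :: real where "kap = r\<^sup>2 / (8 * hi)"

lemma kap_pos: "0 < kap" using r_nonzero hi_pos by (simp add: kap_def)

definition K4 :: real where "K4 = 4 * \<bar>r\<bar> / lo"

definition C2 :: real where "C2 = exp (K4\<^sup>2 * exp K4 * hi)"

definition C3 :: real where "C3 = exp (2 * r\<^sup>2 / lo)"

definition C4 :: real where "C4 = exp kap + (C2 + 1) / 2"

definition C5 :: real where "C5 = kap / 4 * exp kap + C4 / 2"

definition CV :: real where "CV = 1 + C5 * (8 / kap)"

lemma K4_nonneg: "0 \<le> K4" using lo_pos by (simp add: K4_def)

lemma integral_lam_diff_sq:
  assumes d: "0 < d" and v: "v \<in> {\<alpha>..\<beta>}" "v' \<in> {\<alpha>..\<beta>}" "\<beta> + d \<le> \<tau>"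
  shows "r\<^sup>2 * (\<bar>v - v'\<bar>\<^sup>2 / (\<bar>v - v'\<bar> + d)) \<le> (LBINT t:{0..\<tau>}. (lam d v t - lam d v' t)\<^sup>2)" (is ?L)
    and "(LBINT t:{0..\<tau>}. (lam d v t - lam d v' t)\<^sup>2) \<le> r\<^sup>2 * ((\<bar>v - v'\<bar> / d)\<^sup>2 * (\<bar>v - v'\<bar> + d))" (is ?U)
proof -
  define v1 v2 where "v1 = min v v'" and "v2 = max v v'"
  have eq: "(lam d v t - lam d v' t)\<^sup>2 = r\<^sup>2 * (ramp ((t - v1) / d) - ramp ((t - v2) / d))\<^sup>2" for t
  proof -
    have "lam d v t - lam d v' t = r * (ramp ((t - v) / d) - ramp ((t - v') / d))" by (simp add: lam_def algebra_simps)
    then show ?thesis by (auto simp: v1_def v2_def min_def max_def power_mult_distrib power2_commute)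
  qed
  have "(LBINT t:{0..\<tau>}. (lam d v t - lam d v' t)\<^sup>2) = r\<^sup>2 * (LBINT t:{0..\<tau>}. (ramp ((t - v1) / d) - ramp ((t - v2) / d))\<^sup>2)"
    unfolding eq by simp
  note I = this
  have v12: "0 \<le> v1" "v1 \<le> v2" "v2 + d \<le> \<tau>" and h: "\<bar>v - v'\<bar> = v2 - v1"
    using v \<alpha>_pos by (auto simp: v1_def v2_def)
  show ?L unfolding I h by (intro mult_left_mono integral_ramp_diff_sq_ge[OF d v12]) simp
  show ?U unfolding I h by (intro mult_left_mono integral_ramp_diff_sq_le[OF d v12]) simp
qed

end

context ramp_experiment
begin

text \<open>
  The deterministic part of the log-likelihood ratio is moved inside the integral over \<open>t\<close>, so that
  the exponent is the integral of one function \<open>H\<close>, which the later bounds estimate pointwise.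
\<close>

lemma expectation_exp_llr:
  fixes f :: "real \<Rightarrow> real" and s u :: real
  defines "H \<equiv> \<lambda>t. (exp (s * (ln (lam d (par u) t) - ln (lam d \<theta> t)) + f t) - 1) * lam d \<theta> t
      - s * (lam d (par u) t - lam d \<theta> t)"
  assumes [measurable]: "f \<in> borel_measurable borel" and C: "\<And>t. \<bar>f t\<bar> \<le> C" and lc: "\<And>t. continuous (at_left t) f"
  shows "set_integrable lborel {0..\<tau>} H"
    and "integrable M (\<lambda>\<omega>. exp (s * llr u \<omega> + sample_integral f \<omega>))"
    and "expectation (\<lambda>\<omega>. exp (s * llr u \<omega> + sample_integral f \<omega>)) = exp (real n * (LBINT t:{0..\<tau>}. H t))"
proof -
  let ?v = "par u" and ?G = "\<bar>ln lo\<bar> + \<bar>ln hi\<bar>"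
  define F where "F t = s * (ln (lam d ?v t) - ln (lam d \<theta> t)) + f t" for t
  have [measurable]: "F \<in> borel_measurable borel" unfolding F_def by measurable
  have dl: "\<bar>s * (ln (lam d ?v t) - ln (lam d \<theta> t))\<bar> \<le> \<bar>s\<bar> * (?G + ?G)" for t
    unfolding abs_mult by (intro mult_left_mono order.trans[OF abs_triangle_ineq4] add_mono abs_ln_lam_le) auto
  have FC: "\<bar>F t\<bar> \<le> \<bar>s\<bar> * (?G + ?G) + C" for t
    unfolding F_def by (intro order.trans[OF abs_triangle_ineq] add_mono dl C)
  have Flc: "continuous (at_left t) F" for t
    unfolding F_def by (intro continuous_intros left_continuous_ln_lam d_pos lc)
  have i1: "set_integrable lborel {0..\<tau>} (\<lambda>t. (exp (F t) - 1) * lam d \<theta> t)"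
  proof (rule set_integrable_Icc_bounded)
    fix t
    have "\<bar>exp (F t) - 1\<bar> \<le> exp (\<bar>s\<bar> * (?G + ?G) + C) + 1"
      using FC[of t] exp_gt_zero[of "F t"] by (intro order.trans[OF abs_triangle_ineq4]) (auto intro: order.trans)
    then show "\<bar>(exp (F t) - 1) * lam d \<theta> t\<bar> \<le> (exp (\<bar>s\<bar> * (?G + ?G) + C) + 1) * hi"
      unfolding abs_mult by (intro mult_mono abs_lam_le) auto
  qed measurable
  have il: "set_integrable lborel {0..\<tau>} (lam d v)" for v
    by (rule set_integrable_Icc_bounded[OF lam_measurable abs_lam_le])
  have i2: "set_integrable lborel {0..\<tau>} (\<lambda>t. s * (lam d ?v t - lam d \<theta> t))"
    by (intro set_integrable_mult_right set_integral_diff il)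
  have H: "H = (\<lambda>t. (exp (F t) - 1) * lam d \<theta> t - s * (lam d ?v t - lam d \<theta> t))"
    by (simp add: H_def F_def)
  show "set_integrable lborel {0..\<tau>} H" unfolding H by (intro set_integral_diff i1 i2)
  let ?c = "s * real n * ((LBINT t:{0..\<tau>}. lam d ?v t) - (LBINT t:{0..\<tau>}. lam d \<theta> t))"
  have eq: "exp (s * llr u \<omega> + sample_integral f \<omega>) = exp (- ?c) * exp (sample_integral F \<omega>)" if "\<omega> \<in> space M" for \<omega>
  proof -
    have "sample_integral F \<omega> = sample_integral (\<lambda>t. s * (ln (lam d ?v t) - ln (lam d \<theta> t))) \<omega> + sample_integral f \<omega>"
      unfolding F_def by (rule sample_integral_add[OF that _ _ dl C]) measurable
    also have "sample_integral (\<lambda>t. s * (ln (lam d ?v t) - ln (lam d \<theta> t))) \<omega> =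
        s * (sample_integral (\<lambda>t. ln (lam d ?v t)) \<omega> - sample_integral (\<lambda>t. ln (lam d \<theta> t)) \<omega>)"
      unfolding sample_integral_cmult
      by (subst sample_integral_diff[OF that _ _ abs_ln_lam_le abs_ln_lam_le]) auto
    finally show ?thesis by (simp add: llr_def loglik_def exp_add[symmetric] algebra_simps)
  qed
  note E = exp_sample_integral_real[OF \<open>F \<in> _\<close> FC Flc]
  show "integrable M (\<lambda>\<omega>. exp (s * llr u \<omega> + sample_integral f \<omega>))"
    by (subst Bochner_Integration.integrable_cong[OF refl eq]) (use E(1) in auto)
  have "expectation (\<lambda>\<omega>. exp (s * llr u \<omega> + sample_integral f \<omega>)) = exp (- ?c) * expectation (\<lambda>\<omega>. exp (sample_integral F \<omega>))"
    by (subst Bochner_Integration.integral_cong[OF refl eq]) auto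
  also have "\<dots> = exp (real n * ((LBINT t:{0..\<tau>}. (exp (F t) - 1) * lam d \<theta> t) - s * ((LBINT t:{0..\<tau>}. lam d ?v t) - (LBINT t:{0..\<tau>}. lam d \<theta> t))))"
    unfolding E(2) by (simp add: exp_add[symmetric] algebra_simps)
  also have "s * ((LBINT t:{0..\<tau>}. lam d ?v t) - (LBINT t:{0..\<tau>}. lam d \<theta> t)) = (LBINT t:{0..\<tau>}. s * (lam d ?v t - lam d \<theta> t))"
    using il by (simp add: set_integral_diff(2))
  also have "(LBINT t:{0..\<tau>}. (exp (F t) - 1) * lam d \<theta> t) - (LBINT t:{0..\<tau>}. s * (lam d ?v t - lam d \<theta> t)) = (LBINT t:{0..\<tau>}. H t)"
    unfolding H by (rule set_integral_diff(2)[symmetric, OF i1 i2])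
  finally show "expectation (\<lambda>\<omega>. exp (s * llr u \<omega> + sample_integral f \<omega>)) = exp (real n * (LBINT t:{0..\<tau>}. H t))" .
qed

lemma expectation_exp_llr_only:
  fixes s u :: real
  defines "H \<equiv> \<lambda>t. (exp (s * (ln (lam d (par u) t) - ln (lam d \<theta> t))) - 1) * lam d \<theta> t
      - s * (lam d (par u) t - lam d \<theta> t)"
  shows "set_integrable lborel {0..\<tau>} H"
    and "integrable M (\<lambda>\<omega>. exp (s * llr u \<omega>))"
    and "expectation (\<lambda>\<omega>. exp (s * llr u \<omega>)) = exp (real n * (LBINT t:{0..\<tau>}. H t))"
proof -
  have 0: "sample_integral (\<lambda>_. 0) \<omega> = 0" for \<omega> by (simp add: sample_integral_def)
  note * = expectation_exp_llr[of "\<lambda>_. 0" 0 s u, simplified, unfolded 0, simplified]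
  show "set_integrable lborel {0..\<tau>} H" unfolding H_def by (rule *(1))
  show "integrable M (\<lambda>\<omega>. exp (s * llr u \<omega>))" by (rule *(2))
  show "expectation (\<lambda>\<omega>. exp (s * llr u \<omega>)) = exp (real n * (LBINT t:{0..\<tau>}. H t))" unfolding H_def by (rule *(3))
qed

lemma lam_diff_sq_integrable: "set_integrable lborel {0..\<tau>} (\<lambda>t. (lam d v t - lam d v' t)\<^sup>2)"
proof (rule set_integrable_Icc_bounded[where C="hi\<^sup>2"])
  fix t
  have "\<bar>lam d v t - lam d v' t\<bar> \<le> hi"
    using lam_pos[of d v t] lam_pos[of d v' t] lam_le[of d v t] lam_le[of d "v'" t] by linarith
  then show "\<bar>(lam d v t - lam d v' t)\<^sup>2\<bar> \<le> hi\<^sup>2" using hi_pos by (simp add: abs_le_square_iff[symmetric])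
qed measurable

lemma \<theta>_mem: "\<theta> \<in> {\<alpha>..\<beta>}" using \<theta>_in by auto

lemma abs_par_diff: "\<bar>par u - \<theta>\<bar> = \<phi> * \<bar>u\<bar>" using \<phi>_pos by (simp add: par_def abs_mult)

text \<open>
  From \<open>\<phi> \<le> d\<close> and \<open>n \<phi>\<^sup>2 = d\<close> the right-hand side is at least a constant times \<open>u\<^sup>2 / (\<bar>u\<bar> + 1)\<close>, which
  grows linearly. A linear rate is all that survives for large \<open>u\<close>, and it is enough.
\<close>

lemma hellinger_exponent_ge:
  "kap * (\<bar>u\<bar> - 1) \<le> real n / (8 * hi) * (r\<^sup>2 * ((\<phi> * \<bar>u\<bar>)\<^sup>2 / (\<phi> * \<bar>u\<bar> + d)))"
proof -
  have "real n * (\<phi> * \<bar>u\<bar>)\<^sup>2 = d * u\<^sup>2"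
    unfolding power_mult_distrib mult.assoc[symmetric] \<phi>_sq by simp
  then have "real n * ((\<phi> * \<bar>u\<bar>)\<^sup>2 / (\<phi> * \<bar>u\<bar> + d)) = d * u\<^sup>2 / (\<phi> * \<bar>u\<bar> + d)" by simp
  also have "\<dots> \<ge> d * u\<^sup>2 / (d * \<bar>u\<bar> + d)"
    using \<epsilon>_le_1 d_pos \<phi>_pos by (intro divide_left_mono add_mono mult_right_mono mult_pos_pos add_nonneg_pos mult_nonneg_nonneg) (use \<epsilon>_le_1 d_pos in \<open>auto simp: pos_divide_le_eq\<close>)
  also have "d * u\<^sup>2 / (d * \<bar>u\<bar> + d) = u\<^sup>2 / (\<bar>u\<bar> + 1)"
  proof -
    have "d * \<bar>u\<bar> + d = d * (\<bar>u\<bar> + 1)" by (simp add: algebra_simps)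
    then show ?thesis using d_pos by simp
  qed
  also have "\<dots> \<ge> \<bar>u\<bar> - 1"
  proof -
    have "(\<bar>u\<bar> - 1) * (\<bar>u\<bar> + 1) \<le> u\<^sup>2" by (simp add: algebra_simps power2_eq_square)
    then show ?thesis by (simp add: pos_le_divide_eq)
  qed
  finally have "\<bar>u\<bar> - 1 \<le> real n * ((\<phi> * \<bar>u\<bar>)\<^sup>2 / (\<phi> * \<bar>u\<bar> + d))" by simp
  from mult_left_mono[OF this less_imp_le[OF kap_pos]] show ?thesis by (simp add: kap_def mult_ac)
qed

text \<open>
  The Hellinger affinity: for \<open>s = 1 / 2\<close> the exponent \<open>H\<close> is minus half the squared difference of the
  square roots of the two intensities.
\<close>

lemma expectation_sqrt_ratio:
  assumes u: "u \<in> {ul..ur}"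
  shows "integrable M (\<lambda>\<omega>. exp (llr u \<omega> / 2))" and "expectation (\<lambda>\<omega>. exp (llr u \<omega> / 2)) \<le> exp kap * exp (- kap * \<bar>u\<bar>)"
proof -
  note E = expectation_exp_llr_only[of "1/2" u, simplified]
  show "integrable M (\<lambda>\<omega>. exp (llr u \<omega> / 2))" using E(2) by simp
  have pt: "(exp (1/2 * (ln a - ln b)) - 1) * b - 1/2 * (a - b) \<le> - (1 / (8 * hi)) * (a - b)\<^sup>2"
    if "0 < a" "a \<le> hi" "0 < b" "b \<le> hi" for a b
  proof -
    define x y where "x = sqrt a" and "y = sqrt b"
    have xy: "0 < x" "0 < y" "a = x\<^sup>2" "b = y\<^sup>2" using that by (auto simp: x_def y_def)
    have "exp (1/2 * (ln a - ln b)) = x / y"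
    proof -
      have l: "1/2 * (ln a - ln b) = ln x - ln y" using xy by (simp add: ln_realpow)
      show ?thesis unfolding l using xy by (simp add: exp_diff)
    qed
    then have "(exp (1/2 * (ln a - ln b)) - 1) * b - 1/2 * (a - b) = - ((x - y)\<^sup>2 / 2)"
      unfolding xy(3,4) using xy(1,2) by (simp add: field_simps power2_eq_square)
    moreover have "(a - b)\<^sup>2 \<le> (x - y)\<^sup>2 * (4 * hi)"
    proof -
      \<comment> \<open>The difference of square roots is the difference divided by the sum, and the sum is bounded.\<close>
      have "(x + y)\<^sup>2 \<le> 4 * hi"
        using that(2,4) sum_squares_bound[of x y] unfolding xy by (simp add: power2_sum)
      moreover have "(a - b)\<^sup>2 = (x - y)\<^sup>2 * (x + y)\<^sup>2" unfolding xy by (simp add: power_mult_distrib[symmetric] algebra_simps power2_eq_square)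
      ultimately show ?thesis by (simp add: mult_left_mono)
    qed
    then have "1 / (8 * hi) * (a - b)\<^sup>2 \<le> 1 / (8 * hi) * ((x - y)\<^sup>2 * (4 * hi))"
      using hi_pos by (intro mult_left_mono) auto
    then have "1 / (8 * hi) * (a - b)\<^sup>2 \<le> (x - y)\<^sup>2 / 2" using hi_pos by simp
    ultimately show ?thesis by linarith
  qed
  have "(LBINT t:{0..\<tau>}. (exp (1/2 * (ln (lam d (par u) t) - ln (lam d \<theta> t))) - 1) * lam d \<theta> t - 1/2 * (lam d (par u) t - lam d \<theta> t))
      \<le> (LBINT t:{0..\<tau>}. - (1 / (8 * hi)) * (lam d (par u) t - lam d \<theta> t)\<^sup>2)"
    by (intro set_integral_mono set_integrable_mult_right lam_diff_sq_integrable pt lam_pos lam_le)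
      (use E(1) in \<open>simp_all add: lam_le\<close>)
  also have "\<dots> = - (1 / (8 * hi)) * (LBINT t:{0..\<tau>}. (lam d (par u) t - lam d \<theta> t)\<^sup>2)" by (rule set_integral_mult_right)
  also have "\<dots> \<le> - (1 / (8 * hi)) * (r\<^sup>2 * ((\<phi> * \<bar>u\<bar>)\<^sup>2 / (\<phi> * \<bar>u\<bar> + d)))"
    using integral_lam_diff_sq(1)[OF d_pos _ \<theta>_mem \<beta>_d, of "par u"] par_in_iff[of u] u hi_pos
    by (intro mult_left_mono_neg) (auto simp: abs_par_diff)
  finally have "real n * (LBINT t:{0..\<tau>}. (exp (1/2 * (ln (lam d (par u) t) - ln (lam d \<theta> t))) - 1) * lam d \<theta> t - 1/2 * (lam d (par u) t - lam d \<theta> t))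
      \<le> - (real n / (8 * hi) * (r\<^sup>2 * ((\<phi> * \<bar>u\<bar>)\<^sup>2 / (\<phi> * \<bar>u\<bar> + d))))"
    by (drule_tac mult_left_mono[of _ _ "real n"]) simp_all
  also have "\<dots> \<le> kap + - kap * \<bar>u\<bar>" using hellinger_exponent_ge[of u] by (simp add: algebra_simps)
  finally show "expectation (\<lambda>\<omega>. exp (llr u \<omega> / 2)) \<le> exp kap * exp (- kap * \<bar>u\<bar>)"
    using E(3) by (simp add: exp_add[symmetric])
qed

text \<open>
  Multiplication by \<open>exp (llr u)\<close> turns the expectation into the one under the parameter \<open>par u\<close>, where the
  score at \<open>u\<close> is centred. Hence the linear term of the exponent vanishes, and the quadratic one is
  of order \<open>n d (\<phi> / d)\<^sup>2 = 1\<close>. The bound on \<open>c\<close> is the range that the envelope needs.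
\<close>

lemma expectation_ratio_score:
  assumes u: "u \<in> {ul..ur}" and c: "\<bar>c\<bar> \<le> 4"
  shows "integrable M (\<lambda>\<omega>. exp (llr u \<omega> + c * score u \<omega>))" and "expectation (\<lambda>\<omega>. exp (llr u \<omega> + c * score u \<omega>)) \<le> C2"
proof -
  let ?v = "par u"
  define f where "f t = - (c * r * \<phi> / d) * win d ?v t" for t
  have [measurable]: "f \<in> borel_measurable borel" unfolding f_def by measurable
  have fK: "\<bar>f t\<bar> \<le> K4 * (\<phi> / d)" for t
  proof -
    have "\<bar>f t\<bar> = \<bar>c\<bar> * (\<bar>r\<bar> * (\<phi> / d) * \<bar>win d ?v t\<bar>)"
      using \<epsilon>_pos d_pos \<phi>_pos by (simp add: f_def abs_mult)
    also have "\<dots> \<le> 4 * (\<bar>r\<bar> * (\<phi> / d) * (1 / lo))"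
      using \<phi>_pos d_pos lo_pos by (intro mult_mono c mult_left_mono win_bounds(3)) auto
    finally show ?thesis by (simp add: K4_def mult_ac)
  qed
  have fK': "\<bar>f t\<bar> \<le> K4" for t
    using fK[of t] mult_left_mono[OF \<epsilon>_le_1 K4_nonneg] by simp
  have lc: "continuous (at_left t) f" for t
    unfolding f_def by (intro continuous_intros left_continuous_win d_pos)
  note E = expectation_exp_llr[of f K4 1 u, OF _ fK' lc, simplified]
  have eq: "exp (llr u \<omega> + c * score u \<omega>) = exp (c * r * \<phi> * real n) * exp (llr u \<omega> + sample_integral f \<omega>)" for \<omega>
  proof -
    have "sample_integral f \<omega> = - (c * r * \<phi> / d) * sample_integral (win d ?v) \<omega>"
      unfolding f_def by (rule sample_integral_cmult)
    then show ?thesis using d_pos by (simp add: score_def exp_add[symmetric] algebra_simps)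
  qed
  show "integrable M (\<lambda>\<omega>. exp (llr u \<omega> + c * score u \<omega>))"
    unfolding eq using E(2) by simp
  let ?H = "\<lambda>t. (exp (ln (lam d ?v t) - ln (lam d \<theta> t) + f t) - 1) * lam d \<theta> t - (lam d ?v t - lam d \<theta> t)"
  have iH: "set_integrable lborel {0..\<tau>} ?H" using E(1) by simp
  have fl: "set_integrable lborel {0..\<tau>} (\<lambda>t. f t * lam d ?v t)"
  proof (rule set_integrable_Icc_bounded)
    show "\<bar>f t * lam d ?v t\<bar> \<le> K4 * hi" for t
      unfolding abs_mult by (intro mult_mono fK' abs_lam_le K4_nonneg) simp
  qed measurable
  have "(LBINT t:{0..\<tau>}. f t * lam d ?v t) = (LBINT t:{0..\<tau>}. - (c * r * \<phi> / d) * (win d ?v t * lam d ?v t))"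
    unfolding f_def by (simp add: mult.assoc)
  also have "\<dots> = - (c * r * \<phi> / d) * (LBINT t:{0..\<tau>}. win d ?v t * lam d ?v t)"
    by (rule set_integral_mult_right)
  also have "\<dots> = - (c * r * \<phi>)"
    using par_range[OF u] d_pos by (subst integral_win_lam) auto
  finally have If: "(LBINT t:{0..\<tau>}. f t * lam d ?v t) = - (c * r * \<phi>)" .
  have pt: "?H t - f t * lam d ?v t \<le> (K4 * (\<phi> / d))\<^sup>2 * exp K4 * hi * indicator {?v<..?v + d} t" for t
  proof -
    have "exp (ln (lam d ?v t) - ln (lam d \<theta> t) + f t) = lam d ?v t / lam d \<theta> t * exp (f t)"
      using lam_pos[of d ?v t] lam_pos[of d \<theta> t] by (simp add: exp_add exp_diff)
    then have *: "?H t - f t * lam d ?v t = (exp (f t) - 1 - f t) * lam d ?v t"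
      using lam_pos[of d \<theta> t] by (simp add: field_simps)
    show ?thesis
    proof (cases "t \<in> {?v<..?v + d}")
      case False
      then have "f t = 0" by (simp add: f_def win_def)
      then show ?thesis using False unfolding * by simp
    next
      case True
      have "(exp (f t) - 1 - f t) * lam d ?v t \<le> ((f t)\<^sup>2 * exp \<bar>f t\<bar>) * hi"
        using lam_pos[of d ?v t] by (intro mult_mono exp_second_order lam_le) auto
      also have "\<dots> \<le> ((K4 * (\<phi> / d))\<^sup>2 * exp K4) * hi"
        using fK[of t] fK'[of t] hi_pos K4_nonneg \<epsilon>_pos
        by (intro mult_right_mono mult_mono) (use \<phi>_pos d_pos in \<open>auto simp: abs_le_square_iff[symmetric] abs_mult\<close>)
      finally show ?thesis unfolding * using True by simp
    qed
  qed
  have "c * r * \<phi> * real n + real n * (LBINT t:{0..\<tau>}. ?H t) = real n * (LBINT t:{0..\<tau>}. ?H t - f t * lam d ?v t)"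
    by (subst set_integral_diff(2)[OF iH fl]) (simp add: If algebra_simps)
  also have "\<dots> \<le> real n * (LBINT t:{0..\<tau>}. (K4 * (\<phi> / d))\<^sup>2 * exp K4 * hi * indicator {?v<..?v + d} t)"
    by (intro mult_left_mono set_integral_mono set_integral_diff(1)[OF iH fl] pt
        set_integrable_Icc_bounded[where C="\<bar>(K4 * (\<phi> / d))\<^sup>2 * exp K4 * hi\<bar>"]) (auto simp: indicator_def)
  also have "(LBINT t:{0..\<tau>}. (K4 * (\<phi> / d))\<^sup>2 * exp K4 * hi * indicator {?v<..?v + d} t) = (K4 * (\<phi> / d))\<^sup>2 * exp K4 * hi * (?v + d - ?v)"
    by (rule LBINT_indicator_Ioc) (use par_range[OF u] d_pos in auto)
  also have "real n * ((K4 * (\<phi> / d))\<^sup>2 * exp K4 * hi * (?v + d - ?v)) = (real n * d * (\<phi> / d)\<^sup>2) * (K4\<^sup>2 * exp K4 * hi)"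
    by (simp only: power_mult_distrib add_diff_cancel_left' mult_ac)
  also have "\<dots> = K4\<^sup>2 * exp K4 * hi" unfolding \<epsilon>_sq by simp
  finally have "c * r * \<phi> * real n + real n * (LBINT t:{0..\<tau>}. ?H t) \<le> K4\<^sup>2 * exp K4 * hi" .
  moreover have "expectation (\<lambda>\<omega>. exp (llr u \<omega> + c * score u \<omega>)) = exp (c * r * \<phi> * real n + real n * (LBINT t:{0..\<tau>}. ?H t))"
    unfolding eq integral_mult_right_zero E(3) by (simp only: mult_exp_exp)
  ultimately show "expectation (\<lambda>\<omega>. exp (llr u \<omega> + c * score u \<omega>)) \<le> C2" by (simp add: C2_def)
qed

text \<open>
  For \<open>s = - 1\<close> the exponent is a chi-square distance of the two intensities, which grows with \<open>u\<close>. The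
  neighbourhood \<open>\<bar>u\<bar> \<le> 1\<close> of the true value serves to bound the mass of the posterior from below.
\<close>

lemma expectation_inverse_ratio:
  assumes u: "u \<in> {ul..ur}" "\<bar>u\<bar> \<le> 1"
  shows "integrable M (\<lambda>\<omega>. exp (- llr u \<omega>))" and "expectation (\<lambda>\<omega>. exp (- llr u \<omega>)) \<le> C3"
proof -
  let ?H = "\<lambda>t. (exp (ln (lam d \<theta> t) - ln (lam d (par u) t)) - 1) * lam d \<theta> t + (lam d (par u) t - lam d \<theta> t)"
  have "(\<lambda>t. (exp (- 1 * (ln (lam d (par u) t) - ln (lam d \<theta> t))) - 1) * lam d \<theta> t - - 1 * (lam d (par u) t - lam d \<theta> t)) = ?H"
    by (intro ext) simp
  note E = expectation_exp_llr_only[of "- 1" u, unfolded this]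
  show "integrable M (\<lambda>\<omega>. exp (- llr u \<omega>))" using E(2) by simp
  have pt: "?H t \<le> 1 / lo * (lam d (par u) t - lam d \<theta> t)\<^sup>2" for t
  proof -
    have "?H t = 1 / lam d (par u) t * (lam d (par u) t - lam d \<theta> t)\<^sup>2"
      using lam_pos[of d "par u" t] lam_pos[of d \<theta> t] by (simp add: exp_diff field_simps power2_eq_square)
    also have "\<dots> \<le> 1 / lo * (lam d (par u) t - lam d \<theta> t)\<^sup>2"
      using lo_pos by (intro mult_right_mono divide_left_mono lam_ge mult_pos_pos lam_pos) auto
    finally show ?thesis .
  qed
  have "(LBINT t:{0..\<tau>}. ?H t) \<le> (LBINT t:{0..\<tau>}. 1 / lo * (lam d (par u) t - lam d \<theta> t)\<^sup>2)"
    by (intro set_integral_mono set_integrable_mult_right lam_diff_sq_integrable pt) (use E(1) in simp)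
  also have "\<dots> = 1 / lo * (LBINT t:{0..\<tau>}. (lam d (par u) t - lam d \<theta> t)\<^sup>2)" by (rule set_integral_mult_right)
  also have "\<dots> \<le> 1 / lo * (r\<^sup>2 * ((\<phi> * \<bar>u\<bar> / d)\<^sup>2 * (\<phi> * \<bar>u\<bar> + d)))"
    using integral_lam_diff_sq(2)[OF d_pos _ \<theta>_mem \<beta>_d, of "par u"] par_in_iff[of u] u lo_pos
    by (intro mult_left_mono) (auto simp: abs_par_diff)
  finally have "real n * (LBINT t:{0..\<tau>}. ?H t) \<le> real n * (1 / lo * (r\<^sup>2 * ((\<phi> * \<bar>u\<bar> / d)\<^sup>2 * (\<phi> * \<bar>u\<bar> + d))))"
    by (rule mult_left_mono) simp
  also have "\<dots> = r\<^sup>2 / lo * ((real n * d * (\<phi> / d)\<^sup>2) * (u\<^sup>2 * (\<phi> / d * \<bar>u\<bar> + 1)))"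
  proof -
    have e1: "\<phi> * \<bar>u\<bar> + d = d * (\<phi> / d * \<bar>u\<bar> + 1)" using d_pos by (simp add: field_simps)
    have e2: "(\<phi> * \<bar>u\<bar> / d)\<^sup>2 = (\<phi> / d)\<^sup>2 * u\<^sup>2" by (simp add: power_mult_distrib power_divide)
    show ?thesis unfolding e1 e2 by simp
  qed
  also have "\<dots> = r\<^sup>2 / lo * (u\<^sup>2 * (\<phi> / d * \<bar>u\<bar> + 1))" unfolding \<epsilon>_sq by simp
  also have "\<dots> \<le> r\<^sup>2 / lo * (1 * (1 * 1 + 1))"
    using u(2) \<epsilon>_le_1 \<phi>_pos d_pos lo_pos
    by (intro mult_left_mono mult_mono add_mono) (auto simp: abs_square_le_1 intro!: add_nonneg_nonneg)
  finally show "expectation (\<lambda>\<omega>. exp (- llr u \<omega>)) \<le> C3"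
    using E(3) by (simp add: C3_def mult.commute)
qed

text \<open>
  The square root of the likelihood ratio times the absolute score, without losing the exponential
  decay. From \<open>\<bar>x\<bar> \<le> exp x + exp (- x)\<close> and two applications of the inequality between the
  arithmetic and the geometric mean, with the weight \<open>k\<close>, the product is bounded by \<open>k\<close> times a decaying
  term plus \<open>1 / k\<close> times a bounded one. The choice \<open>k = exp (\<kappa> \<bar>u\<bar> / 2)\<close> splits the decay evenly.
\<close>

lemma expectation_sqrt_ratio_score:
  assumes u: "u \<in> {ul..ur}"
  shows "integrable M (\<lambda>\<omega>. exp (llr u \<omega> / 2) * \<bar>score u \<omega>\<bar>)"
    and "expectation (\<lambda>\<omega>. exp (llr u \<omega> / 2) * \<bar>score u \<omega>\<bar>) \<le> C4 * exp (- (kap / 2) * \<bar>u\<bar>)"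
proof -
  define k where "k = exp (kap / 2 * \<bar>u\<bar>)"
  define B where "B \<omega> = k * exp (llr u \<omega> / 2) + 1 / (4 * k) * (exp (llr u \<omega> + 4 * score u \<omega>) + exp (llr u \<omega> + - 4 * score u \<omega>) + 2)" for \<omega>
  have k: "0 < k" by (simp add: k_def)
  have iB: "integrable M B"
    unfolding B_def
    by (intro Bochner_Integration.integrable_add integrable_mult_right integrable_const expectation_sqrt_ratio(1)[OF u] expectation_ratio_score(1)[OF u]) auto
  have *: "exp (y / 2) * exp x \<le> k / 2 * exp (y / 2) + 1 / (4 * k) * (exp (y + 4 * x) + 1)" for x y :: real
  proof -
    have "0 \<le> (k - exp x)\<^sup>2" by simp
    then have "2 * k * exp x \<le> k\<^sup>2 + exp (2 * x)"
      by (simp add: power2_diff exp_double)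
    then have a: "exp x \<le> k / 2 + 1 / (2 * k) * exp (2 * x)" using k by (simp add: field_simps power2_eq_square)
    have "0 \<le> (exp ((y + 4 * x) / 2) - 1)\<^sup>2" by simp
    then have "2 * exp ((y + 4 * x) / 2) \<le> exp (y + 4 * x) + 1"
      by (simp add: power2_diff) (simp add: power2_eq_square mult_exp_exp field_sum_of_halves)
    then have b: "exp (y / 2) * exp (2 * x) \<le> (exp (y + 4 * x) + 1) / 2"
      by (simp add: exp_add[symmetric] add_divide_distrib)
    have "exp (y / 2) * exp x \<le> exp (y / 2) * (k / 2 + 1 / (2 * k) * exp (2 * x))" by (intro mult_left_mono a) simp
    also have "\<dots> = k / 2 * exp (y / 2) + 1 / (2 * k) * (exp (y / 2) * exp (2 * x))" by (simp add: algebra_simps)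
    also have "\<dots> \<le> k / 2 * exp (y / 2) + 1 / (2 * k) * ((exp (y + 4 * x) + 1) / 2)"
      using k by (intro add_left_mono mult_left_mono b) auto
    finally show ?thesis by simp
  qed
  have le: "exp (llr u \<omega> / 2) * \<bar>score u \<omega>\<bar> \<le> B \<omega>" for \<omega>
  proof -
    have "\<bar>x\<bar> \<le> exp x + exp (- x)" for x :: real
      using exp_ge_add_one_self[of x] exp_ge_add_one_self[of "-x"] exp_gt_zero[of x] exp_gt_zero[of "-x"] by linarith
    then have "exp (llr u \<omega> / 2) * \<bar>score u \<omega>\<bar> \<le> exp (llr u \<omega> / 2) * (exp (score u \<omega>) + exp (- score u \<omega>))"
      by (intro mult_left_mono) auto
    also have "\<dots> \<le> B \<omega>"
      using *[of "llr u \<omega>" "score u \<omega>"] *[of "llr u \<omega>" "- score u \<omega>"]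
      by (simp add: B_def distrib_left)
    finally show ?thesis .
  qed
  have m: "(\<lambda>\<omega>. exp (llr u \<omega> / 2) * \<bar>score u \<omega>\<bar>) \<in> borel_measurable M"
    using section_measurable[OF llr_measurable_pair, of u] section_measurable[OF score_measurable_pair, of u] by measurable
  show i: "integrable M (\<lambda>\<omega>. exp (llr u \<omega> / 2) * \<bar>score u \<omega>\<bar>)"
    by (rule Bochner_Integration.integrable_bound[OF iB m]) (use order.trans[OF le abs_ge_self] in auto)
  have "expectation (\<lambda>\<omega>. exp (llr u \<omega> / 2) * \<bar>score u \<omega>\<bar>) \<le> expectation B"
    by (rule integral_mono[OF i iB le])
  also have "\<dots> = k * expectation (\<lambda>\<omega>. exp (llr u \<omega> / 2)) + 1 / (4 * k) *
      (expectation (\<lambda>\<omega>. exp (llr u \<omega> + 4 * score u \<omega>)) + expectation (\<lambda>\<omega>. exp (llr u \<omega> + - 4 * score u \<omega>)) + 2)"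
    unfolding B_def
    using expectation_sqrt_ratio(1)[OF u] expectation_ratio_score(1)[OF u, of 4] expectation_ratio_score(1)[OF u, of "-4"]
    by (simp add: prob_space)
  also have "\<dots> \<le> k * (exp kap * exp (- kap * \<bar>u\<bar>)) + 1 / (4 * k) * (C2 + C2 + 2)"
    using k by (intro add_mono mult_left_mono expectation_sqrt_ratio(2)[OF u] expectation_ratio_score(2)[OF u]) auto
  also have "k * (exp kap * exp (- kap * \<bar>u\<bar>)) = exp kap * exp (- (kap / 2) * \<bar>u\<bar>)"
    by (simp add: k_def exp_add[symmetric] algebra_simps)
  also have "1 / (4 * k) * (C2 + C2 + 2) = (C2 + 1) / 2 * exp (- (kap / 2) * \<bar>u\<bar>)"
    by (simp add: k_def exp_minus field_simps)
  finally show "expectation (\<lambda>\<omega>. exp (llr u \<omega> / 2) * \<bar>score u \<omega>\<bar>) \<le> C4 * exp (- (kap / 2) * \<bar>u\<bar>)"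
    by (simp add: C4_def distrib_right)
qed

definition speed :: "real \<Rightarrow> 'w \<Rightarrow> real" where
  "speed w \<omega> = kap / 4 + \<bar>score w \<omega>\<bar> / 2"

definition weighted :: "real \<Rightarrow> 'w \<Rightarrow> real" where
  "weighted w \<omega> = kap / 4 * \<bar>w\<bar> + llr w \<omega> / 2"

text \<open>
  The total variation bound for \<open>exp (weighted w)\<close>, started from its value \<open>1\<close> at \<open>w = 0\<close>; \<open>speed\<close> bounds the
  derivative of \<open>weighted\<close> in absolute value.
\<close>

definition V :: "'w \<Rightarrow> real" where
  "V \<omega> = 1 + (LBINT w:{ul..ur}. speed w \<omega> * exp (weighted w \<omega>))"

lemma speed_weighted_measurable: "(\<lambda>(w, \<omega>). speed w \<omega> * exp (weighted w \<omega>)) \<in> borel_measurable (borel \<Otimes>\<^sub>M M)"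
  using score_measurable_pair llr_measurable_pair unfolding speed_def weighted_def split_beta by measurable

lemma speed_bound:
  assumes "\<omega> \<in> space M"
  obtains K where "\<And>w. 0 \<le> speed w \<omega>" "\<And>w. speed w \<omega> \<le> K"
proof
  show "0 \<le> speed w \<omega>" for w using kap_pos by (simp add: speed_def)
  show "speed w \<omega> \<le> kap / 4 + (\<bar>r * \<phi> / d\<bar> * (total \<omega> / lo + real n * d)) / 2" for w
    unfolding speed_def by (intro add_left_mono divide_right_mono abs_score_le[OF assms]) simp
qed

lemma speed_weighted_integrable:
  assumes \<omega>: "\<omega> \<in> space M"
  shows "set_integrable lborel {ul..ur} (\<lambda>w. speed w \<omega> * exp (weighted w \<omega>))"
proof -
  obtain K where K: "\<And>w. 0 \<le> speed w \<omega>" "\<And>w. speed w \<omega> \<le> K" using speed_bound[OF \<omega>] by blast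
  let ?B = "2 * ((\<bar>ln lo\<bar> + \<bar>ln hi\<bar>) * total \<omega> + real n * (hi * \<tau>))"
  show ?thesis
  proof (rule set_integrable_Icc_bounded[OF path_measurable[OF speed_weighted_measurable \<omega>]])
    fix w assume w: "w \<in> {ul..ur}"
    have "weighted w \<omega> \<le> kap / 4 * (ur - ul) + ?B / 2"
      unfolding weighted_def using w abs_llr_le[OF \<omega>, of w] kap_pos ul_less ur_greater
      by (intro add_mono mult_left_mono divide_right_mono) auto
    then show "\<bar>speed w \<omega> * exp (weighted w \<omega>)\<bar> \<le> K * exp (kap / 4 * (ur - ul) + ?B / 2)"
      using K[of w] by (simp add: abs_mult mult_mono)
  qed
qed

text \<open>
  One random variable bounds the likelihood ratio at all parameters simultaneously: the function
  \<open>exp (weighted u)\<close> starts from \<open>1\<close> and cannot grow by more than its total variation.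
\<close>

lemma exp_weighted_le_V:
  assumes \<omega>: "\<omega> \<in> space M" and u: "u \<in> {ul..ur}"
  shows "exp (weighted u \<omega>) \<le> V \<omega>"
proof -
  obtain K where K: "\<And>w. 0 \<le> speed w \<omega>" "\<And>w. speed w \<omega> \<le> K" using speed_bound[OF \<omega>] by blast
  have sm: "(\<lambda>w. speed w \<omega>) \<in> borel_measurable borel"
    using path_measurable[OF score_measurable_pair \<omega>] unfolding speed_def by measurable
  have si: "set_integrable lborel {a..b} (\<lambda>w. speed w \<omega>)" for a b
    by (rule set_integrable_Icc_bounded[OF sm, where C=K]) (use K in auto)
  have si': "(\<lambda>w. speed w \<omega>) integrable_on {a..b}" for a b
    by (rule set_borel_integral_eq_integral(1)[OF si])
  have int: "(\<lambda>w. speed w \<omega> * exp (weighted w \<omega>)) integrable_on {ul..ur}"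
    by (rule set_borel_integral_eq_integral(1)[OF speed_weighted_integrable[OF \<omega>]])
  have inc: "\<bar>weighted y \<omega> - weighted x \<omega>\<bar> \<le> integral {x..y} (\<lambda>w. speed w \<omega>)" if "ul \<le> x" "x \<le> y" "y \<le> ur" for x y
  proof -
    have sci: "set_integrable lborel {x..y} (\<lambda>w. \<bar>score w \<omega>\<bar>)" by (rule set_integrable_abs[OF score_integrable[OF \<omega>]])
    have "\<bar>integral {x..y} (\<lambda>w. score w \<omega>)\<bar> \<le> integral {x..y} (\<lambda>w. \<bar>score w \<omega>\<bar>)"
      using integral_norm_bound_integral[of "\<lambda>w. score w \<omega>" "{x..y}" "\<lambda>w. \<bar>score w \<omega>\<bar>"]
        set_borel_integral_eq_integral(1)[OF score_integrable[OF \<omega>]] set_borel_integral_eq_integral(1)[OF sci] by auto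
    then have "\<bar>llr y \<omega> - llr x \<omega>\<bar> \<le> integral {x..y} (\<lambda>w. \<bar>score w \<omega>\<bar>)" using llr_increment[OF \<omega> that] by simp
    moreover have "integral {x..y} (\<lambda>w. speed w \<omega>) = kap / 4 * (y - x) + integral {x..y} (\<lambda>w. \<bar>score w \<omega>\<bar>) / 2"
      unfolding speed_def using set_borel_integral_eq_integral(1)[OF sci] that
      by (subst Henstock_Kurzweil_Integration.integral_add) (auto intro: integrable_on_divide)
    moreover have "\<bar>kap / 4 * \<bar>y\<bar> - kap / 4 * \<bar>x\<bar>\<bar> \<le> kap / 4 * (y - x)"
    proof -
      have "\<bar>\<bar>y\<bar> - \<bar>x\<bar>\<bar> \<le> y - x" using that by linarith
      then have "kap / 4 * \<bar>\<bar>y\<bar> - \<bar>x\<bar>\<bar> \<le> kap / 4 * (y - x)" using kap_pos by (intro mult_left_mono) auto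
      then show ?thesis using kap_pos unfolding right_diff_distrib[symmetric] abs_mult by simp
    qed
    ultimately show ?thesis unfolding weighted_def by linarith
  qed
  have main: "\<bar>exp (weighted b \<omega>) - exp (weighted a \<omega>)\<bar> \<le> integral {ul..ur} (\<lambda>w. speed w \<omega> * exp (weighted w \<omega>))"
    if "ul \<le> a" "a \<le> b" "b \<le> ur" for a b
  proof -
    have "\<bar>exp (weighted b \<omega>) - exp (weighted a \<omega>)\<bar> \<le> integral {a..b} (\<lambda>w. speed w \<omega> * exp (weighted w \<omega>))"
      by (rule exp_increment_le_integral[OF inc _ si' int that]) (use K in auto)
    also have "\<dots> \<le> integral {ul..ur} (\<lambda>w. speed w \<omega> * exp (weighted w \<omega>))"
      by (rule integral_subset_le) (use that K int in \<open>auto intro: integrable_on_subinterval\<close>)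
    finally show ?thesis .
  qed
  have w0: "exp (weighted 0 \<omega>) = 1" by (simp add: weighted_def llr_0)
  have "\<bar>exp (weighted u \<omega>) - exp (weighted 0 \<omega>)\<bar> \<le> integral {ul..ur} (\<lambda>w. speed w \<omega> * exp (weighted w \<omega>))"
    using main[of 0 u] main[of u 0] u ul_less ur_greater by (cases "0 \<le> u") (auto simp: abs_minus_commute)
  then show ?thesis unfolding V_def w0 set_borel_integral_eq_integral(2)[OF speed_weighted_integrable[OF \<omega>]] by linarith
qed

text \<open>
  The weight \<open>exp (\<kappa> \<bar>w\<bar> / 4)\<close> costs only half of the decay \<open>exp (- \<kappa> \<bar>w\<bar> / 2)\<close> of the integrand, so what is left is
  integrable over the whole line.
\<close>

lemma expectation_V: "integrable M V" "expectation V \<le> CV"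
proof -
  let ?F = "\<lambda>w \<omega>. speed w \<omega> * exp (weighted w \<omega>)"
  have F: "?F w \<omega> = exp (kap / 4 * \<bar>w\<bar>) * (kap / 4 * exp (llr w \<omega> / 2) + (exp (llr w \<omega> / 2) * \<bar>score w \<omega>\<bar>) / 2)" for w \<omega>
    by (simp add: speed_def weighted_def exp_add algebra_simps)
  have i: "integrable M (?F w)" if "w \<in> {ul..ur}" for w
    unfolding F using expectation_sqrt_ratio(1)[OF that] expectation_sqrt_ratio_score(1)[OF that] by simp
  have le: "expectation (?F w) \<le> C5 * exp (- (kap / 4) * \<bar>w\<bar>)" if w: "w \<in> {ul..ur}" for w
  proof -
    have "expectation (?F w) = exp (kap / 4 * \<bar>w\<bar>) * (kap / 4 * expectation (\<lambda>\<omega>. exp (llr w \<omega> / 2)) + expectation (\<lambda>\<omega>. exp (llr w \<omega> / 2) * \<bar>score w \<omega>\<bar>) / 2)"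
      unfolding F using expectation_sqrt_ratio(1)[OF w] expectation_sqrt_ratio_score(1)[OF w] by simp
    also have "\<dots> \<le> exp (kap / 4 * \<bar>w\<bar>) * (kap / 4 * (exp kap * exp (- (kap / 2) * \<bar>w\<bar>)) + C4 * exp (- (kap / 2) * \<bar>w\<bar>) / 2)"
    proof (intro mult_left_mono add_mono divide_right_mono expectation_sqrt_ratio_score(2)[OF w])
      have "exp (- kap * \<bar>w\<bar>) \<le> exp (- (kap / 2) * \<bar>w\<bar>)" using kap_pos by (simp add: mult_right_mono)
      then show "expectation (\<lambda>\<omega>. exp (llr w \<omega> / 2)) \<le> exp kap * exp (- (kap / 2) * \<bar>w\<bar>)"
        using expectation_sqrt_ratio(2)[OF w] by (auto intro: order.trans)
    qed (use kap_pos in auto)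
    also have "\<dots> = C5 * (exp (kap / 4 * \<bar>w\<bar>) * exp (- (kap / 2) * \<bar>w\<bar>))" by (simp add: C5_def algebra_simps)
    also have "exp (kap / 4 * \<bar>w\<bar>) * exp (- (kap / 2) * \<bar>w\<bar>) = exp (- (kap / 4) * \<bar>w\<bar>)"
      by (simp add: exp_add[symmetric])
    finally show ?thesis .
  qed
  have nn: "0 \<le> ?F w \<omega>" for w \<omega> using kap_pos by (simp add: speed_def)
  have h: "set_integrable lborel {ul..ur} (\<lambda>w. C5 * exp (- (kap / 4) * \<bar>w\<bar>))"
    by (intro borel_integrable_atLeastAtMost' continuous_intros)
  note E = expectation_LBINT_le[OF speed_weighted_measurable nn speed_weighted_integrable i le h]
  show iV: "integrable M V" unfolding V_def by (intro Bochner_Integration.integrable_add integrable_const E(1)) auto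
  have "expectation V = 1 + expectation (\<lambda>\<omega>. LBINT w:{ul..ur}. ?F w \<omega>)"
    unfolding V_def by (subst Bochner_Integration.integral_add) (use E(1) in \<open>auto simp: prob_space\<close>)
  also have "\<dots> \<le> 1 + (LBINT w:{ul..ur}. C5 * exp (- (kap / 4) * \<bar>w\<bar>))" using E(2) by simp
  also have "(LBINT w:{ul..ur}. C5 * exp (- (kap / 4) * \<bar>w\<bar>)) = C5 * (LBINT w:{ul..ur}. exp (- (kap / 4) * \<bar>w\<bar>))"
    by (rule set_integral_mult_right)
  also have "\<dots> \<le> C5 * (2 / (kap / 4))"
    using integral_exp_minus_abs_le[of "kap / 4" ul ur] kap_pos ul_less ur_greater
    by (intro mult_left_mono) (auto simp: C5_def C4_def C2_def)
  finally show "expectation V \<le> CV" by (simp add: CV_def)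
qed

lemma V_ge_1: "1 \<le> V \<omega>"
  unfolding V_def set_lebesgue_integral_def using kap_pos
  by (simp add: integral_nonneg_AE speed_def indicator_def)

text \<open>
  By Jensen's inequality the reciprocal of \<open>J\<close> is a lower bound for the integral of the likelihood ratio
  over \<open>[0, 1]\<close>.
\<close>

definition J :: "'w \<Rightarrow> real" where
  "J \<omega> = (LBINT u:{0..1}. exp (- llr u \<omega>))"

lemma exp_llr_integrable:
  assumes \<omega>: "\<omega> \<in> space M"
  shows "set_integrable lborel {a..b} (\<lambda>u. exp (c * llr u \<omega>))"
proof (rule set_integrable_Icc_bounded)
  show "(\<lambda>u. exp (c * llr u \<omega>)) \<in> borel_measurable borel"
    using path_measurable[OF llr_measurable_pair \<omega>] by measurable
  show "\<bar>exp (c * llr u \<omega>)\<bar> \<le> exp (\<bar>c\<bar> * (2 * ((\<bar>ln lo\<bar> + \<bar>ln hi\<bar>) * total \<omega> + real n * (hi * \<tau>))))" for u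
    using mult_left_mono[OF abs_llr_le[OF \<omega>, of u], of "\<bar>c\<bar>"] abs_ge_self[of "c * llr u \<omega>"] by (simp add: abs_mult)
qed

lemma expectation_J:
  assumes "1 \<le> ur"
  shows "integrable M J" "expectation J \<le> C3"
proof -
  have m: "(\<lambda>(u, \<omega>). exp (- llr u \<omega>)) \<in> borel_measurable (borel \<Otimes>\<^sub>M M)"
    using llr_measurable_pair unfolding split_beta by measurable
  have u: "u \<in> {ul..ur}" "\<bar>u\<bar> \<le> 1" if "u \<in> {0..1}" for u using that assms ul_less by auto
  have h: "set_integrable lborel {0..1::real} (\<lambda>_. C3)"
    by (rule set_integrable_Icc_bounded[where C=C3]) (auto simp: C3_def)
  note E = expectation_LBINT_le[OF m _ exp_llr_integrable[where c="-1", simplified] expectation_inverse_ratio(1)[OF u] expectation_inverse_ratio(2)[OF u] h]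
  show "integrable M J" unfolding J_def by (rule E(1)) auto
  have "expectation J \<le> (LBINT u:{0..1::real}. C3)" unfolding J_def by (rule E(2)) auto
  then show "expectation J \<le> C3" by (simp add: LBINT_const_Icc)
qed

end

section \<open>Local asymptotic normality at one sample size\<close>

text \<open>
  Twice the hyperbolic cosine minus two. With it a second moment is bounded by exponential moments,
  for which a closed formula exists.
\<close>

lemma square_le_exp_sum: "x\<^sup>2 \<le> exp x + exp (- x) - 2" for x :: real
proof -
  have *: "1 + y + y\<^sup>2 / 2 + y ^ 3 / 6 \<le> exp y" for y :: real
  proof -
    obtain t where t: "exp y = (\<Sum>m<4. y ^ m / fact m) + exp t / fact 4 * y ^ 4"
      using Maclaurin_exp_le[of y 4] by blast
    moreover have "(\<Sum>m<4. y ^ m / fact m) = 1 + y + y\<^sup>2 / 2 + y ^ 3 / 6"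
      by (simp add: numeral_eq_Suc)
    moreover have "0 \<le> exp t / fact 4 * y ^ 4" by (intro mult_nonneg_nonneg) auto
    ultimately show ?thesis by linarith
  qed
  show ?thesis using *[of x] *[of "-x"] by simp
qed

context ramp_intensity
begin

definition C6 :: real where
  "C6 = hi * exp (2 * \<bar>r\<bar> / lo) * (r\<^sup>2 / lo * (\<bar>r\<bar> / lo\<^sup>2 + 2 / lo))"

text \<open>
  The transition zone in the coordinate in which it is the unit interval.
\<close>

lemma LBINT_window:
  fixes g :: "real \<Rightarrow> real"
  assumes "0 \<le> v" "0 < d" "v + d \<le> \<tau>" and [measurable]: "g \<in> borel_measurable borel"
  shows "(LBINT t:{0..\<tau>}. indicator {v<..v + d} t * g t) = d * (LBINT s:{0..1}. g (v + d * s))"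
proof -
  have "(LBINT t:{0..\<tau>}. indicator {v<..v + d} t * g t) = (LINT t|lborel. indicator {v<..v + d} t * g t)"
    unfolding set_lebesgue_integral_def by (rule Bochner_Integration.integral_cong) (use assms in \<open>auto simp: indicator_def\<close>)
  also have "\<dots> = \<bar>d\<bar> *\<^sub>R (LINT s|lborel. indicator {v<..v + d} (v + d * s) * g (v + d * s))"
    by (rule lborel_integral_real_affine) (use assms in auto)
  also have "(LINT s|lborel. indicator {v<..v + d} (v + d * s) * g (v + d * s)) = (LINT s|lborel. indicator {0<..1} s * g (v + d * s))"
    by (rule Bochner_Integration.integral_cong) (use assms in \<open>auto simp: indicator_def zero_less_mult_iff mult_le_cancel_left1\<close>)
  also have "\<dots> = (LINT s|lborel. indicator {0..1} s * g (v + d * s))"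
    by (rule integral_cong_AE) (use AE_lborel_singleton[of 0] in \<open>auto elim!: eventually_mono simp: indicator_def\<close>)
  finally show ?thesis using assms by (simp add: set_lebesgue_integral_def)
qed

lemma lam_window: "0 < d \<Longrightarrow> s \<in> {0..1} \<Longrightarrow> lam d v (v + d * s) = psi_ext (v + d * s) + r * s"
  by (simp add: lam_def ramp_def)

lemma lo_le_window: "s \<in> {0..1} \<Longrightarrow> lo \<le> psi_ext t + r * s"
  using lam_ge[of 1 "t - s" t] by (simp add: lam_def ramp_def)

text \<open>
  Two windows differ by a Lipschitz term inside the common zone and by a bounded term on two
  intervals of length \<open>\<bar>v - v'\<bar>\<close> at the ends. This linear bound, rather than a quadratic one, is due to the jumps of
  the windows.
\<close>

lemma integral_win_diff_le:
  assumes d: "0 < d" and v: "0 \<le> v" "0 \<le> v'" "v + d \<le> \<tau>" "v' + d \<le> \<tau>"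
  shows "(LBINT t:{0..\<tau>}. \<bar>win d v t - win d v' t\<bar>) \<le> \<bar>v - v'\<bar> * (\<bar>r\<bar> / lo\<^sup>2 + 2 / lo)"
proof -
  define a b where "a = min v v'" and "b = max v v'"
  define K where "K = \<bar>r\<bar> * (\<bar>v - v'\<bar> / d) / lo\<^sup>2"
  let ?g = "\<lambda>t. K * indicator {v'<..v' + d} t + (1 / lo * indicator {a<..b} t + 1 / lo * indicator {a + d<..b + d} t)"
  have pt: "\<bar>win d v t - win d v' t\<bar> \<le> ?g t" for t
  proof -
    have inv: "\<bar>1 / lam d v t - 1 / lam d v' t\<bar> \<le> K"
    proof -
      have "\<bar>1 / lam d v t - 1 / lam d v' t\<bar> = \<bar>lam d v t - lam d v' t\<bar> / (lam d v t * lam d v' t)"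
        using lam_pos[of d v t] lam_pos[of d v' t] by (simp add: diff_frac_eq abs_mult abs_minus_commute)
      also have "\<dots> \<le> (\<bar>r\<bar> * (\<bar>v - v'\<bar> / d)) / (lo * lo)"
      proof (rule frac_le)
        have "\<bar>lam d v t - lam d v' t\<bar> = \<bar>r\<bar> * \<bar>ramp ((t - v) / d) - ramp ((t - v') / d)\<bar>"
          by (simp add: lam_def right_diff_distrib[symmetric] abs_mult)
        also have "\<dots> \<le> \<bar>r\<bar> * \<bar>(t - v) / d - (t - v') / d\<bar>" by (intro mult_left_mono ramp_lipschitz) simp
        also have "\<bar>(t - v) / d - (t - v') / d\<bar> = \<bar>v - v'\<bar> / d"
          using d by (simp add: diff_divide_distrib[symmetric] abs_minus_commute)
        finally show "\<bar>lam d v t - lam d v' t\<bar> \<le> \<bar>r\<bar> * (\<bar>v - v'\<bar> / d)" .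
        show "lo * lo \<le> lam d v t * lam d v' t" using lo_pos lam_pos by (intro mult_mono lam_ge) (auto simp: less_imp_le)
      qed (use lo_pos d in auto)
      finally show ?thesis by (simp add: K_def power2_eq_square)
    qed
    have "win d v t - win d v' t = indicator {v'<..v' + d} t * (1 / lam d v t - 1 / lam d v' t)
        + (indicator {v<..v + d} t - indicator {v'<..v' + d} t) * (1 / lam d v t)"
      by (simp add: win_def algebra_simps)
    then have "\<bar>win d v t - win d v' t\<bar> \<le> indicator {v'<..v' + d} t * \<bar>1 / lam d v t - 1 / lam d v' t\<bar>
        + \<bar>indicator {v<..v + d} t - indicator {v'<..v' + d} t\<bar> * (1 / lam d v t)"
      using lam_pos[of d v t] by (auto simp: abs_mult intro: order.trans[OF abs_triangle_ineq])
    also have "\<dots> \<le> indicator {v'<..v' + d} t * K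
        + (indicator {a<..b} t + indicator {a + d<..b + d} t) * (1 / lo)"
    proof (intro add_mono mult_mono inv)
      show "\<bar>indicator {v<..v + d} t - indicator {v'<..v' + d} t\<bar> \<le> (indicator {a<..b} t + indicator {a + d<..b + d} t :: real)"
        by (auto simp: a_def b_def indicator_def min_def max_def split: if_splits)
      show "1 / lam d v t \<le> 1 / lo" using lo_pos by (intro divide_left_mono lam_ge mult_pos_pos lam_pos) auto
    qed (use lam_pos[of d v t] in auto)
    finally show ?thesis by (simp add: algebra_simps)
  qed
  have K: "0 \<le> K" using d by (simp add: K_def)
  have i: "set_integrable lborel {0..\<tau>} (\<lambda>t. c * indicator {p<..q} t)" for c p q :: real
    by (rule set_integrable_Icc_bounded[where C="\<bar>c\<bar>"]) (auto simp: indicator_def)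
  have "(LBINT t:{0..\<tau>}. \<bar>win d v t - win d v' t\<bar>) \<le> (LBINT t:{0..\<tau>}. ?g t)"
  proof (rule set_integral_mono[OF _ _ pt])
    show "set_integrable lborel {0..\<tau>} (\<lambda>t. \<bar>win d v t - win d v' t\<bar>)"
      by (intro set_integrable_abs set_integral_diff(1) set_integrable_Icc_bounded[where C="1/lo"] win_bounds(3) win_measurable)
    show "set_integrable lborel {0..\<tau>} ?g" by (intro set_integral_add i)
  qed
  also have "\<dots> = K * d + (1 / lo * (b - a) + 1 / lo * (b - a))"
  proof -
    have "(LBINT t:{0..\<tau>}. ?g t) = (LBINT t:{0..\<tau>}. K * indicator {v'<..v' + d} t) +
        ((LBINT t:{0..\<tau>}. 1 / lo * indicator {a<..b} t) + (LBINT t:{0..\<tau>}. 1 / lo * indicator {a + d<..b + d} t))"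
      by (subst set_integral_add(2)[OF i set_integral_add(1)[OF i i]], subst set_integral_add(2)[OF i i]) simp
    moreover have "(LBINT t:{0..\<tau>}. K * indicator {v'<..v' + d} t) = K * (v' + d - v')"
      "(LBINT t:{0..\<tau>}. 1 / lo * indicator {a<..b} t) = 1 / lo * (b - a)"
      "(LBINT t:{0..\<tau>}. 1 / lo * indicator {a + d<..b + d} t) = 1 / lo * (b + d - (a + d))"
      by (rule LBINT_indicator_Ioc; use v d in \<open>auto simp: a_def b_def\<close>)+
    ultimately show ?thesis by (simp only: add_diff_cancel_right add_diff_cancel_left')
  qed
  also have "b - a = \<bar>v - v'\<bar>" by (auto simp: a_def b_def)
  also have "K * d + (1 / lo * \<bar>v - v'\<bar> + 1 / lo * \<bar>v - v'\<bar>) = \<bar>v - v'\<bar> * (\<bar>r\<bar> / lo\<^sup>2 + 2 / lo)"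
    using d by (simp add: K_def algebra_simps)
  finally show ?thesis .
qed

end

context ramp_experiment
begin

text \<open>
  The expectation of \<open>lan_error F w\<close>. The difference quotient of the ramp tends to \<open>w\<close>, so that for the
  right \<open>F\<close> the bias vanishes in the limit.
\<close>

definition Bias :: "real \<Rightarrow> real \<Rightarrow> real" where
  "Bias F w = F * w - r\<^sup>2 * (LBINT s:{0..1}. (ramp (s + \<phi> / d * w) - s) / (\<phi> / d) / (psi_ext (par w + d * s) + r * s))"

text \<open>
  The deviation of the score from the affine function that it would be in a Gaussian shift experiment with
  information \<open>F\<close>.
\<close>

definition lan_error :: "real \<Rightarrow> real \<Rightarrow> 'w \<Rightarrow> real" where
  "lan_error F w \<omega> = score w \<omega> - score 0 \<omega> + F * w"

lemma n_\<phi>_\<epsilon>: "real n * \<phi> * (\<phi> / d) = 1"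
  using \<phi>_sq d_pos by (simp add: power2_eq_square)

text \<open>
  The deviation is a sample integral of \<open>f\<close>, a difference of two windows. Its mean is the bias, and the
  second-order term of its exponential moments is \<open>n \<integral> f\<^sup>2\<close>, which is of the order \<open>n (\<phi> / d)\<^sup>2 \<phi> \<bar>w\<bar> = (\<phi> / d) \<bar>w\<bar>\<close> since the
  two windows differ substantially only on a set of length \<open>\<phi> \<bar>w\<bar>\<close>.
\<close>

lemma expectation_lan_error_sq:
  assumes w: "w \<in> {ul..ur}"
  shows "integrable M (\<lambda>\<omega>. (lan_error F w \<omega>)\<^sup>2)"
    and "expectation (\<lambda>\<omega>. (lan_error F w \<omega>)\<^sup>2) \<le> 2 * (exp (C6 * (\<phi> / d) * \<bar>w\<bar> + \<bar>Bias F w\<bar>) - 1)"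
proof -
  let ?v = "par w"
  have \<epsilon>: "0 < \<phi> / d" "\<phi> / d \<le> 1" using \<epsilon>_pos \<epsilon>_le_1 by auto
  define f where "f t = - (r * (\<phi> / d)) * (win d ?v t - win d \<theta> t)" for t
  have [measurable]: "f \<in> borel_measurable borel" unfolding f_def by measurable
  have win_le: "\<bar>win d ?v t - win d \<theta> t\<bar> \<le> 1 / lo" for t
    using win_bounds(1,2)[of d ?v t] win_bounds(1,2)[of d \<theta> t] by linarith
  have abs_f: "\<bar>f t\<bar> = \<bar>r\<bar> * (\<phi> / d) * \<bar>win d ?v t - win d \<theta> t\<bar>" for t
    using \<phi>_pos d_pos by (simp add: f_def abs_mult)
  have fK: "\<bar>f t\<bar> \<le> 2 * \<bar>r\<bar> / lo" for t
  proof -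
    have "\<bar>f t\<bar> \<le> \<bar>r\<bar> * 1 * (1 / lo)" unfolding abs_f
      using \<phi>_pos d_pos by (intro mult_mono win_le mult_left_mono \<epsilon>(2)) auto
    also have "\<dots> \<le> 2 * \<bar>r\<bar> / lo" using lo_pos by (simp add: divide_right_mono)
    finally show ?thesis .
  qed
  have lc: "continuous (at_left t) f" for t
    unfolding f_def by (intro continuous_intros left_continuous_win d_pos)
  have i_win: "set_integrable lborel {0..\<tau>} (\<lambda>t. win d x t * lam d y t)" for x y
  proof (rule set_integrable_Icc_bounded)
    show "\<bar>win d x t * lam d y t\<bar> \<le> 1 / lo * hi" for t
      unfolding abs_mult using lo_pos by (intro mult_mono win_bounds(3) abs_lam_le) auto
  qed measurable
  have mean: "real n * (LBINT t:{0..\<tau>}. f t * lam d \<theta> t) = Bias F w - F * w"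
  proof -
    have "(LBINT t:{0..\<tau>}. f t * lam d \<theta> t) = (LBINT t:{0..\<tau>}. - (r * (\<phi> / d)) * (win d ?v t * lam d \<theta> t - win d \<theta> t * lam d \<theta> t))"
      by (simp add: f_def algebra_simps)
    also have "\<dots> = - (r * (\<phi> / d)) * ((LBINT t:{0..\<tau>}. win d ?v t * lam d \<theta> t) - (LBINT t:{0..\<tau>}. win d \<theta> t * lam d \<theta> t))"
      by (subst set_integral_mult_right, subst set_integral_diff(2)[OF i_win i_win]) simp
    also have "(LBINT t:{0..\<tau>}. win d \<theta> t * lam d \<theta> t) = (LBINT t:{0..\<tau>}. win d ?v t * lam d ?v t)"
      using par_range[OF w] \<theta>_range d_pos by (simp add: integral_win_lam)
    also have "(LBINT t:{0..\<tau>}. win d ?v t * lam d \<theta> t) - \<dots> = (LBINT t:{0..\<tau>}. indicator {?v<..?v + d} t * ((lam d \<theta> t - lam d ?v t) / lam d ?v t))"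
    proof -
      have "win d ?v t * lam d \<theta> t - win d ?v t * lam d ?v t = indicator {?v<..?v + d} t * ((lam d \<theta> t - lam d ?v t) / lam d ?v t)" for t
        using lam_pos[of d ?v t] by (simp add: win_def field_simps)
      then show ?thesis by (subst set_integral_diff(2)[OF i_win i_win, symmetric]) simp
    qed
    also have "\<dots> = d * (LBINT s:{0..1}. (lam d \<theta> (?v + d * s) - lam d ?v (?v + d * s)) / lam d ?v (?v + d * s))"
      by (rule LBINT_window) (use par_range[OF w] d_pos in auto)
    also have "(LBINT s:{0..1}. (lam d \<theta> (?v + d * s) - lam d ?v (?v + d * s)) / lam d ?v (?v + d * s))
        = (LBINT s:{0..1}. (r * (\<phi> / d)) * ((ramp (s + \<phi> / d * w) - s) / (\<phi> / d) / (psi_ext (?v + d * s) + r * s)))"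
    proof (rule set_lebesgue_integral_cong)
      show "\<forall>s. s \<in> {0..1} \<longrightarrow> (lam d \<theta> (?v + d * s) - lam d ?v (?v + d * s)) / lam d ?v (?v + d * s)
          = (r * (\<phi> / d)) * ((ramp (s + \<phi> / d * w) - s) / (\<phi> / d) / (psi_ext (?v + d * s) + r * s))"
      proof (intro allI impI)
        fix s :: real assume s: "s \<in> {0..1}"
        have "(?v + d * s - \<theta>) / d = s + \<phi> / d * w" using d_pos by (simp add: par_def field_simps)
        then have e: "lam d \<theta> (?v + d * s) = psi_ext (?v + d * s) + r * ramp (s + \<phi> / d * w)"
          unfolding lam_def by (simp only:)
        have "lam d \<theta> (?v + d * s) - lam d ?v (?v + d * s) = r * (ramp (s + \<phi> / d * w) - s)"
          unfolding e lam_window[OF d_pos s, of ?v] by (simp add: algebra_simps)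
        then show "(lam d \<theta> (?v + d * s) - lam d ?v (?v + d * s)) / lam d ?v (?v + d * s)
          = (r * (\<phi> / d)) * ((ramp (s + \<phi> / d * w) - s) / (\<phi> / d) / (psi_ext (?v + d * s) + r * s))"
          using lam_window[OF d_pos s, of ?v] \<phi>_pos d_pos by simp
      qed
    qed simp
    also have "\<dots> = (r * (\<phi> / d)) * (LBINT s:{0..1}. (ramp (s + \<phi> / d * w) - s) / (\<phi> / d) / (psi_ext (?v + d * s) + r * s))"
      by (rule set_integral_mult_right)
    finally have "real n * (LBINT t:{0..\<tau>}. f t * lam d \<theta> t) = - (real n * d * (\<phi> / d)\<^sup>2) *
        (r\<^sup>2 * (LBINT s:{0..1}. (ramp (s + \<phi> / d * w) - s) / (\<phi> / d) / (psi_ext (?v + d * s) + r * s)))"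
      by (simp add: power2_eq_square)
    then show ?thesis unfolding \<epsilon>_sq by (simp add: Bias_def)
  qed
  have sq: "real n * (LBINT t:{0..\<tau>}. (f t)\<^sup>2) \<le> (\<phi> / d) * \<bar>w\<bar> * (r\<^sup>2 / lo * (\<bar>r\<bar> / lo\<^sup>2 + 2 / lo))"
  proof -
    have iw: "set_integrable lborel {0..\<tau>} (\<lambda>t. \<bar>win d ?v t - win d \<theta> t\<bar>)"
      by (intro set_integrable_abs set_integral_diff(1) set_integrable_Icc_bounded[where C="1/lo"] win_bounds(3) win_measurable)
    have "(LBINT t:{0..\<tau>}. (f t)\<^sup>2) \<le> (LBINT t:{0..\<tau>}. (r * (\<phi> / d))\<^sup>2 * (1 / lo) * \<bar>win d ?v t - win d \<theta> t\<bar>)"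
    proof (rule set_integral_mono)
      show "set_integrable lborel {0..\<tau>} (\<lambda>t. (f t)\<^sup>2)"
        by (rule set_integrable_Icc_bounded[where C="(2 * \<bar>r\<bar> / lo)\<^sup>2"])
          (use fK lo_pos in \<open>auto simp: abs_le_square_iff[symmetric]\<close>)
      show "set_integrable lborel {0..\<tau>} (\<lambda>t. (r * (\<phi> / d))\<^sup>2 * (1 / lo) * \<bar>win d ?v t - win d \<theta> t\<bar>)"
        by (intro set_integrable_mult_right iw)
      fix t
      have w2: "(win d ?v t - win d \<theta> t)\<^sup>2 = \<bar>win d ?v t - win d \<theta> t\<bar> * \<bar>win d ?v t - win d \<theta> t\<bar>"
        by (simp add: power2_eq_square)
      have "(f t)\<^sup>2 = (r * (\<phi> / d))\<^sup>2 * (\<bar>win d ?v t - win d \<theta> t\<bar> * \<bar>win d ?v t - win d \<theta> t\<bar>)"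
        unfolding w2[symmetric] by (simp only: f_def power_mult_distrib power2_minus)
      also have "\<dots> \<le> (r * (\<phi> / d))\<^sup>2 * ((1 / lo) * \<bar>win d ?v t - win d \<theta> t\<bar>)"
        by (intro mult_left_mono mult_right_mono win_le) auto
      finally show "(f t)\<^sup>2 \<le> (r * (\<phi> / d))\<^sup>2 * (1 / lo) * \<bar>win d ?v t - win d \<theta> t\<bar>" by simp
    qed
    also have "\<dots> = (r * (\<phi> / d))\<^sup>2 * (1 / lo) * (LBINT t:{0..\<tau>}. \<bar>win d ?v t - win d \<theta> t\<bar>)"
      by (rule set_integral_mult_right)
    also have "\<dots> \<le> (r * (\<phi> / d))\<^sup>2 * (1 / lo) * (\<phi> * \<bar>w\<bar> * (\<bar>r\<bar> / lo\<^sup>2 + 2 / lo))"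
      using integral_win_diff_le[OF d_pos par_range(1)[OF w] \<theta>_range(1) par_range(2)[OF w] \<theta>_range(2)] lo_pos
      by (intro mult_left_mono) (auto simp: abs_par_diff)
    finally have "real n * (LBINT t:{0..\<tau>}. (f t)\<^sup>2) \<le> real n * ((r * (\<phi> / d))\<^sup>2 * (1 / lo) * (\<phi> * \<bar>w\<bar> * (\<bar>r\<bar> / lo\<^sup>2 + 2 / lo)))"
      by (rule mult_left_mono) simp
    also have "\<dots> = (real n * \<phi> * (\<phi> / d)) * ((\<phi> / d) * \<bar>w\<bar> * (r\<^sup>2 / lo * (\<bar>r\<bar> / lo\<^sup>2 + 2 / lo)))"
      by (simp add: power2_eq_square mult_ac)
    finally show ?thesis unfolding n_\<phi>_\<epsilon> by simp
  qed
  have I: "lan_error F w \<omega> = sample_integral f \<omega> + F * w" if "\<omega> \<in> space M" for \<omega>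
  proof -
    have "sample_integral f \<omega> = - (r * (\<phi> / d)) * (sample_integral (win d ?v) \<omega> - sample_integral (win d \<theta>) \<omega>)"
      unfolding f_def sample_integral_cmult
      by (subst sample_integral_diff[OF that _ _ win_bounds(3) win_bounds(3)]) auto
    then show ?thesis by (simp add: lan_error_def score_def par_0 algebra_simps)
  qed
  have bd: "integrable M (\<lambda>\<omega>. exp (c * lan_error F w \<omega>)) \<and>
      expectation (\<lambda>\<omega>. exp (c * lan_error F w \<omega>)) \<le> exp (C6 * (\<phi> / d) * \<bar>w\<bar> + \<bar>Bias F w\<bar>)"
    if c: "c = 1 \<or> c = -1" for c :: real
  proof -
    have cK: "\<bar>c * f t\<bar> \<le> 2 * \<bar>r\<bar> / lo" for t using c fK[of t] by (auto simp: abs_mult)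
    have clc: "continuous (at_left t) (\<lambda>t. c * f t)" for t by (intro continuous_intros lc)
    have eq: "exp (c * lan_error F w \<omega>) = exp (c * F * w) * exp (sample_integral (\<lambda>t. c * f t) \<omega>)" if "\<omega> \<in> space M" for \<omega>
      by (simp add: I[OF that] sample_integral_cmult exp_add[symmetric] algebra_simps)
    note E = exp_sample_integral_real[OF _ cK clc, simplified]
    have "integrable M (\<lambda>\<omega>. exp (c * lan_error F w \<omega>))"
      by (subst Bochner_Integration.integrable_cong[OF refl eq]) (use E(1) in auto)
    moreover have "expectation (\<lambda>\<omega>. exp (c * lan_error F w \<omega>)) =
        exp (c * F * w + real n * (LBINT t:{0..\<tau>}. (exp (c * f t) - 1) * lam d \<theta> t))"
      by (subst Bochner_Integration.integral_cong[OF refl eq]) (simp_all add: E(2) exp_add)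
    moreover have "c * F * w + real n * (LBINT t:{0..\<tau>}. (exp (c * f t) - 1) * lam d \<theta> t) \<le> C6 * (\<phi> / d) * \<bar>w\<bar> + \<bar>Bias F w\<bar>"
    proof -
      have i1: "set_integrable lborel {0..\<tau>} (\<lambda>t. (exp (c * f t) - 1 - c * f t) * lam d \<theta> t)"
      proof (rule set_integrable_Icc_bounded)
        fix t
        have "exp (c * f t) \<le> exp (2 * \<bar>r\<bar> / lo)" using cK[of t] by simp
        then have "\<bar>exp (c * f t) - 1 - c * f t\<bar> \<le> exp (2 * \<bar>r\<bar> / lo) + 1 + 2 * \<bar>r\<bar> / lo"
          using cK[of t] exp_gt_zero[of "c * f t"] by linarith
        then show "\<bar>(exp (c * f t) - 1 - c * f t) * lam d \<theta> t\<bar> \<le> (exp (2 * \<bar>r\<bar> / lo) + 1 + 2 * \<bar>r\<bar> / lo) * hi"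
          unfolding abs_mult using lo_pos by (intro mult_mono abs_lam_le) (auto intro!: add_nonneg_nonneg)
      qed measurable
      have i2: "set_integrable lborel {0..\<tau>} (\<lambda>t. c * (f t * lam d \<theta> t))"
      proof (rule set_integrable_Icc_bounded)
        show "\<bar>c * (f t * lam d \<theta> t)\<bar> \<le> 2 * \<bar>r\<bar> / lo * hi" for t
          unfolding mult.assoc[symmetric] abs_mult[of "c * f t"] using lo_pos by (intro mult_mono abs_lam_le cK) auto
      qed measurable
      have i3: "set_integrable lborel {0..\<tau>} (\<lambda>t. hi * exp (2 * \<bar>r\<bar> / lo) * (f t)\<^sup>2)"
        by (intro set_integrable_mult_right set_integrable_Icc_bounded[where C="(2 * \<bar>r\<bar> / lo)\<^sup>2"])
          (use fK lo_pos in \<open>auto simp: abs_le_square_iff[symmetric]\<close>)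
      have "(LBINT t:{0..\<tau>}. (exp (c * f t) - 1) * lam d \<theta> t) = (LBINT t:{0..\<tau>}. (exp (c * f t) - 1 - c * f t) * lam d \<theta> t + c * (f t * lam d \<theta> t))"
        by (simp add: algebra_simps)
      also have "\<dots> = (LBINT t:{0..\<tau>}. (exp (c * f t) - 1 - c * f t) * lam d \<theta> t) + (LBINT t:{0..\<tau>}. c * (f t * lam d \<theta> t))"
        by (rule set_integral_add(2)[OF i1 i2])
      also have "(LBINT t:{0..\<tau>}. c * (f t * lam d \<theta> t)) = c * (LBINT t:{0..\<tau>}. f t * lam d \<theta> t)" by (rule set_integral_mult_right)
      finally have eqn: "c * F * w + real n * (LBINT t:{0..\<tau>}. (exp (c * f t) - 1) * lam d \<theta> t) =
          real n * (LBINT t:{0..\<tau>}. (exp (c * f t) - 1 - c * f t) * lam d \<theta> t) + c * Bias F w"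
        using arg_cong[OF mean, of "\<lambda>x. c * x"] by (simp add: algebra_simps)
      have "(LBINT t:{0..\<tau>}. (exp (c * f t) - 1 - c * f t) * lam d \<theta> t) \<le> (LBINT t:{0..\<tau>}. hi * exp (2 * \<bar>r\<bar> / lo) * (f t)\<^sup>2)"
      proof (rule set_integral_mono[OF i1 i3])
        fix t
        have "(exp (c * f t) - 1 - c * f t) * lam d \<theta> t \<le> ((c * f t)\<^sup>2 * exp \<bar>c * f t\<bar>) * hi"
          using lam_pos[of d \<theta> t] by (intro mult_mono exp_second_order lam_le) auto
        also have "\<dots> \<le> ((f t)\<^sup>2 * exp (2 * \<bar>r\<bar> / lo)) * hi"
          using c cK[of t] hi_pos by (intro mult_right_mono mult_mono) (auto simp: power2_eq_square)
        finally show "(exp (c * f t) - 1 - c * f t) * lam d \<theta> t \<le> hi * exp (2 * \<bar>r\<bar> / lo) * (f t)\<^sup>2" by (simp add: mult_ac)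
      qed
      then have "real n * (LBINT t:{0..\<tau>}. (exp (c * f t) - 1 - c * f t) * lam d \<theta> t) \<le> real n * (hi * exp (2 * \<bar>r\<bar> / lo) * (LBINT t:{0..\<tau>}. (f t)\<^sup>2))"
        unfolding set_integral_mult_right by (intro mult_left_mono) auto
      also have "\<dots> = hi * exp (2 * \<bar>r\<bar> / lo) * (real n * (LBINT t:{0..\<tau>}. (f t)\<^sup>2))" by simp
      also have "\<dots> \<le> hi * exp (2 * \<bar>r\<bar> / lo) * ((\<phi> / d) * \<bar>w\<bar> * (r\<^sup>2 / lo * (\<bar>r\<bar> / lo\<^sup>2 + 2 / lo)))"
        using hi_pos by (intro mult_left_mono sq) auto
      also have "\<dots> = C6 * (\<phi> / d) * \<bar>w\<bar>" by (simp add: C6_def mult_ac)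
      finally have "real n * (LBINT t:{0..\<tau>}. (exp (c * f t) - 1 - c * f t) * lam d \<theta> t) \<le> C6 * (\<phi> / d) * \<bar>w\<bar>" .
      moreover have "c * Bias F w \<le> \<bar>Bias F w\<bar>" using c by auto
      ultimately show ?thesis using eqn by linarith
    qed
    ultimately show ?thesis by simp
  qed
  define D where "D \<omega> = exp (1 * lan_error F w \<omega>) + exp (-1 * lan_error F w \<omega>) - 2" for \<omega>
  have iD: "integrable M D" unfolding D_def
    by (intro Bochner_Integration.integrable_diff Bochner_Integration.integrable_add integrable_const) (use bd[of 1] bd[of "-1"] in auto)
  have le: "(lan_error F w \<omega>)\<^sup>2 \<le> D \<omega>" for \<omega>
    using square_le_exp_sum[of "lan_error F w \<omega>"] by (simp add: D_def)
  have m: "(\<lambda>\<omega>. (lan_error F w \<omega>)\<^sup>2) \<in> borel_measurable M"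
    using section_measurable[OF score_measurable_pair, of w] section_measurable[OF score_measurable_pair, of 0] unfolding lan_error_def by measurable
  show i: "integrable M (\<lambda>\<omega>. (lan_error F w \<omega>)\<^sup>2)"
    by (rule Bochner_Integration.integrable_bound[OF iD m]) (use order.trans[OF le abs_ge_self] in auto)
  have "expectation (\<lambda>\<omega>. (lan_error F w \<omega>)\<^sup>2) \<le> expectation D" by (rule integral_mono[OF i iD le])
  also have "\<dots> = expectation (\<lambda>\<omega>. exp (1 * lan_error F w \<omega>)) + expectation (\<lambda>\<omega>. exp (-1 * lan_error F w \<omega>)) - 2"
    unfolding D_def using bd[of 1] bd[of "-1"] by (simp add: prob_space)
  also have "\<dots> \<le> 2 * (exp (C6 * (\<phi> / d) * \<bar>w\<bar> + \<bar>Bias F w\<bar>) - 1)"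
    using bd[of 1] bd[of "-1"] by simp
  finally show "expectation (\<lambda>\<omega>. (lan_error F w \<omega>)\<^sup>2) \<le> 2 * (exp (C6 * (\<phi> / d) * \<bar>w\<bar> + \<bar>Bias F w\<bar>) - 1)" .
qed

text \<open>
  The variance of the score, in the coordinate of \<open>LBINT_window\<close>.
\<close>

definition Info :: real where
  "Info = r\<^sup>2 * (LBINT s:{0..1}. 1 / (psi_ext (\<theta> + d * s) + r * s))"

text \<open>
  A third-order expansion of the exponential formula. The linear term is cancelled by the centring of the
  score and the third-order remainder is of order \<open>n d (\<phi> / d) ^ 3 = \<phi> / d\<close>, since the integrand is
  supported by a zone of length \<open>d\<close>. The exponent is stated instead of the transform
  in order to avoid a complex logarithm.
\<close>

lemma char_score:
  fixes s :: real
  obtains \<Psi> where "(LINT \<omega>|M. iexp (s * score 0 \<omega>)) = exp \<Psi>"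
    and "cmod (\<Psi> + of_real (s\<^sup>2 / 2 * Info)) \<le> \<bar>s\<bar> ^ 3 * ((\<bar>r\<bar> / lo) ^ 3 * hi / 6) * (\<phi> / d)"
proof -
  define f where "f t = - (r * (\<phi> / d)) * win d \<theta> t" for t
  have [measurable]: "f \<in> borel_measurable borel" unfolding f_def by measurable
  have f_le: "\<bar>f t\<bar> \<le> \<bar>r\<bar> / lo * (\<phi> / d) * indicator {\<theta><..\<theta> + d} t" for t
  proof (cases "t \<in> {\<theta><..\<theta> + d}")
    case True
    have "\<bar>f t\<bar> = \<bar>r\<bar> * (\<phi> / d) * \<bar>win d \<theta> t\<bar>" using \<phi>_pos d_pos by (simp add: f_def abs_mult)
    also have "\<dots> \<le> \<bar>r\<bar> * (\<phi> / d) * (1 / lo)" using \<phi>_pos d_pos by (intro mult_left_mono win_bounds(3)) auto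
    finally show ?thesis using True by (simp add: mult_ac)
  qed (simp add: f_def win_def)
  have fK: "\<bar>f t\<bar> \<le> \<bar>r\<bar> / lo" for t
  proof -
    have "\<bar>r\<bar> / lo * (\<phi> / d) * indicator {\<theta><..\<theta> + d} t \<le> \<bar>r\<bar> / lo * 1 * 1"
      using lo_pos \<epsilon>_le_1 \<phi>_pos d_pos by (intro mult_mono) (auto simp: indicator_def)
    then show ?thesis using f_le[of t] by simp
  qed
  have lc: "continuous (at_left t) f" for t
    unfolding f_def by (intro continuous_intros left_continuous_win d_pos)
  have mean: "real n * (LBINT t:{0..\<tau>}. f t * lam d \<theta> t) = - (r * \<phi> * real n)"
  proof -
    have "(LBINT t:{0..\<tau>}. f t * lam d \<theta> t) = (LBINT t:{0..\<tau>}. - (r * (\<phi> / d)) * (win d \<theta> t * lam d \<theta> t))"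
      by (simp add: f_def mult.assoc)
    also have "\<dots> = - (r * (\<phi> / d)) * d"
      unfolding set_integral_mult_right using integral_win_lam[of \<theta> d] \<theta>_range d_pos by simp
    finally show ?thesis using d_pos by simp
  qed
  have var: "real n * (LBINT t:{0..\<tau>}. (f t)\<^sup>2 * lam d \<theta> t) = Info"
  proof -
    have "(f t)\<^sup>2 * lam d \<theta> t = (r * (\<phi> / d))\<^sup>2 * (indicator {\<theta><..\<theta> + d} t * (1 / lam d \<theta> t))" for t
      using lam_pos[of d \<theta> t] by (simp add: f_def win_def power_mult_distrib power_divide indicator_def) (simp add: power2_eq_square)
    then have "(LBINT t:{0..\<tau>}. (f t)\<^sup>2 * lam d \<theta> t) = (r * (\<phi> / d))\<^sup>2 * (LBINT t:{0..\<tau>}. indicator {\<theta><..\<theta> + d} t * (1 / lam d \<theta> t))"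
      by (simp only: set_integral_mult_right)
    also have "(LBINT t:{0..\<tau>}. indicator {\<theta><..\<theta> + d} t * (1 / lam d \<theta> t)) = d * (LBINT s:{0..1}. 1 / lam d \<theta> (\<theta> + d * s))"
      by (rule LBINT_window) (use \<theta>_range d_pos in auto)
    also have "(LBINT s:{0..1}. 1 / lam d \<theta> (\<theta> + d * s)) = (LBINT s:{0..1}. 1 / (psi_ext (\<theta> + d * s) + r * s))"
      by (rule set_lebesgue_integral_cong) (use lam_window[OF d_pos] in auto)
    finally have "real n * (LBINT t:{0..\<tau>}. (f t)\<^sup>2 * lam d \<theta> t) = (real n * d * (\<phi> / d)\<^sup>2) * Info"
      by (simp only: Info_def power_mult_distrib mult_ac)
    then show ?thesis unfolding \<epsilon>_sq by simp
  qed
  define G where "G t = (iexp (s * f t) - (\<Sum>k\<le>2. (\<i> * of_real (s * f t)) ^ k / fact k)) * of_real (lam d \<theta> t)" for t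
  have cint: "complex_set_integrable lborel {0..\<tau>} g" if "g \<in> borel_measurable borel" "\<And>t. cmod (g t) \<le> C" for g C
    unfolding set_integrable_def using that
    by (intro integrableI_bounded_set_indicator[where B=C]) (auto simp: emeasure_lborel_Icc_eq)
  have Gm[measurable]: "G \<in> borel_measurable borel" unfolding G_def by measurable
  have G_le: "cmod (G t) \<le> \<bar>s\<bar> ^ 3 * (\<bar>r\<bar> / lo * (\<phi> / d)) ^ 3 / 6 * hi * indicator {\<theta><..\<theta> + d} t" for t
  proof (cases "t \<in> {\<theta><..\<theta> + d}")
    case True
    have "cmod (iexp (s * f t) - (\<Sum>k\<le>2. (\<i> * of_real (s * f t)) ^ k / fact k)) \<le> \<bar>s * f t\<bar> ^ Suc 2 / fact (Suc 2)"
      by (rule iexp_approx1)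
    also have "\<dots> = \<bar>s\<bar> ^ 3 * \<bar>f t\<bar> ^ 3 / 6" by (simp add: abs_mult power_mult_distrib fact_numeral)
    also have "\<dots> \<le> \<bar>s\<bar> ^ 3 * (\<bar>r\<bar> / lo * (\<phi> / d)) ^ 3 / 6"
      using f_le[of t] True by (intro divide_right_mono mult_left_mono power_mono) auto
    finally have "cmod (G t) \<le> \<bar>s\<bar> ^ 3 * (\<bar>r\<bar> / lo * (\<phi> / d)) ^ 3 / 6 * hi"
      unfolding G_def norm_mult
      by (rule mult_mono) (use \<phi>_pos d_pos lo_pos abs_lam_le in auto)
    then show ?thesis using True by simp
  next
    case False
    then have "f t = 0" by (simp add: f_def win_def)
    then show ?thesis using False by (simp add: G_def numeral_2_eq_2)
  qed
  define B where "B = \<bar>s\<bar> ^ 3 * (\<bar>r\<bar> / lo * (\<phi> / d)) ^ 3 / 6 * hi"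
  have B: "0 \<le> B" using \<phi>_pos d_pos lo_pos hi_pos by (simp add: B_def)
  have "cmod (G t) \<le> B" for t using G_le[of t] B unfolding B_def[symmetric] by (cases "t \<in> {\<theta><..\<theta> + d}") auto
  note iG = cint[OF Gm this]
  have iB: "set_integrable lborel {0..\<tau>} (\<lambda>t. B * indicator {\<theta><..\<theta> + d} t)"
    by (rule set_integrable_Icc_bounded[where C=B]) (use B in \<open>auto simp: indicator_def\<close>)
  have "cmod (CLBINT t:{0..\<tau>}. G t) \<le> (LBINT t:{0..\<tau>}. cmod (G t))"
    by (rule set_integral_norm_bound[OF iG])
  also have "\<dots> \<le> (LBINT t:{0..\<tau>}. B * indicator {\<theta><..\<theta> + d} t)"
    by (rule set_integral_mono[OF _ iB]) (use set_integrable_norm[OF iG] G_le in \<open>auto simp: B_def\<close>)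
  also have "\<dots> = B * (\<theta> + d - \<theta>)" by (rule LBINT_indicator_Ioc) (use \<theta>_range d_pos in auto)
  finally have "real n * cmod (CLBINT t:{0..\<tau>}. G t) \<le> real n * (B * d)" by (intro mult_left_mono) auto
  also have "\<dots> = \<bar>s\<bar> ^ 3 * ((\<bar>r\<bar> / lo) ^ 3 * hi / 6) * (\<phi> / d) * (real n * d * (\<phi> / d)\<^sup>2)"
  proof -
    have "real n * (\<bar>s\<bar> ^ 3 * (x * e) ^ 3 / 6 * hi * d) = \<bar>s\<bar> ^ 3 * (x ^ 3 * hi / 6) * e * (real n * d * e\<^sup>2)" for x e :: real
      by (simp add: power_mult_distrib power2_eq_square power3_eq_cube)
    then show ?thesis unfolding B_def by blast
  qed
  finally have Gbound: "real n * cmod (CLBINT t:{0..\<tau>}. G t) \<le> \<bar>s\<bar> ^ 3 * ((\<bar>r\<bar> / lo) ^ 3 * hi / 6) * (\<phi> / d)"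
    unfolding \<epsilon>_sq by simp
  let ?I = "CLBINT t:{0..\<tau>}. (exp (\<i> * of_real s * of_real (f t)) - 1) * of_real (lam d \<theta> t)"
  let ?A = "\<lambda>t. of_real (f t * lam d \<theta> t) :: complex" and ?B = "\<lambda>t. of_real ((f t)\<^sup>2 * lam d \<theta> t) :: complex"
  have iA: "complex_set_integrable lborel {0..\<tau>} ?A"
  proof (rule cint)
    show "cmod (?A t) \<le> \<bar>r\<bar> / lo * hi" for t
      unfolding norm_of_real abs_mult using lo_pos by (intro mult_mono fK abs_lam_le) auto
  qed measurable
  have iB2: "complex_set_integrable lborel {0..\<tau>} ?B"
  proof (rule cint)
    show "cmod (?B t) \<le> (\<bar>r\<bar> / lo)\<^sup>2 * hi" for t
      unfolding norm_of_real abs_mult using fK[of t] lo_pos by (intro mult_mono abs_lam_le) (auto simp: abs_le_square_iff[symmetric])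
  qed measurable
  have "?I = (CLBINT t:{0..\<tau>}. G t + (\<i> * of_real s * ?A t + - of_real (s\<^sup>2 / 2) * ?B t))"
  proof (rule set_lebesgue_integral_cong)
    show "\<forall>t. t \<in> {0..\<tau>} \<longrightarrow> (exp (\<i> * of_real s * of_real (f t)) - 1) * of_real (lam d \<theta> t) =
        G t + (\<i> * of_real s * ?A t + - of_real (s\<^sup>2 / 2) * ?B t)"
      by (simp add: G_def numeral_2_eq_2 algebra_simps power_mult_distrib)
  qed simp
  also have "\<dots> = (CLBINT t:{0..\<tau>}. G t) + (\<i> * of_real s * (CLBINT t:{0..\<tau>}. ?A t) + - of_real (s\<^sup>2 / 2) * (CLBINT t:{0..\<tau>}. ?B t))"
    using iA iB2 by (subst set_integral_add(2)[OF iG]) (auto intro!: set_integral_add(1) set_integrable_mult_right simp: set_integral_add(2))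
  also have "(CLBINT t:{0..\<tau>}. ?A t) = of_real (LBINT t:{0..\<tau>}. f t * lam d \<theta> t)" by (rule set_integral_complex_of_real)
  also have "(CLBINT t:{0..\<tau>}. ?B t) = of_real (LBINT t:{0..\<tau>}. (f t)\<^sup>2 * lam d \<theta> t)" by (rule set_integral_complex_of_real)
  finally have fI: "?I = (CLBINT t:{0..\<tau>}. G t) + (\<i> * of_real s * of_real (LBINT t:{0..\<tau>}. f t * lam d \<theta> t)
      + - of_real (s\<^sup>2 / 2) * of_real (LBINT t:{0..\<tau>}. (f t)\<^sup>2 * lam d \<theta> t))" .
  have "of_nat n * ?I = of_nat n * (CLBINT t:{0..\<tau>}. G t) + \<i> * of_real s * of_real (real n * (LBINT t:{0..\<tau>}. f t * lam d \<theta> t))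
      - of_real (s\<^sup>2 / 2) * of_real (real n * (LBINT t:{0..\<tau>}. (f t)\<^sup>2 * lam d \<theta> t))"
    unfolding fI by (simp add: algebra_simps)
  then have I: "\<i> * of_real (s * (r * \<phi> * real n)) + of_nat n * ?I = of_nat n * (CLBINT t:{0..\<tau>}. G t) - of_real (s\<^sup>2 / 2 * Info)"
    unfolding mean var by (simp add: algebra_simps)
  have eq: "iexp (s * score 0 \<omega>) = exp (\<i> * of_real (s * (r * \<phi> * real n))) * exp ((\<i> * of_real s) * of_real (sample_integral f \<omega>))" for \<omega>
  proof -
    have "score 0 \<omega> = r * \<phi> * real n + sample_integral f \<omega>"
      unfolding f_def sample_integral_cmult using d_pos by (simp add: score_def par_0 algebra_simps)
    then show ?thesis by (simp add: exp_add[symmetric] algebra_simps)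
  qed
  show ?thesis
  proof
    show "(LINT \<omega>|M. iexp (s * score 0 \<omega>)) = exp (of_nat n * (CLBINT t:{0..\<tau>}. G t) - of_real (s\<^sup>2 / 2 * Info))"
      unfolding eq integral_mult_right_zero exp_sample_integral(2)[OF \<open>f \<in> _\<close> fK lc] I[symmetric] exp_add ..
    show "cmod (of_nat n * (CLBINT t:{0..\<tau>}. G t) - of_real (s\<^sup>2 / 2 * Info) + of_real (s\<^sup>2 / 2 * Info)) \<le> \<bar>s\<bar> ^ 3 * ((\<bar>r\<bar> / lo) ^ 3 * hi / 6) * (\<phi> / d)"
      using Gbound by (simp add: norm_mult)
  qed
qed

end

section \<open>Limits along a sequence of true parameters\<close>

text \<open>
  The true parameter \<open>t n\<close> may vary with the sample size. For a constant sequence this is the setting of a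
  fixed parameter; arbitrary convergent sequences encode local uniformity.
\<close>

locale ramp_sequence = ramp_intensity +
  fixes \<delta> t :: "nat \<Rightarrow> real" and \<theta>0 :: real and M :: "nat \<Rightarrow> 'w measure"
    and X :: "nat \<Rightarrow> 'w \<Rightarrow> nat \<Rightarrow> real \<Rightarrow> nat" and N0 :: nat
  assumes \<theta>0_in: "\<alpha> < \<theta>0" "\<theta>0 < \<beta>" and t_lim: "t \<longlonglongrightarrow> \<theta>0" and \<delta>_lim: "\<delta> \<longlonglongrightarrow> 0"
    and n\<delta>: "filterlim (\<lambda>n. real n * \<delta> n) at_top sequentially"
    and exper: "\<And>n. N0 \<le> n \<Longrightarrow> ramp_experiment \<alpha> \<beta> \<tau> r \<psi> n (\<delta> n) (t n) (M n) (X n)"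
begin

abbreviation "phi n \<equiv> ramp_experiment.\<phi> n (\<delta> n)"
abbreviation "eps n \<equiv> phi n / \<delta> n"
abbreviation "F0 \<equiv> fisher \<psi> r \<theta>0"
abbreviation "sc n \<equiv> ramp_experiment.score \<tau> r \<psi> n (\<delta> n) (t n) (X n)"
abbreviation "lr n \<equiv> ramp_experiment.llr \<tau> r \<psi> n (\<delta> n) (t n) (X n)"
abbreviation "err n \<equiv> ramp_experiment.lan_error \<tau> r \<psi> n (\<delta> n) (t n) (X n) F0"
abbreviation "bias n \<equiv> ramp_experiment.Bias \<tau> r \<psi> n (\<delta> n) (t n) F0"
abbreviation "info n \<equiv> ramp_experiment.Info \<tau> r \<psi> (\<delta> n) (t n)"
abbreviation "VV n \<equiv> ramp_experiment.V \<alpha> \<beta> \<tau> r \<psi> n (\<delta> n) (t n) (X n)"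
abbreviation "JJ n \<equiv> ramp_experiment.J \<tau> r \<psi> n (\<delta> n) (t n) (X n)"
abbreviation "ulow n \<equiv> ramp_experiment.ul \<alpha> n (\<delta> n) (t n)"
abbreviation "uupp n \<equiv> ramp_experiment.ur \<beta> n (\<delta> n) (t n)"

text \<open>
  The size of the local error of the Gaussian approximation over a compact set of local parameters.
\<close>

definition Q :: "real \<Rightarrow> nat \<Rightarrow> 'w \<Rightarrow> real" where
  "Q K n \<omega> = (LBINT w:{-K..K}. (err n w \<omega>)\<^sup>2)"

lemma eventually_exper: "\<forall>\<^sub>F n in sequentially. ramp_experiment \<alpha> \<beta> \<tau> r \<psi> n (\<delta> n) (t n) (M n) (X n)"
  using eventually_ge_at_top[of N0] by eventually_elim (rule exper)

lemma eps_tendsto: "eps \<longlonglongrightarrow> 0"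
proof -
  have "(\<lambda>n. inverse (real n * \<delta> n)) \<longlonglongrightarrow> 0"
    by (rule tendsto_inverse_0_at_top[OF n\<delta>])
  then have "(\<lambda>n. sqrt (inverse (real n * \<delta> n))) \<longlonglongrightarrow> sqrt 0" by (rule tendsto_real_sqrt)
  moreover have "\<forall>\<^sub>F n in sequentially. sqrt (inverse (real n * \<delta> n)) = eps n"
    using eventually_exper
  proof eventually_elim
    case (elim n)
    interpret ramp_experiment \<alpha> \<beta> \<tau> r \<psi> n "\<delta> n" "t n" "M n" "X n" by (rule elim)
    have "inverse (real n * \<delta> n) = (eps n)\<^sup>2"
      using \<epsilon>_sq nd by (metis inverse_unique)
    then show ?case using \<phi>_pos d_pos by simp
  qed
  ultimately show ?thesis by (simp add: filterlim_cong)
qed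

lemma phi_tendsto: "phi \<longlonglongrightarrow> 0"
proof -
  have "(\<lambda>n. eps n * \<delta> n) \<longlonglongrightarrow> 0 * 0" by (intro tendsto_mult eps_tendsto \<delta>_lim)
  moreover have "\<forall>\<^sub>F n in sequentially. eps n * \<delta> n = phi n"
    using eventually_exper
  proof eventually_elim
    case (elim n)
    then show ?case using ramp_experiment.d_pos[OF elim] by simp
  qed
  ultimately show ?thesis by (simp add: filterlim_cong)
qed

lemma eventually_phi_pos: "\<forall>\<^sub>F n in sequentially. 0 < phi n"
  using eventually_exper by eventually_elim (rule ramp_experiment.\<phi>_pos)

lemma eventually_range: "\<forall>\<^sub>F n in sequentially. {-K..K} \<subseteq> {ulow n..uupp n}"
proof -
  have "(\<lambda>n. phi n * \<bar>K\<bar>) \<longlonglongrightarrow> 0 * \<bar>K\<bar>" by (intro tendsto_intros phi_tendsto)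
  then have lim: "(\<lambda>n. phi n * \<bar>K\<bar>) \<longlonglongrightarrow> 0" by simp
  have a: "(\<lambda>n. t n - \<alpha>) \<longlonglongrightarrow> \<theta>0 - \<alpha>" and b: "(\<lambda>n. \<beta> - t n) \<longlonglongrightarrow> \<beta> - \<theta>0" by (intro tendsto_intros t_lim)+
  have "\<forall>\<^sub>F n in sequentially. 0 < (t n - \<alpha>) - phi n * \<bar>K\<bar>"
    by (rule order_tendstoD(1)[OF tendsto_diff[OF a lim]]) (use \<theta>0_in in simp)
  moreover have "\<forall>\<^sub>F n in sequentially. 0 < (\<beta> - t n) - phi n * \<bar>K\<bar>"
    by (rule order_tendstoD(1)[OF tendsto_diff[OF b lim]]) (use \<theta>0_in in simp)
  ultimately show ?thesis using eventually_exper
  proof eventually_elim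
    case (elim n)
    interpret ramp_experiment \<alpha> \<beta> \<tau> r \<psi> n "\<delta> n" "t n" "M n" "X n" by (rule elim)
    have "ul \<le> - \<bar>K\<bar>" "\<bar>K\<bar> \<le> ur" using elim(1,2) \<phi>_pos by (auto simp: ul_def ur_def field_simps)
    then show ?case by auto
  qed
qed

lemma psi_\<theta>0: "psi_ext \<theta>0 = \<psi> \<theta>0"
  using \<theta>0_in \<alpha>_pos \<beta>_less by (intro psi_ext_eq) auto

text \<open>
  The mean of \<open>r\<^sup>2 / (\<psi> + r s)\<close> over the heights \<open>s\<close> of the ramp: an elementary integral.
\<close>

lemma fisher_eq_integral: "r\<^sup>2 * (LBINT s:{0..1}. 1 / (\<psi> \<theta>0 + r * s)) = F0"
proof -
  have pos: "0 < \<psi> \<theta>0 + r * s" if "s \<in> {0..1}" for s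
    using lo_le_window[OF that, of \<theta>0] lo_pos psi_\<theta>0 by simp
  have c: "continuous_on {0..1} (\<lambda>s. 1 / (\<psi> \<theta>0 + r * s))"
    using pos by (intro continuous_intros) force
  have "((\<lambda>s. 1 / (\<psi> \<theta>0 + r * s)) has_integral (ln (\<psi> \<theta>0 + r * 1) / r - ln (\<psi> \<theta>0 + r * 0) / r)) {0..1}"
  proof (rule fundamental_theorem_of_calculus)
    fix s :: real assume s: "s \<in> {0..1}"
    show "((\<lambda>s. ln (\<psi> \<theta>0 + r * s) / r) has_vector_derivative 1 / (\<psi> \<theta>0 + r * s)) (at s within {0..1})"
      unfolding has_real_derivative_iff_has_vector_derivative[symmetric]
      using pos[OF s] r_nonzero by (auto intro!: derivative_eq_intros)
  qed simp
  then have "(LBINT s:{0..1}. 1 / (\<psi> \<theta>0 + r * s)) = ln (\<psi> \<theta>0 + r) / r - ln (\<psi> \<theta>0) / r"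
    using set_borel_integral_eq_integral(2)[OF borel_integrable_atLeastAtMost'[OF c]] by (simp add: integral_unique)
  moreover have "ln ((\<psi> \<theta>0 + r) / \<psi> \<theta>0) = ln (\<psi> \<theta>0 + r) - ln (\<psi> \<theta>0)"
    using pos[of 0] pos[of 1] by (simp add: ln_div)
  ultimately show ?thesis unfolding fisher_def using r_nonzero by (simp add: field_simps power2_eq_square)
qed

lemma F0_pos: "0 < F0"
proof -
  have p: "0 < \<psi> \<theta>0" "0 < \<psi> \<theta>0 + r"
    using lo_le_window[of 0 \<theta>0] lo_le_window[of 1 \<theta>0] lo_pos psi_\<theta>0 by auto
  show ?thesis
  proof (cases "0 < r")
    case True
    then show ?thesis unfolding fisher_def using p by (intro mult_pos_pos ln_gt_zero) auto
  next
    case False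
    then have "r < 0" using r_nonzero by simp
    moreover have "ln ((\<psi> \<theta>0 + r) / \<psi> \<theta>0) < 0" using p \<open>r < 0\<close> by (intro ln_less_zero) auto
    ultimately show ?thesis unfolding fisher_def by (rule mult_neg_neg)
  qed
qed

lemma psi_window_tendsto:
  assumes "v \<longlonglongrightarrow> \<theta>0"
  shows "(\<lambda>n. psi_ext (v n + \<delta> n * s) + r * s) \<longlonglongrightarrow> \<psi> \<theta>0 + r * s"
proof -
  have "(\<lambda>n. v n + \<delta> n * s) \<longlonglongrightarrow> \<theta>0 + 0 * s" by (intro tendsto_intros assms \<delta>_lim)
  then have "(\<lambda>n. psi_ext (v n + \<delta> n * s)) \<longlonglongrightarrow> psi_ext \<theta>0"
    using continuous_on_psi_ext by (auto simp: continuous_on_eq_continuous_at intro: isCont_tendsto_compose)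
  then show ?thesis unfolding psi_\<theta>0 by (intro tendsto_intros)
qed

lemma psi_window_pos: "s \<in> {0..1} \<Longrightarrow> 0 < psi_ext x + r * s"
  using lo_le_window[of s x] lo_pos by simp

lemma info_tendsto: "info \<longlonglongrightarrow> F0"
proof -
  have "(\<lambda>n. LBINT s:{0..1}. 1 / (psi_ext (t n + \<delta> n * s) + r * s)) \<longlonglongrightarrow> (LBINT s:{0..1}. 1 / (\<psi> \<theta>0 + r * s))"
    unfolding set_lebesgue_integral_def
  proof (rule integral_dominated_convergence[where w="\<lambda>s. indicator {0..1} s * (1 / lo)"])
    show "integrable lborel (\<lambda>s. indicator {0..1::real} s * (1 / lo))" by simp
    show "AE s in lborel. (\<lambda>n. indicat_real {0..1} s *\<^sub>R (1 / (psi_ext (t n + \<delta> n * s) + r * s))) \<longlonglongrightarrow> indicat_real {0..1} s *\<^sub>R (1 / (\<psi> \<theta>0 + r * s))"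
    proof (rule AE_I2)
      fix s :: real
      show "(\<lambda>n. indicat_real {0..1} s *\<^sub>R (1 / (psi_ext (t n + \<delta> n * s) + r * s))) \<longlonglongrightarrow> indicat_real {0..1} s *\<^sub>R (1 / (\<psi> \<theta>0 + r * s))"
      proof (cases "s \<in> {0..1}")
        case True
        have "\<psi> \<theta>0 + r * s \<noteq> 0" using psi_window_pos[OF True, of \<theta>0] psi_\<theta>0 by simp
        then show ?thesis by (intro tendsto_intros psi_window_tendsto t_lim)
      qed simp
    qed
    show "AE s in lborel. norm (indicat_real {0..1} s *\<^sub>R (1 / (psi_ext (t n + \<delta> n * s) + r * s))) \<le> indicator {0..1} s * (1 / lo)" for n
    proof (rule AE_I2)
      fix s :: real
      show "norm (indicat_real {0..1} s *\<^sub>R (1 / (psi_ext (t n + \<delta> n * s) + r * s))) \<le> indicator {0..1} s * (1 / lo)"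
      proof (cases "s \<in> {0..1}")
        case True
        have "1 / (psi_ext (t n + \<delta> n * s) + r * s) \<le> 1 / lo"
          using lo_le_window[OF True] lo_pos psi_window_pos[OF True] by (intro divide_left_mono mult_pos_pos) auto
        then show ?thesis using True psi_window_pos[OF True, of "t n + \<delta> n * s"] by (simp add: less_imp_le)
      qed simp
    qed
  qed measurable
  then have "(\<lambda>n. r\<^sup>2 * (LBINT s:{0..1}. 1 / (psi_ext (t n + \<delta> n * s) + r * s))) \<longlonglongrightarrow> F0"
    unfolding fisher_eq_integral[symmetric] by (intro tendsto_intros)
  moreover have "\<forall>\<^sub>F n in sequentially. r\<^sup>2 * (LBINT s:{0..1}. 1 / (psi_ext (t n + \<delta> n * s) + r * s)) = info n"
    using eventually_exper by eventually_elim (simp add: ramp_experiment.Info_def)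
  ultimately show ?thesis by (rule Lim_transform_eventually)
qed

lemma bias_integrand_bound:
  assumes "0 < e" "s \<in> {0..1}"
  shows "\<bar>(ramp (s + e * w) - s) / e / (psi_ext x + r * s)\<bar> \<le> \<bar>w\<bar> / lo"
proof -
  have "ramp s = s" using assms by (auto simp: ramp_def)
  then have "\<bar>ramp (s + e * w) - s\<bar> \<le> e * \<bar>w\<bar>"
    using ramp_lipschitz[of "s + e * w" s] assms by (simp add: abs_mult)
  then have "\<bar>(ramp (s + e * w) - s) / e\<bar> \<le> \<bar>w\<bar>" using assms by (simp add: abs_divide pos_divide_le_eq mult.commute)
  then show ?thesis
    using lo_le_window[OF assms(2), of x] lo_pos psi_window_pos[OF assms(2), of x]
    unfolding abs_divide by (intro frac_le) auto
qed

lemma bias_eq: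
  assumes "N0 \<le> n"
  shows "bias n w = F0 * w - r\<^sup>2 * (LBINT s:{0..1}. (ramp (s + eps n * w) - s) / eps n / (psi_ext ((t n + phi n * w) + \<delta> n * s) + r * s))"
  unfolding ramp_experiment.Bias_def[OF exper[OF assms]] ramp_experiment.par_def[OF exper[OF assms]] ..

lemma bias_bound:
  assumes "N0 \<le> n"
  shows "\<bar>bias n w\<bar> \<le> (F0 + r\<^sup>2 / lo) * \<bar>w\<bar>"
proof -
  interpret ramp_experiment \<alpha> \<beta> \<tau> r \<psi> n "\<delta> n" "t n" "M n" "X n" by (rule exper[OF assms])
  let ?g = "\<lambda>s. (ramp (s + eps n * w) - s) / eps n / (psi_ext ((t n + phi n * w) + \<delta> n * s) + r * s)"
  have e: "0 < eps n" using \<epsilon>_pos .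
  have i: "set_integrable lborel {0..1} ?g"
    by (rule set_integrable_Icc_bounded[where C="\<bar>w\<bar> / lo"]) (use bias_integrand_bound[OF e] in auto)
  have "\<bar>LBINT s:{0..1}. ?g s\<bar> \<le> (LBINT s:{0..1}. \<bar>?g s\<bar>)"
    using set_integral_norm_bound[OF i] by simp
  also have "\<dots> \<le> (LBINT s:{0..1::real}. \<bar>w\<bar> / lo)"
    unfolding set_lebesgue_integral_def
  proof (rule integral_mono)
    show "integrable lborel (\<lambda>s. indicat_real {0..1} s *\<^sub>R \<bar>?g s\<bar>)" using set_integrable_abs[OF i] by (simp add: set_integrable_def)
    show "indicat_real {0..1} s *\<^sub>R \<bar>?g s\<bar> \<le> indicat_real {0..1} s *\<^sub>R (\<bar>w\<bar> / lo)" for s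
      using bias_integrand_bound[OF e, of s w] by (cases "s \<in> {0..1}") auto
  qed simp
  also have "\<dots> = \<bar>w\<bar> / lo" by (simp add: LBINT_const_Icc)
  finally have "r\<^sup>2 * \<bar>LBINT s:{0..1}. ?g s\<bar> \<le> r\<^sup>2 * (\<bar>w\<bar> / lo)" by (intro mult_left_mono) auto
  moreover have "\<bar>bias n w\<bar> \<le> F0 * \<bar>w\<bar> + r\<^sup>2 * \<bar>LBINT s:{0..1}. ?g s\<bar>"
    unfolding bias_eq[OF assms] by (rule order.trans[OF abs_triangle_ineq4]) (use F0_pos in \<open>simp add: abs_mult\<close>)
  ultimately have "\<bar>bias n w\<bar> \<le> F0 * \<bar>w\<bar> + r\<^sup>2 * (\<bar>w\<bar> / lo)" by linarith
  then show ?thesis by (simp add: distrib_right)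
qed

text \<open>
  For each interior height \<open>s\<close> of the ramp the difference quotient of \<open>ramp\<close> equals \<open>w\<close> as soon as the shift
  is small, so that the integrand converges to \<open>w / (\<psi> \<theta>0 + r s)\<close> for almost every \<open>s\<close>.
\<close>

lemma bias_tendsto: "(\<lambda>n. bias n w) \<longlonglongrightarrow> 0"
proof -
  let ?g = "\<lambda>n s. (ramp (s + eps n * w) - s) / eps n / (psi_ext ((t n + phi n * w) + \<delta> n * s) + r * s)"
  have ev: "\<forall>\<^sub>F n in sequentially. 0 < eps n" using eventually_exper
    by eventually_elim (rule ramp_experiment.\<epsilon>_pos)
  then obtain N where N: "\<And>n. N \<le> n \<Longrightarrow> 0 < eps n" by (auto simp: eventually_sequentially)
  have vlim: "(\<lambda>n. t n + phi n * w) \<longlonglongrightarrow> \<theta>0" using tendsto_add[OF t_lim tendsto_mult_right[OF phi_tendsto, of w]] by simp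
  have "(\<lambda>n. LBINT s:{0..1}. ?g (n + N) s) \<longlonglongrightarrow> (LBINT s:{0..1}. w * (1 / (\<psi> \<theta>0 + r * s)))"
    unfolding set_lebesgue_integral_def
  proof (rule integral_dominated_convergence[where w="\<lambda>s. indicator {0..1} s * (\<bar>w\<bar> / lo)"])
    show "integrable lborel (\<lambda>s. indicator {0..1::real} s * (\<bar>w\<bar> / lo))" by simp
    show "AE s in lborel. (\<lambda>n. indicat_real {0..1} s *\<^sub>R ?g (n + N) s) \<longlonglongrightarrow> indicat_real {0..1} s *\<^sub>R (w * (1 / (\<psi> \<theta>0 + r * s)))"
      using AE_lborel_singleton[of 0] AE_lborel_singleton[of 1]
    proof eventually_elim
      case (elim s)
      show ?case
      proof (cases "s \<in> {0..1}")
        case True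
        have s01: "0 < s" "s < 1" using True elim by auto
        have "(\<lambda>n. s + eps n * w) \<longlonglongrightarrow> s + 0 * w" by (intro tendsto_intros eps_tendsto)
        then have "\<forall>\<^sub>F n in sequentially. 0 < s + eps n * w" "\<forall>\<^sub>F n in sequentially. s + eps n * w < 1"
          using s01 by (auto elim!: order_tendstoD)
        then have "\<forall>\<^sub>F n in sequentially. w * (1 / (psi_ext ((t n + phi n * w) + \<delta> n * s) + r * s)) = ?g n s"
          using ev by eventually_elim (auto simp: ramp_def max_def min_def)
        moreover have "(\<lambda>n. w * (1 / (psi_ext ((t n + phi n * w) + \<delta> n * s) + r * s))) \<longlonglongrightarrow> w * (1 / (\<psi> \<theta>0 + r * s))"
        proof -
          have "\<psi> \<theta>0 + r * s \<noteq> 0" using psi_window_pos[OF True, of \<theta>0] psi_\<theta>0 by simp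
          then show ?thesis by (intro tendsto_intros psi_window_tendsto vlim)
        qed
        ultimately have "(\<lambda>n. ?g n s) \<longlonglongrightarrow> w * (1 / (\<psi> \<theta>0 + r * s))" by (rule Lim_transform_eventually[rotated])
        then have "(\<lambda>n. ?g (n + N) s) \<longlonglongrightarrow> w * (1 / (\<psi> \<theta>0 + r * s))" by (rule LIMSEQ_ignore_initial_segment)
        then show ?thesis using True by simp
      qed simp
    qed
    show "AE s in lborel. norm (indicat_real {0..1} s *\<^sub>R ?g (n + N) s) \<le> indicator {0..1} s * (\<bar>w\<bar> / lo)" for n
    proof (rule AE_I2)
      fix s :: real
      show "norm (indicat_real {0..1} s *\<^sub>R ?g (n + N) s) \<le> indicator {0..1} s * (\<bar>w\<bar> / lo)"
      proof (cases "s \<in> {0..1}")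
        case True
        have "0 < eps (n + N)" by (rule N) simp
        from bias_integrand_bound[OF this True] True show ?thesis by simp
      qed simp
    qed
  qed measurable
  then have "(\<lambda>n. LBINT s:{0..1}. ?g n s) \<longlonglongrightarrow> (LBINT s:{0..1}. w * (1 / (\<psi> \<theta>0 + r * s)))"
    by (rule LIMSEQ_offset)
  then have "(\<lambda>n. F0 * w - r\<^sup>2 * (LBINT s:{0..1}. ?g n s)) \<longlonglongrightarrow> F0 * w - r\<^sup>2 * (w * (LBINT s:{0..1}. 1 / (\<psi> \<theta>0 + r * s)))"
    unfolding set_integral_mult_right by (intro tendsto_intros)
  also have "F0 * w - r\<^sup>2 * (w * (LBINT s:{0..1}. 1 / (\<psi> \<theta>0 + r * s))) = 0"
    using fisher_eq_integral by (simp add: mult.left_commute[of _ w] mult.commute[of w])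
  finally have "(\<lambda>n. F0 * w - r\<^sup>2 * (LBINT s:{0..1}. ?g n s)) \<longlonglongrightarrow> 0" .
  moreover have "\<forall>\<^sub>F n in sequentially. F0 * w - r\<^sup>2 * (LBINT s:{0..1}. ?g n s) = bias n w"
    using eventually_ge_at_top[of N0] by eventually_elim (simp only: bias_eq)
  ultimately show ?thesis by (rule Lim_transform_eventually)
qed

lemma bias_measurable: "N0 \<le> n \<Longrightarrow> bias n \<in> borel_measurable borel"
proof -
  assume n: "N0 \<le> n"
  have "(\<lambda>w. LBINT s:{0..1}. (ramp (s + eps n * w) - s) / eps n / (psi_ext ((t n + phi n * w) + \<delta> n * s) + r * s)) \<in> borel_measurable borel"
    unfolding set_lebesgue_integral_def by (intro lborel.borel_measurable_lebesgue_integral) measurable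
  then show ?thesis using bias_eq[OF n] by (subst measurable_cong[of _ "bias n", OF bias_eq[OF n]]) auto
qed

lemma err_measurable:
  assumes "N0 \<le> n"
  shows "(\<lambda>(w, \<omega>). err n w \<omega>) \<in> borel_measurable (borel \<Otimes>\<^sub>M M n)"
proof -
  interpret ramp_experiment \<alpha> \<beta> \<tau> r \<psi> n "\<delta> n" "t n" "M n" "X n" by (rule exper[OF assms])
  have "(\<lambda>p. score 0 (snd p)) \<in> borel_measurable (borel \<Otimes>\<^sub>M M n)"
    by (rule measurable_compose[OF measurable_snd section_measurable[OF score_measurable_pair]])
  then show ?thesis using score_measurable_pair unfolding lan_error_def split_beta by measurable
qed

lemma err_sq_integrable:
  assumes n: "N0 \<le> n" and \<omega>: "\<omega> \<in> space (M n)"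
  shows "set_integrable lborel {a..b} (\<lambda>w. (err n w \<omega>)\<^sup>2)" "set_integrable lborel {a..b} (\<lambda>w. err n w \<omega>)"
proof -
  interpret ramp_experiment \<alpha> \<beta> \<tau> r \<psi> n "\<delta> n" "t n" "M n" "X n" by (rule exper[OF n])
  let ?B = "\<bar>r * phi n / \<delta> n\<bar> * (total \<omega> / lo + real n * \<delta> n)"
  let ?C = "?B + ?B + F0 * (\<bar>a\<bar> + \<bar>b\<bar>)"
  have m: "(\<lambda>w. err n w \<omega>) \<in> borel_measurable borel" by (rule path_measurable[OF err_measurable[OF n] \<omega>])
  have bd: "\<bar>err n w \<omega>\<bar> \<le> ?C" if "w \<in> {a..b}" for w
  proof -
    have "\<bar>F0 * w\<bar> \<le> F0 * (\<bar>a\<bar> + \<bar>b\<bar>)" using that F0_pos by (auto simp: abs_mult intro!: mult_left_mono)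
    moreover have "\<bar>x - y + z\<bar> \<le> B + B + C" if "\<bar>x\<bar> \<le> B" "\<bar>y\<bar> \<le> B" "\<bar>z\<bar> \<le> C" for x y z B C :: real
      using that by linarith
    ultimately show ?thesis unfolding lan_error_def using abs_score_le[OF \<omega>, of w] abs_score_le[OF \<omega>, of 0] by blast
  qed
  show "set_integrable lborel {a..b} (\<lambda>w. err n w \<omega>)" by (rule set_integrable_Icc_bounded[OF m bd])
  show "set_integrable lborel {a..b} (\<lambda>w. (err n w \<omega>)\<^sup>2)"
  proof (rule set_integrable_Icc_bounded)
    show "\<bar>(err n w \<omega>)\<^sup>2\<bar> \<le> ?C\<^sup>2" if "w \<in> {a..b}" for w
      using power_mono[OF bd[OF that] abs_ge_zero, of 2] by simp
  qed (use m in measurable)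
qed

text \<open>
  The pointwise bounds tend to \<open>0\<close> and stay bounded on the compact set, so that dominated convergence
  applies.
\<close>

lemma expectation_Q:
  shows "\<forall>\<^sub>F n in sequentially. integrable (M n) (Q K n)"
    and "(\<lambda>n. LINT \<omega>|M n. Q K n \<omega>) \<longlonglongrightarrow> 0"
proof -
  define h where "h n w = 2 * (exp (C6 * eps n * \<bar>w\<bar> + \<bar>bias n w\<bar>) - 1)" for n w
  have C6: "0 \<le> C6" using hi_pos lo_pos by (auto simp: C6_def)
  let ?B = "2 * (exp (C6 * \<bar>K\<bar> + (F0 + r\<^sup>2 / lo) * \<bar>K\<bar>) - 1)"
  have h_bound: "0 \<le> h n w \<and> h n w \<le> ?B" if n: "N0 \<le> n" and w: "w \<in> {-K..K}" for n w
  proof -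
    interpret ramp_experiment \<alpha> \<beta> \<tau> r \<psi> n "\<delta> n" "t n" "M n" "X n" by (rule exper[OF n])
    have "\<bar>w\<bar> \<le> \<bar>K\<bar>" using w by auto
    then have "C6 * eps n * \<bar>w\<bar> \<le> C6 * 1 * \<bar>K\<bar>" using C6 \<epsilon>_le_1 \<phi>_pos d_pos by (intro mult_mono) auto
    moreover have "(F0 + r\<^sup>2 / lo) * \<bar>w\<bar> \<le> (F0 + r\<^sup>2 / lo) * \<bar>K\<bar>" using \<open>\<bar>w\<bar> \<le> _\<close> F0_pos lo_pos by (intro mult_left_mono) auto
    ultimately have "C6 * eps n * \<bar>w\<bar> + \<bar>bias n w\<bar> \<le> C6 * \<bar>K\<bar> + (F0 + r\<^sup>2 / lo) * \<bar>K\<bar>"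
      using bias_bound[OF n, of w] by linarith
    moreover have "0 \<le> C6 * eps n * \<bar>w\<bar> + \<bar>bias n w\<bar>" using C6 \<phi>_pos d_pos by auto
    ultimately show ?thesis by (simp add: h_def)
  qed
  have h_meas: "h n \<in> borel_measurable borel" if "N0 \<le> n" for n
    unfolding h_def using bias_measurable[OF that] by measurable
  have h_int: "set_integrable lborel {-K..K} (h n)" if "N0 \<le> n" for n
    by (rule set_integrable_Icc_bounded[OF h_meas[OF that], where C="?B"]) (use h_bound[OF that] in auto)
  have ev: "\<forall>\<^sub>F n in sequentially. integrable (M n) (Q K n) \<and> 0 \<le> (LINT \<omega>|M n. Q K n \<omega>) \<and> (LINT \<omega>|M n. Q K n \<omega>) \<le> (LBINT w:{-K..K}. h n w)"
    using eventually_ge_at_top[of N0] eventually_range[of K]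
  proof eventually_elim
    case (elim n)
    interpret ramp_experiment \<alpha> \<beta> \<tau> r \<psi> n "\<delta> n" "t n" "M n" "X n" by (rule exper[OF elim(1)])
    have m: "(\<lambda>(w, \<omega>). (err n w \<omega>)\<^sup>2) \<in> borel_measurable (borel \<Otimes>\<^sub>M M n)"
      using err_measurable[OF elim(1)] unfolding split_beta by measurable
    have w: "w \<in> {ul..ur}" if "w \<in> {-K..K}" for w using that elim(2) by blast
    note E = expectation_LBINT_le[OF m _ err_sq_integrable(1)[OF elim(1)] expectation_lan_error_sq(1)[OF w, where F=F0] expectation_lan_error_sq(2)[OF w, where F=F0, folded h_def] h_int[OF elim(1)]]
    have "0 \<le> (LINT \<omega>|M n. Q K n \<omega>)"
      unfolding Q_def set_lebesgue_integral_def by (intro integral_nonneg_AE AE_I2) auto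
    with E show ?case unfolding Q_def by auto
  qed
  then show "\<forall>\<^sub>F n in sequentially. integrable (M n) (Q K n)" by eventually_elim simp
  have "(\<lambda>n. LBINT w:{-K..K}. h (n + N0) w) \<longlonglongrightarrow> (LBINT w:{-K..K}. 0)"
    unfolding set_lebesgue_integral_def
  proof (rule integral_dominated_convergence[where w="\<lambda>s. indicator {-K..K} s * ?B"])
    show "integrable lborel (\<lambda>s. indicator {-K..K} s * ?B)"
      by (intro integrable_mult_left integrable_real_indicator) (auto simp: emeasure_lborel_Icc_eq)
    show "AE w in lborel. (\<lambda>n. indicat_real {- K..K} w *\<^sub>R h (n + N0) w) \<longlonglongrightarrow> indicat_real {- K..K} w *\<^sub>R 0"
    proof (rule AE_I2)
      fix w
      have "(\<lambda>n. h n w) \<longlonglongrightarrow> 2 * (exp (C6 * 0 * \<bar>w\<bar> + \<bar>0\<bar>) - 1)"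
        unfolding h_def by (intro tendsto_intros eps_tendsto bias_tendsto)
      then have "(\<lambda>n. h (n + N0) w) \<longlonglongrightarrow> 0" by (intro LIMSEQ_ignore_initial_segment) simp
      then show "(\<lambda>n. indicat_real {- K..K} w *\<^sub>R h (n + N0) w) \<longlonglongrightarrow> indicat_real {- K..K} w *\<^sub>R 0" by (intro tendsto_intros)
    qed
    show "AE w in lborel. norm (indicat_real {- K..K} w *\<^sub>R h (n + N0) w) \<le> indicator {-K..K} w * ?B" for n
      using h_bound[of "n + N0"] by (intro AE_I2) (auto simp: indicator_def)
    show "(\<lambda>w. indicat_real {- K..K} w *\<^sub>R h (n + N0) w) \<in> borel_measurable lborel" for n
      using h_meas[of "n + N0"] by measurable
  qed simp
  then have "(\<lambda>n. LBINT w:{-K..K}. h (n + N0) w) \<longlonglongrightarrow> 0" by (simp add: set_lebesgue_integral_def)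
  then have "(\<lambda>n. LBINT w:{-K..K}. h n w) \<longlonglongrightarrow> 0" by (rule LIMSEQ_offset)
  then show "(\<lambda>n. LINT \<omega>|M n. Q K n \<omega>) \<longlonglongrightarrow> 0"
    by (rule tendsto_sandwich[OF _ _ tendsto_const, rotated 2]) (use ev in \<open>auto elim!: eventually_mono\<close>)
qed

lemma char_score_tendsto: "(\<lambda>n. LINT \<omega>|M n. iexp (s * sc n 0 \<omega>)) \<longlonglongrightarrow> of_real (exp (- (s\<^sup>2 / 2 * F0)))"
proof -
  let ?C = "\<bar>s\<bar> ^ 3 * ((\<bar>r\<bar> / lo) ^ 3 * hi / 6)"
  have "\<exists>\<Psi>. \<forall>n\<ge>N0. (LINT \<omega>|M n. iexp (s * sc n 0 \<omega>)) = exp (\<Psi> n) \<and> cmod (\<Psi> n + of_real (s\<^sup>2 / 2 * info n)) \<le> ?C * eps n"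
  proof (intro choice allI)
    fix n
    show "\<exists>\<Psi>. N0 \<le> n \<longrightarrow> (LINT \<omega>|M n. iexp (s * sc n 0 \<omega>)) = exp \<Psi> \<and> cmod (\<Psi> + of_real (s\<^sup>2 / 2 * info n)) \<le> ?C * eps n"
    proof (cases "N0 \<le> n")
      case True
      show ?thesis by (rule ramp_experiment.char_score[OF exper[OF True], of s]) blast
    qed simp
  qed
  then obtain \<Psi> where P: "\<forall>n\<ge>N0. (LINT \<omega>|M n. iexp (s * sc n 0 \<omega>)) = exp (\<Psi> n) \<and> cmod (\<Psi> n + of_real (s\<^sup>2 / 2 * info n)) \<le> ?C * eps n" ..
  have \<Psi>: "\<And>n. N0 \<le> n \<Longrightarrow> (LINT \<omega>|M n. iexp (s * sc n 0 \<omega>)) = exp (\<Psi> n)"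
    "\<And>n. N0 \<le> n \<Longrightarrow> cmod (\<Psi> n + of_real (s\<^sup>2 / 2 * info n)) \<le> ?C * eps n" using P by simp_all
  have "(\<lambda>n. \<Psi> n + of_real (s\<^sup>2 / 2 * info n)) \<longlonglongrightarrow> 0"
  proof (rule Lim_null_comparison)
    show "\<forall>\<^sub>F n in sequentially. norm (\<Psi> n + of_real (s\<^sup>2 / 2 * info n)) \<le> ?C * eps n"
      using eventually_ge_at_top[of N0] by eventually_elim (rule \<Psi>(2))
    show "(\<lambda>n. ?C * eps n) \<longlonglongrightarrow> 0" by (rule tendsto_mult_right_zero[OF eps_tendsto])
  qed
  moreover have "(\<lambda>n. complex_of_real (s\<^sup>2 / 2 * info n)) \<longlonglongrightarrow> of_real (s\<^sup>2 / 2 * F0)"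
    by (intro tendsto_intros info_tendsto)
  ultimately have "(\<lambda>n. (\<Psi> n + of_real (s\<^sup>2 / 2 * info n)) - of_real (s\<^sup>2 / 2 * info n)) \<longlonglongrightarrow> 0 - of_real (s\<^sup>2 / 2 * F0)"
    by (rule tendsto_diff)
  then have "(\<lambda>n. exp (\<Psi> n)) \<longlonglongrightarrow> exp (- of_real (s\<^sup>2 / 2 * F0))" by (intro tendsto_exp) simp
  moreover have "\<forall>\<^sub>F n in sequentially. exp (\<Psi> n) = (LINT \<omega>|M n. iexp (s * sc n 0 \<omega>))"
    using eventually_ge_at_top[of N0] by eventually_elim (rule \<Psi>(1)[symmetric])
  ultimately have "(\<lambda>n. LINT \<omega>|M n. iexp (s * sc n 0 \<omega>)) \<longlonglongrightarrow> exp (- of_real (s\<^sup>2 / 2 * F0))"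
    by (rule Lim_transform_eventually)
  then show ?thesis by (simp add: exp_of_real[symmetric])
qed

text \<open>
  The constant of \<open>expectation_ratio_score\<close> at \<open>u = 0\<close> is reused; with the factor \<open>4\<close> in the exponent the second
  moment stays below it.
\<close>

lemma expectation_score_sq:
  assumes n: "N0 \<le> n"
  shows "integrable (M n) (\<lambda>\<omega>. (sc n 0 \<omega>)\<^sup>2)" "(LINT \<omega>|M n. (sc n 0 \<omega>)\<^sup>2) \<le> C2"
proof -
  interpret ramp_experiment \<alpha> \<beta> \<tau> r \<psi> n "\<delta> n" "t n" "M n" "X n" by (rule exper[OF n])
  have 0: "0 \<in> {ul..ur}" using ul_less ur_greater by auto
  have E: "integrable (M n) (\<lambda>\<omega>. exp (c * score 0 \<omega>))" "expectation (\<lambda>\<omega>. exp (c * score 0 \<omega>)) \<le> C2" if "\<bar>c\<bar> \<le> 4" for c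
    using expectation_ratio_score[OF 0 that] by (simp_all add: llr_0)
  have iD: "integrable (M n) (\<lambda>\<omega>. exp (1 * score 0 \<omega>) + exp (-1 * score 0 \<omega>) - 2)"
    by (intro Bochner_Integration.integrable_diff Bochner_Integration.integrable_add integrable_const E) auto
  have le: "(score 0 \<omega>)\<^sup>2 \<le> exp (1 * score 0 \<omega>) + exp (-1 * score 0 \<omega>) - 2" for \<omega>
    using square_le_exp_sum[of "score 0 \<omega>"] by simp
  have m: "(\<lambda>\<omega>. (score 0 \<omega>)\<^sup>2) \<in> borel_measurable (M n)"
    using section_measurable[OF score_measurable_pair, of 0] by measurable
  show i: "integrable (M n) (\<lambda>\<omega>. (score 0 \<omega>)\<^sup>2)"
    by (rule Bochner_Integration.integrable_bound[OF iD m]) (use order.trans[OF le abs_ge_self] in auto)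
  have "(LINT \<omega>|M n. (4 * score 0 \<omega>)\<^sup>2) \<le> C2 + C2 - 2"
  proof -
    have i4: "integrable (M n) (\<lambda>\<omega>. exp (4 * score 0 \<omega>) + exp (-4 * score 0 \<omega>) - 2)"
      by (intro Bochner_Integration.integrable_diff Bochner_Integration.integrable_add integrable_const E) auto
    have "(LINT \<omega>|M n. (4 * score 0 \<omega>)\<^sup>2) \<le> expectation (\<lambda>\<omega>. exp (4 * score 0 \<omega>) + exp (-4 * score 0 \<omega>) - 2)"
      using square_le_exp_sum[of "4 * score 0 \<omega>" for \<omega>] i by (intro integral_mono i4) (auto simp: power_mult_distrib)
    also have "\<dots> = expectation (\<lambda>\<omega>. exp (4 * score 0 \<omega>)) + expectation (\<lambda>\<omega>. exp (-4 * score 0 \<omega>)) - 2"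
      using E(1)[of 4] E(1)[of "-4"] by (simp add: prob_space)
    finally show ?thesis using E(2)[of 4] E(2)[of "-4"] by simp
  qed
  then have "16 * expectation (\<lambda>\<omega>. (score 0 \<omega>)\<^sup>2) \<le> 2 * C2 - 2" by (simp add: power_mult_distrib)
  moreover have "1 \<le> C2" using K4_nonneg hi_pos by (simp add: C2_def)
  ultimately show "expectation (\<lambda>\<omega>. (score 0 \<omega>)\<^sup>2) \<le> C2" by linarith
qed

end

section \<open>The centred normal law\<close>

lemma real_distribution_centred_normal: "0 < v \<Longrightarrow> real_distribution (centred_normal v)"
proof -
  assume "0 < v"
  then have "prob_space (centred_normal v)"
    unfolding centred_normal_def by (intro prob_space_normal_density) simp
  then show ?thesis
    unfolding real_distribution_def real_distribution_axioms_def by (simp add: centred_normal_def)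
qed

lemma char_centred_normal:
  assumes "0 < v"
  shows "char (centred_normal v) s = of_real (exp (- (s\<^sup>2 * v / 2)))"
proof -
  define \<sigma> where "\<sigma> = sqrt v"
  have \<sigma>: "0 < \<sigma>" "\<sigma>\<^sup>2 = v" using assms by (auto simp: \<sigma>_def)
  have "char (centred_normal v) s = (LINT x|lborel. normal_density 0 \<sigma> x *\<^sub>R iexp (s * x))"
    unfolding char_def centred_normal_def \<sigma>_def by (subst integral_density) auto
  also have "\<dots> = \<bar>\<sigma>\<bar> *\<^sub>R (LINT x|lborel. normal_density 0 \<sigma> (0 + \<sigma> * x) *\<^sub>R iexp (s * (0 + \<sigma> * x)))"
    by (rule lborel_integral_real_affine) (use \<sigma> in simp)
  also have "\<dots> = (LINT x|lborel. (\<sigma> * normal_density 0 \<sigma> (\<sigma> * x)) *\<^sub>R iexp ((s * \<sigma>) * x))"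
    using \<sigma>(1) by (subst integral_scaleR_right[symmetric]) (simp add: mult.assoc)
  also have "\<dots> = (LINT x|lborel. std_normal_density x *\<^sub>R iexp ((s * \<sigma>) * x))"
  proof -
    have "\<sigma> * normal_density 0 \<sigma> (\<sigma> * x) = std_normal_density x" for x
      using \<sigma>(1) by (simp add: normal_density_def power_mult_distrib real_sqrt_mult)
    then show ?thesis by simp
  qed
  also have "\<dots> = char std_normal_distribution (s * \<sigma>)"
    unfolding char_def by (subst integral_density) auto
  finally show ?thesis by (simp add: char_std_normal_distribution power_mult_distrib \<sigma>(2))
qed

lemma powr_le_one_plus_power:
  assumes "0 \<le> (x::real)" "0 \<le> p" "p \<le> real k"
  shows "x powr p \<le> 1 + x ^ k"
proof (cases "x \<le> 1")
  case True
  then have "x powr p \<le> 1" using assms by (cases "x = 0") (auto intro: powr_le1)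
  then show ?thesis using assms by (simp add: add_increasing2)
next
  case False
  then have "x powr p \<le> x powr real k" using assms by (intro powr_mono) auto
  also have "\<dots> = x ^ k" using False by (simp add: powr_realpow)
  finally show ?thesis by simp
qed

lemma integrable_centred_normal_powr:
  assumes v: "0 < v" and p: "0 \<le> p"
  shows "integrable (centred_normal v) (\<lambda>x. \<bar>x\<bar> powr p)"
proof -
  obtain k where k: "p \<le> real k" using real_arch_simple by blast
  have m: "integrable (centred_normal v) (\<lambda>x. 1 + \<bar>x\<bar> ^ k)"
    unfolding centred_normal_def using v integrable_normal_moment_abs[of "sqrt v" 0 k]
    by (subst integrable_density) (auto simp: distrib_left)
  have "\<bar>x\<bar> powr p \<le> \<bar>1 + \<bar>x\<bar> ^ k\<bar>" for x :: real
    by (rule order.trans[OF powr_le_one_plus_power[OF abs_ge_zero p k] abs_ge_self])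
  then show ?thesis
    by (intro Bochner_Integration.integrable_bound[OF m]) (auto simp: centred_normal_def)
qed

text \<open>
  From \<open>y \<le> exp y\<close> with \<open>y = a x / q\<close>.
\<close>

lemma powr_le_exp:
  assumes "0 \<le> (x::real)" "0 < q" "0 < a"
  shows "x powr q \<le> exp (q * ln (q / a)) * exp (a * x)"
proof (cases "x = 0")
  case False
  then have x: "0 < x" using assms by simp
  have "ln (x * a / q) \<le> x * a / q - 1" using x assms by (intro ln_le_minus_one) simp
  then have "q * ln (x * a / q) \<le> q * (x * a / q - 1)" using assms by (intro mult_left_mono) auto
  then have "q * ln (x * a / q) \<le> a * x" using assms by (simp add: algebra_simps)
  moreover have e: "ln x = ln (q / a) + ln (x * a / q)" using x assms by (simp add: ln_div ln_mult)
  have "q * ln x = q * ln (q / a) + q * ln (x * a / q)" by (subst e) (simp only: distrib_left)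
  ultimately have "q * ln x \<le> q * ln (q / a) + a * x" by linarith
  then show ?thesis using x by (simp add: powr_def exp_add[symmetric])
qed simp

text \<open>Truncation costs at most the moment of doubled order divided by the truncation level.\<close>

lemma truncation_error:
  fixes Y :: "'b \<Rightarrow> real"
  assumes N: "prob_space N" and i1: "integrable N (\<lambda>\<omega>. \<bar>Y \<omega>\<bar> powr p)" and i2: "integrable N (\<lambda>\<omega>. \<bar>Y \<omega>\<bar> powr (2 * p))"
    and b: "(LINT \<omega>|N. \<bar>Y \<omega>\<bar> powr (2 * p)) \<le> B" and K: "0 < K"
  shows "\<bar>(LINT \<omega>|N. \<bar>Y \<omega>\<bar> powr p) - (LINT \<omega>|N. min (\<bar>Y \<omega>\<bar> powr p) K)\<bar> \<le> B / K"
proof -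
  interpret prob_space N by (rule N)
  have im: "integrable N (\<lambda>\<omega>. min (\<bar>Y \<omega>\<bar> powr p) K)" 
    by (rule Bochner_Integration.integrable_bound[OF i1]) (use K borel_measurable_integrable[OF i1] in auto)
  have pt: "0 \<le> z - min z K \<and> z - min z K \<le> z\<^sup>2 / K" if "0 \<le> z" for z :: real
  proof (cases "z \<le> K")
    case True
    then show ?thesis using that K by (simp add: min_def)
  next
    case False
    then have "z * K \<le> z * z" using that by (intro mult_left_mono) auto
    then have "z \<le> z\<^sup>2 / K" using K by (simp add: pos_le_divide_eq power2_eq_square)
    then show ?thesis using False K by simp
  qed
  have sq: "(x powr p)\<^sup>2 = x powr (2 * p)" for x :: real
    by (simp add: power2_eq_square powr_add[symmetric])
  have "(LINT \<omega>|N. \<bar>Y \<omega>\<bar> powr p) - (LINT \<omega>|N. min (\<bar>Y \<omega>\<bar> powr p) K) = (LINT \<omega>|N. \<bar>Y \<omega>\<bar> powr p - min (\<bar>Y \<omega>\<bar> powr p) K)"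
    using i1 im by simp
  moreover have "0 \<le> (LINT \<omega>|N. \<bar>Y \<omega>\<bar> powr p - min (\<bar>Y \<omega>\<bar> powr p) K)"
    by (intro integral_nonneg_AE AE_I2) simp
  moreover have "(LINT \<omega>|N. \<bar>Y \<omega>\<bar> powr p - min (\<bar>Y \<omega>\<bar> powr p) K) \<le> (LINT \<omega>|N. \<bar>Y \<omega>\<bar> powr (2 * p) / K)"
  proof (rule integral_mono)
    show "integrable N (\<lambda>\<omega>. \<bar>Y \<omega>\<bar> powr p - min (\<bar>Y \<omega>\<bar> powr p) K)" by (intro Bochner_Integration.integrable_diff i1 im)
    show "integrable N (\<lambda>\<omega>. \<bar>Y \<omega>\<bar> powr (2 * p) / K)" by (intro integrable_divide i2)
    show "\<bar>Y \<omega>\<bar> powr p - min (\<bar>Y \<omega>\<bar> powr p) K \<le> \<bar>Y \<omega>\<bar> powr (2 * p) / K" for \<omega>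
      using pt[of "\<bar>Y \<omega>\<bar> powr p"] unfolding sq by simp
  qed
  moreover have "\<dots> \<le> B / K" using b K by (simp add: divide_right_mono)
  ultimately show ?thesis by linarith
qed

section \<open>From a local expansion to the limit law and the moments\<close>

text \<open>
  What the limit theory needs of an estimator. \<open>U\<close> is the normalised error, \<open>D\<close> the score, \<open>V\<close> and \<open>J\<close> are
  variables with bounded expectations and \<open>Q\<close> measures the error of the Gaussian approximation. The
  two conditions \<open>growth\<close> and \<open>expansion\<close> are deterministic: they are statements about one path.
\<close>

locale expanding_sequence =
  fixes M :: "nat \<Rightarrow> 'w measure" and U D V J :: "nat \<Rightarrow> 'w \<Rightarrow> real" and Q :: "real \<Rightarrow> nat \<Rightarrow> 'w \<Rightarrow> real"
    and F a C :: real and N0 :: nat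
  assumes F_pos: "0 < F" and a_pos: "0 < a" and C_nonneg: "0 \<le> C"
    and prob: "\<And>n. N0 \<le> n \<Longrightarrow> prob_space (M n)"
    and U_meas: "\<And>n. N0 \<le> n \<Longrightarrow> U n \<in> borel_measurable (M n)"
    and D_meas: "\<And>n. N0 \<le> n \<Longrightarrow> D n \<in> borel_measurable (M n)"
    and V: "\<And>n. N0 \<le> n \<Longrightarrow> integrable (M n) (V n)" "\<And>n. N0 \<le> n \<Longrightarrow> (LINT \<omega>|M n. V n \<omega>) \<le> C"
    and J: "\<And>n. N0 \<le> n \<Longrightarrow> integrable (M n) (J n)" "\<And>n. N0 \<le> n \<Longrightarrow> (LINT \<omega>|M n. J n \<omega>) \<le> C"
    and D2: "\<And>n. N0 \<le> n \<Longrightarrow> integrable (M n) (\<lambda>\<omega>. (D n \<omega>)\<^sup>2)" "\<And>n. N0 \<le> n \<Longrightarrow> (LINT \<omega>|M n. (D n \<omega>)\<^sup>2) \<le> C"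
    and V_nonneg: "\<And>n \<omega>. N0 \<le> n \<Longrightarrow> 0 \<le> V n \<omega>" and J_nonneg: "\<And>n \<omega>. N0 \<le> n \<Longrightarrow> 0 \<le> J n \<omega>" and Q_nonneg: "\<And>K n \<omega>. 0 \<le> Q K n \<omega>"
    and Q_int: "\<And>K. \<forall>\<^sub>F n in sequentially. integrable (M n) (Q K n)"
    and Q_lim: "\<And>K. (\<lambda>n. LINT \<omega>|M n. Q K n \<omega>) \<longlonglongrightarrow> 0"
    and char_D: "\<And>s. (\<lambda>n. LINT \<omega>|M n. iexp (s * D n \<omega>)) \<longlonglongrightarrow> of_real (exp (- (s\<^sup>2 / 2 * F)))"
    and growth: "\<And>n \<omega>. N0 \<le> n \<Longrightarrow> \<omega> \<in> space (M n) \<Longrightarrow> exp (a * \<bar>U n \<omega>\<bar>) \<le> C * (V n \<omega> + 1 + J n \<omega>)"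
    and expansion: "\<And>e B. 0 < e \<Longrightarrow> 0 < B \<Longrightarrow> \<exists>K \<eta> N. 0 < \<eta> \<and> (\<forall>n\<ge>N. \<forall>\<omega>\<in>space (M n).
        V n \<omega> \<le> B \<longrightarrow> J n \<omega> \<le> B \<longrightarrow> \<bar>D n \<omega>\<bar> \<le> B \<longrightarrow> Q K n \<omega> \<le> \<eta> \<longrightarrow> \<bar>U n \<omega> - D n \<omega> / F\<bar> \<le> e)"
begin

text \<open>
  Markov's inequality makes the exceptional events of \<open>expansion\<close> small: first for \<open>V\<close>, \<open>J\<close> and \<open>D\<close> by the
  choice of the level \<open>B\<close>, then for \<open>Q\<close> by the choice of \<open>n\<close>.
\<close>

lemma distance_tendsto:
  assumes e: "0 < e"
  shows "(\<lambda>n. measure (M n) {\<omega> \<in> space (M n). e < \<bar>U n \<omega> - D n \<omega> / F\<bar>}) \<longlonglongrightarrow> 0"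
proof (rule tendstoI)
  fix \<epsilon> :: real assume \<epsilon>: "0 < \<epsilon>"
  define B where "B = max 1 (6 * (C + 1) / \<epsilon>)"
  have B: "1 \<le> B" "6 * (C + 1) / \<epsilon> \<le> B" by (auto simp: B_def)
  then have CB: "3 * C / B \<le> \<epsilon> / 2" using \<epsilon> C_nonneg by (simp add: field_simps)
  have "0 < B" using B(1) by simp
  from expansion[OF e this] obtain K \<eta> N where \<eta>: "0 < \<eta>" and exp: "\<forall>n\<ge>N. \<forall>\<omega>\<in>space (M n).
        V n \<omega> \<le> B \<longrightarrow> J n \<omega> \<le> B \<longrightarrow> \<bar>D n \<omega>\<bar> \<le> B \<longrightarrow> Q K n \<omega> \<le> \<eta> \<longrightarrow> \<bar>U n \<omega> - D n \<omega> / F\<bar> \<le> e"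
    by blast
  have "(\<lambda>n. (LINT \<omega>|M n. Q K n \<omega>) / \<eta>) \<longlonglongrightarrow> 0 / \<eta>" by (intro tendsto_intros Q_lim) (use \<eta> in simp)
  then have "\<forall>\<^sub>F n in sequentially. (LINT \<omega>|M n. Q K n \<omega>) / \<eta> < \<epsilon> / 2"
    by (rule order_tendstoD) (use \<epsilon> in simp)
  then show "\<forall>\<^sub>F n in sequentially. dist (measure (M n) {\<omega> \<in> space (M n). e < \<bar>U n \<omega> - D n \<omega> / F\<bar>}) 0 < \<epsilon>"
    using Q_int[of K] eventually_ge_at_top[of N] eventually_ge_at_top[of N0]
  proof eventually_elim
    case (elim n)
    interpret prob_space "M n" by (rule prob[OF elim(4)])
    note [measurable] = U_meas[OF elim(4)] D_meas[OF elim(4)] borel_measurable_integrable[OF V(1)[OF elim(4)]]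
      borel_measurable_integrable[OF J(1)[OF elim(4)]] borel_measurable_integrable[OF elim(2)]
    let ?A = "{\<omega> \<in> space (M n). e < \<bar>U n \<omega> - D n \<omega> / F\<bar>}"
    let ?V = "{\<omega> \<in> space (M n). B \<le> V n \<omega>}" and ?J = "{\<omega> \<in> space (M n). B \<le> J n \<omega>}"
      and ?D = "{\<omega> \<in> space (M n). B\<^sup>2 \<le> (D n \<omega>)\<^sup>2}" and ?Q = "{\<omega> \<in> space (M n). \<eta> \<le> Q K n \<omega>}"
    have "?A \<subseteq> (?V \<union> ?J) \<union> (?D \<union> ?Q)"
    proof
      fix \<omega> assume \<omega>: "\<omega> \<in> ?A"
      then have "\<not> (V n \<omega> \<le> B \<and> J n \<omega> \<le> B \<and> \<bar>D n \<omega>\<bar> \<le> B \<and> Q K n \<omega> \<le> \<eta>)"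
        using exp elim(3) by fastforce
      moreover have "B < \<bar>D n \<omega>\<bar> \<Longrightarrow> B\<^sup>2 \<le> (D n \<omega>)\<^sup>2"
        using B(1) by (simp add: abs_le_square_iff[symmetric])
      ultimately show "\<omega> \<in> (?V \<union> ?J) \<union> (?D \<union> ?Q)" using \<omega> by auto
    qed
    then have "prob ?A \<le> prob ((?V \<union> ?J) \<union> (?D \<union> ?Q))" by (intro finite_measure_mono) auto
    also have "\<dots> \<le> (prob ?V + prob ?J) + (prob ?D + prob ?Q)"
      by (intro order.trans[OF measure_Un_le] add_mono measure_Un_le) auto
    also have "\<dots> \<le> (C / B + C / B) + (C / B + (LINT \<omega>|M n. Q K n \<omega>) / \<eta>)"
    proof (intro add_mono)
      have mk: "prob {\<omega> \<in> space (M n). c \<le> u \<omega>} \<le> (LINT \<omega>|M n. u \<omega>) / c"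
        if "integrable (M n) u" "\<And>\<omega>. 0 \<le> u \<omega>" "0 < c" for u c
        using integral_Markov_inequality_measure[OF that(1), of "space (M n)" c] that by simp
      show "prob ?V \<le> C / B" by (rule order.trans[OF mk[OF V(1)[OF elim(4)] V_nonneg[OF elim(4)]] divide_right_mono[OF V(2)[OF elim(4)]]]) (use B(1) in auto)
      show "prob ?J \<le> C / B" by (rule order.trans[OF mk[OF J(1)[OF elim(4)] J_nonneg[OF elim(4)]] divide_right_mono[OF J(2)[OF elim(4)]]]) (use B(1) in auto)
      show "prob ?Q \<le> (LINT \<omega>|M n. Q K n \<omega>) / \<eta>" by (rule mk[OF elim(2) Q_nonneg \<eta>])
      have "prob ?D \<le> C / B\<^sup>2" by (rule order.trans[OF mk[OF D2(1)[OF elim(4)]] divide_right_mono[OF D2(2)[OF elim(4)]]]) (use B(1) in auto)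
      also have "\<dots> \<le> C / B" using B(1) C_nonneg by (intro divide_left_mono) (auto simp: self_le_power)
      finally show "prob ?D \<le> C / B" .
    qed
    also have "\<dots> < \<epsilon>" using CB elim(1) by linarith
    finally show ?case by simp
  qed
qed

lemma char_U_tendsto: "(\<lambda>n. LINT \<omega>|M n. iexp (s * U n \<omega>)) \<longlonglongrightarrow> of_real (exp (- (s\<^sup>2 * (1 / F) / 2)))"
proof -
  have 1: "(\<lambda>n. LINT \<omega>|M n. iexp (s / F * D n \<omega>)) \<longlonglongrightarrow> of_real (exp (- (s\<^sup>2 * (1 / F) / 2)))"
    using char_D[of "s / F"] F_pos by (simp add: power_divide power2_eq_square)
  have "(\<lambda>n. (LINT \<omega>|M n. iexp (s * U n \<omega>)) - (LINT \<omega>|M n. iexp (s / F * D n \<omega>))) \<longlonglongrightarrow> 0"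
  proof (rule tendstoI)
    fix \<epsilon> :: real assume \<epsilon>: "0 < \<epsilon>"
    define e where "e = \<epsilon> / (2 * (\<bar>s\<bar> + 1))"
    have e: "0 < e" using \<epsilon> by (simp add: e_def)
    have se: "\<bar>s\<bar> * e \<le> \<epsilon> / 2" using \<epsilon> by (simp add: e_def field_simps)
    have "\<forall>\<^sub>F n in sequentially. measure (M n) {\<omega> \<in> space (M n). e < \<bar>U n \<omega> - D n \<omega> / F\<bar>} < \<epsilon> / 4"
      by (rule order_tendstoD[OF distance_tendsto[OF e]]) (use \<epsilon> in simp)
    then show "\<forall>\<^sub>F n in sequentially. dist ((LINT \<omega>|M n. iexp (s * U n \<omega>)) - (LINT \<omega>|M n. iexp (s / F * D n \<omega>))) 0 < \<epsilon>"
      using eventually_ge_at_top[of N0]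
    proof eventually_elim
      case (elim n)
      interpret prob_space "M n" by (rule prob[OF elim(2)])
      note [measurable] = U_meas[OF elim(2)] D_meas[OF elim(2)]
      let ?A = "{\<omega> \<in> space (M n). e < \<bar>U n \<omega> - D n \<omega> / F\<bar>}"
      have i: "integrable (M n) (\<lambda>\<omega>. iexp (s * U n \<omega>))" "integrable (M n) (\<lambda>\<omega>. iexp (s / F * D n \<omega>))"
        by (auto intro!: integrable_const_bound[where B=1])
      have "cmod ((LINT \<omega>|M n. iexp (s * U n \<omega>)) - (LINT \<omega>|M n. iexp (s / F * D n \<omega>)))
          = cmod (LINT \<omega>|M n. iexp (s * U n \<omega>) - iexp (s / F * D n \<omega>))" using i by simp
      also have "\<dots> \<le> (LINT \<omega>|M n. cmod (iexp (s * U n \<omega>) - iexp (s / F * D n \<omega>)))" by (rule integral_norm_bound)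
      also have "\<dots> \<le> (LINT \<omega>|M n. \<bar>s\<bar> * e + 2 * indicator ?A \<omega>)"
      proof (rule integral_mono)
        show "integrable (M n) (\<lambda>\<omega>. cmod (iexp (s * U n \<omega>) - iexp (s / F * D n \<omega>)))"
          by (intro integrable_norm Bochner_Integration.integrable_diff i)
        show "integrable (M n) (\<lambda>\<omega>. \<bar>s\<bar> * e + 2 * indicator ?A \<omega>)"
          by (intro Bochner_Integration.integrable_add integrable_const integrable_mult_right integrable_real_indicator) (auto simp: emeasure_eq_measure)
        fix \<omega> assume \<omega>: "\<omega> \<in> space (M n)"
        show "cmod (iexp (s * U n \<omega>) - iexp (s / F * D n \<omega>)) \<le> \<bar>s\<bar> * e + 2 * indicator ?A \<omega>"
        proof (cases "\<omega> \<in> ?A")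
          case True
          have "cmod (iexp (s * U n \<omega>) - iexp (s / F * D n \<omega>)) \<le> cmod (iexp (s * U n \<omega>)) + cmod (iexp (s / F * D n \<omega>))"
            by (rule norm_triangle_ineq4)
          also have "\<dots> = 2" unfolding norm_exp_i_times by simp
          finally have "cmod (iexp (s * U n \<omega>) - iexp (s / F * D n \<omega>)) \<le> 2" .
          moreover have "0 \<le> \<bar>s\<bar> * e" using e by simp
          ultimately show ?thesis using True by simp
        next
          case False
          then have le: "\<bar>U n \<omega> - D n \<omega> / F\<bar> \<le> e" using \<omega> by auto
          define x where "x = s * U n \<omega> - s / F * D n \<omega>"
          have "iexp (s * U n \<omega>) - iexp (s / F * D n \<omega>) = iexp (s / F * D n \<omega>) * (iexp x - 1)"
            by (simp add: x_def right_diff_distrib exp_add[symmetric])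
          also have "cmod \<dots> = cmod (iexp x - 1)" unfolding norm_mult norm_exp_i_times by simp
          also have "\<dots> \<le> \<bar>x\<bar>" using iexp_approx1[of x 0] by simp
          also have "x = s * (U n \<omega> - D n \<omega> / F)" by (simp add: x_def algebra_simps)
          also have "\<bar>s * (U n \<omega> - D n \<omega> / F)\<bar> \<le> \<bar>s\<bar> * e" unfolding abs_mult by (intro mult_left_mono le) simp
          finally show ?thesis using False by simp
        qed
      qed
      also have "\<dots> = \<bar>s\<bar> * e + 2 * prob ?A"
        by (subst Bochner_Integration.integral_add) (auto simp: prob_space emeasure_eq_measure intro!: integrable_real_indicator)
      also have "\<dots> < \<epsilon>" using se elim(1) by linarith
      finally show ?case by simp
    qed
  qed
  from tendsto_add[OF this 1] show ?thesis by simp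
qed

text \<open>
  For small \<open>n\<close> nothing is known about \<open>U n\<close>; the limit law is substituted there because Levy's continuity
  theorem requires a probability distribution for every \<open>n\<close>.
\<close>

definition law :: "nat \<Rightarrow> real measure" where
  "law n = (if N0 \<le> n then distr (M n) borel (U n) else centred_normal (1 / F))"

lemma real_distribution_law: "real_distribution (law n)"
  using F_pos prob_space.real_distribution_distr[OF prob U_meas] real_distribution_centred_normal[of "1 / F"]
  by (auto simp: law_def)

lemma weak_conv_law: "weak_conv_m law (centred_normal (1 / F))"
proof (rule levy_continuity[OF real_distribution_law real_distribution_centred_normal])
  show F: "0 < 1 / F" using F_pos by simp
  fix s
  have "\<forall>\<^sub>F n in sequentially. (LINT \<omega>|M n. iexp (s * U n \<omega>)) = char (law n) s"
    using eventually_ge_at_top[of N0]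
  proof eventually_elim
    case (elim n)
    then show ?case unfolding law_def char_def using U_meas[OF elim] by (simp add: integral_distr)
  qed
  from Lim_transform_eventually[OF char_U_tendsto this]
  show "(\<lambda>n. char (law n) s) \<longlonglongrightarrow> char (centred_normal (1 / F)) s"
    unfolding char_centred_normal[OF F] .
qed

theorem weak_convergence:
  "weak_conv_m (\<lambda>n. distr (M n) borel (U n)) (centred_normal (1 / F))"
  unfolding weak_conv_m_def weak_conv_def
proof (intro allI impI)
  fix x assume "isCont (cdf (centred_normal (1 / F))) x"
  then have "(\<lambda>n. cdf (law n) x) \<longlonglongrightarrow> cdf (centred_normal (1 / F)) x"
    using weak_conv_law unfolding weak_conv_m_def weak_conv_def by blast
  moreover have "\<forall>\<^sub>F n in sequentially. cdf (law n) x = cdf (distr (M n) borel (U n)) x"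
    using eventually_ge_at_top[of N0] by eventually_elim (simp add: law_def)
  ultimately show "(\<lambda>n. cdf (distr (M n) borel (U n)) x) \<longlonglongrightarrow> cdf (centred_normal (1 / F)) x"
    by (rule Lim_transform_eventually)
qed

text \<open>
  Exponential growth of the integrable bound gives bounded moments of every order, hence uniform
  integrability of all powers.
\<close>

lemma U_powr:
  assumes "N0 \<le> n" "0 < q"
  shows "integrable (M n) (\<lambda>\<omega>. \<bar>U n \<omega>\<bar> powr q)"
    and "(LINT \<omega>|M n. \<bar>U n \<omega>\<bar> powr q) \<le> exp (q * ln (q / a)) * (C * (C + 1 + C))"
proof -
  interpret prob_space "M n" by (rule prob[OF assms(1)])
  note [measurable] = U_meas[OF assms(1)]
  let ?B = "\<lambda>\<omega>. exp (q * ln (q / a)) * (C * (V n \<omega> + 1 + J n \<omega>))"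
  have iB: "integrable (M n) ?B" using V(1)[OF assms(1)] J(1)[OF assms(1)] by simp
  have le: "\<bar>U n \<omega>\<bar> powr q \<le> ?B \<omega>" if "\<omega> \<in> space (M n)" for \<omega>
    by (rule order.trans[OF powr_le_exp mult_left_mono[OF growth[OF assms(1) that]]]) (use assms(2) a_pos in auto)
  show i: "integrable (M n) (\<lambda>\<omega>. \<bar>U n \<omega>\<bar> powr q)"
    by (rule Bochner_Integration.integrable_bound[OF iB]) (use order.trans[OF le abs_ge_self] in auto)
  have "(LINT \<omega>|M n. \<bar>U n \<omega>\<bar> powr q) \<le> (LINT \<omega>|M n. ?B \<omega>)" by (rule integral_mono[OF i iB le])
  also have "\<dots> = exp (q * ln (q / a)) * (C * ((LINT \<omega>|M n. V n \<omega>) + 1 + (LINT \<omega>|M n. J n \<omega>)))"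
    using V(1)[OF assms(1)] J(1)[OF assms(1)] by (simp add: prob_space)
  also have "\<dots> \<le> exp (q * ln (q / a)) * (C * (C + 1 + C))"
    using V(2)[OF assms(1)] J(2)[OF assms(1)] C_nonneg by (intro mult_left_mono add_mono) auto
  finally show "(LINT \<omega>|M n. \<bar>U n \<omega>\<bar> powr q) \<le> exp (q * ln (q / a)) * (C * (C + 1 + C))" .
qed

text \<open>
  The truncated powers converge by weak convergence; the truncation error is small uniformly in \<open>n\<close>
  because moments of twice the order are bounded.
\<close>

theorem moment_convergence:
  assumes p: "0 < p"
  shows "(\<lambda>n. LINT \<omega>|M n. \<bar>U n \<omega>\<bar> powr p) \<longlonglongrightarrow> (LINT x|centred_normal (1 / F). \<bar>x\<bar> powr p)"
proof (rule tendstoI)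
  fix \<epsilon> :: real assume \<epsilon>: "0 < \<epsilon>"
  let ?G = "centred_normal (1 / F)"
  have F: "0 < 1 / F" using F_pos by simp
  interpret G: real_distribution ?G by (rule real_distribution_centred_normal[OF F])
  define B where "B = max (exp (2 * p * ln (2 * p / a)) * (C * (C + 1 + C))) (LINT x|?G. \<bar>x\<bar> powr (2 * p))"
  define K where "K = max 1 (4 * B / \<epsilon>)"
  have K: "0 < K" "B / K \<le> \<epsilon> / 4" using \<epsilon> by (auto simp: K_def field_simps max_def)
  have eG: "\<bar>(LINT x|?G. \<bar>x\<bar> powr p) - (LINT x|?G. min (\<bar>x\<bar> powr p) K)\<bar> \<le> B / K"
    by (rule truncation_error[OF G.prob_space_axioms _ _ _ K(1)])
      (use p F in \<open>auto simp: B_def intro!: integrable_centred_normal_powr\<close>)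
  have "(\<lambda>n. LINT x|law n. min (\<bar>x\<bar> powr p) K) \<longlonglongrightarrow> (LINT x|?G. min (\<bar>x\<bar> powr p) K)"
    by (rule weak_conv_imp_integral_bdd_continuous_conv[OF real_distribution_law G.real_distribution_axioms weak_conv_law, where B=K])
      (use p K in \<open>auto intro!: continuous_intros\<close>)
  then have "\<forall>\<^sub>F n in sequentially. dist (LINT x|law n. min (\<bar>x\<bar> powr p) K) (LINT x|?G. min (\<bar>x\<bar> powr p) K) < \<epsilon> / 4"
    by (rule tendstoD) (use \<epsilon> in simp)
  then show "\<forall>\<^sub>F n in sequentially. dist (LINT \<omega>|M n. \<bar>U n \<omega>\<bar> powr p) (LINT x|?G. \<bar>x\<bar> powr p) < \<epsilon>"
    using eventually_ge_at_top[of N0]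
  proof eventually_elim
    case (elim n)
    have "\<bar>(LINT \<omega>|M n. \<bar>U n \<omega>\<bar> powr p) - (LINT \<omega>|M n. min (\<bar>U n \<omega>\<bar> powr p) K)\<bar> \<le> B / K"
      by (rule truncation_error[OF prob[OF elim(2)] U_powr(1)[OF elim(2)] U_powr(1)[OF elim(2)] _ K(1)])
        (use p U_powr(2)[OF elim(2), of "2 * p"] in \<open>auto simp: B_def\<close>)
    moreover have "(LINT x|law n. min (\<bar>x\<bar> powr p) K) = (LINT \<omega>|M n. min (\<bar>U n \<omega>\<bar> powr p) K)"
      unfolding law_def using elim(2) U_meas[OF elim(2)] by (simp add: integral_distr)
    ultimately show ?case using elim(1) eG K(2) \<epsilon> unfolding dist_real_def by linarith
  qed
qed

theorem vanishing_probability: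
  assumes \<rho>: "\<rho> \<longlonglongrightarrow> 0" and e: "0 < e"
  shows "(\<lambda>n. measure (M n) {\<omega> \<in> space (M n). e < \<bar>\<rho> n * U n \<omega>\<bar>}) \<longlonglongrightarrow> 0"
proof (rule tendsto_sandwich[OF _ _ tendsto_const])
  let ?B = "exp (1 * ln (1 / a)) * (C * (C + 1 + C))"
  show "\<forall>\<^sub>F n in sequentially. 0 \<le> measure (M n) {\<omega> \<in> space (M n). e < \<bar>\<rho> n * U n \<omega>\<bar>}" by simp
  have "(\<lambda>n. \<bar>\<rho> n\<bar> * ?B / e) \<longlonglongrightarrow> \<bar>0\<bar> * ?B / e" by (intro tendsto_intros \<rho>) (use e in simp)
  then show "(\<lambda>n. \<bar>\<rho> n\<bar> * ?B / e) \<longlonglongrightarrow> 0" by simp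
  show "\<forall>\<^sub>F n in sequentially. measure (M n) {\<omega> \<in> space (M n). e < \<bar>\<rho> n * U n \<omega>\<bar>} \<le> \<bar>\<rho> n\<bar> * ?B / e"
    using eventually_ge_at_top[of N0]
  proof eventually_elim
    case (elim n)
    interpret prob_space "M n" by (rule prob[OF elim])
    note [measurable] = U_meas[OF elim]
    have U1: "integrable (M n) (\<lambda>\<omega>. \<bar>U n \<omega>\<bar>)" "(LINT \<omega>|M n. \<bar>U n \<omega>\<bar>) \<le> ?B"
      using U_powr[OF elim, of 1] by simp_all
    have "prob {\<omega> \<in> space (M n). e < \<bar>\<rho> n * U n \<omega>\<bar>} \<le> prob {\<omega> \<in> space (M n). e \<le> \<bar>\<rho> n\<bar> * \<bar>U n \<omega>\<bar>}"
      by (intro finite_measure_mono) (auto simp: abs_mult)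
    also have "\<dots> \<le> (LINT \<omega>|M n. \<bar>\<rho> n\<bar> * \<bar>U n \<omega>\<bar>) / e"
      using U1(1) e by (intro integral_Markov_inequality_measure[where A="space (M n)"]) auto
    also have "\<dots> \<le> \<bar>\<rho> n\<bar> * ?B / e"
      using U1(2) e by (intro divide_right_mono) (auto intro: mult_left_mono)
    finally show ?case .
  qed
qed

end

section \<open>Posterior means\<close>

text \<open>
  An unnormalised posterior density \<open>p\<close> in the local parameter. One exponential factor is kept apart from
  the integrable weight \<open>wt\<close>, in order to control exponential tails of \<open>p\<close>.
\<close>

locale posterior =
  fixes p wt :: "real \<Rightarrow> real" and c V CQ :: real
  assumes c_pos: "0 < c" and V_pos: "0 < V"
    and p_meas[measurable]: "p \<in> borel_measurable borel" and p_nonneg: "\<And>u. 0 \<le> p u"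
    and wt_int: "integrable lborel wt" and wt_le: "(LINT u|lborel. wt u) \<le> CQ"
    and p_le: "\<And>u. p u \<le> V\<^sup>2 * exp (- c * \<bar>u\<bar>) * wt u"
    and mass_pos: "0 < (LINT u|lborel. p u)"
begin

abbreviation "mass \<equiv> (LINT u|lborel. p u)"
abbreviation "mean \<equiv> (LINT u|lborel. u * p u) / (LINT u|lborel. p u)"

lemma exp_p_le: "exp (c * \<bar>u\<bar>) * p u \<le> V\<^sup>2 * wt u"
proof -
  have "exp (c * \<bar>u\<bar>) * p u \<le> exp (c * \<bar>u\<bar>) * (V\<^sup>2 * exp (- c * \<bar>u\<bar>) * wt u)" by (intro mult_left_mono p_le) simp
  also have "\<dots> = V\<^sup>2 * wt u * (exp (c * \<bar>u\<bar>) * exp (- c * \<bar>u\<bar>))" by simp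
  also have "exp (c * \<bar>u\<bar>) * exp (- c * \<bar>u\<bar>) = 1" by (simp add: exp_add[symmetric])
  finally show ?thesis by simp
qed

lemma wt_nonneg: "0 \<le> wt u"
  using order.trans[OF mult_nonneg_nonneg[OF exp_ge_zero p_nonneg] exp_p_le, of u] V_pos by (simp add: zero_le_mult_iff)

lemma integrable_exp_p: "integrable lborel (\<lambda>u. exp (c * \<bar>u\<bar>) * p u)"
proof (rule Bochner_Integration.integrable_bound)
  show "integrable lborel (\<lambda>u. V\<^sup>2 * wt u)" using wt_int by simp
  show "AE u in lborel. norm (exp (c * \<bar>u\<bar>) * p u) \<le> norm (V\<^sup>2 * wt u)"
    using exp_p_le p_nonneg wt_nonneg by (intro AE_I2) (auto simp: abs_mult)
qed measurable

lemma integrable_p: "integrable lborel p"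
proof (rule Bochner_Integration.integrable_bound[OF integrable_exp_p])
  have "1 * p u \<le> exp (c * \<bar>u\<bar>) * p u" for u using c_pos p_nonneg by (intro mult_right_mono) auto
  then show "AE u in lborel. norm (p u) \<le> norm (exp (c * \<bar>u\<bar>) * p u)"
    using p_nonneg by (intro AE_I2) (auto simp: abs_mult)
qed measurable

lemma integrable_up: "integrable lborel (\<lambda>u. u * p u)"
proof (rule Bochner_Integration.integrable_bound)
  show "integrable lborel (\<lambda>u. 1 / c * (exp (c * \<bar>u\<bar>) * p u))" using integrable_exp_p by simp
  have "\<bar>u\<bar> \<le> 1 / c * exp (c * \<bar>u\<bar>)" for u
  proof -
    have "c * \<bar>u\<bar> \<le> exp (c * \<bar>u\<bar>)" using exp_ge_add_one_self[of "c * \<bar>u\<bar>"] by linarith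
    then show ?thesis using c_pos by (simp add: pos_le_divide_eq mult.commute)
  qed
  then have "\<bar>u\<bar> * p u \<le> 1 / c * exp (c * \<bar>u\<bar>) * p u" for u using p_nonneg by (intro mult_right_mono) auto
  then show "AE u in lborel. norm (u * p u) \<le> norm (1 / c * (exp (c * \<bar>u\<bar>) * p u))"
    using p_nonneg c_pos by (intro AE_I2) (auto simp: abs_mult)
qed measurable

text \<open>Jensen's inequality for the convex function \<open>exp (c \<bar>u\<bar>)\<close>, by its tangent line.\<close>

lemma posterior_growth: "exp (c * \<bar>mean\<bar>) * mass \<le> V\<^sup>2 * CQ"
proof -
  define m where "m = \<bar>mean\<bar>"
  have iabs: "integrable lborel (\<lambda>u. \<bar>u\<bar> * p u)"
    using integrable_norm[OF integrable_up] p_nonneg by (simp add: abs_mult)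
  have mm: "m * mass \<le> (LINT u|lborel. \<bar>u\<bar> * p u)"
  proof -
    have "m * mass = \<bar>LINT u|lborel. u * p u\<bar>" using mass_pos by (simp add: m_def abs_divide)
    also have "\<dots> \<le> (LINT u|lborel. \<bar>u * p u\<bar>)" by (rule integral_abs_bound)
    finally show ?thesis using p_nonneg by (simp add: abs_mult)
  qed
  have "exp (c * m) * mass \<le> exp (c * m) * (mass + c * ((LINT u|lborel. \<bar>u\<bar> * p u) - m * mass))"
    using mm c_pos by (intro mult_left_mono) auto
  also have "\<dots> = (LINT u|lborel. exp (c * m) * (p u + c * (\<bar>u\<bar> * p u - m * p u)))"
    using integrable_p iabs by simp
  also have "\<dots> \<le> (LINT u|lborel. exp (c * \<bar>u\<bar>) * p u)"
  proof (rule integral_mono[OF _ integrable_exp_p])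
    show "integrable lborel (\<lambda>u. exp (c * m) * (p u + c * (\<bar>u\<bar> * p u - m * p u)))"
      using integrable_p iabs by simp
    fix u
    have "exp (c * m) * (1 + c * (\<bar>u\<bar> - m)) \<le> exp (c * m) * exp (c * (\<bar>u\<bar> - m))" by (intro mult_left_mono) auto
    also have "\<dots> = exp (c * \<bar>u\<bar>)" by (simp add: exp_add[symmetric] algebra_simps)
    finally have "exp (c * m) * (1 + c * (\<bar>u\<bar> - m)) * p u \<le> exp (c * \<bar>u\<bar>) * p u" using p_nonneg by (intro mult_right_mono)
    then show "exp (c * m) * (p u + c * (\<bar>u\<bar> * p u - m * p u)) \<le> exp (c * \<bar>u\<bar>) * p u" by (simp add: algebra_simps)
  qed
  also have "\<dots> \<le> (LINT u|lborel. V\<^sup>2 * wt u)" by (rule integral_mono[OF integrable_exp_p _ exp_p_le]) (use wt_int in simp)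
  also have "\<dots> \<le> V\<^sup>2 * CQ" using wt_le by (simp add: mult_left_mono)
  finally show ?thesis by (simp add: m_def)
qed

text \<open>
  On a window of radius \<open>K\<close> around \<open>m0\<close> the density is close to a Gaussian profile centred at \<open>m0\<close>, whose
  first moment about \<open>m0\<close> vanishes by symmetry; outside the window the exponential bound applies.
\<close>

lemma posterior_close:
  fixes F g0 m0 K \<rho> B :: real
  assumes F: "0 < F" and K: "0 < K" and m0: "\<bar>m0\<bar> \<le> B" and \<rho>: "0 \<le> \<rho>"
    and close: "\<And>u. \<bar>u - m0\<bar> \<le> K \<Longrightarrow> \<bar>p u - g0 * exp (- F / 2 * (u - m0)\<^sup>2)\<bar> \<le> \<rho>"
  shows "\<bar>mean - m0\<bar> * mass \<le> 2 * K\<^sup>2 * \<rho> + V\<^sup>2 * CQ * (2 / c * exp (c * B) * exp (- c * K / 2))"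
proof -
  define I where "I = {m0 - K..m0 + K}"
  define T where "T = 2 / c * exp (c * B) * exp (- c * K / 2)"
  have T: "0 \<le> T" using c_pos by (simp add: T_def)
  define G where "G u = g0 * exp (- F / 2 * (u - m0)\<^sup>2)" for u
  have cG: "continuous_on {m0 - K..m0 + K} (\<lambda>u. (u - m0) * G u)" unfolding G_def by (intro continuous_intros)
  \<comment> \<open>The Gaussian profile contributes nothing to the first moment about its centre.\<close>
  have G0: "(LBINT u:I. (u - m0) * G u) = 0"
  proof -
    have "((\<lambda>u. (u - m0) * G u) has_integral (- G (m0 + K) / F - (- G (m0 - K) / F))) {m0 - K..m0 + K}"
    proof (rule fundamental_theorem_of_calculus)
      show "m0 - K \<le> m0 + K" using K by simp
      fix u
      show "((\<lambda>u. - G u / F) has_vector_derivative (u - m0) * G u) (at u within {m0 - K..m0 + K})"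
        unfolding has_real_derivative_iff_has_vector_derivative[symmetric] G_def
        using F by (auto intro!: derivative_eq_intros)
    qed
    moreover have "G (m0 + K) = G (m0 - K)" by (simp add: G_def)
    ultimately show ?thesis
      using set_borel_integral_eq_integral(2)[OF borel_integrable_atLeastAtMost'[OF cG]] by (simp add: integral_unique I_def)
  qed
  have iG: "integrable lborel (\<lambda>u. indicator I u * ((u - m0) * G u))"
    using borel_integrable_atLeastAtMost'[OF cG] by (simp add: set_integrable_def I_def)
  have ip: "integrable lborel (\<lambda>u. (u - m0) * p u)" using integrable_up integrable_p by (simp add: left_diff_distrib)
  have "(mean - m0) * mass = (LINT u|lborel. (u - m0) * p u)"
    using mass_pos integrable_up integrable_p by (simp add: left_diff_distrib)
  also have "\<dots> = (LINT u|lborel. (u - m0) * p u) - (LBINT u:I. (u - m0) * G u)" using G0 by simp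
  also have "\<dots> = (LINT u|lborel. (u - m0) * p u - indicator I u * ((u - m0) * G u))"
    using ip iG by (simp add: set_lebesgue_integral_def)
  finally have "\<bar>mean - m0\<bar> * mass = \<bar>LINT u|lborel. (u - m0) * p u - indicator I u * ((u - m0) * G u)\<bar>"
    using mass_pos by (metis abs_mult abs_of_pos)
  also have "\<dots> \<le> (LINT u|lborel. \<bar>(u - m0) * p u - indicator I u * ((u - m0) * G u)\<bar>)" by (rule integral_abs_bound)
  also have "\<dots> \<le> (LINT u|lborel. indicator I u * (K * \<rho>) + V\<^sup>2 * T * wt u)"
  proof (rule integral_mono)
    show "integrable lborel (\<lambda>u. \<bar>(u - m0) * p u - indicator I u * ((u - m0) * G u)\<bar>)" using ip iG by simp
    show "integrable lborel (\<lambda>u. indicator I u * (K * \<rho>) + V\<^sup>2 * T * wt u)"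
      using wt_int by (intro Bochner_Integration.integrable_add integrable_mult_left integrable_mult_right integrable_real_indicator)
        (auto simp: I_def emeasure_lborel_Icc_eq)
    fix u
    show "\<bar>(u - m0) * p u - indicator I u * ((u - m0) * G u)\<bar> \<le> indicator I u * (K * \<rho>) + V\<^sup>2 * T * wt u"
    proof (cases "u \<in> I")
      case True
      then have "\<bar>u - m0\<bar> \<le> K" by (auto simp: I_def)
      then have "\<bar>u - m0\<bar> * \<bar>p u - G u\<bar> \<le> K * \<rho>" using close[of u] K by (intro mult_mono) (auto simp: G_def)
      moreover have "\<bar>(u - m0) * p u - indicator I u * ((u - m0) * G u)\<bar> = \<bar>u - m0\<bar> * \<bar>p u - G u\<bar>"
        using True by (simp add: abs_mult[symmetric] right_diff_distrib)
      moreover have "0 \<le> V\<^sup>2 * T * wt u" using T wt_nonneg by simp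
      ultimately show ?thesis using True by simp
    next
      case False
      define z where "z = \<bar>u - m0\<bar>"
      have z: "K \<le> z" "z - B \<le> \<bar>u\<bar>" using False m0 by (auto simp: I_def z_def)
      \<comment> \<open>Half of the exponential decay pays for the factor z.\<close>
      have "z \<le> 2 / c * exp (c * z / 2)"
        using exp_ge_add_one_self[of "c * z / 2"] c_pos by (simp add: pos_le_divide_eq field_simps)
      then have "z * exp (- c * \<bar>u\<bar>) \<le> 2 / c * exp (c * z / 2) * exp (- c * (z - B))"
        using z c_pos by (intro mult_mono) auto
      also have "\<dots> = 2 / c * exp (c * B) * exp (- c * z / 2)"
        by (simp add: exp_add[symmetric] algebra_simps)
      also have "\<dots> \<le> T" unfolding T_def using z c_pos by (intro mult_left_mono) auto
      finally have zT: "z * exp (- c * \<bar>u\<bar>) \<le> T" .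
      have "\<bar>(u - m0) * p u\<bar> = z * p u" using p_nonneg by (simp add: abs_mult z_def)
      also have "\<dots> \<le> z * (V\<^sup>2 * exp (- c * \<bar>u\<bar>) * wt u)" using p_le by (intro mult_left_mono) (auto simp: z_def)
      also have "\<dots> = (z * exp (- c * \<bar>u\<bar>)) * (V\<^sup>2 * wt u)" by simp
      also have "\<dots> \<le> T * (V\<^sup>2 * wt u)" using wt_nonneg by (intro mult_right_mono zT) auto
      finally show ?thesis using False by (simp add: mult_ac)
    qed
  qed
  also have "\<dots> = 2 * K * (K * \<rho>) + V\<^sup>2 * T * (LINT u|lborel. wt u)"
    using K wt_int by (subst Bochner_Integration.integral_add)
      (auto simp: I_def emeasure_lborel_Icc_eq intro!: integrable_mult_left integrable_real_indicator)
  also have "\<dots> \<le> 2 * K * (K * \<rho>) + V\<^sup>2 * T * CQ" using T wt_le by (intro add_left_mono mult_left_mono) auto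
  finally show ?thesis by (simp add: T_def power2_eq_square mult_ac)
qed

end

section \<open>Quadratic approximation of the log-likelihood, and its maximum\<close>

context ramp_experiment
begin

text \<open>
  Integration of the score. The mean square error is used instead of the mean absolute error because it has
  a closed bound; the free parameter \<open>\<eta>\<close> balances the two terms of \<open>\<bar>x\<bar> \<le> \<eta> / 2 + x\<^sup>2 / (2 \<eta>)\<close>.
\<close>

lemma llr_quadratic:
  assumes \<omega>: "\<omega> \<in> space M" and K: "{-K..K} \<subseteq> {ul..ur}" and u: "\<bar>u\<bar> \<le> K" and \<eta>: "0 < \<eta>"
    and int: "set_integrable lborel {-K..K} (\<lambda>w. lan_error F w \<omega>)" "set_integrable lborel {-K..K} (\<lambda>w. (lan_error F w \<omega>)\<^sup>2)"
  shows "\<bar>llr u \<omega> - (u * score 0 \<omega> - F / 2 * u\<^sup>2)\<bar> \<le> K * \<eta> + (LBINT w:{-K..K}. (lan_error F w \<omega>)\<^sup>2) / (2 * \<eta>)"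
proof -
  let ?e = "\<lambda>w. lan_error F w \<omega>" and ?q = "\<lambda>u. u * score 0 \<omega> - F / 2 * u\<^sup>2"
  have hk: "?e integrable_on {-K..K}" "(\<lambda>w. (?e w)\<^sup>2) integrable_on {-K..K}" "(\<lambda>w. \<bar>?e w\<bar>) integrable_on {-K..K}"
    using int set_integrable_abs[OF int(1)] by (auto intro: set_borel_integral_eq_integral(1))
  have K0: "0 \<le> K" using u by linarith
  have inc: "\<bar>(llr b \<omega> - ?q b) - (llr a \<omega> - ?q a)\<bar> \<le> integral {-K..K} (\<lambda>w. \<bar>?e w\<bar>)"
    if ab: "-K \<le> a" "a \<le> b" "b \<le> K" for a b
  proof -
    have sub: "{a..b} \<subseteq> {-K..K}" using ab by auto
    have "((\<lambda>w. score 0 \<omega> - F * w) has_integral (?q b - ?q a)) {a..b}"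
      by (rule fundamental_theorem_of_calculus[OF ab(2)])
        (auto simp: has_real_derivative_iff_has_vector_derivative[symmetric] intro!: derivative_eq_intros)
    moreover have "(?e has_integral integral {a..b} ?e) {a..b}"
      by (rule integrable_integral[OF integrable_on_subinterval[OF hk(1) sub]])
    ultimately have "((\<lambda>w. ?e w + (score 0 \<omega> - F * w)) has_integral (integral {a..b} ?e + (?q b - ?q a))) {a..b}"
      by (rule has_integral_add[rotated])
    then have "integral {a..b} (\<lambda>w. score w \<omega>) = integral {a..b} ?e + (?q b - ?q a)"
      by (simp add: lan_error_def integral_unique)
    moreover have "llr b \<omega> - llr a \<omega> = integral {a..b} (\<lambda>w. score w \<omega>)"
      by (rule llr_increment[OF \<omega>]) (use ab K K0 in auto)
    moreover have "\<bar>integral {a..b} ?e\<bar> \<le> integral {a..b} (\<lambda>w. \<bar>?e w\<bar>)"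
      using integral_norm_bound_integral[of ?e "{a..b}" "\<lambda>w. \<bar>?e w\<bar>"]
        integrable_on_subinterval[OF hk(1) sub] integrable_on_subinterval[OF hk(3) sub] by auto
    moreover have "integral {a..b} (\<lambda>w. \<bar>?e w\<bar>) \<le> integral {-K..K} (\<lambda>w. \<bar>?e w\<bar>)"
      by (rule integral_subset_le[OF sub integrable_on_subinterval[OF hk(3) sub] hk(3)]) simp
    ultimately show ?thesis by simp
  qed
  have "\<bar>llr u \<omega> - ?q u\<bar> \<le> integral {-K..K} (\<lambda>w. \<bar>?e w\<bar>)"
    using inc[of 0 u] inc[of u 0] u by (cases "0 \<le> u") (auto simp: llr_0)
  also have "\<dots> \<le> integral {-K..K} (\<lambda>w. \<eta> / 2 + (?e w)\<^sup>2 / (2 * \<eta>))"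
  proof (rule integral_le[OF hk(3)])
    show "(\<lambda>w. \<eta> / 2 + (?e w)\<^sup>2 / (2 * \<eta>)) integrable_on {-K..K}"
      by (intro integrable_add integrable_on_divide hk(2)) auto
    show "\<bar>?e w\<bar> \<le> \<eta> / 2 + (?e w)\<^sup>2 / (2 * \<eta>)" for w
    proof -
      have "0 \<le> (\<eta> - \<bar>?e w\<bar>)\<^sup>2" by simp
      then have "2 * \<eta> * \<bar>?e w\<bar> \<le> \<eta>\<^sup>2 + (?e w)\<^sup>2" by (simp add: power2_diff)
      then show ?thesis using \<eta> by (simp add: field_simps power2_eq_square)
    qed
  qed
  also have "\<dots> = K * \<eta> + integral {-K..K} (\<lambda>w. (?e w)\<^sup>2) / (2 * \<eta>)"
    using hk(2) K0 by (subst Henstock_Kurzweil_Integration.integral_add) (auto intro!: integrable_on_divide)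
  finally show ?thesis unfolding set_borel_integral_eq_integral(2)[OF int(2)] .
qed

text \<open>
  Only local parameters in the interior are compared with the maximiser, because the supremum ranges over the
  open parameter interval; the maximiser itself may be an endpoint.
\<close>

lemma MLE_properties:
  assumes \<omega>: "\<omega> \<in> space M" and d: "d = \<delta> n" and x: "x \<in> {\<alpha>..\<beta>}"
    and sup: "likelihood \<psi> r \<tau> \<delta> n x (X \<omega>) = (SUP v\<in>{\<alpha><..<\<beta>}. likelihood \<psi> r \<tau> \<delta> n v (X \<omega>))"
  shows "(x - \<theta>) / \<phi> \<in> {ul..ur}" and "\<And>u. u \<in> {ul<..<ur} \<Longrightarrow> llr u \<omega> \<le> llr ((x - \<theta>) / \<phi>) \<omega>"
proof -
  let ?L = "\<lambda>v. likelihood \<psi> r \<tau> \<delta> n v (X \<omega>)"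
  have par_u: "par ((v - \<theta>) / \<phi>) = v" for v using \<phi>_pos by (simp add: par_def)
  show "(x - \<theta>) / \<phi> \<in> {ul..ur}" using par_in_iff[of "(x - \<theta>) / \<phi>"] x by (simp add: par_u)
  have L: "?L v = exp (llr ((v - \<theta>) / \<phi>) \<omega> + loglik \<theta> \<omega> + real n * \<tau>)" for v
    unfolding likelihood_eq[where \<delta>=\<delta>, OF \<omega> d] llr_def par_u by simp
  have bdd: "bdd_above (?L ` {\<alpha><..<\<beta>})"
  proof (rule bdd_aboveI2)
    fix v
    show "?L v \<le> exp (2 * ((\<bar>ln lo\<bar> + \<bar>ln hi\<bar>) * total \<omega> + real n * (hi * \<tau>)) + loglik \<theta> \<omega> + real n * \<tau>)"
      unfolding L using abs_llr_le[OF \<omega>, of "(v - \<theta>) / \<phi>"] by auto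
  qed
  fix u assume u: "u \<in> {ul<..<ur}"
  then have "par u \<in> {\<alpha><..<\<beta>}" using \<phi>_pos by (auto simp: par_def ul_def ur_def field_simps)
  then have "?L (par u) \<le> ?L x" unfolding sup by (intro cSUP_upper bdd)
  moreover have "(par u - \<theta>) / \<phi> = u" using \<phi>_pos by (simp add: par_def)
  ultimately show "llr u \<omega> \<le> llr ((x - \<theta>) / \<phi>) \<omega>" unfolding L by simp
qed

end

context ramp_sequence
begin

text \<open>
  The likelihood ratio at the maximiser is at least \<open>1\<close>, its value at the true parameter, whereas the envelope
  forces it to be small far away.
\<close>

lemma MLE_growth:
  assumes n: "N0 \<le> n" and \<omega>: "\<omega> \<in> space (M n)" and x: "x \<in> {\<alpha>..\<beta>}"
    and sup: "likelihood \<psi> r \<tau> \<delta> n x (X n \<omega>) = (SUP v\<in>{\<alpha><..<\<beta>}. likelihood \<psi> r \<tau> \<delta> n v (X n \<omega>))"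
  shows "exp (kap / 4 * \<bar>(x - t n) / phi n\<bar>) \<le> VV n \<omega>"
proof -
  interpret ramp_experiment \<alpha> \<beta> \<tau> r \<psi> n "\<delta> n" "t n" "M n" "X n" by (rule exper[OF n])
  note P = MLE_properties[OF \<omega> refl x sup]
  have "llr 0 \<omega> \<le> llr ((x - t n) / \<phi>) \<omega>" by (rule P(2)) (use ul_less ur_greater in auto)
  then have "kap / 4 * \<bar>(x - t n) / \<phi>\<bar> \<le> weighted ((x - t n) / \<phi>) \<omega>" by (simp add: weighted_def llr_0)
  then show ?thesis using exp_weighted_le_V[OF \<omega> P(1)] by (meson exp_le_cancel_iff order.trans)
qed

text \<open>
  The maximiser \<open>y\<close> and the vertex \<open>m = D / F\<close> of the approximating parabola both lie in \<open>[-K, K]\<close>: the former by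
  the envelope, the latter because \<open>D\<close> is bounded. Comparing \<open>llr\<close> at the two points, the
  parabola drops by \<open>F (y - m)\<^sup>2 / 2\<close>, which is at most twice the approximation error.
\<close>

lemma MLE_expansion:
  assumes e: "0 < e" and B: "0 < B"
  obtains K \<eta> N where "0 < \<eta>" and "\<And>n \<omega> x. N \<le> n \<Longrightarrow> \<omega> \<in> space (M n) \<Longrightarrow> x \<in> {\<alpha>..\<beta>} \<Longrightarrow>
      likelihood \<psi> r \<tau> \<delta> n x (X n \<omega>) = (SUP v\<in>{\<alpha><..<\<beta>}. likelihood \<psi> r \<tau> \<delta> n v (X n \<omega>)) \<Longrightarrow>
      VV n \<omega> \<le> B \<Longrightarrow> \<bar>sc n 0 \<omega>\<bar> \<le> B \<Longrightarrow> Q K n \<omega> \<le> \<eta> \<Longrightarrow> \<bar>(x - t n) / phi n - sc n 0 \<omega> / F0\<bar> \<le> e"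
proof -
  define K where "K = 4 * B / kap + B / F0 + 1"
  have K1: "4 * B / kap < K" "B / F0 < K" "0 < K" using B kap_pos F0_pos by (auto simp: K_def add_pos_pos)
  define \<rho> where "\<rho> = F0 * e\<^sup>2 / 8"
  have \<rho>: "0 < \<rho>" using F0_pos e by (simp add: \<rho>_def)
  define \<eta>1 where "\<eta>1 = \<rho> / K"
  have \<eta>1: "0 < \<eta>1" using \<rho> K1 by (simp add: \<eta>1_def)
  obtain N where N: "\<And>n. N \<le> n \<Longrightarrow> {-K..K} \<subseteq> {ulow n..uupp n}"
    using eventually_range[of K] by (auto simp: eventually_sequentially)
  show ?thesis
  proof (rule that[where K=K and N="max N N0" and \<eta>="2 * \<eta>1 * \<rho>"])
    show "0 < 2 * \<eta>1 * \<rho>" using \<rho> \<eta>1 by simp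
    fix n \<omega> x
    assume n: "max N N0 \<le> n" and \<omega>: "\<omega> \<in> space (M n)" and x: "x \<in> {\<alpha>..\<beta>}"
      and sup: "likelihood \<psi> r \<tau> \<delta> n x (X n \<omega>) = (SUP v\<in>{\<alpha><..<\<beta>}. likelihood \<psi> r \<tau> \<delta> n v (X n \<omega>))"
      and VB: "VV n \<omega> \<le> B" and DB: "\<bar>sc n 0 \<omega>\<bar> \<le> B" and QB: "Q K n \<omega> \<le> 2 * \<eta>1 * \<rho>"
    have n0: "N0 \<le> n" and K: "{-K..K} \<subseteq> {ulow n..uupp n}" using n N by auto
    interpret ramp_experiment \<alpha> \<beta> \<tau> r \<psi> n "\<delta> n" "t n" "M n" "X n" by (rule exper[OF n0])
    define y where "y = (x - t n) / phi n"
    define m where "m = score 0 \<omega> / F0"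
    have "kap / 4 * \<bar>y\<bar> \<le> B"
      using MLE_growth[OF n0 \<omega> x sup] VB exp_ge_add_one_self[of "kap / 4 * \<bar>y\<bar>"] unfolding y_def by linarith
    then have "\<bar>y\<bar> \<le> 4 * B / kap" using kap_pos by (simp add: pos_le_divide_eq mult.commute)
    then have y: "\<bar>y\<bar> \<le> K" using K1 by simp
    have "\<bar>m\<bar> \<le> B / F0" unfolding m_def abs_divide using DB F0_pos by (simp add: divide_right_mono)
    then have m: "\<bar>m\<bar> < K" using K1 by simp
    have approx: "\<bar>llr u \<omega> - (u * score 0 \<omega> - F0 / 2 * u\<^sup>2)\<bar> \<le> 2 * \<rho>" if "\<bar>u\<bar> \<le> K" for u
    proof -
      have "\<bar>llr u \<omega> - (u * score 0 \<omega> - F0 / 2 * u\<^sup>2)\<bar> \<le> K * \<eta>1 + Q K n \<omega> / (2 * \<eta>1)"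
        unfolding Q_def by (rule llr_quadratic[OF \<omega> K that \<eta>1 err_sq_integrable(2,1)[OF n0 \<omega>]])
      also have "\<dots> \<le> \<rho> + \<rho>"
      proof (rule add_mono)
        show "K * \<eta>1 \<le> \<rho>" using K1 by (simp add: \<eta>1_def)
        show "Q K n \<omega> / (2 * \<eta>1) \<le> \<rho>" using QB \<eta>1 by (simp add: pos_divide_le_eq mult_ac)
      qed
      finally show ?thesis by simp
    qed
    have "m \<in> {ul<..<ur}"
    proof -
      have "-K \<in> {ul..ur}" "K \<in> {ul..ur}" using K K1 by auto
      then show ?thesis using m by auto
    qed
    then have "llr m \<omega> \<le> llr y \<omega>" using MLE_properties(2)[OF \<omega> refl x sup] by (simp add: y_def)
    then have "(m * score 0 \<omega> - F0 / 2 * m\<^sup>2) - (y * score 0 \<omega> - F0 / 2 * y\<^sup>2) \<le> 4 * \<rho>"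
      using approx[of m] approx[of y] m y by simp
    moreover have "score 0 \<omega> = F0 * m" using F0_pos by (simp add: m_def)
    then have "(m * score 0 \<omega> - F0 / 2 * m\<^sup>2) - (y * score 0 \<omega> - F0 / 2 * y\<^sup>2) = F0 / 2 * (y - m)\<^sup>2"
      by (simp add: power2_eq_square algebra_simps)
    ultimately have "F0 / 2 * (y - m)\<^sup>2 \<le> F0 / 2 * e\<^sup>2" by (simp add: \<rho>_def)
    then have "(y - m)\<^sup>2 \<le> e\<^sup>2" using F0_pos by simp
    then have "\<bar>y - m\<bar> \<le> \<bar>e\<bar>" by (simp add: abs_le_square_iff)
    then show "\<bar>(x - t n) / phi n - sc n 0 \<omega> / F0\<bar> \<le> e" using e by (simp add: y_def m_def)
  qed
qed

end

section \<open>The Bayesian estimator\<close>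

lemma abs_exp_minus_one_le:
  fixes x :: real
  assumes "\<bar>x\<bar> \<le> 1"
  shows "\<bar>exp x - 1\<bar> \<le> 4 * \<bar>x\<bar>"
proof -
  have "exp \<bar>x\<bar> \<le> exp 1" using assms by simp
  then have "exp \<bar>x\<bar> \<le> 3" using exp_le by linarith
  moreover have "x\<^sup>2 \<le> \<bar>x\<bar>" using assms mult_left_le[of "\<bar>x\<bar>" "\<bar>x\<bar>"] by (simp add: power2_eq_square)
  ultimately have "x\<^sup>2 * exp \<bar>x\<bar> \<le> \<bar>x\<bar> * 3" by (intro mult_mono) auto
  then show ?thesis using exp_second_order[of x] by linarith
qed

locale bayes_sequence = ramp_sequence +
  fixes q :: "real \<Rightarrow> real"
  assumes q: "prior_density \<alpha> \<beta> q"
begin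

text \<open>
  Extension by zero; every integral over the parameter interval becomes one over the whole line.
\<close>

definition prior :: "real \<Rightarrow> real" where "prior v = indicator {\<alpha><..<\<beta>} v * q v"

definition post :: "nat \<Rightarrow> 'a \<Rightarrow> real \<Rightarrow> real" where
  "post n \<omega> u = prior (t n + phi n * u) * exp (lr n u \<omega>)"

definition weight :: "nat \<Rightarrow> real \<Rightarrow> real" where
  "weight n u = prior (t n + phi n * u) * exp (- (kap / 4) * \<bar>u\<bar>)"

abbreviation "q0 \<equiv> q \<theta>0"

lemma prior_nonneg: "0 \<le> prior v"
  using q by (auto simp: prior_def prior_density_def indicator_def less_imp_le)

lemma prior_integrable: "integrable lborel prior" and prior_integral: "(LINT v|lborel. prior v) = 1"
proof -
  have "prior = (\<lambda>v. indicator {\<alpha><..<\<beta>} v *\<^sub>R q v)" by (simp add: prior_def fun_eq_iff)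
  then show "integrable lborel prior" "(LINT v|lborel. prior v) = 1"
    using q by (simp_all add: prior_density_def set_integrable_def set_lebesgue_integral_def)
qed

lemma prior_measurable[measurable]: "prior \<in> borel_measurable borel"
  using borel_measurable_integrable[OF prior_integrable] by simp

lemma q0_pos: "0 < q0" using q \<theta>0_in by (simp add: prior_density_def)

lemma prior_continuous:
  assumes "0 < e"
  obtains \<rho> where "0 < \<rho>" "\<And>v. \<bar>v - \<theta>0\<bar> \<le> \<rho> \<Longrightarrow> \<bar>prior v - q0\<bar> \<le> e"
proof -
  have "isCont q \<theta>0"
    using q \<theta>0_in continuous_on_interior[of "{\<alpha><..<\<beta>}" q \<theta>0] by (simp add: prior_density_def interior_open)
  then obtain \<rho>1 where \<rho>1: "0 < \<rho>1" "\<And>v. dist v \<theta>0 < \<rho>1 \<Longrightarrow> dist (q v) q0 < e"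
    using assms unfolding continuous_at_eps_delta by blast
  define \<rho> where "\<rho> = min (\<rho>1 / 2) (min ((\<theta>0 - \<alpha>) / 2) ((\<beta> - \<theta>0) / 2))"
  have "0 < \<rho>" using \<rho>1 \<theta>0_in by (simp add: \<rho>_def)
  moreover have "\<bar>prior v - q0\<bar> \<le> e" if v: "\<bar>v - \<theta>0\<bar> \<le> \<rho>" for v
  proof -
    have "\<rho> < \<rho>1" "\<rho> < \<theta>0 - \<alpha>" "\<rho> < \<beta> - \<theta>0" using \<rho>1 \<theta>0_in by (auto simp: \<rho>_def min_def)
    then have "dist v \<theta>0 < \<rho>1" "v \<in> {\<alpha><..<\<beta>}" using v by (auto simp: dist_real_def)
    then show ?thesis using \<rho>1(2)[of v] by (simp add: prior_def dist_real_def less_imp_le)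
  qed
  ultimately show ?thesis by (rule that)
qed

lemma eventually_prior_close:
  assumes "0 < e"
  shows "\<forall>\<^sub>F n in sequentially. \<forall>u. \<bar>u\<bar> \<le> K \<longrightarrow> \<bar>prior (t n + phi n * u) - q0\<bar> \<le> e"
proof -
  obtain \<rho> where \<rho>: "0 < \<rho>" "\<And>v. \<bar>v - \<theta>0\<bar> \<le> \<rho> \<Longrightarrow> \<bar>prior v - q0\<bar> \<le> e" using prior_continuous[OF assms] by blast
  have "(\<lambda>n. \<bar>t n - \<theta>0\<bar> + phi n * \<bar>K\<bar>) \<longlonglongrightarrow> \<bar>\<theta>0 - \<theta>0\<bar> + 0 * \<bar>K\<bar>" by (intro tendsto_intros t_lim phi_tendsto)
  then have "\<forall>\<^sub>F n in sequentially. \<bar>t n - \<theta>0\<bar> + phi n * \<bar>K\<bar> < \<rho>" by (rule order_tendstoD) (use \<rho> in simp)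
  then show ?thesis using eventually_phi_pos
  proof eventually_elim
    case (elim n)
    show ?case
    proof (intro allI impI)
      fix u assume "\<bar>u\<bar> \<le> K"
      then have "phi n * \<bar>u\<bar> \<le> phi n * \<bar>K\<bar>" using elim by (intro mult_left_mono) auto
      moreover have "\<bar>phi n * u\<bar> = phi n * \<bar>u\<bar>" using elim by (simp add: abs_mult)
      ultimately have "\<bar>t n + phi n * u - \<theta>0\<bar> \<le> \<rho>" using elim by linarith
      then show "\<bar>prior (t n + phi n * u) - q0\<bar> \<le> e" by (rule \<rho>(2))
    qed
  qed
qed

lemma LINT_local_coordinate:
  fixes h :: "real \<Rightarrow> real"
  assumes "N0 \<le> n"
  shows "(LINT v|lborel. h v) = phi n * (LINT u|lborel. h (t n + phi n * u))"
  using lborel_integral_real_affine[of "phi n" h "t n"] ramp_experiment.\<phi>_pos[OF exper[OF assms]] by simp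

lemma post_measurable:
  assumes "N0 \<le> n" "\<omega> \<in> space (M n)"
  shows "post n \<omega> \<in> borel_measurable borel"
proof -
  interpret ramp_experiment \<alpha> \<beta> \<tau> r \<psi> n "\<delta> n" "t n" "M n" "X n" by (rule exper[OF assms(1)])
  show ?thesis using path_measurable[OF llr_measurable_pair assms(2)] unfolding post_def by measurable
qed

text \<open>
  The envelope bounds the square of \<open>exp (weighted u)\<close>, that is, the likelihood ratio times \<open>exp (\<kappa> \<bar>u\<bar> / 2)\<close>.
  Half of this decay goes into the weight, the other half stays explicit.
\<close>

lemma post_le_weight:
  assumes n: "N0 \<le> n" and \<omega>: "\<omega> \<in> space (M n)"
  shows "post n \<omega> u \<le> (VV n \<omega>)\<^sup>2 * exp (- (kap / 4) * \<bar>u\<bar>) * weight n u"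
proof -
  interpret ramp_experiment \<alpha> \<beta> \<tau> r \<psi> n "\<delta> n" "t n" "M n" "X n" by (rule exper[OF n])
  show ?thesis
  proof (cases "prior (t n + \<phi> * u) = 0")
    case True
    then show ?thesis by (simp add: post_def weight_def)
  next
    case False
    then have "par u \<in> {\<alpha>..\<beta>}" by (auto simp: prior_def par_def indicator_def split: if_splits)
    then have u: "u \<in> {ul..ur}" by (rule par_in_iff[THEN iffD1])
    have "exp (llr u \<omega>) = (exp (weighted u \<omega>))\<^sup>2 * (exp (- (kap / 4) * \<bar>u\<bar>) * exp (- (kap / 4) * \<bar>u\<bar>))"
      by (simp add: weighted_def power2_eq_square exp_add[symmetric])
    also have "\<dots> \<le> (V \<omega>)\<^sup>2 * (exp (- (kap / 4) * \<bar>u\<bar>) * exp (- (kap / 4) * \<bar>u\<bar>))"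
      by (intro mult_right_mono power_mono exp_weighted_le_V[OF \<omega> u]) auto
    finally have "prior (t n + \<phi> * u) * exp (llr u \<omega>) \<le>
        prior (t n + \<phi> * u) * ((V \<omega>)\<^sup>2 * (exp (- (kap / 4) * \<bar>u\<bar>) * exp (- (kap / 4) * \<bar>u\<bar>)))"
      by (intro mult_left_mono prior_nonneg)
    then show ?thesis by (simp add: post_def weight_def mult_ac)
  qed
qed

text \<open>
  The prior may be unbounded near the ends of the parameter interval. Near the true value it is bounded by
  continuity; far away the exponential factor is of smaller order than the scale \<open>phi n\<close>, and total
  mass one of the prior is enough.
\<close>

lemma weight_bound:
  obtains CQ N where "0 \<le> CQ" "N0 \<le> N" "\<And>n. N \<le> n \<Longrightarrow> integrable lborel (weight n)" "\<And>n. N \<le> n \<Longrightarrow> (LINT u|lborel. weight n u) \<le> CQ"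
proof -
  let ?c = "kap / 4"
  obtain \<rho> where \<rho>: "0 < \<rho>" "\<And>v. \<bar>v - \<theta>0\<bar> \<le> \<rho> \<Longrightarrow> \<bar>prior v - q0\<bar> \<le> 1" using prior_continuous[of 1] by auto
  have "\<forall>\<^sub>F n in sequentially. dist (t n) \<theta>0 < \<rho> / 2" by (rule tendstoD[OF t_lim]) (use \<rho> in simp)
  then obtain N1 where N1: "\<And>n. N1 \<le> n \<Longrightarrow> \<bar>t n - \<theta>0\<bar> < \<rho> / 2" by (auto simp: eventually_sequentially dist_real_def)
  define CQ where "CQ = (q0 + 1) * (2 / ?c) + 2 / (?c * \<rho>)"
  have main: "integrable lborel (weight n) \<and> (LINT u|lborel. weight n u) \<le> CQ" if n: "max N0 N1 \<le> n" for n
  proof -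
    have n0: "N0 \<le> n" using n by simp
    interpret ramp_experiment \<alpha> \<beta> \<tau> r \<psi> n "\<delta> n" "t n" "M n" "X n" by (rule exper[OF n0])
    define x where "x = ?c * (\<rho> / (2 * \<phi>))"
    have x: "0 < x" using kap_pos \<rho> \<phi>_pos by (simp add: x_def)
    let ?g = "\<lambda>u. (q0 + 1) * (indicator {ul..ur} u * exp (- ?c * \<bar>u\<bar>)) + exp (- x) * prior (t n + \<phi> * u)"
    have ie: "set_integrable lborel {ul..ur} (\<lambda>u. exp (- ?c * \<bar>u\<bar>))"
      by (intro borel_integrable_atLeastAtMost' continuous_intros)
    have ip: "integrable lborel (\<lambda>u. prior (t n + \<phi> * u))"
      using lborel_integrable_real_affine[OF prior_integrable, of \<phi> "t n"] \<phi>_pos by simp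
    have ig: "integrable lborel ?g"
      using ie ip by (intro Bochner_Integration.integrable_add integrable_mult_right) (auto simp: set_integrable_def)
    have le: "weight n u \<le> ?g u" for u
    proof (cases "prior (t n + \<phi> * u) = 0")
      case True
      then show ?thesis using q0_pos by (simp add: weight_def)
    next
      case False
      then have "par u \<in> {\<alpha>..\<beta>}" by (auto simp: prior_def par_def indicator_def split: if_splits)
      then have u: "u \<in> {ul..ur}" by (rule par_in_iff[THEN iffD1])
      show ?thesis
      proof (cases "\<phi> * \<bar>u\<bar> \<le> \<rho> / 2")
        case True
        have "\<bar>\<phi> * u\<bar> \<le> \<rho> / 2" using True \<phi>_pos by (simp add: abs_mult)
        moreover have "\<bar>t n - \<theta>0\<bar> < \<rho> / 2" by (rule N1) (use n in simp)
        ultimately have "\<bar>t n + \<phi> * u - \<theta>0\<bar> \<le> \<rho>" by linarith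
        then have "prior (t n + \<phi> * u) \<le> q0 + 1" using \<rho>(2)[of "t n + \<phi> * u"] by linarith
        then have "weight n u \<le> (q0 + 1) * exp (- ?c * \<bar>u\<bar>)" unfolding weight_def by (intro mult_right_mono) auto
        moreover have "0 \<le> exp (- x) * prior (t n + \<phi> * u)" using prior_nonneg by simp
        ultimately show ?thesis using u by simp
      next
        case False
        then have "\<rho> / (2 * \<phi>) \<le> \<bar>u\<bar>" using \<phi>_pos by (simp add: pos_divide_le_eq mult_ac)
        then have "x \<le> ?c * \<bar>u\<bar>" unfolding x_def using kap_pos by (intro mult_left_mono) auto
        then have "weight n u \<le> prior (t n + \<phi> * u) * exp (- x)" unfolding weight_def by (intro mult_left_mono prior_nonneg) simp
        moreover have "0 \<le> (q0 + 1) * (indicator {ul..ur} u * exp (- ?c * \<bar>u\<bar>))" using q0_pos by simp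
        ultimately show ?thesis by (simp add: mult.commute)
      qed
    qed
    have wm: "weight n \<in> borel_measurable lborel" unfolding weight_def by measurable
    have wn: "0 \<le> weight n u" for u using prior_nonneg by (simp add: weight_def)
    have iw: "integrable lborel (weight n)"
      by (rule Bochner_Integration.integrable_bound[OF ig wm]) (use order.trans[OF le abs_ge_self] wn in auto)
    have "(LINT u|lborel. weight n u) \<le> (LINT u|lborel. ?g u)" by (rule integral_mono[OF iw ig le])
    also have "\<dots> = (q0 + 1) * (LBINT u:{ul..ur}. exp (- ?c * \<bar>u\<bar>)) + exp (- x) * (LINT u|lborel. prior (t n + \<phi> * u))"
      using ie ip by (subst Bochner_Integration.integral_add) (auto simp: set_integrable_def set_lebesgue_integral_def)
    also have "(LINT u|lborel. prior (t n + \<phi> * u)) = 1 / \<phi>"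
      using LINT_local_coordinate[OF n0, of prior] prior_integral \<phi>_pos by (simp add: field_simps)
    also have "(q0 + 1) * (LBINT u:{ul..ur}. exp (- ?c * \<bar>u\<bar>)) + exp (- x) * (1 / \<phi>) \<le> CQ"
      unfolding CQ_def
    proof (rule add_mono)
      show "(q0 + 1) * (LBINT u:{ul..ur}. exp (- ?c * \<bar>u\<bar>)) \<le> (q0 + 1) * (2 / ?c)"
        using integral_exp_minus_abs_le[of ?c ul ur] kap_pos ul_less ur_greater q0_pos by (intro mult_left_mono) auto
      \<comment> \<open>In the original parameter the prior has mass one, in the local one 1 / phi, which x * exp (- x) <= 1 absorbs.\<close>
      have "x \<le> exp x" using exp_ge_add_one_self[of x] by linarith
      then have "x * exp (- x) \<le> 1" by (simp add: exp_minus field_simps)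
      moreover have "1 / \<phi> = x * (2 / (?c * \<rho>))" using kap_pos \<rho> \<phi>_pos by (simp add: x_def field_simps)
      then have "exp (- x) * (1 / \<phi>) = (x * exp (- x)) * (2 / (?c * \<rho>))" by simp
      ultimately show "exp (- x) * (1 / \<phi>) \<le> 2 / (?c * \<rho>)"
        using mult_right_mono[of "x * exp (- x)" 1 "2 / (?c * \<rho>)"] kap_pos \<rho> by simp
    qed
    finally show ?thesis using iw by simp
  qed
  show ?thesis
  proof (rule that[of CQ "max N0 N1"])
    show "0 \<le> CQ" using q0_pos kap_pos \<rho> by (simp add: CQ_def)
  qed (use main in auto)
qed

lemma J_pos:
  assumes n: "N0 \<le> n" and \<omega>: "\<omega> \<in> space (M n)"
  shows "0 < JJ n \<omega>"
proof -
  interpret ramp_experiment \<alpha> \<beta> \<tau> r \<psi> n "\<delta> n" "t n" "M n" "X n" by (rule exper[OF n])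
  define B where "B = 2 * ((\<bar>ln lo\<bar> + \<bar>ln hi\<bar>) * total \<omega> + real n * (hi * \<tau>))"
  have "exp (- B) = (LBINT u:{0..1::real}. exp (- B))" by (simp add: LBINT_const_Icc)
  also have "\<dots> \<le> J \<omega>" unfolding J_def
  proof (rule set_integral_mono)
    show "set_integrable lborel {0..1::real} (\<lambda>_. exp (- B))" by (rule set_integrable_Icc_bounded[where C="exp (- B)"]) auto
    show "set_integrable lborel {0..1} (\<lambda>u. exp (- llr u \<omega>))" using exp_llr_integrable[OF \<omega>, of 0 1 "-1"] by simp
    show "exp (- B) \<le> exp (- llr u \<omega>)" for u using abs_llr_le[OF \<omega>, of u] by (simp add: B_def abs_le_iff)
  qed
  finally show ?thesis using exp_gt_zero[of "- B"] by linarith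
qed

text \<open>
  Jensen's inequality for the reciprocal on \<open>[0, 1]\<close>, in the form \<open>x \<ge> 2 s - s\<^sup>2 / x\<close> with \<open>s = 1 / J\<close>; the prior is at
  least half its value at the limit point there.
\<close>

lemma mass_ge:
  obtains N where "N0 \<le> N" "\<And>n \<omega>. N \<le> n \<Longrightarrow> \<omega> \<in> space (M n) \<Longrightarrow> integrable lborel (post n \<omega>) \<Longrightarrow>
      q0 / 2 / JJ n \<omega> \<le> (LINT u|lborel. post n \<omega> u)"
proof -
  obtain N1 where N1: "\<And>n u. N1 \<le> n \<Longrightarrow> \<bar>u\<bar> \<le> 1 \<Longrightarrow> \<bar>prior (t n + phi n * u) - q0\<bar> \<le> q0 / 2"
    using eventually_prior_close[of "q0 / 2" 1] q0_pos by (auto simp: eventually_sequentially)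
  show ?thesis
  proof (rule that[of "max N0 N1"])
    fix n \<omega> assume n: "max N0 N1 \<le> n" and \<omega>: "\<omega> \<in> space (M n)" and ip: "integrable lborel (post n \<omega>)"
    have n0: "N0 \<le> n" using n by simp
    interpret ramp_experiment \<alpha> \<beta> \<tau> r \<psi> n "\<delta> n" "t n" "M n" "X n" by (rule exper[OF n0])
    define s where "s = 1 / J \<omega>"
    have J: "0 < J \<omega>" by (rule J_pos[OF n0 \<omega>])
    have i: "set_integrable lborel {0..1} (\<lambda>u. exp (c * llr u \<omega>))" for c by (rule exp_llr_integrable[OF \<omega>])
    have i1: "set_integrable lborel {0..1} (\<lambda>u. exp (llr u \<omega>))" "set_integrable lborel {0..1} (\<lambda>u. exp (- llr u \<omega>))"
      using i[of 1] i[of "-1"] by simp_all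
    have ic: "set_integrable lborel {0..1::real} (\<lambda>_. 2 * s)" by (rule set_integrable_Icc_bounded[where C="\<bar>2 * s\<bar>"]) auto
    have "s = 2 * s - s\<^sup>2 * J \<omega>" using J by (simp add: s_def power2_eq_square)
    also have "\<dots> = (LBINT u:{0..1}. 2 * s - s\<^sup>2 * exp (- llr u \<omega>))"
      using ic i1(2) by (subst set_integral_diff(2)) (auto simp: J_def LBINT_const_Icc)
    also have "\<dots> \<le> (LBINT u:{0..1}. exp (llr u \<omega>))"
    proof (rule set_integral_mono[OF _ i1(1)])
      show "set_integrable lborel {0..1} (\<lambda>u. 2 * s - s\<^sup>2 * exp (- llr u \<omega>))"
        using i1(2) by (intro set_integral_diff(1)[OF ic] set_integrable_mult_right)
      fix u
      have "0 \<le> (exp (llr u \<omega>) - s)\<^sup>2 * exp (- llr u \<omega>)" by simp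
      also have "\<dots> = exp (llr u \<omega>) * (exp (llr u \<omega>) * exp (- llr u \<omega>)) - 2 * s * (exp (llr u \<omega>) * exp (- llr u \<omega>)) + s\<^sup>2 * exp (- llr u \<omega>)"
        by (simp add: power2_eq_square algebra_simps)
      also have "exp (llr u \<omega>) * exp (- llr u \<omega>) = 1" by (simp add: exp_add[symmetric])
      finally show "2 * s - s\<^sup>2 * exp (- llr u \<omega>) \<le> exp (llr u \<omega>)" by simp
    qed
    finally have "q0 / 2 * s \<le> q0 / 2 * (LBINT u:{0..1}. exp (llr u \<omega>))" using q0_pos by (intro mult_left_mono) auto
    also have "\<dots> = (LINT u|lborel. q0 / 2 * (indicator {0..1} u * exp (llr u \<omega>)))" by (simp add: set_lebesgue_integral_def)
    also have "\<dots> \<le> (LINT u|lborel. post n \<omega> u)"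
    proof (rule integral_mono[OF _ ip])
      show "integrable lborel (\<lambda>u. q0 / 2 * (indicator {0..1} u * exp (llr u \<omega>)))" using i1(1) by (simp add: set_integrable_def)
      show "q0 / 2 * (indicator {0..1} u * exp (llr u \<omega>)) \<le> post n \<omega> u" for u
      proof (cases "u \<in> {0..1}")
        case True
        then have "\<bar>prior (t n + \<phi> * u) - q0\<bar> \<le> q0 / 2" using N1[of n u] n by auto
        then have "q0 / 2 \<le> prior (t n + \<phi> * u)" by linarith
        then show ?thesis using True unfolding post_def by (auto intro!: mult_right_mono)
      next
        case False
        then show ?thesis using prior_nonneg by (simp add: post_def)
      qed
    qed
    finally show "q0 / 2 / J \<omega> \<le> (LINT u|lborel. post n \<omega> u)" by (simp add: s_def)
  qed simp
qed

text \<open>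
  After the change to the local parameter the common factors \<open>phi n\<close> and the likelihood at the true value cancel in the
  quotient.
\<close>

lemma bayes_eq:
  assumes n: "N0 \<le> n" and \<omega>: "\<omega> \<in> space (M n)" and i: "integrable lborel (post n \<omega>)" "integrable lborel (\<lambda>u. u * post n \<omega> u)"
    and pos: "0 < (LINT u|lborel. post n \<omega> u)"
  shows "(bayes_estimator \<psi> r \<tau> \<delta> \<alpha> \<beta> q n (X n \<omega>) - t n) / phi n = (LINT u|lborel. u * post n \<omega> u) / (LINT u|lborel. post n \<omega> u)"
proof -
  interpret ramp_experiment \<alpha> \<beta> \<tau> r \<psi> n "\<delta> n" "t n" "M n" "X n" by (rule exper[OF n])
  define k where "k = exp (loglik (t n) \<omega> + real n * \<tau>)"
  have k: "0 < k" by (simp add: k_def)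
  have L: "likelihood \<psi> r \<tau> \<delta> n (t n + \<phi> * u) (X n \<omega>) = k * exp (llr u \<omega>)" for u
    unfolding likelihood_eq[where \<delta>=\<delta>, OF \<omega> refl] k_def llr_def par_def by (simp add: exp_add[symmetric])
  have "(LBINT v:{\<alpha><..<\<beta>}. q v * likelihood \<psi> r \<tau> \<delta> n v (X n \<omega>)) = (LINT v|lborel. prior v * likelihood \<psi> r \<tau> \<delta> n v (X n \<omega>))"
    unfolding set_lebesgue_integral_def prior_def by (simp add: mult.assoc)
  also have "\<dots> = \<phi> * (LINT u|lborel. k * post n \<omega> u)"
    unfolding LINT_local_coordinate[OF n, of "\<lambda>v. prior v * likelihood \<psi> r \<tau> \<delta> n v (X n \<omega>)"] L post_def by (simp add: mult_ac)
  finally have den: "(LBINT v:{\<alpha><..<\<beta>}. q v * likelihood \<psi> r \<tau> \<delta> n v (X n \<omega>)) = \<phi> * (k * (LINT u|lborel. post n \<omega> u))" by simp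
  have "(LBINT v:{\<alpha><..<\<beta>}. v * q v * likelihood \<psi> r \<tau> \<delta> n v (X n \<omega>)) = (LINT v|lborel. v * prior v * likelihood \<psi> r \<tau> \<delta> n v (X n \<omega>))"
    unfolding set_lebesgue_integral_def prior_def by (simp add: mult_ac)
  also have "\<dots> = \<phi> * (LINT u|lborel. k * (t n * post n \<omega> u + \<phi> * (u * post n \<omega> u)))"
    unfolding LINT_local_coordinate[OF n, of "\<lambda>v. v * prior v * likelihood \<psi> r \<tau> \<delta> n v (X n \<omega>)"] L post_def by (simp add: algebra_simps)
  also have "\<dots> = \<phi> * (k * (t n * (LINT u|lborel. post n \<omega> u) + \<phi> * (LINT u|lborel. u * post n \<omega> u)))"
    using i by simp
  finally have num: "(LBINT v:{\<alpha><..<\<beta>}. v * q v * likelihood \<psi> r \<tau> \<delta> n v (X n \<omega>)) = \<dots>" .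
  show ?thesis unfolding bayes_estimator_def num den using \<phi>_pos k pos by (simp add: field_simps)
qed

text \<open>
  The facts about the posterior that both estimates below start from, with one threshold for \<open>n\<close>.
\<close>

lemma posterior_setup:
  "\<exists>CQ N. 0 \<le> CQ \<and> N0 \<le> N \<and> (\<forall>n\<ge>N. \<forall>\<omega>\<in>space (M n). posterior (post n \<omega>) (weight n) (kap / 4) (VV n \<omega>) CQ \<and> q0 / 2 / JJ n \<omega> \<le> (LINT u|lborel. post n \<omega> u) \<and>
      (bayes_estimator \<psi> r \<tau> \<delta> \<alpha> \<beta> q n (X n \<omega>) - t n) / phi n = (LINT u|lborel. u * post n \<omega> u) / (LINT u|lborel. post n \<omega> u))"
proof -
  obtain CQ N1 where W: "0 \<le> CQ" "N0 \<le> N1" "\<And>n. N1 \<le> n \<Longrightarrow> integrable lborel (weight n)" "\<And>n. N1 \<le> n \<Longrightarrow> (LINT u|lborel. weight n u) \<le> CQ"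
    by (rule weight_bound) blast
  obtain N2 where N2: "N0 \<le> N2" "\<And>n \<omega>. N2 \<le> n \<Longrightarrow> \<omega> \<in> space (M n) \<Longrightarrow> integrable lborel (post n \<omega>) \<Longrightarrow>
      q0 / 2 / JJ n \<omega> \<le> (LINT u|lborel. post n \<omega> u)" by (rule mass_ge) blast
  have main: "posterior (post n \<omega>) (weight n) (kap / 4) (VV n \<omega>) CQ \<and> q0 / 2 / JJ n \<omega> \<le> (LINT u|lborel. post n \<omega> u) \<and>
      (bayes_estimator \<psi> r \<tau> \<delta> \<alpha> \<beta> q n (X n \<omega>) - t n) / phi n = (LINT u|lborel. u * post n \<omega> u) / (LINT u|lborel. post n \<omega> u)"
    if n: "max N1 N2 \<le> n" and \<omega>: "\<omega> \<in> space (M n)" for n \<omega>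
  proof -
    have n': "N0 \<le> n" "N1 \<le> n" "N2 \<le> n" using n W(2) by auto
    interpret ramp_experiment \<alpha> \<beta> \<tau> r \<psi> n "\<delta> n" "t n" "M n" "X n" by (rule exper[OF n'(1)])
    have V1: "0 < V \<omega>" using V_ge_1[of \<omega>] by linarith
    have wn: "0 \<le> weight n u" for u using prior_nonneg by (simp add: weight_def)
    have pn: "0 \<le> post n \<omega> u" for u using prior_nonneg by (simp add: post_def)
    have "post n \<omega> u \<le> (V \<omega>)\<^sup>2 * weight n u" for u
    proof -
      have "(V \<omega>)\<^sup>2 * exp (- (kap / 4) * \<bar>u\<bar>) * weight n u \<le> (V \<omega>)\<^sup>2 * 1 * weight n u"
        using wn kap_pos by (intro mult_right_mono mult_left_mono) auto
      then show ?thesis using post_le_weight[OF n'(1) \<omega>, of u] by simp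
    qed
    note le = this
    have ip: "integrable lborel (post n \<omega>)"
    proof (rule Bochner_Integration.integrable_bound)
      show "integrable lborel (\<lambda>u. (V \<omega>)\<^sup>2 * weight n u)" using W(3)[OF n'(2)] by simp
      show "AE u in lborel. norm (post n \<omega> u) \<le> norm ((V \<omega>)\<^sup>2 * weight n u)"
        using le pn wn by (intro AE_I2) (simp add: abs_mult)
    qed (use post_measurable[OF n'(1) \<omega>] in simp)
    have mass: "q0 / 2 / J \<omega> \<le> (LINT u|lborel. post n \<omega> u)" by (rule N2(2)[OF n'(3) \<omega> ip])
    have "0 < q0 / 2 / J \<omega>" using q0_pos J_pos[OF n'(1) \<omega>] by simp
    then have mpos: "0 < (LINT u|lborel. post n \<omega> u)" using mass by linarith
    have P: "posterior (post n \<omega>) (weight n) (kap / 4) (V \<omega>) CQ"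
      using kap_pos V1 post_measurable[OF n'(1) \<omega>] pn W(3,4)[OF n'(2)] post_le_weight[OF n'(1) \<omega>] mpos
      by unfold_locales auto
    show ?thesis using P mass bayes_eq[OF n'(1) \<omega> ip posterior.integrable_up[OF P] mpos] by blast
  qed
  show ?thesis
  proof (intro exI[of _ CQ] exI[of _ "max N1 N2"] conjI allI impI ballI)
    show "0 \<le> CQ" by fact
    show "N0 \<le> max N1 N2" using W(2) by simp
  qed (use main in blast)+
qed

text \<open>
  By Jensen's inequality and the lower bound for the mass, \<open>exp (\<kappa> \<bar>U\<bar> / 4)\<close> is at most a constant times \<open>V\<^sup>2 J\<close>. Such a
  product need not be integrable; its fourth root is bounded by the sum of the factors, and this
  is why the rate drops to \<open>\<kappa> / 16\<close>.
\<close>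

lemma bayes_growth:
  obtains C N where "0 \<le> C" "N0 \<le> N" "\<And>n \<omega>. N \<le> n \<Longrightarrow> \<omega> \<in> space (M n) \<Longrightarrow>
      exp (kap / 16 * \<bar>(bayes_estimator \<psi> r \<tau> \<delta> \<alpha> \<beta> q n (X n \<omega>) - t n) / phi n\<bar>) \<le> C * (VV n \<omega> + 1 + JJ n \<omega>)"
proof -
  from posterior_setup obtain CQ N where S0: "0 \<le> CQ" "N0 \<le> N" "\<forall>n\<ge>N. \<forall>\<omega>\<in>space (M n). posterior (post n \<omega>) (weight n) (kap / 4) (VV n \<omega>) CQ \<and> q0 / 2 / JJ n \<omega> \<le> (LINT u|lborel. post n \<omega> u) \<and>
      (bayes_estimator \<psi> r \<tau> \<delta> \<alpha> \<beta> q n (X n \<omega>) - t n) / phi n = (LINT u|lborel. u * post n \<omega> u) / (LINT u|lborel. post n \<omega> u)"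
    by blast
  have S: "0 \<le> CQ" "N0 \<le> N" by fact+
  have S3: "posterior (post n \<omega>) (weight n) (kap / 4) (VV n \<omega>) CQ"
    and S4: "q0 / 2 / JJ n \<omega> \<le> (LINT u|lborel. post n \<omega> u)"
    and S5: "(bayes_estimator \<psi> r \<tau> \<delta> \<alpha> \<beta> q n (X n \<omega>) - t n) / phi n = (LINT u|lborel. u * post n \<omega> u) / (LINT u|lborel. post n \<omega> u)"
    if "N \<le> n" "\<omega> \<in> space (M n)" for n \<omega>
    using S0(3) that by blast+
  define C where "C = max 1 (2 * CQ / q0)"
  show ?thesis
  proof (rule that[of C N, OF _ S(2)])
    show "0 \<le> C" by (simp add: C_def)
    fix n \<omega> assume n: "N \<le> n" and \<omega>: "\<omega> \<in> space (M n)"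
    have n0: "N0 \<le> n" using n S(2) by simp
    interpret ramp_experiment \<alpha> \<beta> \<tau> r \<psi> n "\<delta> n" "t n" "M n" "X n" by (rule exper[OF n0])
    interpret P: posterior "post n \<omega>" "weight n" "kap / 4" "V \<omega>" CQ by (rule S3[OF n \<omega>])
    let ?y = "(bayes_estimator \<psi> r \<tau> \<delta> \<alpha> \<beta> q n (X n \<omega>) - t n) / \<phi>" and ?W = "V \<omega> + 1 + J \<omega>"
    have J: "0 < J \<omega>" by (rule J_pos[OF n0 \<omega>])
    have y: "?y = P.mean" by (rule S5[OF n \<omega>])
    have "exp (kap / 4 * \<bar>?y\<bar>) * (q0 / 2 / J \<omega>) \<le> exp (kap / 4 * \<bar>?y\<bar>) * P.mass"
      by (intro mult_left_mono S4[OF n \<omega>]) simp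
    also have "\<dots> \<le> (V \<omega>)\<^sup>2 * CQ" unfolding y by (rule P.posterior_growth)
    finally have "exp (kap / 4 * \<bar>?y\<bar>) \<le> (V \<omega>)\<^sup>2 * J \<omega> * (2 * CQ / q0)"
      using J q0_pos by (simp add: field_simps)
    also have "\<dots> \<le> ?W ^ 2 * ?W * C"
    proof (intro mult_mono power_mono)
      show "2 * CQ / q0 \<le> C" by (simp add: C_def)
    qed (use J V_ge_1[of \<omega>] S(1) q0_pos in auto)
    also have "\<dots> \<le> ?W ^ 3 * ?W * (C * C ^ 3)"
    proof -
      have W1: "1 \<le> ?W" and C1: "1 \<le> C" using J V_ge_1[of \<omega>] by (auto simp: C_def)
      have "?W ^ 2 * ?W * C = ?W ^ 3 * 1 * (C * 1)" by (simp add: power2_eq_square power3_eq_cube)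
      also have "\<dots> \<le> ?W ^ 3 * ?W * (C * C ^ 3)"
        using W1 C1 by (intro mult_mono) (auto simp: one_le_power)
      finally show ?thesis .
    qed
    also have "\<dots> = (C * ?W) ^ 4" by (simp add: power_mult_distrib eval_nat_numeral)
    finally have "(exp (kap / 16 * \<bar>?y\<bar>)) ^ 4 \<le> (C * ?W) ^ 4" by (simp add: exp_of_nat_mult[symmetric])
    moreover have "0 \<le> C * ?W" using J V_ge_1[of \<omega>] by (auto simp: C_def)
    ultimately show "exp (kap / 16 * \<bar>?y\<bar>) \<le> C * ?W"
      using power_mono_iff[of "exp (kap / 16 * \<bar>?y\<bar>)" "C * ?W" 4] by simp
  qed
qed

text \<open>
  The posterior density is compared with the Gaussian profile of centre \<open>m = D / F0\<close> on a window of radius \<open>K\<close>. The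
  constants are chosen in this order: \<open>K\<close> makes the tail outside the window small, \<open>\<rho>\<close> is the
  tolerated error inside, \<open>R\<close> the error of \<open>llr\<close> that guarantees it, and \<open>K'\<close> bounds the
  window seen from \<open>0\<close>, where the expansion of \<open>llr\<close> is available. The mass is bounded below by means of \<open>J\<close>.
\<close>

lemma bayes_expansion:
  assumes e: "0 < e" and B: "0 < B"
  obtains K \<eta> N where "0 < \<eta>" and "\<And>n \<omega>. N \<le> n \<Longrightarrow> \<omega> \<in> space (M n) \<Longrightarrow>
      VV n \<omega> \<le> B \<Longrightarrow> JJ n \<omega> \<le> B \<Longrightarrow> \<bar>sc n 0 \<omega>\<bar> \<le> B \<Longrightarrow> Q K n \<omega> \<le> \<eta> \<Longrightarrow>
      \<bar>(bayes_estimator \<psi> r \<tau> \<delta> \<alpha> \<beta> q n (X n \<omega>) - t n) / phi n - sc n 0 \<omega> / F0\<bar> \<le> e"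
proof -
  from posterior_setup obtain CQ N1 where S0: "0 \<le> CQ" "N0 \<le> N1" "\<forall>n\<ge>N1. \<forall>\<omega>\<in>space (M n). posterior (post n \<omega>) (weight n) (kap / 4) (VV n \<omega>) CQ \<and> q0 / 2 / JJ n \<omega> \<le> (LINT u|lborel. post n \<omega> u) \<and>
      (bayes_estimator \<psi> r \<tau> \<delta> \<alpha> \<beta> q n (X n \<omega>) - t n) / phi n = (LINT u|lborel. u * post n \<omega> u) / (LINT u|lborel. post n \<omega> u)"
    by blast
  have S: "0 \<le> CQ" "N0 \<le> N1" by fact+
  have S3: "posterior (post n \<omega>) (weight n) (kap / 4) (VV n \<omega>) CQ"
    and S4: "q0 / 2 / JJ n \<omega> \<le> (LINT u|lborel. post n \<omega> u)"
    and S5: "(bayes_estimator \<psi> r \<tau> \<delta> \<alpha> \<beta> q n (X n \<omega>) - t n) / phi n = (LINT u|lborel. u * post n \<omega> u) / (LINT u|lborel. post n \<omega> u)"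
    if "N1 \<le> n" "\<omega> \<in> space (M n)" for n \<omega>
    using S0(3) that by blast+
  let ?c = "kap / 4"
  have c: "0 < ?c" using kap_pos by simp
  define A where "A = B\<^sup>2 * CQ * (2 / ?c * exp (?c * (B / F0))) + 1"
  have A: "0 < A" "B\<^sup>2 * CQ * (2 / ?c * exp (?c * (B / F0))) \<le> A"
    using S(1) c by (auto simp: A_def intro!: add_nonneg_pos)
  define \<epsilon>1 where "\<epsilon>1 = e * q0 / (4 * B * A)"
  have \<epsilon>1: "0 < \<epsilon>1" using e q0_pos B A by (simp add: \<epsilon>1_def)
  define K where "K = max 1 (- (2 / ?c) * ln \<epsilon>1)"
  have K: "0 < K" by (simp add: K_def)
  have eK: "exp (- ?c * K / 2) \<le> \<epsilon>1"
  proof -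
    have "- (2 / ?c) * ln \<epsilon>1 \<le> K" by (simp add: K_def)
    then have "- ?c * K / 2 \<le> ln \<epsilon>1" using c by (simp add: field_simps)
    then have "exp (- ?c * K / 2) \<le> exp (ln \<epsilon>1)" by (rule exp_le_cancel_iff[THEN iffD2])
    then show ?thesis using \<epsilon>1 by simp
  qed
  define \<rho> where "\<rho> = e * q0 / (8 * B * K\<^sup>2)"
  have \<rho>: "0 < \<rho>" using e q0_pos B K by (simp add: \<rho>_def)
  \<comment> \<open>An upper bound for the exponential of the approximating parabola.\<close>
  define E where "E = exp (B\<^sup>2 / (2 * F0))"
  have E: "0 < E" by (simp add: E_def)
  define R where "R = min 1 (\<rho> / (8 * q0 * E))"
  have R: "0 < R" "R \<le> 1" "R \<le> \<rho> / (8 * q0 * E)" using \<rho> q0_pos E by (auto simp: R_def)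
  define K' where "K' = K + B / F0"
  have K': "0 < K'" unfolding K'_def using K B F0_pos by (intro add_pos_pos divide_pos_pos)
  define \<eta>1 where "\<eta>1 = R / (2 * K')"
  have \<eta>1: "0 < \<eta>1" using R K' by (simp add: \<eta>1_def)
  obtain N2 where N2: "\<And>n. N2 \<le> n \<Longrightarrow> {-K'..K'} \<subseteq> {ulow n..uupp n}"
    using eventually_range[of K'] by (auto simp: eventually_sequentially)
  have "0 < \<rho> / (6 * E)" using \<rho> E by simp
  from eventually_prior_close[OF this, of K'] obtain N3
    where N3: "\<And>n u. N3 \<le> n \<Longrightarrow> \<bar>u\<bar> \<le> K' \<Longrightarrow> \<bar>prior (t n + phi n * u) - q0\<bar> \<le> \<rho> / (6 * E)"
    by (auto simp: eventually_sequentially)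
  show ?thesis
  proof (rule that[where K=K' and N="max N1 (max N2 N3)" and \<eta>="\<eta>1 * R"])
    show "0 < \<eta>1 * R" using R \<eta>1 by simp
    fix n \<omega>
    assume n: "max N1 (max N2 N3) \<le> n" and \<omega>: "\<omega> \<in> space (M n)"
      and VB: "VV n \<omega> \<le> B" and JB: "JJ n \<omega> \<le> B" and DB: "\<bar>sc n 0 \<omega>\<bar> \<le> B" and QB: "Q K' n \<omega> \<le> \<eta>1 * R"
    have n': "N0 \<le> n" "N1 \<le> n" "N2 \<le> n" "N3 \<le> n" using n S(2) by auto
    interpret ramp_experiment \<alpha> \<beta> \<tau> r \<psi> n "\<delta> n" "t n" "M n" "X n" by (rule exper[OF n'(1)])
    interpret P: posterior "post n \<omega>" "weight n" ?c "V \<omega>" CQ by (rule S3[OF n'(2) \<omega>])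
    define D where "D = score 0 \<omega>"
    define m where "m = D / F0"
    have m: "\<bar>m\<bar> \<le> B / F0" unfolding m_def abs_divide using DB F0_pos by (simp add: divide_right_mono D_def)
    have quad: "u * D - F0 / 2 * u\<^sup>2 = D\<^sup>2 / (2 * F0) + - F0 / 2 * (u - m)\<^sup>2" for u
      using F0_pos by (simp add: m_def field_simps power2_eq_square)
    have quad_le: "exp (u * D - F0 / 2 * u\<^sup>2) \<le> E" for u
    proof -
      have "D\<^sup>2 \<le> B\<^sup>2" using DB by (simp add: D_def abs_le_square_iff[symmetric])
      then have "D\<^sup>2 / (2 * F0) \<le> B\<^sup>2 / (2 * F0)" using F0_pos by (intro divide_right_mono) auto
      moreover have "- F0 / 2 * (u - m)\<^sup>2 \<le> 0" using F0_pos by simp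
      ultimately show ?thesis unfolding quad E_def by (intro exp_le_cancel_iff[THEN iffD2]) linarith
    qed
    have close: "\<bar>post n \<omega> u - (q0 * exp (D\<^sup>2 / (2 * F0))) * exp (- F0 / 2 * (u - m)\<^sup>2)\<bar> \<le> \<rho>" if u: "\<bar>u - m\<bar> \<le> K" for u
    proof -
      have uK: "\<bar>u\<bar> \<le> K'" using u m unfolding K'_def by linarith
      define x where "x = llr u \<omega> - (u * D - F0 / 2 * u\<^sup>2)"
      define G where "G = exp (u * D - F0 / 2 * u\<^sup>2)"
      have G: "0 < G" "G \<le> E" using quad_le[of u] by (auto simp: G_def)
      have "\<bar>x\<bar> \<le> K' * \<eta>1 + Q K' n \<omega> / (2 * \<eta>1)"
        unfolding Q_def x_def D_def by (rule llr_quadratic[OF \<omega> N2[OF n'(3)] uK \<eta>1 err_sq_integrable(2,1)[OF n'(1) \<omega>]])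
      also have "\<dots> \<le> R / 2 + R / 2"
      proof (rule add_mono)
        show "K' * \<eta>1 \<le> R / 2" using K' by (simp add: \<eta>1_def)
        show "Q K' n \<omega> / (2 * \<eta>1) \<le> R / 2" using QB \<eta>1 by (simp add: pos_divide_le_eq mult_ac)
      qed
      finally have x: "\<bar>x\<bar> \<le> R" by simp
      have ex: "\<bar>exp x - 1\<bar> \<le> 4 * R" using abs_exp_minus_one_le[of x] x R(2) by linarith
      have "exp x \<le> exp 1" using x R(2) by (intro exp_le_cancel_iff[THEN iffD2]) linarith
      then have e3: "exp x \<le> 3" using exp_le by linarith
      have ll: "exp (llr u \<omega>) = G * exp x" by (simp add: G_def x_def exp_add[symmetric])
      have qG: "(q0 * exp (D\<^sup>2 / (2 * F0))) * exp (- F0 / 2 * (u - m)\<^sup>2) = q0 * G"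
        unfolding G_def quad exp_add by simp
      have "post n \<omega> u - (q0 * exp (D\<^sup>2 / (2 * F0))) * exp (- F0 / 2 * (u - m)\<^sup>2)
          = (prior (t n + \<phi> * u) - q0) * (G * exp x) + q0 * (G * (exp x - 1))"
        unfolding post_def ll qG by (simp add: algebra_simps)
      also have "\<bar>\<dots>\<bar> \<le> \<bar>prior (t n + \<phi> * u) - q0\<bar> * (G * exp x) + q0 * (G * \<bar>exp x - 1\<bar>)"
        using G q0_pos by (intro order.trans[OF abs_triangle_ineq]) (simp add: abs_mult)
      also have "\<dots> \<le> \<rho> / (6 * E) * (E * 3) + q0 * (E * (4 * R))"
        using G e3 ex q0_pos \<rho> E N3[OF n'(4) uK] by (intro add_mono mult_mono mult_left_mono) auto
      also have "\<dots> \<le> \<rho> / 2 + \<rho> / 2"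
      proof (rule add_mono)
        show "\<rho> / (6 * E) * (E * 3) \<le> \<rho> / 2" using E by simp
        have "q0 * (E * (4 * R)) \<le> q0 * (E * (4 * (\<rho> / (8 * q0 * E))))" using q0_pos E R(3) by (intro mult_left_mono) auto
        also have "\<dots> = \<rho> / 2" using q0_pos E by (simp add: field_simps)
        finally show "q0 * (E * (4 * R)) \<le> \<rho> / 2" .
      qed
      finally show ?thesis by simp
    qed
    have J: "0 < J \<omega>" by (rule J_pos[OF n'(1) \<omega>])
    have "q0 / 2 / B \<le> q0 / 2 / J \<omega>" using J JB q0_pos B by (intro divide_left_mono) auto
    then have mass: "q0 / 2 / B \<le> P.mass" using S4[OF n'(2) \<omega>] by linarith
    have "\<bar>P.mean - m\<bar> * (q0 / 2 / B) \<le> \<bar>P.mean - m\<bar> * P.mass" by (intro mult_left_mono mass) simp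
    also have "\<dots> \<le> 2 * K\<^sup>2 * \<rho> + (V \<omega>)\<^sup>2 * CQ * (2 / ?c * exp (?c * (B / F0)) * exp (- ?c * K / 2))"
      by (rule P.posterior_close[OF F0_pos K m less_imp_le[OF \<rho>] close])
    also have "\<dots> \<le> e * q0 / (4 * B) + e * q0 / (4 * B)"
    proof (rule add_mono)
      show "2 * K\<^sup>2 * \<rho> \<le> e * q0 / (4 * B)" using K B by (simp add: \<rho>_def field_simps)
      have "(V \<omega>)\<^sup>2 \<le> B\<^sup>2" using VB V_ge_1[of \<omega>] by (intro power_mono) auto
      then have "(V \<omega>)\<^sup>2 * CQ * (2 / ?c * exp (?c * (B / F0)) * exp (- ?c * K / 2)) \<le> B\<^sup>2 * CQ * (2 / ?c * exp (?c * (B / F0)) * exp (- ?c * K / 2))"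
        using S(1) c by (intro mult_right_mono) auto
      also have "\<dots> = (B\<^sup>2 * CQ * (2 / ?c * exp (?c * (B / F0)))) * exp (- ?c * K / 2)" by simp
      also have "\<dots> \<le> A * \<epsilon>1" using A eK by (intro mult_mono) auto
      also have "\<dots> = e * q0 / (4 * B)" using A B by (simp add: \<epsilon>1_def)
      finally show "(V \<omega>)\<^sup>2 * CQ * (2 / ?c * exp (?c * (B / F0)) * exp (- ?c * K / 2)) \<le> e * q0 / (4 * B)" .
    qed
    also have "\<dots> = e * (q0 / 2 / B)" by simp
    finally have "\<bar>P.mean - m\<bar> \<le> e" by (rule mult_right_le_imp_le) (use q0_pos B in simp)
    then show "\<bar>(bayes_estimator \<psi> r \<tau> \<delta> \<alpha> \<beta> q n (X n \<omega>) - t n) / \<phi> - score 0 \<omega> / F0\<bar> \<le> e"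
      unfolding S5[OF n'(2) \<omega>] by (simp add: m_def D_def)
  qed
qed

text \<open>
  The estimator is a quotient of parameter integrals of a jointly measurable function.
\<close>

lemma bayes_measurable:
  assumes n: "N0 \<le> n"
  shows "(\<lambda>\<omega>. bayes_estimator \<psi> r \<tau> \<delta> \<alpha> \<beta> q n (X n \<omega>)) \<in> borel_measurable (M n)"
proof -
  interpret ramp_experiment \<alpha> \<beta> \<tau> r \<psi> n "\<delta> n" "t n" "M n" "X n" by (rule exper[OF n])
  have m: "(\<lambda>\<omega>. LINT v|lborel. g v * prior v * exp (loglik v \<omega> + real n * \<tau>)) \<in> borel_measurable (M n)"
    if [measurable]: "g \<in> borel_measurable borel" for g :: "real \<Rightarrow> real"
  proof (rule lborel.borel_measurable_lebesgue_integral)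
    have sw: "(\<lambda>p. loglik (snd p) (fst p)) \<in> borel_measurable (M n \<Otimes>\<^sub>M lborel)"
      using measurable_pair_swap[OF loglik_measurable_pair]
      by (subst measurable_cong_sets[OF sets_pair_measure_cong[OF refl sets_lborel] refl]) (simp add: split_beta)
    show "(\<lambda>(\<omega>, v). g v * prior v * exp (loglik v \<omega> + real n * \<tau>)) \<in> borel_measurable (M n \<Otimes>\<^sub>M lborel)"
      using sw unfolding split_beta by measurable
  qed
  have eq: "bayes_estimator \<psi> r \<tau> \<delta> \<alpha> \<beta> q n (X n \<omega>) =
      (LINT v|lborel. v * prior v * exp (loglik v \<omega> + real n * \<tau>)) / (LINT v|lborel. 1 * prior v * exp (loglik v \<omega> + real n * \<tau>))"
    if "\<omega> \<in> space (M n)" for \<omega>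
    unfolding bayes_estimator_def set_lebesgue_integral_def likelihood_eq[where \<delta>=\<delta>, OF that refl] prior_def by (simp add: mult_ac)
  show ?thesis
    by (subst measurable_cong[OF eq]) (auto intro!: borel_measurable_divide m)
qed

end

section \<open>Both estimators expand in the score\<close>

context ramp_sequence
begin

text \<open>
  The conditions on the score, the envelope and the approximation error hold for every sequence, so
  that only the two pathwise conditions remain to be checked for an estimator.
\<close>

lemma expanding_of_growth_and_expansion:
  fixes est :: "nat \<Rightarrow> 'w \<Rightarrow> real"
  assumes meas: "\<And>n. N0 \<le> n \<Longrightarrow> est n \<in> borel_measurable (M n)"
    and a: "0 < a" and C: "0 \<le> C"
    and growth: "\<And>n \<omega>. N \<le> n \<Longrightarrow> \<omega> \<in> space (M n) \<Longrightarrow> exp (a * \<bar>(est n \<omega> - t n) / phi n\<bar>) \<le> C * (VV n \<omega> + 1 + JJ n \<omega>)"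
    and expansion: "\<And>e B. 0 < e \<Longrightarrow> 0 < B \<Longrightarrow> \<exists>K \<eta> N. 0 < \<eta> \<and> (\<forall>n\<ge>N. \<forall>\<omega>\<in>space (M n).
        VV n \<omega> \<le> B \<longrightarrow> JJ n \<omega> \<le> B \<longrightarrow> \<bar>sc n 0 \<omega>\<bar> \<le> B \<longrightarrow> Q K n \<omega> \<le> \<eta> \<longrightarrow> \<bar>(est n \<omega> - t n) / phi n - sc n 0 \<omega> / F0\<bar> \<le> e)"
  obtains N1 C1 where "N0 \<le> N1" "expanding_sequence M (\<lambda>n \<omega>. (est n \<omega> - t n) / phi n) (\<lambda>n. sc n 0) VV JJ Q F0 a C1 N1"
proof -
  obtain N2 where N2: "\<And>n. N2 \<le> n \<Longrightarrow> {-1..1} \<subseteq> {ulow n..uupp n}"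
    using eventually_range[of 1] by (auto simp: eventually_sequentially)
  define N1 where "N1 = max N0 (max N N2)"
  define C1 where "C1 = max C (max CV (max C3 C2))"
  have C1: "C \<le> C1" "CV \<le> C1" "C3 \<le> C1" "C2 \<le> C1" by (auto simp: C1_def)
  have n': "N0 \<le> n" "N \<le> n" "N2 \<le> n" if "N1 \<le> n" for n using that by (auto simp: N1_def)
  have facts: "prob_space (M n) \<and> (\<lambda>\<omega>. (est n \<omega> - t n) / phi n) \<in> borel_measurable (M n) \<and> sc n 0 \<in> borel_measurable (M n)
      \<and> integrable (M n) (VV n) \<and> (LINT \<omega>|M n. VV n \<omega>) \<le> C1 \<and> integrable (M n) (JJ n) \<and> (LINT \<omega>|M n. JJ n \<omega>) \<le> C1
      \<and> (\<forall>\<omega>. 0 \<le> VV n \<omega>) \<and> (\<forall>\<omega>. 0 \<le> JJ n \<omega>)" if n: "N1 \<le> n" for n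
  proof -
    interpret ramp_experiment \<alpha> \<beta> \<tau> r \<psi> n "\<delta> n" "t n" "M n" "X n" by (rule exper[OF n'(1)[OF n]])
    have [measurable]: "est n \<in> borel_measurable (M n)" by (rule meas[OF n'(1)[OF n]])
    have "1 \<in> {ul..ur}" using N2[OF n'(3)[OF n]] by auto
    then have ur1: "1 \<le> ur" by simp
    have "0 \<le> V \<omega>" for \<omega> using V_ge_1[of \<omega>] by linarith
    moreover have "0 \<le> J \<omega>" for \<omega>
      unfolding J_def set_lebesgue_integral_def by (intro integral_nonneg_AE AE_I2) (simp add: indicator_def)
    ultimately show ?thesis
      using prob_space_axioms section_measurable[OF score_measurable_pair, of 0] expectation_V expectation_J[OF ur1] C1
      by (auto intro: order.trans)
  qed
  have CC: "0 \<le> C1" using C C1 by simp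
  have "expanding_sequence M (\<lambda>n \<omega>. (est n \<omega> - t n) / phi n) (\<lambda>n. sc n 0) VV JJ Q F0 a C1 N1"
  proof (rule expanding_sequence.intro)
    show "0 < F0" by (rule F0_pos)
    show "0 < a" "0 \<le> C1" by fact+
    show "integrable (M n) (\<lambda>\<omega>. (sc n 0 \<omega>)\<^sup>2)" "(LINT \<omega>|M n. (sc n 0 \<omega>)\<^sup>2) \<le> C1" if "N1 \<le> n" for n
      using expectation_score_sq[OF n'(1)[OF that]] C1(4) by auto
    show "0 \<le> Q K n \<omega>" for K n \<omega>
      unfolding Q_def set_lebesgue_integral_def by (intro integral_nonneg_AE AE_I2) simp
    show "\<forall>\<^sub>F n in sequentially. integrable (M n) (Q K n)" for K by (rule expectation_Q(1))
    show "(\<lambda>n. LINT \<omega>|M n. Q K n \<omega>) \<longlonglongrightarrow> 0" for K by (rule expectation_Q(2))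
    show "(\<lambda>n. LINT \<omega>|M n. iexp (s * sc n 0 \<omega>)) \<longlonglongrightarrow> of_real (exp (- (s\<^sup>2 / 2 * F0)))" for s
      by (rule char_score_tendsto)
    show "exp (a * \<bar>(est n \<omega> - t n) / phi n\<bar>) \<le> C1 * (VV n \<omega> + 1 + JJ n \<omega>)" if "N1 \<le> n" "\<omega> \<in> space (M n)" for n \<omega>
    proof -
      have "0 \<le> VV n \<omega> + 1 + JJ n \<omega>" using facts[OF that(1)] by (auto intro: add_nonneg_nonneg)
      then have "C * (VV n \<omega> + 1 + JJ n \<omega>) \<le> C1 * (VV n \<omega> + 1 + JJ n \<omega>)" by (rule mult_right_mono[OF C1(1)])
      then show ?thesis using growth[OF n'(2)[OF that(1)] that(2)] by linarith
    qed
  qed (use facts expansion in blast)+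
  then show ?thesis by (rule that[rotated]) (simp add: N1_def)
qed

lemma MLE_expanding:
  assumes meas: "\<And>n. N0 \<le> n \<Longrightarrow> est n \<in> borel_measurable (M n)"
    and MLE: "\<And>n \<omega>. N0 \<le> n \<Longrightarrow> \<omega> \<in> space (M n) \<Longrightarrow> est n \<omega> \<in> {\<alpha>..\<beta>} \<and>
      likelihood \<psi> r \<tau> \<delta> n (est n \<omega>) (X n \<omega>) = (SUP v\<in>{\<alpha><..<\<beta>}. likelihood \<psi> r \<tau> \<delta> n v (X n \<omega>))"
  obtains a N1 C1 where "N0 \<le> N1" "expanding_sequence M (\<lambda>n \<omega>. (est n \<omega> - t n) / phi n) (\<lambda>n. sc n 0) VV JJ Q F0 a C1 N1"
proof (rule expanding_of_growth_and_expansion[OF meas, of "kap / 4" 1 N0])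
  show "exp (kap / 4 * \<bar>(est n \<omega> - t n) / phi n\<bar>) \<le> 1 * (VV n \<omega> + 1 + JJ n \<omega>)" if n: "N0 \<le> n" and \<omega>: "\<omega> \<in> space (M n)" for n \<omega>
  proof -
    interpret ramp_experiment \<alpha> \<beta> \<tau> r \<psi> n "\<delta> n" "t n" "M n" "X n" by (rule exper[OF n])
    have "0 \<le> J \<omega>"
      unfolding J_def set_lebesgue_integral_def by (intro integral_nonneg_AE AE_I2) (simp add: indicator_def)
    then show ?thesis using MLE_growth[OF n \<omega>] MLE[OF n \<omega>] by fastforce
  qed
  fix e B :: real assume e: "0 < e" and B: "0 < B"
  obtain K \<eta> N where \<eta>: "0 < \<eta>" and K: "\<And>n \<omega> x. N \<le> n \<Longrightarrow> \<omega> \<in> space (M n) \<Longrightarrow> x \<in> {\<alpha>..\<beta>} \<Longrightarrow>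
      likelihood \<psi> r \<tau> \<delta> n x (X n \<omega>) = (SUP v\<in>{\<alpha><..<\<beta>}. likelihood \<psi> r \<tau> \<delta> n v (X n \<omega>)) \<Longrightarrow>
      VV n \<omega> \<le> B \<Longrightarrow> \<bar>sc n 0 \<omega>\<bar> \<le> B \<Longrightarrow> Q K n \<omega> \<le> \<eta> \<Longrightarrow> \<bar>(x - t n) / phi n - sc n 0 \<omega> / F0\<bar> \<le> e"
    by (rule MLE_expansion[OF e B]) blast
  show "\<exists>K \<eta> N. 0 < \<eta> \<and> (\<forall>n\<ge>N. \<forall>\<omega>\<in>space (M n).
        VV n \<omega> \<le> B \<longrightarrow> JJ n \<omega> \<le> B \<longrightarrow> \<bar>sc n 0 \<omega>\<bar> \<le> B \<longrightarrow> Q K n \<omega> \<le> \<eta> \<longrightarrow> \<bar>(est n \<omega> - t n) / phi n - sc n 0 \<omega> / F0\<bar> \<le> e)"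
  proof (rule exI[of _ K], rule exI[of _ \<eta>], rule exI[of _ "max N0 N"], intro conjI \<eta> allI ballI impI)
    fix n \<omega> assume n: "max N0 N \<le> n" and \<omega>: "\<omega> \<in> space (M n)" and *: "VV n \<omega> \<le> B" "\<bar>sc n 0 \<omega>\<bar> \<le> B" "Q K n \<omega> \<le> \<eta>"
    have "N0 \<le> n" "N \<le> n" using n by auto
    then show "\<bar>(est n \<omega> - t n) / phi n - sc n 0 \<omega> / F0\<bar> \<le> e" using K[OF _ \<omega> _ _ *] MLE[OF _ \<omega>] by blast
  qed
qed (use kap_pos that in auto)

end

context bayes_sequence
begin

lemma bayes_expanding:
  assumes est: "\<And>n \<omega>. N0 \<le> n \<Longrightarrow> \<omega> \<in> space (M n) \<Longrightarrow> est n \<omega> = bayes_estimator \<psi> r \<tau> \<delta> \<alpha> \<beta> q n (X n \<omega>)"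
  obtains a N1 C1 where "N0 \<le> N1" "expanding_sequence M (\<lambda>n \<omega>. (est n \<omega> - t n) / phi n) (\<lambda>n. sc n 0) VV JJ Q F0 a C1 N1"
proof -
  obtain C N where C: "0 \<le> C" "N0 \<le> N" "\<And>n \<omega>. N \<le> n \<Longrightarrow> \<omega> \<in> space (M n) \<Longrightarrow>
      exp (kap / 16 * \<bar>(bayes_estimator \<psi> r \<tau> \<delta> \<alpha> \<beta> q n (X n \<omega>) - t n) / phi n\<bar>) \<le> C * (VV n \<omega> + 1 + JJ n \<omega>)"
    by (rule bayes_growth) blast
  show ?thesis
  proof (rule expanding_of_growth_and_expansion[of est "kap / 16" C N])
    show "est n \<in> borel_measurable (M n)" if "N0 \<le> n" for n
      using bayes_measurable[OF that] by (subst measurable_cong[OF est[OF that]])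
    show "exp (kap / 16 * \<bar>(est n \<omega> - t n) / phi n\<bar>) \<le> C * (VV n \<omega> + 1 + JJ n \<omega>)" if n: "N \<le> n" and \<omega>: "\<omega> \<in> space (M n)" for n \<omega>
      using C(3)[OF n \<omega>] est[OF order.trans[OF C(2) n] \<omega>] by simp
    fix e B :: real assume e: "0 < e" and B: "0 < B"
    obtain K \<eta> N where \<eta>: "0 < \<eta>" and K: "\<And>n \<omega>. N \<le> n \<Longrightarrow> \<omega> \<in> space (M n) \<Longrightarrow>
      VV n \<omega> \<le> B \<Longrightarrow> JJ n \<omega> \<le> B \<Longrightarrow> \<bar>sc n 0 \<omega>\<bar> \<le> B \<Longrightarrow> Q K n \<omega> \<le> \<eta> \<Longrightarrow>
      \<bar>(bayes_estimator \<psi> r \<tau> \<delta> \<alpha> \<beta> q n (X n \<omega>) - t n) / phi n - sc n 0 \<omega> / F0\<bar> \<le> e"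
      by (rule bayes_expansion[OF e B]) blast
    show "\<exists>K \<eta> N. 0 < \<eta> \<and> (\<forall>n\<ge>N. \<forall>\<omega>\<in>space (M n).
        VV n \<omega> \<le> B \<longrightarrow> JJ n \<omega> \<le> B \<longrightarrow> \<bar>sc n 0 \<omega>\<bar> \<le> B \<longrightarrow> Q K n \<omega> \<le> \<eta> \<longrightarrow> \<bar>(est n \<omega> - t n) / phi n - sc n 0 \<omega> / F0\<bar> \<le> e)"
    proof (rule exI[of _ K], rule exI[of _ \<eta>], rule exI[of _ "max N0 N"], intro conjI \<eta> allI ballI impI)
      fix n \<omega> assume n: "max N0 N \<le> n" and \<omega>: "\<omega> \<in> space (M n)" and *: "VV n \<omega> \<le> B" "JJ n \<omega> \<le> B" "\<bar>sc n 0 \<omega>\<bar> \<le> B" "Q K n \<omega> \<le> \<eta>"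
      have "N0 \<le> n" "N \<le> n" using n by auto
      then show "\<bar>(est n \<omega> - t n) / phi n - sc n 0 \<omega> / F0\<bar> \<le> e" using K[OF _ \<omega> *] est[OF _ \<omega>] by simp
    qed
  qed (use kap_pos that C(1) in auto)
qed

end

section \<open>Uniformity over compact sets of parameters\<close>

text \<open>
  Otherwise there are parameters with error at least \<open>\<epsilon>\<close> for infinitely many \<open>n\<close>. A subsequence of them converges by
  compactness and contradicts the convergence along sequences.
\<close>

lemma uniform_limit_of_continuous_convergence:
  fixes f :: "nat \<Rightarrow> real \<Rightarrow> real" and g :: "real \<Rightarrow> real"
  assumes K: "compact K" and g: "continuous_on K g"
    and conv: "\<And>t x. (\<And>n. t n \<in> K) \<Longrightarrow> x \<in> K \<Longrightarrow> t \<longlonglongrightarrow> x \<Longrightarrow> (\<lambda>n. f n (t n)) \<longlonglongrightarrow> g x"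
    and \<epsilon>: "0 < \<epsilon>"
  shows "\<forall>\<^sub>F n in sequentially. \<forall>x\<in>K. \<bar>f n x - g x\<bar> < \<epsilon>"
proof (rule ccontr)
  assume "\<not> ?thesis"
  then have "\<exists>\<^sub>F n in sequentially. \<exists>x\<in>K. \<epsilon> \<le> \<bar>f n x - g x\<bar>"
    by (simp add: frequently_def not_le Ball_def Bex_def)
  then have inf: "infinite {n. \<exists>x\<in>K. \<epsilon> \<le> \<bar>f n x - g x\<bar>}"
    by (simp add: frequently_cofinite[symmetric] cofinite_eq_sequentially)
  define r0 where "r0 = enumerate {n. \<exists>x\<in>K. \<epsilon> \<le> \<bar>f n x - g x\<bar>}"
  have r0: "strict_mono r0" unfolding r0_def by (rule strict_mono_enumerate[OF inf])
  have "\<forall>k. \<exists>x\<in>K. \<epsilon> \<le> \<bar>f (r0 k) x - g x\<bar>" using enumerate_in_set[OF inf] unfolding r0_def by blast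
  then obtain y where y: "\<And>k. y k \<in> K" "\<And>k. \<epsilon> \<le> \<bar>f (r0 k) (y k) - g (y k)\<bar>" by metis
  obtain x r1 where x: "x \<in> K" "strict_mono r1" "(y \<circ> r1) \<longlonglongrightarrow> x"
    using K y(1) unfolding compact_def by metis
  define r where "r = r0 \<circ> r1"
  have r: "strict_mono r" unfolding r_def by (rule strict_mono_o[OF r0 x(2)])
  \<comment> \<open>Outside the subsequence the parameters are filled up with the limit point.\<close>
  define t where "t n = (if n \<in> range r then y (r1 (inv r n)) else x)" for n
  have tr: "t (r k) = y (r1 k)" for k using strict_mono_imp_inj_on[OF r] by (simp add: t_def inv_f_f)
  have "t \<longlonglongrightarrow> x"
  proof (rule LIMSEQ_I)
    fix e :: real assume "0 < e"
    from LIMSEQ_D[OF x(3) this] obtain k0 where k0: "\<And>k. k0 \<le> k \<Longrightarrow> norm (y (r1 k) - x) < e" by auto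
    show "\<exists>n0. \<forall>n\<ge>n0. norm (t n - x) < e"
    proof (intro exI allI impI)
      fix n assume n: "r k0 \<le> n"
      show "norm (t n - x) < e"
      proof (cases "n \<in> range r")
        case True
        then obtain k where k: "n = r k" by auto
        then have "k0 \<le> k" using n strict_mono_less_eq[OF r] by simp
        then show ?thesis using k0 by (simp add: k tr)
      next
        case False
        then show ?thesis using \<open>0 < e\<close> by (simp add: t_def)
      qed
    qed
  qed
  moreover have "t n \<in> K" for n using x(1) y(1) by (simp add: t_def)
  ultimately have "(\<lambda>n. f n (t n)) \<longlonglongrightarrow> g x" using x(1) by (intro conv)
  then have "(\<lambda>k. f (r k) (t (r k))) \<longlonglongrightarrow> g x" using r by (rule LIMSEQ_subseq_LIMSEQ[unfolded comp_def])
  moreover have "(\<lambda>k. g (y (r1 k))) \<longlonglongrightarrow> g x"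
    by (rule continuous_on_tendsto_compose[OF g]) (use x y in \<open>auto simp: comp_def\<close>)
  ultimately have "(\<lambda>k. f (r k) (y (r1 k)) - g (y (r1 k))) \<longlonglongrightarrow> g x - g x" unfolding tr by (rule tendsto_diff)
  then have "(\<lambda>k. \<bar>f (r k) (y (r1 k)) - g (y (r1 k))\<bar>) \<longlonglongrightarrow> 0" by (simp add: tendsto_rabs_zero)
  then have "\<epsilon> \<le> 0" by (rule tendsto_lowerbound) (use y(2) in \<open>auto simp: r_def\<close>)
  then show False using \<epsilon> by simp
qed

text \<open>
  A real supremum is meaningful only for a set that is bounded above; for large \<open>n\<close> closeness to the bounded
  function \<open>g\<close> provides this.
\<close>

lemma SUP_tendsto_of_uniform:
  fixes f :: "nat \<Rightarrow> real \<Rightarrow> real" and g :: "real \<Rightarrow> real"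
  assumes ne: "S \<noteq> {}" and bdd: "\<And>x. x \<in> S \<Longrightarrow> \<bar>g x\<bar> \<le> C"
    and unif: "\<And>\<epsilon>. 0 < \<epsilon> \<Longrightarrow> \<forall>\<^sub>F n in sequentially. \<forall>x\<in>S. \<bar>f n x - g x\<bar> < \<epsilon>"
  shows "(\<lambda>n. SUP x\<in>S. f n x) \<longlonglongrightarrow> (SUP x\<in>S. g x)"
proof (rule tendstoI)
  fix \<epsilon> :: real assume \<epsilon>: "0 < \<epsilon>"
  have bg: "bdd_above (g ` S)" using bdd by (intro bdd_aboveI2[of _ _ C]) (auto simp: abs_le_iff)
  from unif[of "\<epsilon> / 2"] \<epsilon> have "\<forall>\<^sub>F n in sequentially. \<forall>x\<in>S. \<bar>f n x - g x\<bar> < \<epsilon> / 2" by simp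
  then show "\<forall>\<^sub>F n in sequentially. dist (SUP x\<in>S. f n x) (SUP x\<in>S. g x) < \<epsilon>"
  proof eventually_elim
    case (elim n)
    have le: "f n x \<le> (SUP x\<in>S. g x) + \<epsilon> / 2" if "x \<in> S" for x
      using bspec[OF elim that] cSUP_upper[OF that bg] unfolding abs_less_iff by linarith
    have bf: "bdd_above (f n ` S)" using le by (rule bdd_aboveI2)
    have "(SUP x\<in>S. f n x) \<le> (SUP x\<in>S. g x) + \<epsilon> / 2" by (rule cSUP_least[OF ne le])
    moreover have "(SUP x\<in>S. g x) \<le> (SUP x\<in>S. f n x) + \<epsilon> / 2"
    proof (rule cSUP_least[OF ne])
      fix x assume "x \<in> S"
      then show "g x \<le> (SUP x\<in>S. f n x) + \<epsilon> / 2"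
        using bspec[OF elim \<open>x \<in> S\<close>] cSUP_upper[OF \<open>x \<in> S\<close> bf] unfolding abs_less_iff by linarith
    qed
    ultimately show ?case using \<epsilon> by (auto simp: dist_real_def abs_less_iff)
  qed
qed

section \<open>The limit theorem for both estimators\<close>

lemma second_moment_centred_normal:
  assumes "0 < v"
  shows "(LINT x|centred_normal v. \<bar>x\<bar> powr 2) = v"
proof -
  have "(LINT x|centred_normal v. \<bar>x\<bar> powr 2) = (LINT x|lborel. normal_density 0 (sqrt v) x * (x - 0) ^ (2 * 1))"
    unfolding centred_normal_def using assms
    by (subst integral_density) (auto simp: powr_numeral intro!: Bochner_Integration.integral_cong)
  also have "\<dots> = fact (2 * 1) / ((2 / (sqrt v)\<^sup>2) ^ 1 * fact 1)"
    by (rule has_bochner_integral_integral_eq[OF normal_moment_even]) (use assms in simp)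
  finally show ?thesis using assms by simp
qed

theorem theorem2:
  fixes \<alpha> \<beta> \<tau> r :: real
    and \<psi> :: "real \<Rightarrow> real"
    and \<delta> :: "nat \<Rightarrow> real"
    and S :: "nat \<Rightarrow> 'w measure"
    and P :: "nat \<Rightarrow> real \<Rightarrow> 'w measure"
    and X :: "nat \<Rightarrow> 'w \<Rightarrow> nat \<Rightarrow> real \<Rightarrow> nat"
    and est :: "nat \<Rightarrow> 'w \<Rightarrow> real"
  assumes "0 < \<alpha>" and "\<alpha> < \<beta>" and "\<beta> < \<tau>"
    and "continuous_on {0..\<tau>} \<psi>" and "\<forall>t\<in>{0..\<tau>}. \<psi> t > 0"
    and "r > - (INF t\<in>{0..\<tau>}. \<psi> t)" and "r \<noteq> 0"
    and "\<forall>n\<ge>1. \<delta> n > 0" and "antimono_on {1..} \<delta>" and "\<delta> \<longlonglongrightarrow> 0"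
    and "filterlim (\<lambda>n. real n * \<delta> n) at_top sequentially"
    and "poisson_model \<psi> r \<tau> \<delta> {\<alpha><..<\<beta>} S P X"
    and "is_MLE \<psi> r \<tau> \<delta> \<alpha> \<beta> S X est \<or>
         (\<exists>q. prior_density \<alpha> \<beta> q \<and> is_bayes \<psi> r \<tau> \<delta> \<alpha> \<beta> q S X est)"
  shows
    "(\<forall>\<theta>\<in>{\<alpha><..<\<beta>}. \<forall>\<epsilon>>0.
        (\<lambda>n. measure (P n \<theta>) {\<omega>\<in>space (P n \<theta>). \<bar>est n \<omega> - \<theta>\<bar> > \<epsilon>}) \<longlonglongrightarrow> 0) \<and>
     (\<forall>\<theta>\<in>{\<alpha><..<\<beta>}.
        weak_conv_m (\<lambda>n. distr (P n \<theta>) borel (\<lambda>\<omega>. (est n \<omega> - \<theta>) / rate \<delta> n))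
          (centred_normal (1 / fisher \<psi> r \<theta>))) \<and>
     (\<forall>\<theta>\<in>{\<alpha><..<\<beta>}. \<forall>p>0.
        (\<lambda>n. rate \<delta> n powr (- p) * (LINT \<omega>|P n \<theta>. \<bar>est n \<omega> - \<theta>\<bar> powr p))
          \<longlonglongrightarrow> (LINT x|centred_normal (1 / fisher \<psi> r \<theta>). \<bar>x\<bar> powr p)) \<and>
     (\<forall>\<theta>\<^sub>0\<in>{\<alpha><..<\<beta>}. \<exists>g :: real \<Rightarrow> real.
        (\<forall>\<^sub>F \<epsilon> in at_right 0.
           (\<lambda>n. SUP \<theta>\<in>{\<theta>\<in>{\<alpha><..<\<beta>}. \<bar>\<theta> - \<theta>\<^sub>0\<bar> < \<epsilon>}.
                  (LINT \<omega>|P n \<theta>. (est n \<omega> - \<theta>)\<^sup>2) / (rate \<delta> n)\<^sup>2) \<longlonglongrightarrow> g \<epsilon>) \<and>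
        (g \<longlongrightarrow> 1 / fisher \<psi> r \<theta>\<^sub>0) (at_right 0))"
proof -
  note a = assms
  have intens: "ramp_intensity \<alpha> \<beta> \<tau> r \<psi>" using a(1-7) by (rule ramp_intensity.intro)
  interpret ramp_intensity \<alpha> \<beta> \<tau> r \<psi> by (rule intens)
  have "\<forall>\<^sub>F n in sequentially. \<delta> n < \<tau> - \<beta>" using order_tendstoD(2)[OF a(10)] a(3) by simp
  moreover have "\<forall>\<^sub>F n in sequentially. 1 \<le> real n * \<delta> n" using a(11) by (auto simp: filterlim_at_top)
  ultimately have "\<forall>\<^sub>F n in sequentially. 1 \<le> n \<and> \<delta> n < \<tau> - \<beta> \<and> 1 \<le> real n * \<delta> n"
    using eventually_ge_at_top[of "1::nat"] by eventually_elim simp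
  then obtain N0 where N0: "\<And>n. N0 \<le> n \<Longrightarrow> 1 \<le> n \<and> \<delta> n < \<tau> - \<beta> \<and> 1 \<le> real n * \<delta> n"
    by (auto simp: eventually_sequentially)
  have model: "prob_space (P n \<theta>)" "sets (P n \<theta>) = sets (S n)"
      "\<forall>j\<in>{1..n}. poisson_process (P n \<theta>) \<tau> (intensity \<psi> r \<tau> (\<delta> n) \<theta>) (\<lambda>\<omega>. X n \<omega> j)"
      "prob_space.indep_vars (P n \<theta>) (\<lambda>j. \<Pi>\<^sub>M t\<in>{0..\<tau>}. count_space UNIV) (\<lambda>j \<omega>. restrict (X n \<omega> j) {0..\<tau>}) {1..n}"
    if "1 \<le> n" "\<theta> \<in> {\<alpha><..<\<beta>}" for n \<theta>
    using a(12) that unfolding poisson_model_def by blast+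
  have exper: "ramp_experiment \<alpha> \<beta> \<tau> r \<psi> n (\<delta> n) \<theta> (P n \<theta>) (X n)" if n: "N0 \<le> n" and \<theta>: "\<theta> \<in> {\<alpha><..<\<beta>}" for n \<theta>
  proof -
    have n1: "1 \<le> n" "\<delta> n < \<tau> - \<beta>" "1 \<le> real n * \<delta> n" using N0[OF n] by auto
    show ?thesis
      by (intro ramp_experiment.intro ramp_experiment_axioms.intro intens)
        (use n1 model[OF n1(1) \<theta>] \<theta> a(8) in auto)
  qed
  have sequence: "ramp_sequence \<alpha> \<beta> \<tau> r \<psi> \<delta> t x (\<lambda>n. P n (t n)) X N0"
    if "\<And>n. t n \<in> {\<alpha><..<\<beta>}" "x \<in> {\<alpha><..<\<beta>}" "t \<longlonglongrightarrow> x" for t x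
    by (intro ramp_sequence.intro ramp_sequence_axioms.intro intens) (use that a(10,11) exper in auto)
  have fisher_pos: "0 < fisher \<psi> r x" if "x \<in> {\<alpha><..<\<beta>}" for x
    by (rule ramp_sequence.F0_pos[OF sequence[of "\<lambda>_. x"]]) (use that in auto)

  \<comment> \<open>The sequence of true parameters is arbitrary: the fixed parameter and the uniform statement are both special cases.\<close>
  define U where "U t n \<omega> = (est n \<omega> - t n) / rate \<delta> n" for t n \<omega>
  have main: "weak_conv_m (\<lambda>n. distr (P n (t n)) borel (U t n)) (centred_normal (1 / fisher \<psi> r x))"
      "\<And>p. 0 < p \<Longrightarrow> (\<lambda>n. LINT \<omega>|P n (t n). \<bar>U t n \<omega>\<bar> powr p) \<longlonglongrightarrow> (LINT y|centred_normal (1 / fisher \<psi> r x). \<bar>y\<bar> powr p)"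
      "\<And>e. 0 < e \<Longrightarrow> (\<lambda>n. measure (P n (t n)) {\<omega>\<in>space (P n (t n)). e < \<bar>est n \<omega> - t n\<bar>}) \<longlonglongrightarrow> 0"
    if t: "\<And>n. t n \<in> {\<alpha><..<\<beta>}" "x \<in> {\<alpha><..<\<beta>}" "t \<longlonglongrightarrow> x" for t x
  proof -
    interpret ramp_sequence \<alpha> \<beta> \<tau> r \<psi> \<delta> t x "\<lambda>n. P n (t n)" X N0 by (rule sequence[OF t])
    have sp: "sets (P n (t n)) = sets (S n)" "space (P n (t n)) = space (S n)" if "N0 \<le> n" for n
      using model(2)[OF _ t(1)] sets_eq_imp_space_eq N0[OF that] by metis+
    have "\<exists>a C N1. N0 \<le> N1 \<and> expanding_sequence (\<lambda>n. P n (t n)) (\<lambda>n \<omega>. (est n \<omega> - t n) / phi n) (\<lambda>n. sc n 0) VV JJ Q (fisher \<psi> r x) a C N1"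
      using a(13)
    proof
      assume mle: "is_MLE \<psi> r \<tau> \<delta> \<alpha> \<beta> S X est"
      have m: "est n \<in> borel_measurable (P n (t n))" if "N0 \<le> n" for n
        using mle N0[OF that] measurable_cong_sets[OF sp(1)[OF that] refl] unfolding is_MLE_def by auto
      have "est n \<omega> \<in> {\<alpha>..\<beta>} \<and>
          likelihood \<psi> r \<tau> \<delta> n (est n \<omega>) (X n \<omega>) = (SUP v\<in>{\<alpha><..<\<beta>}. likelihood \<psi> r \<tau> \<delta> n v (X n \<omega>))"
        if "N0 \<le> n" "\<omega> \<in> space (P n (t n))" for n \<omega>
        using mle N0[OF that(1)] that(2) unfolding is_MLE_def sp(2)[OF that(1)] by blast
      from MLE_expanding[OF m this] show ?thesis by blast
    next
      assume "\<exists>q. prior_density \<alpha> \<beta> q \<and> is_bayes \<psi> r \<tau> \<delta> \<alpha> \<beta> q S X est"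
      then obtain q where bayes: "prior_density \<alpha> \<beta> q" "is_bayes \<psi> r \<tau> \<delta> \<alpha> \<beta> q S X est" by blast
      interpret bayes_sequence \<alpha> \<beta> \<tau> r \<psi> \<delta> t x "\<lambda>n. P n (t n)" X N0 q
        by unfold_locales (rule bayes(1))
      have "est n \<omega> = bayes_estimator \<psi> r \<tau> \<delta> \<alpha> \<beta> q n (X n \<omega>)" if "N0 \<le> n" "\<omega> \<in> space (P n (t n))" for n \<omega>
        using bayes(2) N0[OF that(1)] that(2) unfolding is_bayes_def sp(2)[OF that(1)] by blast
      from bayes_expanding[OF this] show ?thesis by blast
    qed
    then obtain a C N1 where N1: "N0 \<le> N1" and
      exs: "expanding_sequence (\<lambda>n. P n (t n)) (\<lambda>n \<omega>. (est n \<omega> - t n) / phi n) (\<lambda>n. sc n 0) VV JJ Q (fisher \<psi> r x) a C N1"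
      by blast
    interpret E: expanding_sequence "\<lambda>n. P n (t n)" "\<lambda>n \<omega>. (est n \<omega> - t n) / phi n" "\<lambda>n. sc n 0" VV JJ Q "fisher \<psi> r x" a C N1
      by (rule exs)
    have rate: "phi n = rate \<delta> n" if "N0 \<le> n" for n
      unfolding rate_def by (rule ramp_experiment.\<phi>_def[OF exper[OF that]])
    have U: "(\<lambda>\<omega>. (est n \<omega> - t n) / phi n) = U t n" if "N0 \<le> n" for n
      using rate[OF that] by (simp add: U_def fun_eq_iff)
    note ev = eventually_mono[OF eventually_ge_at_top[of N0]]
    show "weak_conv_m (\<lambda>n. distr (P n (t n)) borel (U t n)) (centred_normal (1 / fisher \<psi> r x))"
      unfolding weak_conv_m_def weak_conv_def
    proof (intro allI impI)
      fix y assume "isCont (cdf (centred_normal (1 / fisher \<psi> r x))) y"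
      then have "(\<lambda>n. cdf (distr (P n (t n)) borel (\<lambda>\<omega>. (est n \<omega> - t n) / phi n)) y) \<longlonglongrightarrow> cdf (centred_normal (1 / fisher \<psi> r x)) y"
        using E.weak_convergence unfolding weak_conv_m_def weak_conv_def by blast
      then show "(\<lambda>n. cdf (distr (P n (t n)) borel (U t n)) y) \<longlonglongrightarrow> cdf (centred_normal (1 / fisher \<psi> r x)) y"
        by (rule Lim_transform_eventually) (rule ev, simp add: U)
    qed
    show "(\<lambda>n. LINT \<omega>|P n (t n). \<bar>U t n \<omega>\<bar> powr p) \<longlonglongrightarrow> (LINT y|centred_normal (1 / fisher \<psi> r x). \<bar>y\<bar> powr p)" if "0 < p" for p
      by (rule Lim_transform_eventually[OF E.moment_convergence[OF that]]) (rule ev, simp add: U_def rate)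
    show "(\<lambda>n. measure (P n (t n)) {\<omega>\<in>space (P n (t n)). e < \<bar>est n \<omega> - t n\<bar>}) \<longlonglongrightarrow> 0" if "0 < e" for e
    proof (rule Lim_transform_eventually[OF E.vanishing_probability[OF phi_tendsto that]])
      show "\<forall>\<^sub>F n in sequentially. measure (P n (t n)) {\<omega> \<in> space (P n (t n)). e < \<bar>phi n * ((est n \<omega> - t n) / phi n)\<bar>}
          = measure (P n (t n)) {\<omega>\<in>space (P n (t n)). e < \<bar>est n \<omega> - t n\<bar>}"
        using eventually_phi_pos by eventually_elim simp
    qed
  qed

  have rate_pos: "0 < rate \<delta> n" if "N0 \<le> n" for n
    using N0[OF that] a(8) by (auto simp: rate_def)
  have consistent: "(\<lambda>n. measure (P n \<theta>) {\<omega>\<in>space (P n \<theta>). \<bar>est n \<omega> - \<theta>\<bar> > \<epsilon>}) \<longlonglongrightarrow> 0"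
    if "\<theta> \<in> {\<alpha><..<\<beta>}" "0 < \<epsilon>" for \<theta> \<epsilon>
    by (rule main(3)[of "\<lambda>_. \<theta>" \<theta>]) (use that in auto)
  have normal: "weak_conv_m (\<lambda>n. distr (P n \<theta>) borel (\<lambda>\<omega>. (est n \<omega> - \<theta>) / rate \<delta> n)) (centred_normal (1 / fisher \<psi> r \<theta>))"
    if "\<theta> \<in> {\<alpha><..<\<beta>}" for \<theta>
    using main(1)[of "\<lambda>_. \<theta>" \<theta>] that unfolding U_def by auto
  have moments: "(\<lambda>n. rate \<delta> n powr (- p) * (LINT \<omega>|P n \<theta>. \<bar>est n \<omega> - \<theta>\<bar> powr p))
      \<longlonglongrightarrow> (LINT x|centred_normal (1 / fisher \<psi> r \<theta>). \<bar>x\<bar> powr p)" if \<theta>: "\<theta> \<in> {\<alpha><..<\<beta>}" and p: "0 < p" for \<theta> p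
  proof (rule Lim_transform_eventually[OF main(2)[of "\<lambda>_. \<theta>" \<theta> p]])
    show "\<forall>\<^sub>F n in sequentially. (LINT \<omega>|P n \<theta>. \<bar>U (\<lambda>_. \<theta>) n \<omega>\<bar> powr p)
        = rate \<delta> n powr (- p) * (LINT \<omega>|P n \<theta>. \<bar>est n \<omega> - \<theta>\<bar> powr p)"
      using eventually_ge_at_top[of N0]
    proof eventually_elim
      case (elim n)
      then have "\<bar>U (\<lambda>_. \<theta>) n \<omega>\<bar> powr p = rate \<delta> n powr (- p) * \<bar>est n \<omega> - \<theta>\<bar> powr p" for \<omega>
        using rate_pos[of n] by (simp add: U_def powr_divide powr_minus_divide)
      then show ?case by simp
    qed
  qed (use \<theta> p in auto)

  \<comment> \<open>The second moment of the limit law is continuous in the parameter, so that the risk converges uniformly near any point.\<close>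
  define f where "f n \<theta> = (LINT \<omega>|P n \<theta>. (est n \<omega> - \<theta>)\<^sup>2) / (rate \<delta> n)\<^sup>2" for n \<theta>
  have risk: "(\<lambda>n. f n (t n)) \<longlonglongrightarrow> 1 / fisher \<psi> r x"
    if t: "\<And>n. t n \<in> {\<alpha><..<\<beta>}" "x \<in> {\<alpha><..<\<beta>}" "t \<longlonglongrightarrow> x" for t x
  proof -
    have "(LINT \<omega>|P n (t n). \<bar>U t n \<omega>\<bar> powr 2) = f n (t n)" for n
      by (simp add: U_def f_def powr_numeral power_divide)
    moreover have "(LINT y|centred_normal (1 / fisher \<psi> r x). \<bar>y\<bar> powr 2) = 1 / fisher \<psi> r x"
      by (rule second_moment_centred_normal) (use fisher_pos[OF t(2)] in simp)
    ultimately show ?thesis using main(2)[OF t, of 2] by simp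
  qed
  define h where "h x = 1 / fisher \<psi> r x" for x
  have h_cont: "continuous_on {\<alpha><..<\<beta>} h"
  proof -
    have sub: "{\<alpha><..<\<beta>} \<subseteq> {0..\<tau>}" using a(1-3) by auto
    have pos: "0 < \<psi> x" "0 < \<psi> x + r" if "x \<in> {\<alpha><..<\<beta>}" for x
      using lo_le_window[of 0 x] lo_le_window[of 1 x] lo_pos psi_ext_eq[of x] subsetD[OF sub that] by auto
    have [continuous_intros]: "continuous_on {\<alpha><..<\<beta>} \<psi>" by (rule continuous_on_subset[OF a(4) sub])
    show ?thesis unfolding h_def fisher_def
    proof (intro continuous_intros ballI)
      show "\<psi> x \<noteq> 0" "(\<psi> x + r) / \<psi> x \<noteq> 0" if "x \<in> {\<alpha><..<\<beta>}" for x using pos[OF that] by auto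
      show "r * ln ((\<psi> x + r) / \<psi> x) \<noteq> 0" if "x \<in> {\<alpha><..<\<beta>}" for x
        using fisher_pos[OF that] unfolding fisher_def by (rule less_imp_neq[symmetric])
    qed
  qed
  have efficient: "\<exists>g :: real \<Rightarrow> real.
        (\<forall>\<^sub>F \<epsilon> in at_right 0. (\<lambda>n. SUP \<theta>\<in>{\<theta>\<in>{\<alpha><..<\<beta>}. \<bar>\<theta> - \<theta>\<^sub>0\<bar> < \<epsilon>}. f n \<theta>) \<longlonglongrightarrow> g \<epsilon>) \<and>
        (g \<longlongrightarrow> 1 / fisher \<psi> r \<theta>\<^sub>0) (at_right 0)" if \<theta>0: "\<theta>\<^sub>0 \<in> {\<alpha><..<\<beta>}" for \<theta>\<^sub>0
  proof -
    define B where "B \<epsilon> = {\<theta>\<in>{\<alpha><..<\<beta>}. \<bar>\<theta> - \<theta>\<^sub>0\<bar> < \<epsilon>}" for \<epsilon>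
    define \<epsilon>0 where "\<epsilon>0 = min (\<theta>\<^sub>0 - \<alpha>) (\<beta> - \<theta>\<^sub>0) / 2"
    have \<epsilon>0: "0 < \<epsilon>0" using \<theta>0 by (auto simp: \<epsilon>0_def)
    \<comment> \<open>A compact neighbourhood inside the open interval: there 1 / F is bounded and the convergence is uniform.\<close>
    define K where "K = {\<theta>\<^sub>0 - \<epsilon>0..\<theta>\<^sub>0 + \<epsilon>0}"
    have K: "compact K" "K \<subseteq> {\<alpha><..<\<beta>}" using \<theta>0 by (auto simp: K_def \<epsilon>0_def min_def field_simps)
    have h_K: "continuous_on K h" by (rule continuous_on_subset[OF h_cont K(2)])
    have BK: "B \<epsilon> \<subseteq> K" if "\<epsilon> < \<epsilon>0" for \<epsilon> using that by (auto simp: B_def K_def)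
    have ne: "\<theta>\<^sub>0 \<in> B \<epsilon>" if "0 < \<epsilon>" for \<epsilon> using that \<theta>0 by (simp add: B_def)
    obtain C where C: "\<And>x. x \<in> K \<Longrightarrow> \<bar>h x\<bar> \<le> C"
      using compact_imp_bounded[OF compact_continuous_image[OF h_K K(1)]] by (auto simp: bounded_iff)
    have unif: "\<forall>\<^sub>F n in sequentially. \<forall>x\<in>K. \<bar>f n x - h x\<bar> < e" if "0 < e" for e
    proof (rule uniform_limit_of_continuous_convergence[OF K(1) h_K _ that])
      show "(\<lambda>n. f n (t n)) \<longlonglongrightarrow> h x" if "\<And>n. t n \<in> K" "x \<in> K" "t \<longlonglongrightarrow> x" for t x
        unfolding h_def by (rule risk[OF subsetD[OF K(2) that(1)] subsetD[OF K(2) that(2)] that(3)])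
    qed
    have lim: "(\<lambda>n. SUP \<theta>\<in>B \<epsilon>. f n \<theta>) \<longlonglongrightarrow> (SUP \<theta>\<in>B \<epsilon>. h \<theta>)" if \<epsilon>: "0 < \<epsilon>" "\<epsilon> < \<epsilon>0" for \<epsilon>
    proof (rule SUP_tendsto_of_uniform)
      show "B \<epsilon> \<noteq> {}" using ne[OF \<epsilon>(1)] by blast
      show "\<bar>h x\<bar> \<le> C" if "x \<in> B \<epsilon>" for x using C BK[OF \<epsilon>(2)] that by blast
      show "\<forall>\<^sub>F n in sequentially. \<forall>x\<in>B \<epsilon>. \<bar>f n x - h x\<bar> < e" if "0 < e" for e
        using unif[OF that] by eventually_elim (use BK[OF \<epsilon>(2)] in blast)
    qed
    have ev: "\<forall>\<^sub>F \<epsilon> in at_right 0. 0 < \<epsilon> \<and> \<epsilon> < \<epsilon>1" if "0 < \<epsilon>1" for \<epsilon>1 :: real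
      using eventually_at_right_real[OF that] by simp
    have "((\<lambda>\<epsilon>. SUP \<theta>\<in>B \<epsilon>. h \<theta>) \<longlongrightarrow> h \<theta>\<^sub>0) (at_right 0)"
    proof (rule tendstoI)
      fix e :: real assume e: "0 < e"
      have "isCont h \<theta>\<^sub>0" using h_cont \<theta>0 by (simp add: continuous_on_eq_continuous_at)
      then obtain \<epsilon>1 where \<epsilon>1: "0 < \<epsilon>1" "\<And>x. dist x \<theta>\<^sub>0 < \<epsilon>1 \<Longrightarrow> dist (h x) (h \<theta>\<^sub>0) < e / 2"
        using e unfolding continuous_at_eps_delta by (metis half_gt_zero)
      have "0 < min \<epsilon>0 \<epsilon>1" using \<epsilon>0 \<epsilon>1 by simp
      from ev[OF this] show "\<forall>\<^sub>F \<epsilon> in at_right 0. dist (SUP \<theta>\<in>B \<epsilon>. h \<theta>) (h \<theta>\<^sub>0) < e"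
      proof eventually_elim
        case (elim \<epsilon>)
        have close: "h x \<le> h \<theta>\<^sub>0 + e / 2" if "x \<in> B \<epsilon>" for x
        proof -
          have "dist x \<theta>\<^sub>0 < \<epsilon>1" using that elim by (auto simp: B_def dist_real_def)
          from \<epsilon>1(2)[OF this] show ?thesis unfolding dist_real_def abs_less_iff by linarith
        qed
        have "h \<theta>\<^sub>0 \<le> (SUP \<theta>\<in>B \<epsilon>. h \<theta>)"
          by (rule cSUP_upper[OF ne bdd_aboveI2[OF close]]) (use elim in auto)
        moreover have "(SUP \<theta>\<in>B \<epsilon>. h \<theta>) \<le> h \<theta>\<^sub>0 + e / 2"
          by (rule cSUP_least[OF _ close]) (use ne[of \<epsilon>] elim in auto)
        ultimately show ?case using e by (simp add: dist_real_def)
      qed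
    qed
    moreover have "\<forall>\<^sub>F \<epsilon> in at_right 0. (\<lambda>n. SUP \<theta>\<in>B \<epsilon>. f n \<theta>) \<longlonglongrightarrow> (SUP \<theta>\<in>B \<epsilon>. h \<theta>)"
      using ev[OF \<epsilon>0] by eventually_elim (use lim in blast)
    ultimately show ?thesis unfolding B_def h_def by (intro exI conjI)
  qed
  show ?thesis using consistent normal moments efficient unfolding f_def by blast
qed

end
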